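(* Let $1<p<\infty$ and let $v_0,v_1$, $a$, $\mathscr{W}_{p',1/v_1}$, $\mathfrak{D}_{\mathscr{W}_{p',1/v_1}}$, $J_{\mathscr{W}_{p',1/v_1}}$ and $\mathop{W}\limits^{\circ\circ}{}^1_p$ be as in the context. Let $f\in\mathfrak{D}_{\mathscr{W}_{p',1/v_1}}$. Then $J_{\mathscr{W}_{p',1/v_1}}(f)<\infty$ if and only if $f=\tilde f$ almost everywhere for some $\tilde f\in \mathop{W}\limits^{\circ\circ}{}^1_p$, and in that case $\|f\|_{W^1_p}\approx J_{\mathscr{W}_{p',1/v_1}}(f)$. Consequently $$\mathop{W}\limits^{\circ\circ}{}^1_p=[\mathscr{W}_{p',1/v_1}]'_w=\bigl[[\mathop{W}\limits^{\circ\circ}{}^1_p]'_w\bigr]'_w$$ (as sets, with equivalent norms).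
   Context: Let $1<p<\infty$, $p'=p/(p-1)$. For $1\le r<\infty$ let $\mathscr V_r(0,\infty)$ be the set of functions $v\in L^r_{\rm loc}(0,\infty)$ with $v\ge 0$ and $\|v\|_{L^1(0,\infty)}\neq 0$. Let $v_0,v_1\in\mathscr V_p(0,\infty)$ with $1/v_1\in L^{p'}_{\rm loc}(0,\infty)$, and assume there is $c\in(0,\infty)$ with $\|v_1^{-1}\|_{L^{p'}(0,c)}\|v_0\|_{L^p(0,c)}=\|v_1^{-1}\|_{L^{p'}(c,\infty)}\|v_0\|_{L^p(c,\infty)}=\infty$. Under these assumptions there exist unique strictly increasing absolutely continuous functions $a,b$ on $(0,\infty)$ with $a(t),b(t)\to0$ as $t\to0$, $a(t),b(t)\to\infty$ as $t\to\infty$, $a(t)<t<b(t)$, $\int_{a(t)}^t v_1^{-p'}=\int_t^{b(t)}v_1^{-p'}$ and $\bigl(\int_{a(t)}^{b(t)}v_1^{-p'}\bigr)^{1/p'}\bigl(\int_{a(t)}^{b(t)}v_0^{p}\bigr)^{1/p}=1$ for all $t>0$; $a^{-1}$ denotes the inverse of $a$, and $V_1(t):=\int_{a(t)}^{b(t)}v_1^{-p'}$. For $g\in L^1_{\rm loc}(0,\infty)$ put $\mathbb G(g)=\Bigl(\int_0^\infty v_1^{-p'}(t)\Bigl|\int_t^{a^{-1}(t)}\frac{g(x)}{V_1(x)}\bigl(\int_{a(x)}^t v_1^{-p'}\bigr)dx\Bigr|^{p'}dt\Bigr)^{1/p'}$ and $\mathcal G(g)=\Bigl(\int_0^\infty v_1^{-p'}(t)V_1^{p'}(t)\Bigl|\int_t^{a^{-1}(t)}\frac{g(x)}{V_1(x)}dx\Bigr|^{p'}dt\Bigr)^{1/p'}$,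 and let $\mathscr W_{p',1/v_1}=\{g\in L^1_{\rm loc}(0,\infty):\|g\|_{\mathscr W_{p',1/v_1}}:=\mathbb G(g)+\mathcal G(g)<\infty\}$. The weighted Sobolev space $W^1_p$ consists of $u\in L^1_{\rm loc}(0,\infty)$ with distributional derivative $Du\in L^1_{\rm loc}(0,\infty)$ and $\|u\|_{W^1_p}:=\|v_0u\|_{L^p(0,\infty)}+\|v_1Du\|_{L^p(0,\infty)}<\infty$; $\mathop{W}\limits^{\circ\circ}{}^1_p$ is the subspace of all locally absolutely continuous $f$ on $(0,\infty)$ with $f(0)=0$, $\operatorname{supp} f$ compact in $(0,\infty)$, and $\|f\|_{W^1_p}<\infty$. For a normed space $(X,\|\cdot\|_X)$ of measurable functions on $(0,\infty)$, $\mathfrak D_X:=\{g \text{ measurable}:\int_0^\infty|fg|<\infty\ \forall f\in X\}$, and for $g\in\mathfrak D_X$, $J_X(g):=\sup_{0\neq f\in X}\frac{|\int_0^\infty fg|}{\|f\|_X}$; the weak associate space is $X'_w=\{g:\|g\|_{X'_w}:=J_X(g)<\infty\}$. $A\lesssim B$ means $A\le cB$ with $c$ depending only on $p$; $A\approx B$ means $A\lesssim B\lesssim A$. *)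

theory Defs
  imports "HOL-Analysis.Analysis"
begin

definition nnI :: "real set \<Rightarrow> (real \<Rightarrow> real) \<Rightarrow> ennreal" where
  "nnI A h = (\<integral>\<^sup>+x\<in>A. ennreal (h x) \<partial>lebesgue)"

definition Lloc :: "real \<Rightarrow> (real \<Rightarrow> real) \<Rightarrow> bool" where
  "Lloc r v \<longleftrightarrow> v \<in> borel_measurable (lebesgue_on {0<..}) \<and>
     (\<forall>x y. 0 < x \<longrightarrow> x \<le> y \<longrightarrow> nnI {x..y} (\<lambda>t. \<bar>v t\<bar> powr r) < \<infinity>)"

definition weight :: "real \<Rightarrow> (real \<Rightarrow> real) \<Rightarrow> bool" where
  "weight r v \<longleftrightarrow> Lloc r v \<and> (\<forall>x>0. 0 \<le> v x) \<and> nnI {0<..} v \<noteq> 0"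

definition Lp_pow :: "real \<Rightarrow> (real \<Rightarrow> real) \<Rightarrow> ennreal" where
  "Lp_pow p h = nnI {0<..} (\<lambda>x. \<bar>h x\<bar> powr p)"

definition Lp_norm :: "real \<Rightarrow> (real \<Rightarrow> real) \<Rightarrow> real" where
  "Lp_norm p h = enn2real (Lp_pow p h) powr (1 / p)"

definition abs_cont_on :: "real \<Rightarrow> real \<Rightarrow> (real \<Rightarrow> real) \<Rightarrow> bool" where
  "abs_cont_on l r f \<longleftrightarrow>
     (\<forall>\<epsilon>>0. \<exists>\<delta>>0. \<forall>I :: (real \<times> real) set.
        finite I \<and> (\<forall>(x, y)\<in>I. l \<le> x \<and> x < y \<and> y \<le> r) \<and>
        pairwise (\<lambda>(x, y) (u, v). y \<le> u \<or> v \<le> x) I \<and>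
        (\<Sum>(x, y)\<in>I. y - x) < \<delta> \<longrightarrow> (\<Sum>(x, y)\<in>I. \<bar>f y - f x\<bar>) < \<epsilon>)"

definition loc_abs_cont :: "(real \<Rightarrow> real) \<Rightarrow> bool" where
  "loc_abs_cont f \<longleftrightarrow> (\<forall>x y. 0 < x \<longrightarrow> x < y \<longrightarrow> abs_cont_on x y f)"

definition cpt_supp :: "(real \<Rightarrow> real) \<Rightarrow> bool" where
  "cpt_supp f \<longleftrightarrow> compact (closure {x. 0 < x \<and> f x \<noteq> 0}) \<and>
                   closure {x. 0 < x \<and> f x \<noteq> 0} \<subseteq> {0<..}"

definition test_fun :: "(real \<Rightarrow> real) \<Rightarrow> bool" where
  "test_fun \<phi> \<longleftrightarrow> (\<forall>n x. (deriv ^^ n) \<phi> differentiable (at x)) \<and>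
                   compact (closure {x. \<phi> x \<noteq> 0}) \<and> closure {x. \<phi> x \<noteq> 0} \<subseteq> {0<..}"

definition weak_deriv :: "(real \<Rightarrow> real) \<Rightarrow> (real \<Rightarrow> real) \<Rightarrow> bool" where
  "weak_deriv u g \<longleftrightarrow> Lloc 1 u \<and> Lloc 1 g \<and>
     (\<forall>\<phi>. test_fun \<phi> \<longrightarrow>
        (LINT x:{0<..}|lebesgue. u x * deriv \<phi> x) = - (LINT x:{0<..}|lebesgue. g x * \<phi> x))"

definition Dw :: "(real \<Rightarrow> real) \<Rightarrow> (real \<Rightarrow> real)" where
  "Dw u = (SOME g. weak_deriv u g)"

definition sob_norm :: "real \<Rightarrow> (real \<Rightarrow> real) \<Rightarrow> (real \<Rightarrow> real) \<Rightarrow> (real \<Rightarrow> real) \<Rightarrow> real" where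
  "sob_norm p v0 v1 u = Lp_norm p (\<lambda>x. v0 x * u x) + Lp_norm p (\<lambda>x. v1 x * Dw u x)"

definition W00 :: "real \<Rightarrow> (real \<Rightarrow> real) \<Rightarrow> (real \<Rightarrow> real) \<Rightarrow> (real \<Rightarrow> real) set" where
  "W00 p v0 v1 = {f. loc_abs_cont f \<and> (f \<longlongrightarrow> 0) (at_right 0) \<and> cpt_supp f \<and>
       (\<exists>g. weak_deriv f g) \<and>
       Lp_pow p (\<lambda>x. v0 x * f x) < \<infinity> \<and> Lp_pow p (\<lambda>x. v1 x * Dw f x) < \<infinity>}"

definition conj_exp :: "real \<Rightarrow> real" where
  "conj_exp p = p / (p - 1)"

definition wgt :: "real \<Rightarrow> (real \<Rightarrow> real) \<Rightarrow> real \<Rightarrow> real" where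
  "wgt p v1 x = inverse (v1 x) powr conj_exp p"

definition V1 :: "real \<Rightarrow> (real \<Rightarrow> real) \<Rightarrow> (real \<Rightarrow> real) \<Rightarrow> (real \<Rightarrow> real) \<Rightarrow> real \<Rightarrow> real" where
  "V1 p v1 a b t = enn2real (nnI {a t..b t} (wgt p v1))"

definition Gbb_pow :: "real \<Rightarrow> (real \<Rightarrow> real) \<Rightarrow> (real \<Rightarrow> real) \<Rightarrow> (real \<Rightarrow> real) \<Rightarrow> (real \<Rightarrow> real) \<Rightarrow> ennreal" where
  "Gbb_pow p v1 a b g = nnI {0<..} (\<lambda>t. wgt p v1 t *
      \<bar>LINT x:{t..inv_into {0<..} a t}|lebesgue.
          g x / V1 p v1 a b x * enn2real (nnI {a x..t} (wgt p v1))\<bar> powr conj_exp p)"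

definition Gcal_pow :: "real \<Rightarrow> (real \<Rightarrow> real) \<Rightarrow> (real \<Rightarrow> real) \<Rightarrow> (real \<Rightarrow> real) \<Rightarrow> (real \<Rightarrow> real) \<Rightarrow> ennreal" where
  "Gcal_pow p v1 a b g = nnI {0<..} (\<lambda>t. wgt p v1 t * V1 p v1 a b t powr conj_exp p *
      \<bar>LINT x:{t..inv_into {0<..} a t}|lebesgue. g x / V1 p v1 a b x\<bar> powr conj_exp p)"

definition Wset :: "real \<Rightarrow> (real \<Rightarrow> real) \<Rightarrow> (real \<Rightarrow> real) \<Rightarrow> (real \<Rightarrow> real) \<Rightarrow> (real \<Rightarrow> real) set" where
  "Wset p v1 a b = {g. Lloc 1 g \<and> Gbb_pow p v1 a b g < \<infinity> \<and> Gcal_pow p v1 a b g < \<infinity>}"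

definition Wnorm :: "real \<Rightarrow> (real \<Rightarrow> real) \<Rightarrow> (real \<Rightarrow> real) \<Rightarrow> (real \<Rightarrow> real) \<Rightarrow> (real \<Rightarrow> real) \<Rightarrow> real" where
  "Wnorm p v1 a b g = enn2real (Gbb_pow p v1 a b g) powr (1 / conj_exp p)
                    + enn2real (Gcal_pow p v1 a b g) powr (1 / conj_exp p)"

definition Dset :: "(real \<Rightarrow> real) set \<Rightarrow> (real \<Rightarrow> real) set" where
  "Dset X = {g. g \<in> borel_measurable (lebesgue_on {0<..}) \<and>
                 (\<forall>f\<in>X. nnI {0<..} (\<lambda>x. \<bar>f x * g x\<bar>) < \<infinity>)}"

definition Jfun :: "(real \<Rightarrow> real) set \<Rightarrow> ((real \<Rightarrow> real) \<Rightarrow> real) \<Rightarrow> (real \<Rightarrow> real) \<Rightarrow> ennreal" where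
  "Jfun X N g = (SUP f\<in>{f\<in>X. N f \<noteq> 0}.
      ennreal (\<bar>LINT x:{0<..}|lebesgue. f x * g x\<bar> / N f))"

definition weak_assoc :: "(real \<Rightarrow> real) set \<Rightarrow> ((real \<Rightarrow> real) \<Rightarrow> real) \<Rightarrow> (real \<Rightarrow> real) set" where
  "weak_assoc X N = {g\<in>Dset X. Jfun X N g < \<infinity>}"

definition assoc_norm :: "(real \<Rightarrow> real) set \<Rightarrow> ((real \<Rightarrow> real) \<Rightarrow> real) \<Rightarrow> (real \<Rightarrow> real) \<Rightarrow> real" where
  "assoc_norm X N g = enn2real (Jfun X N g)"

definition standing :: "real \<Rightarrow> (real \<Rightarrow> real) \<Rightarrow> (real \<Rightarrow> real) \<Rightarrow> real \<Rightarrow>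
    (real \<Rightarrow> real) \<Rightarrow> (real \<Rightarrow> real) \<Rightarrow> bool" where
  "standing p v0 v1 c a b \<longleftrightarrow>
     weight p v0 \<and> weight p v1 \<and>
     (AE x in lebesgue. 0 < x \<longrightarrow> 0 < v1 x) \<and>
     Lloc (conj_exp p) (\<lambda>x. inverse (v1 x)) \<and>
     0 < c \<and>
     nnI {0<..<c} (wgt p v1) * nnI {0<..<c} (\<lambda>x. v0 x powr p) = \<infinity> \<and>
     nnI {c<..} (wgt p v1) * nnI {c<..} (\<lambda>x. v0 x powr p) = \<infinity> \<and>
     strict_mono_on {0<..} a \<and> strict_mono_on {0<..} b \<and>
     loc_abs_cont a \<and> loc_abs_cont b \<and>
     (a \<longlongrightarrow> 0) (at_right 0) \<and> (b \<longlongrightarrow> 0) (at_right 0) \<and>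
     filterlim a at_top at_top \<and> filterlim b at_top at_top \<and>
     (\<forall>t>0. a t < t \<and> t < b t \<and>
        nnI {a t..t} (wgt p v1) = nnI {t..b t} (wgt p v1) \<and>
        enn2real (nnI {a t..b t} (wgt p v1)) powr (1 / conj_exp p) *
        enn2real (nnI {a t..b t} (\<lambda>x. v0 x powr p)) powr (1 / p) = 1)"

end

theory Submission
  imports Defs
begin

text \<open>
  Write \<open>w = v\<^sub>1\<close> to the power \<open>-p'\<close>, \<open>q = p'\<close>, \<open>A\<close> for the inverse of \<open>a\<close>, and let \<open>Om\<close> be a primitive of
  \<open>w\<close>, so that \<open>a t\<close> and \<open>b t\<close> are the points at \<open>Om\<close>-distance \<open>V t / 2\<close> from \<open>t\<close>.

  Sobolev functions are bounded functionals: for \<open>g\<close> in the space \<open>W\<close> let \<open>U\<close> be a primitive of \<open>u = g / V\<close>. The inner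
  integral \<open>E\<close> of the first part of the norm of \<open>g\<close> satisfies \<open>E' = w (U \<circ> A - U) - V u / 2\<close>. Integrating \<open>f' E\<close> by
  parts expresses \<open>\<integral> f g\<close> through \<open>\<integral> f' E\<close> and \<open>\<integral> w f (U \<circ> A - U)\<close>, which Hoelder's inequality bounds by the two parts
  of the norm of \<open>g\<close>, together with a Hardy inequality for \<open>\<integral> w |f / V|\<^sup>p\<close>. The latter is proved on consecutive
  windows \<open>[a t, b t]\<close>, where the mass of \<open>v\<^sub>0\<close> is balanced against \<open>V\<close>.

  Conversely, let \<open>f\<close> pair integrably with \<open>W\<close>. Since \<open>V u\<close> has small norm when \<open>u\<close> oscillates fast, testing against
  functions oscillating with arbitrary amplitude on dyadic intervals forces \<open>f\<close> to have compact support. Testing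
  against \<open>w \<psi>\<close> bounds \<open>\<integral> w |f / V|\<^sup>p\<close>, and testing against \<open>V u\<close> with \<open>u = U'\<close> bounds \<open>\<integral> f V U'\<close> by the norm of \<open>U\<close>
  in \<open>L\<^sup>q\<close> with weight \<open>w V\<^sup>q\<close>. Trapezoidal \<open>U\<close> then show that \<open>f V\<close> is locally absolutely continuous, and duality
  puts its derivative into the weighted \<open>L\<^sup>p\<close> space.
\<close>

section \<open>Primitives of locally integrable functions\<close>

text \<open>All calculus is done with pairs of a primitive and a density, because \<open>f\<close>,
  \<open>a\<close>, \<open>b\<close> and the functions tested against are only absolutely
  continuous. What makes the estimates close is the midpoint relation: \<open>Om\<close> at
  \<open>a t\<close> and at \<open>b t\<close> adds up to \<open>2 * Om t\<close>, and both summands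
  increase, so neither grows faster than \<open>2 * Om\<close>. Hence \<open>V\<close> has a density
  of modulus at most \<open>2 * w\<close>, its values at points of a common window are comparable,
  and differentiating a quotient by \<open>V\<close> costs only a term of size
  \<open>w * \<bar>f / V\<bar>\<close>. Since \<open>V\<close> need not be monotone, Hardy-type
  estimates replace it by a shifted copy of \<open>Om\<close> lying below it. The converse direction
  starts from a function that is merely measurable, so even values at points have to be produced
  first, as limits of averages. Constants depending on \<open>p\<close> alone result because the
  weights enter only through these relations and through the identity that the
  \<open>v\<^sub>0\<close>-mass of a window is \<open>V\<close> to the power
  \<open>1 - p\<close>.\<close>

definition L1loc :: "(real \<Rightarrow> real) \<Rightarrow> bool" where
  "L1loc f \<longleftrightarrow> (\<forall>x y. 0 < x \<longrightarrow> x \<le> y \<longrightarrow> f absolutely_integrable_on {x..y})"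

text \<open>Encodes that \<open>F\<close> is locally absolutely continuous on the half line with
  derivative \<open>f\<close> almost everywhere. The integral identity takes the place of
  derivatives: it survives changes of \<open>f\<close> on null sets, and values at nonpositive
  arguments do not enter.\<close>

definition prim :: "(real \<Rightarrow> real) \<Rightarrow> (real \<Rightarrow> real) \<Rightarrow> bool" where
  "prim F f \<longleftrightarrow> L1loc f \<and> (\<forall>x y. 0 < x \<longrightarrow> x \<le> y \<longrightarrow> integral {x..y} f = F y - F x)"

text \<open>The guard \<open>0 < a\<close> is moved into the predicate, so that local information is
  asked only for intervals inside the half line; the radius \<open>d\<close> at \<open>x\<close>
  need not be smaller than \<open>x\<close>.\<close>

lemma pos_Bolzano:
  fixes P :: "real \<Rightarrow> real \<Rightarrow> bool"
  assumes "0 < l" "l \<le> r"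
    and trans: "\<And>a b c. P a b \<Longrightarrow> P b c \<Longrightarrow> 0 < a \<Longrightarrow> a \<le> b \<Longrightarrow> b \<le> c \<Longrightarrow> P a c"
    and local: "\<And>x. 0 < x \<Longrightarrow> \<exists>d>0. \<forall>a b. 0 < a \<longrightarrow> a \<le> x \<longrightarrow> x \<le> b \<longrightarrow> b - a < d \<longrightarrow> P a b"
  shows "P l r"
proof -
  have "0 < l \<longrightarrow> P l r"
  proof (rule Bolzano[OF assms(2), where P = "\<lambda>a b. 0 < a \<longrightarrow> P a b"])
    fix a b c assume "0 < a \<longrightarrow> P a b" "0 < b \<longrightarrow> P b c" "a \<le> b" "b \<le> c"
    then show "0 < a \<longrightarrow> P a c" using trans[of a b c] by auto
  next
    fix x assume "l \<le> x" "x \<le> r"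
    then have "0 < x" using assms(1) by auto
    from local[OF this] show "\<exists>d>0. \<forall>a b. a \<le> x \<and> x \<le> b \<and> b - a < d \<longrightarrow> 0 < a \<longrightarrow> P a b"
      by metis
  qed
  with assms(1) show ?thesis by simp
qed

lemma L1locD: "L1loc f \<Longrightarrow> 0 < x \<Longrightarrow> f absolutely_integrable_on {x..y}"
  unfolding L1loc_def by (cases "x \<le> y") auto

lemma L1loc_integrable: "L1loc f \<Longrightarrow> 0 < x \<Longrightarrow> f integrable_on {x..y}"
  using L1locD set_lebesgue_integral_eq_integral(1) by blast

lemma L1loc_add: "L1loc f \<Longrightarrow> L1loc g \<Longrightarrow> L1loc (\<lambda>x. f x + g x)"
  unfolding L1loc_def by (auto intro!: set_integral_add)

lemma L1loc_diff: "L1loc f \<Longrightarrow> L1loc g \<Longrightarrow> L1loc (\<lambda>x. f x - g x)"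
  unfolding L1loc_def by (auto intro!: set_integral_diff)

lemma L1loc_cmult: "L1loc f \<Longrightarrow> L1loc (\<lambda>x. c * f x)"
  unfolding L1loc_def by auto

lemma L1loc_abs: "L1loc f \<Longrightarrow> L1loc (\<lambda>x. \<bar>f x\<bar>)"
  unfolding L1loc_def by (auto intro: set_integrable_abs)

lemma exhaust_pos: "0 < x \<Longrightarrow> \<forall>\<^sub>F n in sequentially. x \<in> {1 / real (Suc n)..real (Suc n)}"
proof -
  assume x: "0 < x"
  have "(\<lambda>n. 1 / real (Suc n)) \<longlonglongrightarrow> 0" by (rule LIMSEQ_Suc[OF lim_1_over_n])
  then have "\<forall>\<^sub>F n in sequentially. 1 / real (Suc n) < x" using x by (rule order_tendstoD(2))
  moreover have "\<forall>\<^sub>F n in sequentially. x \<le> real n"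
    using filterlim_real_sequentially by (simp add: filterlim_at_top)
  ultimately show ?thesis by eventually_elim simp
qed

lemma L1loc_measurable:
  assumes "L1loc f" shows "f \<in> borel_measurable (lebesgue_on {0<..})"
proof -
  have "(\<lambda>x. if x \<in> {0<..} then f x else 0) \<in> borel_measurable lebesgue"
  proof (rule borel_measurable_LIMSEQ_metric)
    show "(\<lambda>x. if x \<in> {1 / real (Suc n)..real (Suc n)} then f x else 0) \<in> borel_measurable lebesgue" for n
      using absolutely_integrable_imp_borel_measurable[OF L1locD[OF assms]]
      by (subst borel_measurable_if) auto
    fix x :: real
    have "\<forall>\<^sub>F n in sequentially. (if x \<in> {1 / real (Suc n)..real (Suc n)} then f x else 0) = (if x \<in> {0<..} then f x else 0)"
    proof (cases "0 < x")
      case True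
      show ?thesis using exhaust_pos[OF True] by eventually_elim (use True in simp)
    next
      case False
      have "x \<notin> {1 / real (Suc n)..real (Suc n)}" for n
        using False less_le_trans[of 0 "1 / real (Suc n)" x] by auto
      with False show ?thesis by simp
    qed
    then show "(\<lambda>n. if x \<in> {1 / real (Suc n)..real (Suc n)} then f x else 0) \<longlonglongrightarrow> (if x \<in> {0<..} then f x else 0)"
      by (rule tendsto_eventually)
  qed
  then show ?thesis by (subst (asm) borel_measurable_if) auto
qed

lemma meas_sub:
  assumes "f \<in> borel_measurable (lebesgue_on {0<..})" "S \<subseteq> {0<..}"
  shows "f \<in> borel_measurable (lebesgue_on S)"
  using measurable_restrict_mono[OF assms] .

lemma cont_meas:
  "continuous_on {0<..} (m :: real \<Rightarrow> real) \<Longrightarrow> m \<in> borel_measurable (lebesgue_on {0<..})"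
  by (intro continuous_imp_measurable_on_sets_lebesgue) auto

lemma cont_sub: "continuous_on {0<..} (m :: real \<Rightarrow> real) \<Longrightarrow> 0 < x \<Longrightarrow> continuous_on {x..y} m"
  by (erule continuous_on_subset) auto

lemma L1loc_dom:
  assumes "L1loc g" "f \<in> borel_measurable (lebesgue_on {0<..})"
    and "\<And>x y. 0 < x \<Longrightarrow> x \<le> y \<Longrightarrow> \<exists>B. \<forall>t\<in>{x..y}. \<bar>f t\<bar> \<le> B * \<bar>g t\<bar>"
  shows "L1loc f"
  unfolding L1loc_def
proof (intro allI impI)
  fix x y :: real assume xy: "0 < x" "x \<le> y"
  from assms(3)[OF xy] obtain B where B: "\<forall>t\<in>{x..y}. \<bar>f t\<bar> \<le> B * \<bar>g t\<bar>" by auto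
  have "(\<lambda>t. B * \<bar>g t\<bar>) absolutely_integrable_on {x..y}"
    using L1loc_cmult[OF L1loc_abs[OF assms(1)]] xy by (simp add: L1locD)
  then have i: "(\<lambda>t. B * \<bar>g t\<bar>) integrable_on {x..y}"
    using set_lebesgue_integral_eq_integral(1) by blast
  show "f absolutely_integrable_on {x..y}"
    by (rule measurable_bounded_by_integrable_imp_absolutely_integrable[OF meas_sub[OF assms(2)] _ i])
       (use B xy in auto)
qed

lemma L1loc_cont_mult:
  assumes "continuous_on {0<..} m" "L1loc f"
  shows "L1loc (\<lambda>x. m x * f x)"
proof (rule L1loc_dom[OF assms(2)])
  show "(\<lambda>x. m x * f x) \<in> borel_measurable (lebesgue_on {0<..})"
    using cont_meas[OF assms(1)] L1loc_measurable[OF assms(2)] by measurable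
  fix x y :: real assume xy: "0 < x" "x \<le> y"
  have "compact (m ` {x..y})"
    by (intro compact_continuous_image cont_sub[OF assms(1)] xy) auto
  then obtain B where "\<forall>z\<in>m ` {x..y}. \<bar>z\<bar> \<le> B"
    using compact_imp_bounded[of "m ` {x..y}"] by (auto simp: bounded_real)
  then show "\<exists>B. \<forall>t\<in>{x..y}. \<bar>m t * f t\<bar> \<le> B * \<bar>f t\<bar>"
    by (intro exI[of _ B]) (auto simp: abs_mult intro!: mult_right_mono)
qed

lemma L1loc_cont: "continuous_on {0<..} m \<Longrightarrow> L1loc m"
  unfolding L1loc_def
  by (auto intro!: absolutely_integrable_continuous_real cont_sub)

lemma primD: "prim F f \<Longrightarrow> 0 < x \<Longrightarrow> x \<le> y \<Longrightarrow> integral {x..y} f = F y - F x"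
  unfolding prim_def by auto

lemma prim_L1: "prim F f \<Longrightarrow> L1loc f" unfolding prim_def by auto

lemma primI: "L1loc f \<Longrightarrow> (\<And>x y. 0 < x \<Longrightarrow> x \<le> y \<Longrightarrow> integral {x..y} f = F y - F x) \<Longrightarrow> prim F f"
  unfolding prim_def by auto

lemma prim_has_integral:
  "prim F f \<Longrightarrow> 0 < x \<Longrightarrow> x \<le> y \<Longrightarrow> (f has_integral (F y - F x)) {x..y}"
  using primD[of F f x y] L1loc_integrable[OF prim_L1, of F f x y]
  by (metis integrable_integral)

lemma prim_exists:
  assumes "L1loc f" shows "\<exists>F. prim F f"
proof -
  define F where "F t = (if 1 \<le> t then integral {1..t} f else - integral {t..1} f)" for t :: real
  note i = L1loc_integrable[OF assms]
  have "prim F f"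
  proof (rule primI[OF assms])
    fix x y :: real assume xy: "0 < x" "x \<le> y"
    consider "1 \<le> x" | "y < 1" | "x < 1" "1 \<le> y" by linarith
    then show "integral {x..y} f = F y - F x"
    proof cases
      case 1 then show ?thesis
        using Henstock_Kurzweil_Integration.integral_combine[of 1 x y f] i[of 1 y] xy by (simp add: F_def)
    next
      case 2 then show ?thesis
        using Henstock_Kurzweil_Integration.integral_combine[of x y 1 f] i[of x 1] xy by (simp add: F_def)
    next
      case 3 then show ?thesis
        using Henstock_Kurzweil_Integration.integral_combine[of x 1 y f] i[of x y] xy by (simp add: F_def)
    qed
  qed
  then show ?thesis by blast
qed

lemma prim_continuous:
  assumes "prim F f" shows "continuous_on {0<..} F"
proof -
  have "isCont F t" if t: "0 < t" for t
  proof -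
    have "continuous_on {t/2..2*t} (\<lambda>s. F (t/2) + integral {t/2..s} f)"
      using L1loc_integrable[OF prim_L1[OF assms], of "t/2" "2*t"] t
      by (intro continuous_intros indefinite_integral_continuous_1) auto
    moreover have "F (t/2) + integral {t/2..s} f = F s" if "s \<in> {t/2..2*t}" for s
      using primD[OF assms, of "t/2" s] that t by auto
    ultimately have "continuous_on {t/2..2*t} F" using continuous_on_eq by blast
    then show ?thesis
      by (rule continuous_on_interior) (use t in auto)
  qed
  then show ?thesis by (simp add: continuous_on_eq_continuous_at)
qed

lemma prim_add: "prim F f \<Longrightarrow> prim G g \<Longrightarrow> prim (\<lambda>x. F x + G x) (\<lambda>x. f x + g x)"
  by (rule primI) (auto simp: L1loc_add prim_L1 primD integral_add L1loc_integrable)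

lemma prim_diff: "prim F f \<Longrightarrow> prim G g \<Longrightarrow> prim (\<lambda>x. F x - G x) (\<lambda>x. f x - g x)"
  by (rule primI) (auto simp: L1loc_diff prim_L1 primD integral_diff L1loc_integrable)

lemma prim_cmult: "prim F f \<Longrightarrow> prim (\<lambda>x. c * F x) (\<lambda>x. c * f x)"
  by (rule primI) (auto simp: L1loc_cmult prim_L1 primD algebra_simps)

lemma prim_const: "prim (\<lambda>x. c) (\<lambda>x. 0)"
  by (rule primI) (auto simp: L1loc_def)

lemma prim_minus: "prim F f \<Longrightarrow> prim (\<lambda>x. - F x) (\<lambda>x. - f x)"
  using prim_cmult[of F f "-1"] by simp

lemma prim_shift: "prim F f \<Longrightarrow> prim (\<lambda>x. F x + c) f"
  using prim_add[OF _ prim_const[of c], of F f] by simp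

lemma prim_sum:
  assumes "\<And>i. i \<in> I \<Longrightarrow> prim (F i) (f i)"
  shows "prim (\<lambda>x. \<Sum>i\<in>I. F i x) (\<lambda>x. \<Sum>i\<in>I. f i x)"
  using assms by (induct I rule: infinite_finite_induct) (auto intro: prim_const prim_add)

lemma prim_cong_on:
  assumes "prim F f" "\<And>x. 0 < x \<Longrightarrow> G x = F x" "\<And>x. 0 < x \<Longrightarrow> g x = f x"
  shows "prim G g"
proof -
  have "L1loc g" using prim_L1[OF assms(1)] unfolding L1loc_def
  proof (intro allI impI)
    fix x y :: real assume f: "\<forall>x y. 0 < x \<longrightarrow> x \<le> y \<longrightarrow> f absolutely_integrable_on {x..y}" and xy: "0 < x" "x \<le> y"
    show "g absolutely_integrable_on {x..y}"
      by (rule absolutely_integrable_spike[OF f[rule_format, OF xy] negligible_empty]) (use xy assms(3) in auto)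
  qed
  moreover have "integral {x..y} g = integral {x..y} f" if "0 < x" for x y
    by (rule integral_cong) (use that assms(3) in auto)
  ultimately show ?thesis using primD[OF assms(1)] assms(2) by (intro primI) auto
qed

lemma prim_cong_AE:
  assumes "prim F f" "AE x in lebesgue. 0 < x \<longrightarrow> g x = f x"
  shows "prim F g"
proof -
  obtain N where N: "negligible N" "\<And>x. 0 < x \<Longrightarrow> x \<notin> N \<Longrightarrow> g x = f x"
  proof -
    from assms(2) obtain N where N: "{x \<in> space lebesgue. \<not> (0 < x \<longrightarrow> g x = f x)} \<subseteq> N"
      "emeasure lebesgue N = 0" "N \<in> sets lebesgue" by (rule AE_E)
    have "negligible N" unfolding negligible_iff_null_sets using N by (intro null_setsI)
    then show ?thesis using that N(1) by auto
  qed
  have "L1loc g" using prim_L1[OF assms(1)] unfolding L1loc_def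
  proof (intro allI impI)
    fix x y :: real assume f: "\<forall>x y. 0 < x \<longrightarrow> x \<le> y \<longrightarrow> f absolutely_integrable_on {x..y}" and xy: "0 < x" "x \<le> y"
    show "g absolutely_integrable_on {x..y}"
      by (rule absolutely_integrable_spike[OF f[rule_format, OF xy] N(1)]) (use xy N(2) in auto)
  qed
  moreover have "integral {x..y} g = integral {x..y} f" if "0 < x" for x y
    by (rule integral_spike[OF N(1)]) (use that N(2) in auto)
  ultimately show ?thesis using primD[OF assms(1)] by (intro primI) auto
qed

lemma integral_abs_bound:
  assumes "L1loc f" "L1loc g" "0 < x" "\<And>t. x \<le> t \<Longrightarrow> t \<le> y \<Longrightarrow> \<bar>f t\<bar> \<le> g t"
  shows "\<bar>integral {x..y} f\<bar> \<le> integral {x..y} g"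
proof -
  have "norm (integral {x..y} f) \<le> integral {x..y} g"
    by (rule Henstock_Kurzweil_Integration.integral_norm_bound_integral)
       (use L1loc_integrable[OF assms(1,3)] L1loc_integrable[OF assms(2,3)] assms(4) in simp_all)
  then show ?thesis by simp
qed

text \<open>The chain rule for primitives applies this to the defect of the formula over an interval.\<close>

lemma additive_local_zero:
  fixes D :: "real \<Rightarrow> real \<Rightarrow> real"
  assumes "L1loc k" "0 < x" "x \<le> y"
    and add: "\<And>u v r. 0 < u \<Longrightarrow> u \<le> v \<Longrightarrow> v \<le> r \<Longrightarrow> D u r = D u v + D v r"
    and loc: "\<And>\<epsilon> t. 0 < \<epsilon> \<Longrightarrow> 0 < t \<Longrightarrow> \<exists>d>0. \<forall>u v. 0 < u \<longrightarrow> u \<le> t \<longrightarrow> t \<le> v \<longrightarrow> v - u < d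
         \<longrightarrow> \<bar>D u v\<bar> \<le> \<epsilon> * integral {u..v} k"
  shows "D x y = 0"
proof -
  have b: "\<bar>D x y\<bar> \<le> \<epsilon> * integral {x..y} k" if "0 < \<epsilon>" for \<epsilon>
  proof (rule pos_Bolzano[OF assms(2,3), where P = "\<lambda>u v. \<bar>D u v\<bar> \<le> \<epsilon> * integral {u..v} k"])
    fix a b c :: real assume h: "\<bar>D a b\<bar> \<le> \<epsilon> * integral {a..b} k" "\<bar>D b c\<bar> \<le> \<epsilon> * integral {b..c} k"
      "0 < a" "a \<le> b" "b \<le> c"
    have "integral {a..c} k = integral {a..b} k + integral {b..c} k"
      using Henstock_Kurzweil_Integration.integral_combine[of a b c k] L1loc_integrable[OF assms(1), of a c] h by simp
    then show "\<bar>D a c\<bar> \<le> \<epsilon> * integral {a..c} k"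
      using add[of a b c] h by (auto simp: distrib_left)
  next
    fix t :: real assume "0 < t"
    from loc[OF that this] show "\<exists>d>0. \<forall>a b. 0 < a \<longrightarrow> a \<le> t \<longrightarrow> t \<le> b \<longrightarrow> b - a < d \<longrightarrow> \<bar>D a b\<bar> \<le> \<epsilon> * integral {a..b} k" .
  qed
  have "\<bar>D x y\<bar> \<le> 0"
  proof (rule field_le_epsilon)
    fix e :: real assume e: "0 < e"
    define K where "K = \<bar>integral {x..y} k\<bar> + 1"
    have K: "K > 0" "integral {x..y} k \<le> K" unfolding K_def by linarith+
    have "\<bar>D x y\<bar> \<le> e / K * integral {x..y} k" using b[of "e / K"] e K by simp
    also have "\<dots> \<le> e / K * K" using e K by (intro mult_left_mono) auto
    finally show "\<bar>D x y\<bar> \<le> 0 + e" using K by simp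
  qed
  then show ?thesis by simp
qed

lemma cont_pos_ball:
  fixes F :: "real \<Rightarrow> real"
  assumes "continuous_on {0<..} F" "0 < t" "0 < \<epsilon>"
  obtains d where "0 < d" "\<And>s. 0 < s \<Longrightarrow> \<bar>s - t\<bar> < d \<Longrightarrow> \<bar>F s - F t\<bar> < \<epsilon>"
proof -
  from assms obtain d where "d > 0" "\<forall>s\<in>{0<..}. dist s t < d \<longrightarrow> dist (F s) (F t) < \<epsilon>"
    unfolding continuous_on_iff by (metis greaterThan_iff)
  then show ?thesis using that by (auto simp: dist_real_def)
qed

lemma integral_combine_pos:
  "L1loc k \<Longrightarrow> 0 < a \<Longrightarrow> a \<le> b \<Longrightarrow> b \<le> c \<Longrightarrow> integral {a..c} k = integral {a..b} k + integral {b..c} k"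
  using Henstock_Kurzweil_Integration.integral_combine[of a b c k] L1loc_integrable[of k a c] by simp


text \<open>The endpoints are in no particular order because they will be the values of a function
  at two times, and the derivative is taken within \<open>S\<close> so that functions such as real
  powers on \<open>{0<..}\<close> qualify.\<close>

lemma mvt_segment:
  fixes \<Phi> :: "real \<Rightarrow> real"
  assumes "convex S" "a \<in> S" "b \<in> S"
    and d: "\<And>z. z \<in> S \<Longrightarrow> (\<Phi> has_real_derivative \<phi> z) (at z within S)"
  shows "\<exists>z\<in>closed_segment a b. \<Phi> b - \<Phi> a = \<phi> z * (b - a)"
proof -
  have main: "\<exists>z\<ge>x. z \<le> y \<and> \<Phi> y - \<Phi> x = \<phi> z * (y - x)" if le: "x \<le> y" and sub: "{x..y} \<subseteq> S" for x y
  proof (cases "x = y")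
    case False
    have dd: "(\<Phi> has_derivative (\<lambda>h. \<phi> s * h)) (at s within {x..y})" if "s \<in> {x..y}" for s
      using has_field_derivative_subset[OF d[of s] sub] that sub
      unfolding has_field_derivative_def by auto
    have xy: "x < y" using le False by simp
    obtain z where "x < z" "z < y" "\<Phi> y - \<Phi> x = \<phi> z * (y - x)"
    proof (rule mvt[OF xy, of \<Phi> "\<lambda>s h. \<phi> s * h"])
      show "continuous_on {x..y} \<Phi>" by (rule has_derivative_continuous_on[OF dd])
      fix s assume "x < s" "s < y"
      then have "at s within {x..y} = at s" "s \<in> {x..y}" by (simp_all add: at_within_Icc_at)
      with dd[of s] show "(\<Phi> has_derivative (\<lambda>h. \<phi> s * h)) (at s)" by metis
    qed
    then show ?thesis by (intro exI[of _ z]) auto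
  qed (use le in auto)
  have sub: "closed_segment a b \<subseteq> S" using assms by (intro closed_segment_subset) auto
  show ?thesis
  proof (cases "a \<le> b")
    case True
    then obtain z where "a \<le> z" "z \<le> b" "\<Phi> b - \<Phi> a = \<phi> z * (b - a)"
      using main[of a b] sub True by (auto simp: closed_segment_eq_real_ivl1)
    with True show ?thesis by (intro bexI[of _ z]) (auto simp: closed_segment_eq_real_ivl)
  next
    case False
    then obtain z where z: "b \<le> z" "z \<le> a" "\<Phi> a - \<Phi> b = \<phi> z * (a - b)"
      using main[of b a] sub False by (auto simp: closed_segment_commute[of a b] closed_segment_eq_real_ivl1)
    then have "\<Phi> b - \<Phi> a = \<phi> z * (b - a)"
      by (metis minus_diff_eq mult_minus_right)
    with z False show ?thesis by (intro bexI[of _ z]) (auto simp: closed_segment_eq_real_ivl)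
  qed
qed

text \<open>Over a short interval around \<open>t\<close> the increment of
  \<open>\<Phi> \<circ> F\<close> is \<open>\<phi> z\<close> times the integral of \<open>f\<close>,
  for some \<open>z\<close> near \<open>F t\<close>. Since \<open>\<phi> \<circ> F\<close> is also
  close to \<open>\<phi> z\<close> there, the defect of the formula is at most
  \<open>\<epsilon>\<close> times the integral of \<open>\<bar>f\<bar>\<close>, and defects are
  additive.\<close>

lemma prim_chain:
  assumes F: "prim F f" and S: "\<And>x. 0 < x \<Longrightarrow> F x \<in> S" "convex S"
    and d: "\<And>z. z \<in> S \<Longrightarrow> (\<Phi> has_real_derivative \<phi> z) (at z within S)" and c: "continuous_on S \<phi>"
  shows "prim (\<lambda>x. \<Phi> (F x)) (\<lambda>x. \<phi> (F x) * f x)"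
proof -
  note cF = prim_continuous[OF F]
  note Lf = prim_L1[OF F]
  define h where "h = (\<lambda>x. \<phi> (F x) * f x)"
  have cphi: "continuous_on {0<..} (\<lambda>x. \<phi> (F x))"
    using S by (intro continuous_on_compose2[OF c cF]) auto
  have Lh: "L1loc h" unfolding h_def by (rule L1loc_cont_mult[OF cphi Lf])
  define k where "k x = \<bar>f x\<bar>" for x
  have Lk: "L1loc k" unfolding k_def by (intro L1loc_abs Lf)
  define D where "D u v = (\<Phi> (F v) - \<Phi> (F u)) - integral {u..v} h" for u v
  have "D x y = 0" if xy: "0 < x" "x \<le> y" for x y
  proof (rule additive_local_zero[OF Lk xy])
    fix u v r :: real assume "0 < u" "u \<le> v" "v \<le> r"
    then show "D u r = D u v + D v r"
      using integral_combine_pos[OF Lh, of u v r] by (simp add: D_def)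
  next
    fix \<epsilon> t :: real assume e: "0 < \<epsilon>" and t: "0 < t"
    obtain d0 where d0: "0 < d0" "\<And>z. z \<in> S \<Longrightarrow> \<bar>z - F t\<bar> < d0 \<Longrightarrow> \<bar>\<phi> z - \<phi> (F t)\<bar> < \<epsilon>/2"
      using c[unfolded continuous_on_iff, rule_format, OF S(1)[OF t], of "\<epsilon>/2"] e
      by (auto simp: dist_real_def)
    obtain d1 where d1: "0 < d1" "\<And>s. 0 < s \<Longrightarrow> \<bar>s - t\<bar> < d1 \<Longrightarrow> \<bar>F s - F t\<bar> < d0"
      using cont_pos_ball[OF cF t, of d0] d0 by auto
    show "\<exists>d>0. \<forall>u v. 0 < u \<longrightarrow> u \<le> t \<longrightarrow> t \<le> v \<longrightarrow> v - u < d \<longrightarrow> \<bar>D u v\<bar> \<le> \<epsilon> * integral {u..v} k"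
    proof (intro exI[of _ d1] conjI allI impI)
      fix u v assume uv: "0 < u" "u \<le> t" "t \<le> v" "v - u < d1"
      have FG: "\<bar>F s - F t\<bar> < d0" if "u \<le> s" "s \<le> v" for s
        using d1(2)[of s] uv that by auto
      have "\<exists>z\<in>S. \<bar>z - F t\<bar> < d0 \<and> \<Phi> (F v) - \<Phi> (F u) = \<phi> z * (F v - F u)"
      proof -
        have "\<exists>z\<in>closed_segment (F u) (F v). \<Phi> (F v) - \<Phi> (F u) = \<phi> z * (F v - F u)"
          by (rule mvt_segment[OF S(2) _ _ d]) (use S(1) uv in auto)
        then obtain z where z: "z \<in> closed_segment (F u) (F v)" "\<Phi> (F v) - \<Phi> (F u) = \<phi> z * (F v - F u)" by auto
        have "z \<in> S" using z(1) closed_segment_subset[of "F u" S "F v"] S uv by auto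
        moreover have "\<bar>z - F t\<bar> < d0"
          using z(1) FG[of u] FG[of v] uv by (auto simp: closed_segment_eq_real_ivl split: if_splits)
        ultimately show ?thesis using z(2) by blast
      qed
      then obtain z where z: "z \<in> S" "\<bar>z - F t\<bar> < d0" "\<Phi> (F v) - \<Phi> (F u) = \<phi> z * (F v - F u)" by auto
      have Lc: "L1loc (\<lambda>s. \<phi> z * f s)" by (intro L1loc_cmult Lf)
      have "\<Phi> (F v) - \<Phi> (F u) = integral {u..v} (\<lambda>s. \<phi> z * f s)"
        using primD[OF F, of u v] uv z(3) by simp
      then have "D u v = integral {u..v} (\<lambda>s. \<phi> z * f s - h s)"
        unfolding D_def using L1loc_integrable[OF Lc] L1loc_integrable[OF Lh] uv
        by (subst integral_diff) auto
      also have "\<bar>\<dots>\<bar> \<le> integral {u..v} (\<lambda>s. \<epsilon> * k s)"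
      proof (rule integral_abs_bound)
        show "L1loc (\<lambda>s. \<phi> z * f s - h s)" by (intro L1loc_diff Lc Lh)
        show "L1loc (\<lambda>s. \<epsilon> * k s)" by (intro L1loc_cmult Lk)
        fix s assume s: "u \<le> s" "s \<le> v"
        have "\<bar>\<phi> z - \<phi> (F s)\<bar> \<le> \<epsilon>"
        proof -
          have "F s \<in> S" using S(1)[of s] s uv by simp
          then show ?thesis using d0(2)[OF z(1,2)] d0(2)[of "F s"] FG[OF s] by linarith
        qed
        moreover have "\<phi> z * f s - h s = (\<phi> z - \<phi> (F s)) * f s"
          unfolding h_def by (simp add: algebra_simps)
        ultimately show "\<bar>\<phi> z * f s - h s\<bar> \<le> \<epsilon> * k s"
          by (simp add: k_def abs_mult mult_right_mono)
      qed (use uv in auto)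
      finally show "\<bar>D u v\<bar> \<le> \<epsilon> * integral {u..v} k" by simp
    qed (use d1 in auto)
  qed
  then show ?thesis using Lh by (intro primI) (auto simp: D_def h_def)
qed

text \<open>Polarization: the product is half of
  \<open>(F + G)\<^sup>2 - F\<^sup>2 - G\<^sup>2\<close>, and each square is an instance of the
  chain rule.\<close>

lemma prim_mult:
  assumes F: "prim F f" and G: "prim G g"
  shows "prim (\<lambda>x. F x * G x) (\<lambda>x. f x * G x + F x * g x)"
proof -
  have sq: "prim (\<lambda>x. (K x)\<^sup>2) (\<lambda>x. 2 * K x * k x)" if "prim K k" for K k
    by (rule prim_chain[OF that, of UNIV "\<lambda>z. z\<^sup>2" "\<lambda>z. 2 * z"]) (auto intro!: derivative_eq_intros continuous_intros)
  from prim_cmult[OF prim_diff[OF sq[OF prim_add[OF F G]] prim_add[OF sq[OF F] sq[OF G]]], of "1 / 2"]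
  show ?thesis by (rule prim_cong_on) (simp_all add: power2_eq_square algebra_simps)
qed

section \<open>Absolute continuity\<close>

text \<open>Lebesgue's differentiation theorem for integrable functions on the line, applied to the
  truncations of \<open>g\<close> to compact subintervals; near a given \<open>x\<close> some
  truncation coincides with \<open>g\<close>. The right difference quotient suffices, both for
  comparing densities and for the averages that define representatives later.\<close>

lemma prim_lebesgue_diff:
  assumes "prim G g"
  shows "AE x in lebesgue. 0 < x \<longrightarrow> ((\<lambda>h. (G (x + h) - G x) / h) \<longlongrightarrow> g x) (at_right 0)"
proof -
  define f where "f k x = (if x \<in> {1 / real (Suc k)..real (Suc k)} then g x else 0)" for k x
  have fi: "f k integrable_on cbox a b" for k a b
  proof -
    have "g integrable_on {1 / real (Suc k)..real (Suc k)}"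
      by (rule L1loc_integrable[OF prim_L1[OF assms]]) simp
    then have "f k integrable_on UNIV" unfolding f_def by (subst integrable_restrict_UNIV)
    then show ?thesis by (rule integrable_on_subcbox) simp
  qed
  have "\<exists>N. negligible N \<and> (\<forall>x e. x \<notin> N \<longrightarrow> 0 < e \<longrightarrow>
     (\<exists>d>0. \<forall>h. 0 < h \<and> h < d \<longrightarrow> norm (integral (cbox x (x + h *\<^sub>R One)) (f k) /\<^sub>R h ^ DIM(real) - f k x) < e))" for k
    using integrable_ccontinuous_explicit[OF fi, of k] by metis
  then obtain N where N: "\<And>k. negligible (N k)" and Nd: "\<And>k x e. x \<notin> N k \<Longrightarrow> 0 < e \<Longrightarrow>
     \<exists>d>0. \<forall>h. 0 < h \<and> h < d \<longrightarrow> norm (integral (cbox x (x + h *\<^sub>R One)) (f k) /\<^sub>R h ^ DIM(real) - f k x) < e"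
    by metis
  have "negligible (\<Union>k. N k)" using N by (rule negligible_Union_nat)
  then have "AE x in lebesgue. x \<notin> (\<Union>k. N k)"
    unfolding negligible_iff_null_sets by (rule AE_not_in)
  then show ?thesis
  proof (rule AE_mp, intro AE_I2 impI)
    fix x :: real assume x: "x \<notin> (\<Union>k. N k)" "0 < x"
    obtain n m where n: "inverse (real (Suc n)) < x" and m: "x < real m"
      using x reals_Archimedean reals_Archimedean2 by metis
    define k where "k = max n m"
    have k: "1 / real (Suc k) < x" "x < real (Suc k)"
    proof -
      have "1 / real (Suc k) \<le> inverse (real (Suc n))"
        unfolding k_def by (simp add: inverse_eq_divide frac_le)
      with n show "1 / real (Suc k) < x" by linarith
      have "real m \<le> real (Suc k)" unfolding k_def by simp
      with m show "x < real (Suc k)" by linarith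
    qed
    show "((\<lambda>h. (G (x + h) - G x) / h) \<longlongrightarrow> g x) (at_right 0)"
    proof (rule tendstoI)
      fix e :: real assume e: "0 < e"
      obtain d where d: "d > 0" "\<And>h. 0 < h \<Longrightarrow> h < d \<Longrightarrow> \<bar>integral {x..x + h} (f k) / h - f k x\<bar> < e"
        using Nd[of x k e] x e by (auto simp: divide_inverse mult.commute)
      have "dist ((G (x + h) - G x) / h) (g x) < e" if h: "0 < h" "h < min d (real (Suc k) - x)" for h
      proof -
        have "integral {x..x + h} (f k) = integral {x..x+h} g"
          by (rule integral_cong) (use k h in \<open>auto simp: f_def simp del: of_nat_Suc\<close>)
        also have "\<dots> = G (x + h) - G x" using primD[OF assms, of x "x + h"] x h by simp
        finally have "integral {x..x + h} (f k) = G (x + h) - G x" .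
        moreover have "f k x = g x" using k by (simp add: f_def)
        ultimately show ?thesis using d(2)[of h] h by (simp add: dist_real_def)
      qed
      then show "\<forall>\<^sub>F h in at_right 0. dist ((G (x + h) - G x) / h) (g x) < e"
        using d k by (intro eventually_at_rightI[of 0 "min d (real (Suc k) - x)"]) auto
    qed
  qed
qed

text \<open>Compare right difference quotients at a point where both converge. Bounds for densities
  are obtained in this way from inequalities between increments.\<close>

lemma prim_mono_density:
  assumes "prim G g" "prim H h" "\<And>x y. 0 < x \<Longrightarrow> x \<le> y \<Longrightarrow> G y - G x \<le> H y - H x"
  shows "AE x in lebesgue. 0 < x \<longrightarrow> g x \<le> h x"
proof -
  have "AE x in lebesgue. 0 < x \<longrightarrow> ((\<lambda>e. (G (x + e) - G x) / e) \<longlongrightarrow> g x) (at_right 0)"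
       "AE x in lebesgue. 0 < x \<longrightarrow> ((\<lambda>e. (H (x + e) - H x) / e) \<longlongrightarrow> h x) (at_right 0)"
    using assms prim_lebesgue_diff by auto
  then show ?thesis
  proof eventually_elim
    case (elim x)
    show ?case
    proof
      assume x: "0 < x"
      have "(G (x + e) - G x) / e \<le> (H (x + e) - H x) / e" if "0 < e" for e
        using assms(3)[of x "x + e"] x that by (simp add: divide_right_mono)
      then have "\<forall>\<^sub>F e in at_right 0. (G (x + e) - G x) / e \<le> (H (x + e) - H x) / e"
        by (intro eventually_at_rightI[of 0 1]) auto
      then show "g x \<le> h x"
        using elim x by (intro tendsto_le[of "at_right (0::real)"]) auto
    qed
  qed
qed

lemma prim_unique_AE:
  assumes "prim G g" "prim G h" shows "AE x in lebesgue. 0 < x \<longrightarrow> g x = h x"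
  using prim_mono_density[OF assms] prim_mono_density[OF assms(2,1)]
  by (auto elim!: AE_mp)

section \<open>Families of non-overlapping intervals and absolute continuity of primitives\<close>

definition fam :: "real \<Rightarrow> real \<Rightarrow> (real \<times> real) set \<Rightarrow> bool" where
  "fam l r I \<longleftrightarrow> finite I \<and> (\<forall>(x, y)\<in>I. l \<le> x \<and> x < y \<and> y \<le> r) \<and>
        pairwise (\<lambda>(x, y) (u, v). y \<le> u \<or> v \<le> x) I"

lemma abs_cont_on_fam:
  "abs_cont_on l r f \<longleftrightarrow> (\<forall>\<epsilon>>0. \<exists>\<delta>>0. \<forall>I. fam l r I \<and> (\<Sum>(x, y)\<in>I. y - x) < \<delta> \<longrightarrow> (\<Sum>(x, y)\<in>I. \<bar>f y - f x\<bar>) < \<epsilon>)"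
  unfolding abs_cont_on_def fam_def by simp

lemma famD: "fam l r I \<Longrightarrow> (x, y) \<in> I \<Longrightarrow> l \<le> x \<and> x < y \<and> y \<le> r"
  unfolding fam_def by auto

lemma fam_disj: "fam l r I \<Longrightarrow> (x, y) \<in> I \<Longrightarrow> (u, v) \<in> I \<Longrightarrow> (x, y) \<noteq> (u, v) \<Longrightarrow> y \<le> u \<or> v \<le> x"
  unfolding fam_def pairwise_def by fastforce

lemma fam_finite: "fam l r I \<Longrightarrow> finite I" unfolding fam_def by simp

lemma famI: "finite I \<Longrightarrow> (\<And>x y. (x, y) \<in> I \<Longrightarrow> l \<le> x \<and> x < y \<and> y \<le> r) \<Longrightarrow>
   (\<And>x y u v. (x, y) \<in> I \<Longrightarrow> (u, v) \<in> I \<Longrightarrow> (x, y) \<noteq> (u, v) \<Longrightarrow> y \<le> u \<or> v \<le> x) \<Longrightarrow> fam l r I"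
  unfolding fam_def pairwise_def by fastforce

lemma fam_mono: "fam l r I \<Longrightarrow> l' \<le> l \<Longrightarrow> r \<le> r' \<Longrightarrow> fam l' r' I"
  unfolding fam_def by fastforce

lemma fam_integral:
  fixes h :: "real \<Rightarrow> real"
  assumes I: "fam l r I" and h: "h integrable_on {l..r}" "\<And>x. l \<le> x \<Longrightarrow> x \<le> r \<Longrightarrow> 0 \<le> h x"
  shows "(\<Sum>(x, y)\<in>I. integral {x..y} h) \<le> integral {l..r} h"
proof -
  let ?S = "\<lambda>(x::real, y). {x..y}"
  have hi: "(h has_integral (\<Sum>p\<in>I. integral (?S p) h)) (\<Union>p\<in>I. ?S p)"
  proof (rule Henstock_Kurzweil_Integration.has_integral_UN)
    show "finite I" using I by (rule fam_finite)
    fix p assume p: "p \<in> I"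
    then obtain x y where xy: "p = (x, y)" by (cases p)
    then have "l \<le> x" "y \<le> r" using famD[OF I] p by auto
    then have "h integrable_on {x..y}" using integrable_on_subinterval[OF h(1)] by auto
    then show "(h has_integral integral (?S p) h) (?S p)" using xy by (simp add: integrable_integral)
  next
    show "pairwise (\<lambda>p p'. negligible (?S p \<inter> ?S p')) I"
    proof (rule pairwiseI)
      fix p p' assume p: "p \<in> I" "p' \<in> I" "p \<noteq> p'"
      obtain x y u v where xy: "p = (x, y)" "p' = (u, v)" by (cases p, cases p')
      then have "y \<le> u \<or> v \<le> x" using fam_disj[OF I] p by auto
      then have "{x..y} \<inter> {u..v} \<subseteq> {y, x}" by auto
      then have "negligible ({x..y} \<inter> {u..v})" by (rule negligible_subset[rotated]) simp
      with xy show "negligible (?S p \<inter> ?S p')" by simp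
    qed
  qed
  have sub: "(\<Union>p\<in>I. ?S p) \<subseteq> {l..r}" using famD[OF I] by fastforce
  have "integral (\<Union>p\<in>I. ?S p) h \<le> integral {l..r} h"
    using hi h by (intro integral_subset_le[OF sub]) (auto simp: has_integral_integrable)
  then show ?thesis using integral_unique[OF hi] by (simp add: case_prod_unfold)
qed

lemma fam_length: 
  assumes "fam l r I" "l \<le> r" shows "(\<Sum>(x, y)\<in>I. y - x) \<le> r - l"
proof -
  have "(\<Sum>(x, y)\<in>I. y - x) = (\<Sum>(x, y)\<in>I. integral {x..y} (\<lambda>_. 1::real))"
    by (intro sum.cong) (auto dest: famD[OF assms(1)])
  also have "\<dots> \<le> integral {l..r} (\<lambda>_. 1)" by (rule fam_integral[OF assms(1)]) auto
  finally show ?thesis using assms(2) by simp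
qed

text \<open>Cutting \<open>\<bar>f\<bar>\<close> at height \<open>K\<close> leaves an excess of
  small integral, by dominated convergence. The bounded part then contributes at most
  \<open>K\<close> times the total length of a family, which is how absolute continuity of
  primitives follows.\<close>

lemma integral_tail_small:
  assumes f: "f absolutely_integrable_on {x..y::real}" and e: "0 < (\<epsilon>::real)"
  shows "\<exists>K\<ge>0. (\<lambda>t. max 0 (\<bar>f t\<bar> - K)) integrable_on {x..y} \<and> integral {x..y} (\<lambda>t. max 0 (\<bar>f t\<bar> - K)) < \<epsilon>"
proof -
  have "(\<lambda>t. \<bar>f t\<bar>) absolutely_integrable_on {x..y}" using set_integrable_abs[OF f] .
  then have fi: "(\<lambda>t. \<bar>f t\<bar>) integrable_on {x..y}" using set_lebesgue_integral_eq_integral(1) by blast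
  have mi: "(\<lambda>t. max 0 (\<bar>f t\<bar> - real n)) integrable_on {x..y}" for n
  proof (rule measurable_bounded_by_integrable_imp_integrable[OF _ fi])
    have "f \<in> borel_measurable (lebesgue_on {x..y})"
      by (rule absolutely_integrable_imp_borel_measurable[OF f]) simp
    then show "(\<lambda>t. max 0 (\<bar>f t\<bar> - real n)) \<in> borel_measurable (lebesgue_on {x..y})" by measurable
  qed auto
  have "(\<lambda>n. integral {x..y} (\<lambda>t. max 0 (\<bar>f t\<bar> - real n))) \<longlonglongrightarrow> integral {x..y} (\<lambda>t. 0)"
  proof (rule dominated_convergence(2)[OF mi fi])
    fix t assume "t \<in> {x..y}"
    obtain m where "\<bar>f t\<bar> < real m" using reals_Archimedean2 by blast
    then have "\<forall>n\<ge>m. max 0 (\<bar>f t\<bar> - real n) = 0" by fastforce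
    then show "(\<lambda>n. max 0 (\<bar>f t\<bar> - real n)) \<longlonglongrightarrow> 0"
      by (intro tendsto_eventually) (auto simp: eventually_sequentially)
  qed auto
  then have "\<forall>\<^sub>F n in sequentially. integral {x..y} (\<lambda>t. max 0 (\<bar>f t\<bar> - real n)) < \<epsilon>"
    using e by (intro order_tendstoD(2)[of _ 0]) auto
  then obtain n where "integral {x..y} (\<lambda>t. max 0 (\<bar>f t\<bar> - real n)) < \<epsilon>"
    by (meson eventually_happens trivial_limit_sequentially)
  then show ?thesis using mi[of n] by (intro exI[of _ "real n"]) auto
qed

lemma prim_loc_abs_cont:
  assumes "prim F f" shows "loc_abs_cont F"
  unfolding loc_abs_cont_def abs_cont_on_fam
proof (intro allI impI)
  fix l r \<epsilon> :: real assume lr: "0 < l" "l < r" and e: "0 < \<epsilon>"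
  obtain K where K: "K \<ge> 0" "(\<lambda>t. max 0 (\<bar>f t\<bar> - K)) integrable_on {l..r}"
     "integral {l..r} (\<lambda>t. max 0 (\<bar>f t\<bar> - K)) < \<epsilon>/2"
    using integral_tail_small[OF L1locD[OF prim_L1[OF assms] lr(1)], of "\<epsilon>/2" r] e by auto
  define \<delta> where "\<delta> = \<epsilon> / (2 * (K + 1))"
  have d: "\<delta> > 0" using e K by (simp add: \<delta>_def)
  have Kd: "K * \<delta> \<le> \<epsilon>/2" using e K by (simp add: \<delta>_def field_simps)
  show "\<exists>\<delta>>0. \<forall>I. fam l r I \<and> (\<Sum>(x, y)\<in>I. y - x) < \<delta> \<longrightarrow> (\<Sum>(x, y)\<in>I. \<bar>F y - F x\<bar>) < \<epsilon>"
  proof (intro exI[of _ \<delta>] conjI d allI impI, elim conjE)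
    fix I assume I: "fam l r I" and len: "(\<Sum>(x, y)\<in>I. y - x) < \<delta>"
    have "(\<Sum>(x, y)\<in>I. \<bar>F y - F x\<bar>) \<le> (\<Sum>(x, y)\<in>I. K * (y - x) + integral {x..y} (\<lambda>t. max 0 (\<bar>f t\<bar> - K)))"
    proof (rule sum_mono, clarify)
      fix x y assume "(x, y) \<in> I"
      then have xy: "l \<le> x" "x < y" "y \<le> r" using famD[OF I] by auto
      have i1: "(\<lambda>t. max 0 (\<bar>f t\<bar> - K)) integrable_on {x..y}"
        using integrable_on_subinterval[OF K(2)] xy by auto
      have i2: "f integrable_on {x..y}" using L1loc_integrable[OF prim_L1[OF assms]] lr xy by auto
      have "\<bar>F y - F x\<bar> = norm (integral {x..y} f)" using primD[OF assms, of x y] lr xy by simp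
      also have "\<dots> \<le> integral {x..y} (\<lambda>t. K + max 0 (\<bar>f t\<bar> - K))"
        by (rule Henstock_Kurzweil_Integration.integral_norm_bound_integral[OF i2])
          (use i1 in \<open>auto intro!: integrable_add\<close>)
      also have "\<dots> = K * (y - x) + integral {x..y} (\<lambda>t. max 0 (\<bar>f t\<bar> - K))"
        using i1 xy by (subst integral_add) (auto simp: mult.commute)
      finally show "\<bar>F y - F x\<bar> \<le> K * (y - x) + integral {x..y} (\<lambda>t. max 0 (\<bar>f t\<bar> - K))" .
    qed
    also have "\<dots> = K * (\<Sum>(x, y)\<in>I. y - x) + (\<Sum>(x, y)\<in>I. integral {x..y} (\<lambda>t. max 0 (\<bar>f t\<bar> - K)))"
      by (simp add: case_prod_unfold sum.distrib sum_distrib_left)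
    also have "\<dots> < \<epsilon>"
    proof -
      have "K * (\<Sum>(x, y)\<in>I. y - x) \<le> K * \<delta>" using K len by (intro mult_left_mono) auto
      moreover have "(\<Sum>(x, y)\<in>I. integral {x..y} (\<lambda>t. max 0 (\<bar>f t\<bar> - K))) \<le> integral {l..r} (\<lambda>t. max 0 (\<bar>f t\<bar> - K))"
        by (rule fam_integral[OF I K(2)]) auto
      ultimately show ?thesis using K Kd by linarith
    qed
    finally show "(\<Sum>(x, y)\<in>I. \<bar>F y - F x\<bar>) < \<epsilon>" .
  qed
qed

section \<open>Positive variation and the Jordan decomposition\<close>

definition posvar :: "(real \<Rightarrow> real) \<Rightarrow> real \<Rightarrow> real \<Rightarrow> real" where
  "posvar f l r = (SUP I\<in>Collect (fam l r). \<Sum>(x, y)\<in>I. f y - f x)"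

lemma fam_empty: "fam l r {}" by (rule famI) auto

context
  fixes f :: "real \<Rightarrow> real" and l r :: real
  assumes lr: "l \<le> r" and bd: "\<And>I. fam l r I \<Longrightarrow> (\<Sum>(x, y)\<in>I. \<bar>f y - f x\<bar>) \<le> 1"
begin

lemma posvar_bdd: 
  assumes "l \<le> x" "y \<le> r" shows "bdd_above ((\<lambda>I. \<Sum>(x, y)\<in>I. f y - f x) ` Collect (fam x y))"
proof (rule bdd_aboveI2)
  fix I assume "I \<in> Collect (fam x y)"
  then have I: "fam l r I" using assms fam_mono by blast
  have "(\<Sum>(x, y)\<in>I. f y - f x) \<le> (\<Sum>(x, y)\<in>I. \<bar>f y - f x\<bar>)" by (intro sum_mono) auto
  with bd[OF I] show "(\<Sum>(x, y)\<in>I. f y - f x) \<le> 1" by linarith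
qed

lemma posvar_upper:
  assumes "l \<le> x" "y \<le> r" "fam x y I" shows "(\<Sum>(x, y)\<in>I. f y - f x) \<le> posvar f x y"
  unfolding posvar_def using assms posvar_bdd[OF assms(1,2)] by (intro cSUP_upper) auto

lemma posvar_least:
  assumes "\<And>I. fam x y I \<Longrightarrow> (\<Sum>(x, y)\<in>I. f y - f x) \<le> B" shows "posvar f x y \<le> B"
  unfolding posvar_def using assms fam_empty by (intro cSUP_least) auto


lemma posvar_approx:
  assumes "l \<le> x" "y \<le> r" "0 < e"
  obtains I where "fam x y I" "posvar f x y \<le> (\<Sum>(x, y)\<in>I. f y - f x) + e"
proof -
  have "\<exists>I\<in>Collect (fam x y). posvar f x y - e < (\<Sum>(x, y)\<in>I. f y - f x)"
    using less_cSUP_iff[OF _ posvar_bdd[OF assms(1,2)], of "posvar f x y - e"] fam_empty assms(3)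
    unfolding posvar_def by auto
  then show ?thesis using that by force
qed

text \<open>A family in \<open>{l..x}\<close> can be enlarged by the interval from \<open>x\<close>
  to \<open>y\<close>, or left as it is. Together the two inequalities make
  \<open>posvar f l\<close> and \<open>posvar f l - f\<close> increasing, which is the Jordan
  decomposition of \<open>f\<close>.\<close>

lemma posvar_increment:
  assumes "l \<le> x" "x \<le> y" "y \<le> r"
  shows "f y - f x \<le> posvar f l y - posvar f l x" "0 \<le> posvar f l y - posvar f l x"
proof -
  have "posvar f l x \<le> posvar f l y - (f y - f x)"
  proof (cases "x = y")
    case False
    show ?thesis
    proof (rule posvar_least)
      fix I assume I: "fam l x I"
      have nin: "(x, y) \<notin> I" using famD[OF I, of x y] assms False by auto
      have "fam l y (insert (x, y) I)"
      proof (rule famI)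
        show "finite (insert (x, y) I)" using fam_finite[OF I] by simp
        fix u v assume "(u, v) \<in> insert (x, y) I"
        then show "l \<le> u \<and> u < v \<and> v \<le> y" using famD[OF I, of u v] assms False by auto
      next
        fix a b u v assume "(a, b) \<in> insert (x, y) I" "(u, v) \<in> insert (x, y) I" "(a, b) \<noteq> (u, v)"
        then show "b \<le> u \<or> v \<le> a"
          using fam_disj[OF I, of a b u v] famD[OF I, of a b] famD[OF I, of u v] by auto
      qed
      then have "(\<Sum>(x, y)\<in>insert (x, y) I. f y - f x) \<le> posvar f l y" 
        using posvar_upper[of l y] assms by simp
      then show "(\<Sum>(x, y)\<in>I. f y - f x) \<le> posvar f l y - (f y - f x)"
        using nin fam_finite[OF I] by simp
    qed
  qed simp
  then show "f y - f x \<le> posvar f l y - posvar f l x" by simp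
  have "posvar f l x \<le> posvar f l y"
  proof (rule posvar_least)
    fix I assume "fam l x I"
    then have "fam l y I" using assms fam_mono by blast
    then show "(\<Sum>(x, y)\<in>I. f y - f x) \<le> posvar f l y" using posvar_upper[of l y] assms by simp
  qed
  then show "0 \<le> posvar f l y - posvar f l x" by simp
qed

text \<open>Every interval of a family is cut at \<open>x\<close> by \<open>min\<close> and
  \<open>max\<close>. The signed increments add up exactly; pieces that degenerate to a point
  contribute zero and are dropped, so that the strict inequality in \<open>fam\<close>
  survives.\<close>

lemma posvar_split:
  assumes "l \<le> x" "x \<le> y" "y \<le> r"
  shows "posvar f l y - posvar f l x \<le> posvar f x y"
proof -
  have "posvar f l y \<le> posvar f l x + posvar f x y"
  proof (rule posvar_least)
    fix I assume I: "fam l y I"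
    let ?c1 = "\<lambda>(u::real, v). (min u x, min v x)" and ?c2 = "\<lambda>(u::real, v). (max u x, max v x)"
    define I1 where "I1 = {p\<in>I. fst p < x}"
    define I2 where "I2 = {p\<in>I. x < snd p}"
    have fin: "finite I" using I by (rule fam_finite)
    have key: "u < v \<and> l \<le> u \<and> v \<le> y" if "(u, v) \<in> I" for u v using famD[OF I that] by auto
    have inj1: "inj_on ?c1 I1"
    proof (rule inj_onI, clarify)
      fix a b u v assume h: "(a, b) \<in> I1" "(u, v) \<in> I1" "min a x = min u x" "min b x = min v x"
      then have "a = u" unfolding I1_def by auto
      moreover have "b = v" 
        using fam_disj[OF I, of a b u v] key[of a b] key[of u v] h \<open>a = u\<close> unfolding I1_def by fastforce
      ultimately show "a = u \<and> b = v" by simp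
    qed
    have inj2: "inj_on ?c2 I2"
    proof (rule inj_onI, clarify)
      fix a b u v assume h: "(a, b) \<in> I2" "(u, v) \<in> I2" "max a x = max u x" "max b x = max v x"
      then have "b = v" unfolding I2_def by auto
      moreover have "a = u" 
        using fam_disj[OF I, of a b u v] key[of a b] key[of u v] h \<open>b = v\<close> unfolding I2_def by fastforce
      ultimately show "a = u \<and> b = v" by simp
    qed
    have f1: "fam l x (?c1 ` I1)"
    proof (rule famI)
      show "finite (?c1 ` I1)" using fin by (simp add: I1_def)
      fix a b assume "(a, b) \<in> ?c1 ` I1"
      then obtain u v where uv: "(u, v) \<in> I" "u < x" "a = u" "b = min v x" unfolding I1_def by auto
      then show "l \<le> a \<and> a < b \<and> b \<le> x" using key[OF uv(1)] by auto
      fix a' b' assume "(a', b') \<in> ?c1 ` I1" and ne: "(a, b) \<noteq> (a', b')"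
      then obtain u' v' where uv': "(u', v') \<in> I" "u' < x" "a' = u'" "b' = min v' x" unfolding I1_def by auto
      have "(u, v) \<noteq> (u', v')" using uv uv' ne by auto
      then show "b \<le> a' \<or> b' \<le> a" using fam_disj[OF I uv(1) uv'(1)] uv uv' by auto
    qed
    have f2: "fam x y (?c2 ` I2)"
    proof (rule famI)
      show "finite (?c2 ` I2)" using fin by (simp add: I2_def)
      fix a b assume "(a, b) \<in> ?c2 ` I2"
      then obtain u v where uv: "(u, v) \<in> I" "x < v" "a = max u x" "b = v" unfolding I2_def by auto
      then show "x \<le> a \<and> a < b \<and> b \<le> y" using key[OF uv(1)] by auto
      fix a' b' assume "(a', b') \<in> ?c2 ` I2" and ne: "(a, b) \<noteq> (a', b')"
      then obtain u' v' where uv': "(u', v') \<in> I" "x < v'" "a' = max u' x" "b' = v'" unfolding I2_def by auto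
      have "(u, v) \<noteq> (u', v')" using uv uv' ne by auto
      then show "b \<le> a' \<or> b' \<le> a" using fam_disj[OF I uv(1) uv'(1)] uv uv' by auto
    qed
    have "(\<Sum>(u, v)\<in>I. f v - f u) = (\<Sum>(u, v)\<in>I. (f (min v x) - f (min u x)) + (f (max v x) - f (max u x)))"
      by (intro sum.cong) (auto simp: min_def max_def)
    also have "\<dots> = (\<Sum>(u, v)\<in>I. f (min v x) - f (min u x)) + (\<Sum>(u, v)\<in>I. f (max v x) - f (max u x))"
      by (simp add: case_prod_unfold sum.distrib)
    also have "(\<Sum>(u, v)\<in>I. f (min v x) - f (min u x)) = (\<Sum>(u, v)\<in>I1. f (min v x) - f (min u x))"
      using fin key by (intro sum.mono_neutral_right) (force simp: I1_def min_def)+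
    also have "\<dots> = (\<Sum>(u, v)\<in>?c1 ` I1. f v - f u)"
      by (subst sum.reindex[OF inj1]) (simp add: case_prod_unfold)
    also have "\<dots> \<le> posvar f l x" using posvar_upper[OF _ _ f1] assms by simp
    also have "(\<Sum>(u, v)\<in>I. f (max v x) - f (max u x)) = (\<Sum>(u, v)\<in>I2. f (max v x) - f (max u x))"
      using fin key by (intro sum.mono_neutral_right) (force simp: I2_def max_def)+
    also have "\<dots> = (\<Sum>(u, v)\<in>?c2 ` I2. f v - f u)"
      by (subst sum.reindex[OF inj2]) (simp add: case_prod_unfold)
    also have "\<dots> \<le> posvar f x y" using posvar_upper[OF _ _ f2] assms by simp
    finally show "(\<Sum>(x, y)\<in>I. f y - f x) \<le> posvar f l x + posvar f x y" by simp
  qed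
  then show ?thesis by simp
qed

text \<open>Each interval of the given family is replaced by a nearly optimal family inside it. The
  union of these is again admissible and not longer, so absolute continuity of \<open>f\<close>
  bounds its increments; the total error is distributed evenly, as \<open>\<eta>\<close> per
  interval.\<close>

lemma posvar_abs_cont:
  assumes ac: "abs_cont_on l r f" shows "abs_cont_on l r (posvar f l)"
  unfolding abs_cont_on_fam
proof (intro allI impI)
  fix \<epsilon> :: real assume e: "0 < \<epsilon>"
  obtain \<delta> where d: "\<delta> > 0" "\<And>I. fam l r I \<Longrightarrow> (\<Sum>(x, y)\<in>I. y - x) < \<delta> \<Longrightarrow> (\<Sum>(x, y)\<in>I. \<bar>f y - f x\<bar>) < \<epsilon>/2"
    using ac e unfolding abs_cont_on_fam by (metis half_gt_zero)
  show "\<exists>\<delta>>0. \<forall>I. fam l r I \<and> (\<Sum>(x, y)\<in>I. y - x) < \<delta> \<longrightarrow> (\<Sum>(x, y)\<in>I. \<bar>posvar f l y - posvar f l x\<bar>) < \<epsilon>"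
  proof (intro exI[of _ \<delta>] conjI d allI impI, elim conjE)
    fix J assume J: "fam l r J" and len: "(\<Sum>(x, y)\<in>J. y - x) < \<delta>"
    define \<eta> where "\<eta> = \<epsilon> / (4 * (real (card J) + 1))"
    have eta: "0 < \<eta>" using e by (simp add: \<eta>_def)
    have key: "l \<le> fst p \<and> fst p < snd p \<and> snd p \<le> r" if "p \<in> J" for p
      using famD[OF J, of "fst p" "snd p"] that by auto
    have "\<exists>I. fam (fst p) (snd p) I \<and> posvar f (fst p) (snd p) \<le> (\<Sum>(x, y)\<in>I. f y - f x) + \<eta>" if "p \<in> J" for p
      using posvar_approx[of "fst p" "snd p" \<eta>] key[OF that] eta by metis
    then obtain I where I: "\<And>p. p \<in> J \<Longrightarrow> fam (fst p) (snd p) (I p)"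
       "\<And>p. p \<in> J \<Longrightarrow> posvar f (fst p) (snd p) \<le> (\<Sum>(x, y)\<in>I p. f y - f x) + \<eta>" by metis
    have finJ: "finite J" using J by (rule fam_finite)
    have sep: "b \<le> u \<or> v \<le> a" if "p \<in> J" "q \<in> J" "p \<noteq> q" "(a, b) \<in> I p" "(u, v) \<in> I q" for p q a b u v
      using fam_disj[OF J, of "fst p" "snd p" "fst q" "snd q"] that famD[OF I(1)[of p], of a b] famD[OF I(1)[of q], of u v]
      by (auto simp: prod_eq_iff)
    have disj: "\<forall>p\<in>J. \<forall>q\<in>J. p \<noteq> q \<longrightarrow> I p \<inter> I q = {}"
    proof (intro ballI impI, rule ccontr)
      fix p q assume h: "p \<in> J" "q \<in> J" "p \<noteq> q" "I p \<inter> I q \<noteq> {}"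
      then obtain a b where ab: "(a, b) \<in> I p" "(a, b) \<in> I q" by auto
      then show False using sep[OF h(1-3) ab] famD[OF I(1)[OF h(1)] ab(1)] by auto
    qed
    have U: "fam l r (\<Union>p\<in>J. I p)"
    proof (rule famI)
      show "finite (\<Union>p\<in>J. I p)" using finJ I(1) fam_finite by blast
      fix a b assume "(a, b) \<in> (\<Union>p\<in>J. I p)"
      then obtain p where p: "p \<in> J" "(a, b) \<in> I p" by auto
      then show "l \<le> a \<and> a < b \<and> b \<le> r" using famD[OF I(1)[OF p(1)] p(2)] key[OF p(1)] by auto
      fix u v assume "(u, v) \<in> (\<Union>p\<in>J. I p)" and ne: "(a, b) \<noteq> (u, v)"
      then obtain q where q: "q \<in> J" "(u, v) \<in> I q" by auto
      show "b \<le> u \<or> v \<le> a"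
      proof (cases "p = q")
        case True then show ?thesis using fam_disj[OF I(1)[OF p(1)] p(2), of u v] q ne by auto
      next
        case False then show ?thesis using sep[OF p(1) q(1) False p(2) q(2)] by auto
      qed
    qed
    have sumU: "(\<Sum>q\<in>(\<Union>p\<in>J. I p). g q) = (\<Sum>p\<in>J. \<Sum>q\<in>I p. g q)" for g :: "real \<times> real \<Rightarrow> real"
      using finJ fam_finite[OF I(1)] disj by (intro sum.UNION_disjoint) blast+
    have "(\<Sum>(x, y)\<in>(\<Union>p\<in>J. I p). y - x) \<le> (\<Sum>(x, y)\<in>J. y - x)"
      unfolding sumU using fam_length[OF I(1)] key by (intro sum_mono) (force simp: case_prod_unfold)
    then have small: "(\<Sum>(x, y)\<in>(\<Union>p\<in>J. I p). \<bar>f y - f x\<bar>) < \<epsilon>/2" using d(2)[OF U] len by simp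
    have "(\<Sum>(x, y)\<in>J. \<bar>posvar f l y - posvar f l x\<bar>) \<le> (\<Sum>p\<in>J. (\<Sum>(x, y)\<in>I p. f y - f x) + \<eta>)"
    proof (rule sum_mono, clarify)
      fix x y assume xy: "(x, y) \<in> J"
      then have "l \<le> x" "x \<le> y" "y \<le> r" using famD[OF J xy] by auto
      then show "\<bar>posvar f l y - posvar f l x\<bar> \<le> (\<Sum>(x, y)\<in>I (x, y). f y - f x) + \<eta>"
        using posvar_increment(2)[of x y] posvar_split[of x y] I(2)[OF xy] by simp
    qed
    also have "\<dots> = (\<Sum>(x, y)\<in>(\<Union>p\<in>J. I p). f y - f x) + real (card J) * \<eta>"
      unfolding sumU by (simp add: sum.distrib)
    also have "\<dots> \<le> (\<Sum>(x, y)\<in>(\<Union>p\<in>J. I p). \<bar>f y - f x\<bar>) + \<epsilon>/2"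
    proof (rule add_mono)
      show "real (card J) * \<eta> \<le> \<epsilon>/2" using e by (simp add: \<eta>_def field_simps)
    qed (intro sum_mono, auto)
    also have "\<dots> < \<epsilon>" using small by simp
    finally show "(\<Sum>(x, y)\<in>J. \<bar>posvar f l y - posvar f l x\<bar>) < \<epsilon>" .
  qed
qed

end

section \<open>Densities of absolutely continuous functions\<close>

lemma clamp_simps:
  fixes l r x y :: real
  assumes "l \<le> r"
  shows "l \<le> max l (min r x)" "max l (min r x) \<le> r" "x \<le> y \<Longrightarrow> max l (min r x) \<le> max l (min r y)"
    "l \<le> x \<Longrightarrow> x \<le> r \<Longrightarrow> max l (min r x) = x"
  using assms by (simp_all add: max_def min_def)

lemma abs_cont_on_single:
  assumes "abs_cont_on l r g" "0 < \<epsilon>"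
  obtains \<delta> where "\<delta> > 0" "\<And>x y. l \<le> x \<Longrightarrow> x \<le> y \<Longrightarrow> y \<le> r \<Longrightarrow> y - x < \<delta> \<Longrightarrow> \<bar>g y - g x\<bar> < \<epsilon>"
proof -
  obtain \<delta> where d: "\<delta> > 0" "\<And>I. fam l r I \<Longrightarrow> (\<Sum>(x, y)\<in>I. y - x) < \<delta> \<Longrightarrow> (\<Sum>(x, y)\<in>I. \<bar>g y - g x\<bar>) < \<epsilon>"
    using assms unfolding abs_cont_on_fam by metis
  have "\<bar>g y - g x\<bar> < \<epsilon>" if "l \<le> x" "x \<le> y" "y \<le> r" "y - x < \<delta>" for x y
  proof (cases "x = y")
    case False
    then have "fam l r {(x, y)}" using that by (intro famI) auto
    from d(2)[OF this] show ?thesis using that by simp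
  qed (use assms in simp)
  then show ?thesis using that d(1) by blast
qed

text \<open>Radon-Nikodym: the Stieltjes measure of \<open>g\<close>, extended by constants outside
  \<open>{l..r}\<close>, is finite, and absolute continuity of \<open>g\<close> makes it absolutely
  continuous with respect to Lebesgue measure. Its density is the derivative.\<close>

lemma mono_abs_cont_density:
  fixes g :: "real \<Rightarrow> real"
  assumes lr: "l \<le> r" and mono: "\<And>x y. l \<le> x \<Longrightarrow> x \<le> y \<Longrightarrow> y \<le> r \<Longrightarrow> g x \<le> g y"
    and ac: "abs_cont_on l r g"
  shows "\<exists>h. h absolutely_integrable_on {l..r} \<and> (\<forall>x\<in>{l..r}. integral {l..x} h = g x - g l)"
proof -
  define cl where "cl x = max l (min r x)" for x
  note cl = clamp_simps[OF lr, folded cl_def]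
  define G where "G x = g (cl x)" for x
  have Gmono: "G x \<le> G y" if "x \<le> y" for x y unfolding G_def using that cl by (intro mono) auto
  have Gcont: "continuous_on UNIV G"
    unfolding continuous_on_iff
  proof (intro ballI allI impI)
    fix x e :: real assume e: "0 < e"
    obtain \<delta> where d: "\<delta> > 0" "\<And>x y. l \<le> x \<Longrightarrow> x \<le> y \<Longrightarrow> y \<le> r \<Longrightarrow> y - x < \<delta> \<Longrightarrow> \<bar>g y - g x\<bar> < e"
      using abs_cont_on_single[OF ac e] by blast
    show "\<exists>d>0. \<forall>x'\<in>UNIV. dist x' x < d \<longrightarrow> dist (G x') (G x) < e"
    proof (intro exI[of _ \<delta>] conjI d ballI impI)
      fix y assume "dist y x < \<delta>"
      then have *: "\<bar>cl y - cl x\<bar> < \<delta>" by (auto simp: cl_def dist_real_def)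
      show "dist (G y) (G x) < e"
      proof (cases "cl x \<le> cl y")
        case True
        then have "\<bar>g (cl y) - g (cl x)\<bar> < e" using d(2)[of "cl x" "cl y"] cl(1,2) * by auto
        then show ?thesis by (simp add: G_def dist_real_def)
      next
        case False
        then have "\<bar>g (cl x) - g (cl y)\<bar> < e" using d(2)[of "cl y" "cl x"] cl(1,2) * by auto
        then show ?thesis by (simp add: G_def dist_real_def abs_minus_commute)
      qed
    qed
  qed
  have Grc: "continuous (at_right a) G" for a
    using Gcont by (auto simp: continuous_on_eq_continuous_at intro: continuous_at_imp_continuous_at_within)
  define M where "M = interval_measure G"
  have sM: "sets M = sets borel" "space M = UNIV" by (auto simp: M_def)
  have MI: "emeasure M {a<..b} = ennreal (G b - G a)" if "a \<le> b" for a b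
    unfolding M_def using that by (intro emeasure_interval_measure_Ioc Gmono Grc)
  have "emeasure M (space M) \<le> ennreal (g r - g l)"
  proof -
    have U: "(\<Union>n. {- real n<..real n}) = (UNIV :: real set)"
    proof (rule UNIV_eq_I[symmetric])
      fix x :: real
      obtain n where "\<bar>x\<bar> < real n" using reals_Archimedean2 by blast
      then have "x \<in> {- real n<..real n}" by auto
      then show "x \<in> (\<Union>n. {- real n<..real n})" by blast
    qed
    have "emeasure M (\<Union>n. {- real n<..real n}) = (SUP n. emeasure M {- real n<..real n})"
      by (rule SUP_emeasure_incseq[symmetric]) (auto simp: sM incseq_def)
    also have "\<dots> \<le> ennreal (g r - g l)"
    proof (rule SUP_least)
      fix n :: nat
      have "G (real n) - G (- real n) \<le> g r - g l"
        unfolding G_def using mono[of "cl (real n)" r] mono[of l "cl (- real n)"] cl lr by (smt (verit))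
      then show "emeasure M {- real n<..real n} \<le> ennreal (g r - g l)"
        by (subst MI) (auto intro: ennreal_leI)
    qed
    finally show ?thesis unfolding U sM .
  qed
  then have fin: "emeasure M (space M) \<noteq> \<infinity>" using ennreal_less_top le_less_trans by (metis infinity_ennreal_def less_irrefl)
  \<comment> \<open>The null set \<open>K\<close> has an open neighbourhood \<open>T\<close> of
    measure below \<open>\<delta>\<close>, which contains all balls of radius \<open>\<eta>\<close>
    around points of \<open>K\<close>. Cells of a grid of mesh \<open>\<eta> / 2\<close> that meet
    \<open>K\<close> therefore stay in \<open>T\<close>, their total length is below
    \<open>\<delta>\<close>, and absolute continuity applies to them.\<close>
  have M0: "emeasure M K \<le> ennreal \<epsilon>" if e: "0 < \<epsilon>" and K: "compact K" "emeasure lborel K = 0" for K \<epsilon>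
  proof -
    obtain \<delta> where d: "\<delta> > 0" "\<And>I. fam l r I \<Longrightarrow> (\<Sum>(x, y)\<in>I. y - x) < \<delta> \<Longrightarrow> (\<Sum>(x, y)\<in>I. \<bar>g y - g x\<bar>) < \<epsilon>"
      using ac e unfolding abs_cont_on_fam by metis
    have Kb: "K \<in> sets borel" using compact_imp_closed[OF K(1)] by (rule borel_closed)
    then have "K \<in> sets lebesgue" by auto
    then obtain T where T: "open T" "K \<subseteq> T" "(T - K) \<in> lmeasurable" "emeasure lebesgue (T - K) < ennreal \<delta>"
      using sets_lebesgue_outer_open[OF _ d(1)] by metis
    obtain \<eta> where eta: "\<eta> > 0" "(\<Union>x\<in>K. ball x \<eta>) \<subseteq> T"
      using compact_subset_open_imp_ball_epsilon_subset[OF K(1) T(1,2)] by metis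
    define \<mu> where "\<mu> = \<eta> / 2"
    have mu: "\<mu> > 0" using eta by (simp add: \<mu>_def)
    define c where "c k = {of_int k * \<mu><..of_int (k + 1) * \<mu>}" for k :: int
    define Z where "Z = {k. c k \<inter> K \<noteq> {}}"
    have cover: "x \<in> c (\<lceil>x / \<mu>\<rceil> - 1)" for x
    proof -
      have "of_int (\<lceil>x / \<mu>\<rceil> - 1) < x / \<mu>" by linarith
      then have "of_int (\<lceil>x / \<mu>\<rceil> - 1) * \<mu> < x" using mu by (simp only: pos_less_divide_eq)
      moreover have "x \<le> of_int \<lceil>x / \<mu>\<rceil> * \<mu>"
        unfolding pos_divide_le_eq[OF mu, symmetric] by (rule le_of_int_ceiling)
      ultimately show ?thesis by (simp add: c_def)
    qed
    have cuniq: "\<lceil>x / \<mu>\<rceil> = k + 1" if "x \<in> c k" for x k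
      using that mu by (intro ceiling_unique) (auto simp: c_def field_simps)
    obtain B where B: "\<And>x. x \<in> K \<Longrightarrow> \<bar>x\<bar> \<le> B" using compact_imp_bounded[OF K(1)] by (auto simp: bounded_real)
    have finZ: "finite Z"
    proof (rule finite_subset)
      show "Z \<subseteq> {\<lceil>(- B) / \<mu>\<rceil> - 1..\<lceil>B / \<mu>\<rceil>}"
      proof
        fix k assume "k \<in> Z"
        then obtain x where x: "x \<in> c k" "x \<in> K" unfolding Z_def by auto
        have "(- B) / \<mu> \<le> x / \<mu>" "x / \<mu> \<le> B / \<mu>" using B[OF x(2)] mu by (intro divide_right_mono; simp)+
        then have "\<lceil>(- B) / \<mu>\<rceil> \<le> \<lceil>x / \<mu>\<rceil>" "\<lceil>x / \<mu>\<rceil> \<le> \<lceil>B / \<mu>\<rceil>" using ceiling_mono by blast+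
        then show "k \<in> {\<lceil>(- B) / \<mu>\<rceil> - 1..\<lceil>B / \<mu>\<rceil>}" using cuniq[OF x(1)] by auto
      qed
    qed auto
    have cT: "c k \<subseteq> T" if "k \<in> Z" for k
    proof
      fix y assume y: "y \<in> c k"
      obtain x where x: "x \<in> c k" "x \<in> K" using \<open>k \<in> Z\<close> unfolding Z_def by auto
      have "\<bar>x - y\<bar> \<le> \<mu>" using x y by (auto simp: c_def algebra_simps)
      then have "y \<in> ball x \<eta>" using eta by (simp add: \<mu>_def dist_real_def)
      then show "y \<in> T" using eta x by blast
    qed
    have cdisj: "disjoint_family_on c Z"
      unfolding disjoint_family_on_def using cuniq by (metis add_right_cancel disjoint_iff)
    have KU: "K \<subseteq> (\<Union>k\<in>Z. c k)"
    proof
      fix x assume "x \<in> K"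
      then have "\<lceil>x / \<mu>\<rceil> - 1 \<in> Z" unfolding Z_def using cover[of x] by blast
      then show "x \<in> (\<Union>k\<in>Z. c k)" using cover[of x] by blast
    qed
    have cme: "emeasure lborel (c k) = ennreal \<mu>" for k
      using mu by (simp add: c_def emeasure_lborel_Ioc distrib_right)
    have "ennreal (real (card Z) * \<mu>) = (\<Sum>k\<in>Z. emeasure lborel (c k))"
      using mu unfolding cme by (simp add: ennreal_of_nat_eq_real_of_nat ennreal_mult)
    also have "\<dots> = emeasure lborel (\<Union>k\<in>Z. c k)"
      by (rule sum_emeasure[OF _ cdisj finZ]) (auto simp: c_def)
    also have "\<dots> \<le> emeasure lborel T" using cT T(1) by (intro emeasure_mono) auto
    also have "\<dots> = emeasure lebesgue T" using T(1) by simp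
    also have "\<dots> \<le> emeasure lebesgue (T - K) + emeasure lebesgue K"
      using emeasure_subadditive[of "T - K" lebesgue K] T Kb
      by (metis Diff_partition Un_commute \<open>K \<in> sets lebesgue\<close> fmeasurableD)
    also have "\<dots> < ennreal \<delta>" using T(4) K(2) Kb by simp
    finally have len: "real (card Z) * \<mu> < \<delta>" using d(1) by (simp add: ennreal_less_iff mu less_imp_le)
    \<comment> \<open>Cells that are clamped to a point have no increment and are left out, as
      families consist of nondegenerate intervals.\<close>
    define Z' where "Z' = {k\<in>Z. cl (of_int k * \<mu>) < cl (of_int (k + 1) * \<mu>)}"
    let ?J = "\<lambda>k::int. (cl (of_int k * \<mu>), cl (of_int (k + 1) * \<mu>))"
    have ord: "of_int (k + 1) * \<mu> \<le> of_int k' * \<mu>" if "k < k'" for k k' :: int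
      using that mu by (intro mult_right_mono) auto
    have inj: "inj_on ?J Z'"
    proof (rule inj_onI, rule ccontr)
      fix k k' assume h: "k \<in> Z'" "k' \<in> Z'" "?J k = ?J k'" "k \<noteq> k'"
      then have "k < k' \<or> k' < k" by linarith
      then show False using ord[of k k'] ord[of k' k] h cl(3) unfolding Z'_def by fastforce
    qed
    have fI: "fam l r (?J ` Z')"
    proof (rule famI)
      show "finite (?J ` Z')" using finZ by (simp add: Z'_def)
      fix x y assume "(x, y) \<in> ?J ` Z'"
      then obtain k where k: "k \<in> Z'" "x = cl (of_int k * \<mu>)" "y = cl (of_int (k + 1) * \<mu>)" by auto
      then show "l \<le> x \<and> x < y \<and> y \<le> r" using cl(1,2) unfolding Z'_def by auto
      fix u v assume "(u, v) \<in> ?J ` Z'" and ne: "(x, y) \<noteq> (u, v)"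
      then obtain k' where k': "k' \<in> Z'" "u = cl (of_int k' * \<mu>)" "v = cl (of_int (k' + 1) * \<mu>)" by auto
      have "k < k' \<or> k' < k" using k k' ne by (metis linorder_cases)
      then show "y \<le> u \<or> v \<le> x" using ord[of k k'] ord[of k' k] cl(3) k k' by blast
    qed
    have "(\<Sum>(x, y)\<in>?J ` Z'. y - x) = (\<Sum>k\<in>Z'. cl (of_int (k + 1) * \<mu>) - cl (of_int k * \<mu>))"
      by (subst sum.reindex[OF inj]) simp
    also have "\<dots> \<le> (\<Sum>k\<in>Z'. \<mu>)"
    proof (rule sum_mono)
      fix k show "cl (of_int (k + 1) * \<mu>) - cl (of_int k * \<mu>) \<le> \<mu>"
        using mu unfolding cl_def by (auto simp: distrib_right)
    qed
    also have "\<dots> \<le> real (card Z) * \<mu>"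
      using mu card_mono[OF finZ, of Z'] by (auto simp: Z'_def intro!: mult_right_mono)
    finally have small: "(\<Sum>(x, y)\<in>?J ` Z'. \<bar>g y - g x\<bar>) < \<epsilon>" using d(2)[OF fI] len by linarith
    have "emeasure M K \<le> emeasure M (\<Union>k\<in>Z. c k)" using KU finZ by (intro emeasure_mono) (auto simp: sM c_def)
    also have "\<dots> \<le> (\<Sum>k\<in>Z. emeasure M (c k))" using finZ by (intro emeasure_subadditive_finite) (auto simp: sM c_def)
    also have "\<dots> = (\<Sum>k\<in>Z. ennreal (G (of_int (k + 1) * \<mu>) - G (of_int k * \<mu>)))"
      unfolding c_def using mu by (intro sum.cong refl MI mult_right_mono) auto
    also have "\<dots> = ennreal (\<Sum>k\<in>Z. G (of_int (k + 1) * \<mu>) - G (of_int k * \<mu>))"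
      using mu by (intro sum_ennreal) (auto intro!: Gmono mult_right_mono)
    also have "(\<Sum>k\<in>Z. G (of_int (k + 1) * \<mu>) - G (of_int k * \<mu>)) = (\<Sum>k\<in>Z'. G (of_int (k + 1) * \<mu>) - G (of_int k * \<mu>))"
    proof (rule sum.mono_neutral_right[OF finZ])
      show "Z' \<subseteq> Z" by (auto simp: Z'_def)
      show "\<forall>k\<in>Z - Z'. G (of_int (k + 1) * \<mu>) - G (of_int k * \<mu>) = 0"
      proof
        fix k assume "k \<in> Z - Z'"
        then have "cl (of_int (k + 1) * \<mu>) \<le> cl (of_int k * \<mu>)" by (auto simp: Z'_def)
        moreover have "cl (of_int k * \<mu>) \<le> cl (of_int (k + 1) * \<mu>)" using mu by (intro cl(3) mult_right_mono) auto
        ultimately show "G (of_int (k + 1) * \<mu>) - G (of_int k * \<mu>) = 0" by (simp add: G_def)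
      qed
    qed
    also have "\<dots> \<le> (\<Sum>(x, y)\<in>?J ` Z'. \<bar>g y - g x\<bar>)"
      by (subst sum.reindex[OF inj]) (auto simp: G_def intro!: sum_mono)
    finally show ?thesis using small by (meson ennreal_leI less_imp_le order_trans)
  qed
  have ac': "absolutely_continuous lborel M"
    unfolding absolutely_continuous_def
  proof
    fix N :: "real set" assume N: "N \<in> null_sets lborel"
    \<comment> \<open>Inner regularity of the finite measure reduces null sets to compact null sets,
      for which finite covers exist.\<close>
    have "emeasure M N = (SUP K\<in>{K. K \<subseteq> N \<and> compact K}. emeasure M K)"
      using N by (intro inner_regular[OF sM(1) fin]) auto
    also have "\<dots> \<le> 0"
    proof (rule SUP_least)
      fix K assume "K \<in> {K. K \<subseteq> N \<and> compact K}"
      then have K: "K \<subseteq> N" "compact K" by auto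
      have "emeasure lborel K \<le> emeasure lborel N" using K N by (intro emeasure_mono) auto
      then have "emeasure lborel K = 0" using N by auto
      then have K0: "emeasure lborel K = 0" .
      show "emeasure M K \<le> 0"
      proof (rule ennreal_le_epsilon)
        fix e :: real assume "0 < e"
        from M0[OF this K(2) K0] show "emeasure M K \<le> 0 + ennreal e" by simp
      qed
    qed
    finally show "N \<in> null_sets M" using N sM by (intro null_setsI) auto
  qed
  have fm: "finite_measure M" using fin by (rule finite_measureI)
  have sl: "sets M = sets lborel" by (simp add: sM)
  obtain D where D: "D \<in> borel_measurable lborel" "AE x in lborel. RN_deriv lborel M x = ennreal (D x)"
      "AE x in M. 0 < D x" "\<And>x. 0 \<le> D x"
    by (rule sigma_finite_measure.real_RN_deriv[OF sigma_finite_lborel fm ac' sl]) (rule that; assumption)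
  have int: "(D has_integral (g x - g l)) {l..x}" if x: "l \<le> x" "x \<le> r" for x
  proof -
    have "density lborel (RN_deriv lborel M) = M"
      using sigma_finite_measure.density_RN_deriv[OF sigma_finite_lborel ac' sl] .
    then have "emeasure M {l<..x} = emeasure (density lborel (RN_deriv lborel M)) {l<..x}" by simp
    also have "\<dots> = (\<integral>\<^sup>+t. RN_deriv lborel M t * indicator {l<..x} t \<partial>lborel)"
      by (subst emeasure_density) auto
    also have "\<dots> = (\<integral>\<^sup>+t. ennreal (D t * indicator {l<..x} t) \<partial>lborel)"
      using D(2) by (intro nn_integral_cong_AE) (auto simp: indicator_def)
    finally have "(\<integral>\<^sup>+t. ennreal (D t * indicator {l<..x} t) \<partial>lborel) = ennreal (g x - g l)"
      using MI[of l x] x cl(4)[of x] cl(4)[of l] lr by (simp add: G_def)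
    then have "((\<lambda>t. D t * indicator {l<..x} t) has_integral (g x - g l)) UNIV"
      using D(1,4) mono[of l x] x by (intro nn_integral_has_integral) auto
    then have "((\<lambda>t. if t \<in> {l<..x} then D t else 0) has_integral (g x - g l)) UNIV"
      by (rule has_integral_eq[rotated]) auto
    then have DI: "(D has_integral (g x - g l)) {l<..x}" by (simp only: has_integral_restrict_UNIV)
    show ?thesis
    proof -
      have "negligible {t \<in> {l<..x} - {l..x}. D t \<noteq> 0}" by (rule negligible_subset[of "{}"]) auto
      moreover have "negligible {t \<in> {l..x} - {l<..x}. D t \<noteq> 0}" by (rule negligible_subset[of "{l}"]) auto
      ultimately have "(D has_integral (g x - g l)) {l<..x} \<longleftrightarrow> (D has_integral (g x - g l)) {l..x}"
        by (rule has_integral_spike_set_eq)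
      with DI show ?thesis by simp
    qed
  qed
  show ?thesis
  proof (intro exI[of _ D] conjI ballI)
    show "D absolutely_integrable_on {l..r}"
      using has_integral_integrable[OF int[OF lr order_refl]] D(4) by (intro nonnegative_absolutely_integrable_1) simp_all
    fix x assume "x \<in> {l..r}"
    then have "l \<le> x" "x \<le> r" by simp_all
    then show "integral {l..x} D = g x - g l" by (rule integral_unique[OF int])
  qed
qed

lemma combine_density:
  fixes f h1 h2 :: "real \<Rightarrow> real"
  assumes "a \<le> b" "b \<le> c" "h1 absolutely_integrable_on {a..b}" "h2 absolutely_integrable_on {b..c}"
    and "\<forall>s\<in>{a..b}. integral {a..s} h1 = f s - f a" "\<forall>s\<in>{b..c}. integral {b..s} h2 = f s - f b"
    and h: "\<And>t. t < b \<Longrightarrow> h t = h1 t" "\<And>t. b < t \<Longrightarrow> h t = h2 t"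
  shows "h absolutely_integrable_on {a..c}" "\<forall>s\<in>{a..c}. integral {a..s} h = f s - f a"
proof -
  have n: "negligible {b}" by simp
  have i1: "h absolutely_integrable_on {a..b}"
    by (rule absolutely_integrable_spike[OF assms(3) n]) (use h(1) in auto)
  have i2: "h absolutely_integrable_on {b..c}"
    by (rule absolutely_integrable_spike[OF assms(4) n]) (use h(2) in auto)
  show i: "h absolutely_integrable_on {a..c}"
    using absolutely_integrable_on_combine[OF i1 i2] assms by simp
  have e1: "integral {a..s} h = f s - f a" if "s \<in> {a..b}" for s
  proof -
    have "integral {a..s} h = integral {a..s} h1" by (rule integral_spike[OF n]) (use h(1) that in auto)
    then show ?thesis using assms(5) that by simp
  qed
  have e2: "integral {b..s} h = f s - f b" if "s \<in> {b..c}" for s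
  proof -
    have "integral {b..s} h = integral {b..s} h2" by (rule integral_spike[OF n]) (use h(2) that in auto)
    then show ?thesis using assms(6) that by simp
  qed
  show "\<forall>s\<in>{a..c}. integral {a..s} h = f s - f a"
  proof
    fix s assume s: "s \<in> {a..c}"
    show "integral {a..s} h = f s - f a"
    proof (cases "s \<le> b")
      case True then show ?thesis using e1 s by simp
    next
      case False
      have "h absolutely_integrable_on {a..s}" using absolutely_integrable_on_subinterval[OF i] s by auto
      then have "h integrable_on {a..s}" using set_lebesgue_integral_eq_integral(1) by blast
      then have "integral {a..s} h = integral {a..b} h + integral {b..s} h"
        using Henstock_Kurzweil_Integration.integral_combine[of a b s h] False assms(1) by simp
      then show ?thesis using e1[of b] e2[of s] s False assms(1) by simp
    qed
  qed
qed

lemma abs_cont_on_diff: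
  assumes "abs_cont_on l r f" "abs_cont_on l r g" shows "abs_cont_on l r (\<lambda>x. f x - g x)"
  unfolding abs_cont_on_fam
proof (intro allI impI)
  fix \<epsilon> :: real assume e: "0 < \<epsilon>"
  then have e2: "0 < \<epsilon>/2" by simp
  obtain d1 where d1: "d1 > 0" "\<And>I. fam l r I \<Longrightarrow> (\<Sum>(x, y)\<in>I. y - x) < d1 \<Longrightarrow> (\<Sum>(x, y)\<in>I. \<bar>f y - f x\<bar>) < \<epsilon>/2"
    using assms(1)[unfolded abs_cont_on_fam, rule_format, OF e2] by auto
  obtain d2 where d2: "d2 > 0" "\<And>I. fam l r I \<Longrightarrow> (\<Sum>(x, y)\<in>I. y - x) < d2 \<Longrightarrow> (\<Sum>(x, y)\<in>I. \<bar>g y - g x\<bar>) < \<epsilon>/2"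
    using assms(2)[unfolded abs_cont_on_fam, rule_format, OF e2] by auto
  show "\<exists>\<delta>>0. \<forall>I. fam l r I \<and> (\<Sum>(x, y)\<in>I. y - x) < \<delta> \<longrightarrow> (\<Sum>(x, y)\<in>I. \<bar>(f y - g y) - (f x - g x)\<bar>) < \<epsilon>"
  proof (intro exI[of _ "min d1 d2"] conjI allI impI, use d1 d2 in simp, elim conjE)
    fix I assume I: "fam l r I" "(\<Sum>(x, y)\<in>I. y - x) < min d1 d2"
    have "(\<Sum>(x, y)\<in>I. \<bar>(f y - g y) - (f x - g x)\<bar>) \<le> (\<Sum>(x, y)\<in>I. \<bar>f y - f x\<bar> + \<bar>g y - g x\<bar>)"
      by (intro sum_mono) auto
    also have "\<dots> = (\<Sum>(x, y)\<in>I. \<bar>f y - f x\<bar>) + (\<Sum>(x, y)\<in>I. \<bar>g y - g x\<bar>)"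
      by (simp add: case_prod_unfold sum.distrib)
    also have "\<dots> < \<epsilon>" using d1(2)[OF I(1)] d2(2)[OF I(1)] I(2) by simp
    finally show "(\<Sum>(x, y)\<in>I. \<bar>(f y - g y) - (f x - g x)\<bar>) < \<epsilon>" .
  qed
qed

lemma abs_cont_on_sub:
  assumes "abs_cont_on l r f" "l \<le> l'" "r' \<le> r" shows "abs_cont_on l' r' f"
  unfolding abs_cont_on_fam
proof (intro allI impI)
  fix \<epsilon> :: real assume e: "0 < \<epsilon>"
  obtain d where d: "d > 0" "\<And>I. fam l r I \<Longrightarrow> (\<Sum>(x, y)\<in>I. y - x) < d \<Longrightarrow> (\<Sum>(x, y)\<in>I. \<bar>f y - f x\<bar>) < \<epsilon>"
    using assms(1)[unfolded abs_cont_on_fam, rule_format, OF e] by auto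
  show "\<exists>\<delta>>0. \<forall>I. fam l' r' I \<and> (\<Sum>(x, y)\<in>I. y - x) < \<delta> \<longrightarrow> (\<Sum>(x, y)\<in>I. \<bar>f y - f x\<bar>) < \<epsilon>"
  proof (intro exI[of _ d] conjI d(1) allI impI, elim conjE)
    fix I assume I: "fam l' r' I" "(\<Sum>(x, y)\<in>I. y - x) < d"
    show "(\<Sum>(x, y)\<in>I. \<bar>f y - f x\<bar>) < \<epsilon>" by (rule d(2)[OF fam_mono[OF I(1) assms(2,3)] I(2)])
  qed
qed

text \<open>The bound on the variation makes the supremum in \<open>posvar\<close> finite. Then
  \<open>f\<close> is the difference of the increasing functions \<open>posvar f l\<close> and
  \<open>posvar f l - f\<close>, both absolutely continuous.\<close>

lemma abs_cont_density_short:
  fixes f :: "real \<Rightarrow> real"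
  assumes lr: "l \<le> r" and ac: "abs_cont_on l r f"
    and bd: "\<And>I. fam l r I \<Longrightarrow> (\<Sum>(x, y)\<in>I. \<bar>f y - f x\<bar>) \<le> 1"
  shows "\<exists>h. h absolutely_integrable_on {l..r} \<and> (\<forall>x\<in>{l..r}. integral {l..x} h = f x - f l)"
proof -
  let ?P = "posvar f l"
  note inc = posvar_increment[OF lr bd] and pac = posvar_abs_cont[OF lr bd ac]
  have "\<exists>h. h absolutely_integrable_on {l..r} \<and> (\<forall>x\<in>{l..r}. integral {l..x} h = ?P x - ?P l)"
    by (rule mono_abs_cont_density[OF lr _ pac]) (use inc in force)
  then obtain h1 where h1: "h1 absolutely_integrable_on {l..r}" "\<And>x. x \<in> {l..r} \<Longrightarrow> integral {l..x} h1 = ?P x - ?P l" by blast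
  have "\<exists>h. h absolutely_integrable_on {l..r} \<and> (\<forall>x\<in>{l..r}. integral {l..x} h = (?P x - f x) - (?P l - f l))"
    by (rule mono_abs_cont_density[OF lr _ abs_cont_on_diff[OF pac ac]]) (use inc in force)
  then obtain h2 where h2: "h2 absolutely_integrable_on {l..r}" "\<And>x. x \<in> {l..r} \<Longrightarrow> integral {l..x} h2 = (?P x - f x) - (?P l - f l)" by blast
  show ?thesis
  proof (intro exI[of _ "\<lambda>x. h1 x - h2 x"] conjI ballI)
    show "(\<lambda>x. h1 x - h2 x) absolutely_integrable_on {l..r}" by (intro set_integral_diff h1 h2)
    fix x assume x: "x \<in> {l..r}"
    have "h1 absolutely_integrable_on {l..x}" "h2 absolutely_integrable_on {l..x}"
      using absolutely_integrable_on_subinterval[OF h1(1)] absolutely_integrable_on_subinterval[OF h2(1)] x by auto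
    then have "h1 integrable_on {l..x}" "h2 integrable_on {l..x}" using set_lebesgue_integral_eq_integral(1) by blast+
    then show "integral {l..x} (\<lambda>x. h1 x - h2 x) = f x - f l"
      using h1(2)[OF x] h2(2)[OF x] by (simp add: integral_diff)
  qed
qed

text \<open>Absolute continuity with \<open>\<epsilon> = 1\<close> bounds the variation by one on
  sufficiently short intervals; densities on adjacent intervals are pasted together.\<close>

lemma abs_cont_density_local:
  assumes ac: "loc_abs_cont f" and xy: "0 < x" "x \<le> y"
  shows "\<exists>h. h absolutely_integrable_on {x..y} \<and> (\<forall>s\<in>{x..y}. integral {x..s} h = f s - f x)"
proof (rule pos_Bolzano[OF xy])
  fix a b c assume h: "\<exists>h. h absolutely_integrable_on {a..b} \<and> (\<forall>s\<in>{a..b}. integral {a..s} h = f s - f a)"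
    "\<exists>h. h absolutely_integrable_on {b..c} \<and> (\<forall>s\<in>{b..c}. integral {b..s} h = f s - f b)"
    "0 < a" "a \<le> b" "b \<le> c"
  then obtain h1 h2 where h12: "h1 absolutely_integrable_on {a..b}" "\<forall>s\<in>{a..b}. integral {a..s} h1 = f s - f a"
    "h2 absolutely_integrable_on {b..c}" "\<forall>s\<in>{b..c}. integral {b..s} h2 = f s - f b" by blast
  show "\<exists>h. h absolutely_integrable_on {a..c} \<and> (\<forall>s\<in>{a..c}. integral {a..s} h = f s - f a)"
    using combine_density[OF h(4,5) h12(1,3,2,4), of "\<lambda>t. if t < b then h1 t else h2 t"]
    by (intro exI[of _ "\<lambda>t. if t < b then h1 t else h2 t"]) auto
next
  fix t :: real assume t: "0 < t"
  then have "abs_cont_on (t/2) (2*t) f" using ac unfolding loc_abs_cont_def by simp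
  then obtain \<delta> where d: "\<delta> > 0" "\<And>I. fam (t/2) (2*t) I \<Longrightarrow> (\<Sum>(x, y)\<in>I. y - x) < \<delta> \<Longrightarrow> (\<Sum>(x, y)\<in>I. \<bar>f y - f x\<bar>) < 1"
    unfolding abs_cont_on_fam by (meson zero_less_one)
  show "\<exists>d>0. \<forall>a b. 0 < a \<longrightarrow> a \<le> t \<longrightarrow> t \<le> b \<longrightarrow> b - a < d \<longrightarrow>
     (\<exists>h. h absolutely_integrable_on {a..b} \<and> (\<forall>s\<in>{a..b}. integral {a..s} h = f s - f a))"
  proof (intro exI[of _ "min \<delta> (t/2)"] conjI allI impI, use d t in simp)
    fix a b assume ab: "0 < a" "a \<le> t" "t \<le> b" "b - a < min \<delta> (t/2)"
    have sub: "t/2 \<le> a" "b \<le> 2*t" "a \<le> b" using ab t by auto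
    show "\<exists>h. h absolutely_integrable_on {a..b} \<and> (\<forall>s\<in>{a..b}. integral {a..s} h = f s - f a)"
    proof (rule abs_cont_density_short[OF sub(3)])
      show "abs_cont_on a b f" using abs_cont_on_sub[OF \<open>abs_cont_on (t/2) (2*t) f\<close> sub(1,2)] .
      fix I assume I: "fam a b I"
      have "(\<Sum>(x, y)\<in>I. y - x) < \<delta>" using fam_length[OF I sub(3)] ab by linarith
      then show "(\<Sum>(x, y)\<in>I. \<bar>f y - f x\<bar>) \<le> 1" using d(2)[OF fam_mono[OF I sub(1,2)]] by simp
    qed
  qed
qed

section \<open>The dyadic partition of the half line\<close>

definition dy :: "int \<Rightarrow> real" where "dy n = (2::real) powi n"

lemma dy_pos: "0 < dy n" by (simp add: dy_def)

lemma dy_Suc: "dy (n + 1) = 2 * dy n" by (simp add: dy_def power_int_add)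

lemma dy_less: "dy n < dy (n + 1)" using dy_pos[of n] by (simp add: dy_Suc)

lemma dy_mono: "n \<le> m \<Longrightarrow> dy n \<le> dy m" unfolding dy_def by (intro power_int_increasing) auto

lemma dy_level: assumes "dy n \<le> x" "x < dy (n + 1)" shows "\<lfloor>log 2 x\<rfloor> = n"
proof -
  have "0 < x" using assms dy_pos[of n] by linarith
  then have "of_int n \<le> log 2 x" "log 2 x < of_int (n + 1)"
    using assms by (simp_all add: dy_def le_log_iff log_less_iff powr_real_of_int' del: of_int_add)
  then show ?thesis by linarith
qed

lemma dy_bounds: assumes "0 < x" shows "dy \<lfloor>log 2 x\<rfloor> \<le> x" "x < dy (\<lfloor>log 2 x\<rfloor> + 1)"
proof -
  have "of_int \<lfloor>log 2 x\<rfloor> \<le> log 2 x" "log 2 x < of_int (\<lfloor>log 2 x\<rfloor> + 1)" by linarith+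
  then show "dy \<lfloor>log 2 x\<rfloor> \<le> x" "x < dy (\<lfloor>log 2 x\<rfloor> + 1)"
    using assms by (simp_all add: dy_def le_log_iff log_less_iff powr_real_of_int' del: of_int_add of_int_floor_le)
qed

text \<open>Densities found on different intervals agree only almost everywhere, so one of them is
  fixed on each interval \<open>{dy n..dy (n+1)}\<close> and they are joined through the level
  \<open>\<lfloor>log 2 x\<rfloor>\<close>. This also admits integrands that jump at the dyadic
  points, as the oscillating functions later do.\<close>

lemma dyadic_prim:
  assumes H: "\<And>n. H n absolutely_integrable_on {dy n..dy (n+1)}"
     "\<And>n s. s \<in> {dy n..dy (n+1)} \<Longrightarrow> integral {dy n..s} (H n) = f s - f (dy n)"
  shows "prim f (\<lambda>x. H \<lfloor>log 2 x\<rfloor> x)"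
proof -
  define h where "h x = H \<lfloor>log 2 x\<rfloor> x" for x
  have piece: "h absolutely_integrable_on {u..v} \<and> (\<forall>s\<in>{u..v}. integral {u..s} h = f s - f u)"
    if uv: "dy n \<le> u" "u \<le> v" "v \<le> dy (n + 1)" for u v n
  proof -
    have eq: "h t = H n t" if "t \<in> {u..v} - {dy (n+1)}" for t
      using dy_level[of n t] that uv by (auto simp: h_def)
    have ai: "H n absolutely_integrable_on {u..v}"
      using absolutely_integrable_on_subinterval[OF H(1)] uv by auto
    have "h absolutely_integrable_on {u..v}"
      by (rule absolutely_integrable_spike[OF ai, of "{dy (n+1)}"]) (use eq in auto)
    moreover have "integral {u..s} h = f s - f u" if s: "s \<in> {u..v}" for s
    proof -
      have "integral {u..s} h = integral {u..s} (H n)"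
        by (rule integral_spike[of "{dy (n+1)}"]) (use eq s in auto)
      moreover have "H n absolutely_integrable_on {dy n..s}"
        using absolutely_integrable_on_subinterval[OF H(1)] uv s by auto
      then have "H n integrable_on {dy n..s}" using set_lebesgue_integral_eq_integral(1) by blast
      then have "integral {dy n..s} (H n) = integral {dy n..u} (H n) + integral {u..s} (H n)"
        using Henstock_Kurzweil_Integration.integral_combine[of "dy n" u s "H n"] uv s by simp
      ultimately show ?thesis using H(2)[of s n] H(2)[of u n] uv s by simp
    qed
    ultimately show ?thesis by blast
  qed
  have main: "h absolutely_integrable_on {x..y} \<and> (\<forall>s\<in>{x..y}. integral {x..s} h = f s - f x)" if xy: "0 < x" "x \<le> y" for x y
  proof (rule pos_Bolzano[OF xy])
    fix a b c :: real assume k: "h absolutely_integrable_on {a..b} \<and> (\<forall>s\<in>{a..b}. integral {a..s} h = f s - f a)"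
      "h absolutely_integrable_on {b..c} \<and> (\<forall>s\<in>{b..c}. integral {b..s} h = f s - f b)" "a \<le> b" "b \<le> c"
    show "h absolutely_integrable_on {a..c} \<and> (\<forall>s\<in>{a..c}. integral {a..s} h = f s - f a)"
      using combine_density[OF k(3,4) conjunct1[OF k(1)] conjunct1[OF k(2)] conjunct2[OF k(1)] conjunct2[OF k(2)], of h] by simp
  next
    fix t :: real assume t: "0 < t"
    define n where "n = \<lfloor>log 2 t\<rfloor>"
    have n: "dy n \<le> t" "t < dy (n + 1)" using dy_bounds[OF t] by (auto simp: n_def)
    \<comment> \<open>A dyadic point belongs by its level to the interval on its right, so the
      interval on its left has level \<open>n - 1\<close>.\<close>
    obtain m where m: "dy m < t" "t \<le> dy (m + 1)"
    proof (cases "dy n = t")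
      case True
      then show ?thesis using that[of "n - 1"] dy_less[of "n - 1"] by simp
    next
      case False then show ?thesis using that[of n] n by simp
    qed
    show "\<exists>d>0. \<forall>a b. 0 < a \<longrightarrow> a \<le> t \<longrightarrow> t \<le> b \<longrightarrow> b - a < d \<longrightarrow>
       h absolutely_integrable_on {a..b} \<and> (\<forall>s\<in>{a..b}. integral {a..s} h = f s - f a)"
    proof (intro exI[of _ "min (t - dy m) (dy (n + 1) - t)"] conjI[of "0 < _"] allI impI, use m n in simp)
      fix a b assume ab: "0 < a" "a \<le> t" "t \<le> b" "b - a < min (t - dy m) (dy (n + 1) - t)"
      have p1: "h absolutely_integrable_on {a..t} \<and> (\<forall>s\<in>{a..t}. integral {a..s} h = f s - f a)"
        using piece[of m a t] ab m by auto
      have p2: "h absolutely_integrable_on {t..b} \<and> (\<forall>s\<in>{t..b}. integral {t..s} h = f s - f t)"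
        using piece[of n t b] ab n by auto
      show "h absolutely_integrable_on {a..b} \<and> (\<forall>s\<in>{a..b}. integral {a..s} h = f s - f a)"
        using combine_density[OF ab(2,3) conjunct1[OF p1] conjunct1[OF p2] conjunct2[OF p1] conjunct2[OF p2], of h] by simp
    qed
  qed
  have L: "L1loc h" unfolding L1loc_def using main by blast
  have "integral {x..y} h = f y - f x" if "0 < x" "x \<le> y" for x y
    using main[OF that] that by auto
  with L have "prim f h" by (rule primI)
  then show ?thesis unfolding h_def[abs_def] .
qed

lemma loc_abs_cont_prim:
  assumes ac: "loc_abs_cont f"
  shows "\<exists>h. prim f h"
proof -
  have "\<exists>h. h absolutely_integrable_on {dy n..dy (n+1)} \<and> (\<forall>s\<in>{dy n..dy (n+1)}. integral {dy n..s} h = f s - f (dy n))" for n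
    by (rule abs_cont_density_local[OF ac dy_pos less_imp_le[OF dy_less]])
  then obtain H where "\<And>n. H n absolutely_integrable_on {dy n..dy (n+1)}"
     "\<And>n s. s \<in> {dy n..dy (n+1)} \<Longrightarrow> integral {dy n..s} (H n) = f s - f (dy n)" by metis
  then have "prim f (\<lambda>x. H \<lfloor>log 2 x\<rfloor> x)" by (rule dyadic_prim)
  then show ?thesis by (intro exI)
qed

section \<open>Test functions and weak derivatives\<close>

text \<open>Peels off the first derivative taken, whereas \<open>deriv ^^ n\<close> peels off the
  last one; closure under products and affine substitutions then follows by induction with
  \<open>f\<close> arbitrary.\<close>

primrec smooth_upto :: "nat \<Rightarrow> (real \<Rightarrow> real) \<Rightarrow> bool" where
  "smooth_upto 0 f \<longleftrightarrow> (\<forall>x. f differentiable at x)"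
| "smooth_upto (Suc n) f \<longleftrightarrow> (\<forall>x. f differentiable at x) \<and> smooth_upto n (deriv f)"


lemma smooth_upto_iter: "smooth_upto n f \<Longrightarrow> (deriv ^^ n) f differentiable at x"
proof (induct n arbitrary: f)
  case (Suc n)
  then have "(deriv ^^ n) (deriv f) differentiable at x" by simp
  then show ?case by (simp add: funpow_swap1)
qed simp

lemma smooth_upto_Suc: "smooth_upto (Suc n) f \<Longrightarrow> smooth_upto n f"
proof (induct n arbitrary: f)
  case (Suc n)
  have "smooth_upto (Suc n) (deriv f)" using Suc.prems by simp
  from Suc.hyps[OF this] show ?case using Suc.prems by simp
qed simp

lemma has_real_derivative_differentiable: "(f has_real_derivative D) (at x) \<Longrightarrow> f differentiable at x"
  using real_differentiable_def by blast

lemma differentiable_has_deriv: "f differentiable at x \<Longrightarrow> (f has_real_derivative deriv f x) (at x)" for f :: "real \<Rightarrow> real"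
  using DERIV_deriv_iff_real_differentiable by blast

lemma smooth_upto_add: "smooth_upto n f \<Longrightarrow> smooth_upto n g \<Longrightarrow> smooth_upto n (\<lambda>x. f x + g x)"
proof (induct n arbitrary: f g)
  case (Suc n)
  have d: "((\<lambda>x. f x + g x) has_real_derivative deriv f x + deriv g x) (at x)" for x
    using Suc.prems by (intro DERIV_add differentiable_has_deriv) auto
  have "deriv (\<lambda>x. f x + g x) = (\<lambda>x. deriv f x + deriv g x)"
    by (rule ext) (rule DERIV_imp_deriv[OF d])
  then show ?case using Suc has_real_derivative_differentiable[OF d] by simp
qed auto

lemma smooth_upto_mult: "smooth_upto n f \<Longrightarrow> smooth_upto n g \<Longrightarrow> smooth_upto n (\<lambda>x. f x * g x)"
proof (induct n arbitrary: f g)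
  case (Suc n)
  have d: "((\<lambda>x. f x * g x) has_real_derivative deriv f x * g x + deriv g x * f x) (at x)" for x
    using Suc.prems by (intro DERIV_mult differentiable_has_deriv) auto
  have "deriv (\<lambda>x. f x * g x) = (\<lambda>x. deriv f x * g x + deriv g x * f x)"
    by (rule ext) (rule DERIV_imp_deriv[OF d])
  moreover have "smooth_upto n (\<lambda>x. deriv f x * g x + deriv g x * f x)"
    using Suc.prems by (intro smooth_upto_add Suc.hyps smooth_upto_Suc[OF Suc.prems(1)] smooth_upto_Suc[OF Suc.prems(2)]) auto
  ultimately show ?case using has_real_derivative_differentiable[OF d] by simp
qed auto

lemma smooth_upto_const: "smooth_upto n (\<lambda>x. c)"
  by (induct n arbitrary: c) auto

lemma smooth_upto_affine: "smooth_upto n f \<Longrightarrow> smooth_upto n (\<lambda>x. f (a * x + b))"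
proof (induct n arbitrary: f)
  case 0
  have "(f \<circ> (\<lambda>x. a * x + b)) differentiable at x" for x
    by (rule differentiable_chain_at) (use 0 in \<open>auto intro!: derivative_intros\<close>)
  then show ?case by (simp add: o_def)
next
  case (Suc n)
  have d: "((\<lambda>x. f (a * x + b)) has_real_derivative deriv f (a * x + b) * a) (at x)" for x
  proof (rule DERIV_chain2[where f = f and g = "\<lambda>x. a * x + b"])
    show "(f has_real_derivative deriv f (a * x + b)) (at (a * x + b))"
      using Suc.prems by (intro differentiable_has_deriv) auto
    show "((\<lambda>x. a * x + b) has_real_derivative a) (at x)" by (auto intro!: derivative_eq_intros)
  qed
  have "deriv (\<lambda>x. f (a * x + b)) = (\<lambda>x. deriv f (a * x + b) * a)"
    by (rule ext) (rule DERIV_imp_deriv[OF d])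
  moreover have "smooth_upto n (\<lambda>x. deriv f (a * x + b) * a)"
    using Suc.prems by (intro smooth_upto_mult smooth_upto_const Suc.hyps) auto
  ultimately show ?case using has_real_derivative_differentiable[OF d] by simp
qed

section \<open>Smooth bump functions\<close>

definition flat_exp :: "real poly \<Rightarrow> real \<Rightarrow> real" where
  "flat_exp P x = (if 0 < x then poly P (1 / x) * exp (- (1 / x)) else 0)"

lemma poly_exp_decay: "((\<lambda>y. poly Q y * exp (- y)) \<longlongrightarrow> (0::real)) at_top"
proof -
  have "((\<lambda>y. \<Sum>i\<le>degree Q. coeff Q i * (y ^ i / exp y)) \<longlongrightarrow> (\<Sum>i\<le>degree Q. coeff Q i * 0)) at_top"
    by (intro tendsto_sum tendsto_mult tendsto_const tendsto_power_div_exp_0)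
  moreover have "(\<Sum>i\<le>degree Q. coeff Q i * (y ^ i / exp y)) = poly Q y * exp (- y)" for y :: real
    by (simp add: poly_altdef sum_distrib_right exp_minus divide_inverse mult.assoc)
  ultimately show ?thesis by simp
qed

text \<open>These functions are closed under differentiation: in the variable
  \<open>y = 1 / x\<close> the polynomial \<open>P\<close> turns into
  \<open>y\<^sup>2 * (P - P')\<close>. At zero the exponential beats every power, so the derivative
  is zero there. Smoothness of every order follows by induction.\<close>

lemma flat_exp_deriv:
  "(flat_exp P has_real_derivative flat_exp (monom 1 2 * (P - pderiv P)) x) (at x)"
proof -
  consider "0 < x" | "x < 0" | "x = 0" by linarith
  then show ?thesis
  proof cases
    case 1
    have "((\<lambda>x. poly P (1 / x) * exp (- (1 / x))) has_real_derivative
       poly (monom 1 2 * (P - pderiv P)) (1 / x) * exp (- (1 / x))) (at x)"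
      using 1 by (auto intro!: derivative_eq_intros poly_DERIV[THEN DERIV_chain2] simp: poly_monom field_simps power2_eq_square)
    then show ?thesis
      using 1 by (auto simp: flat_exp_def elim!: has_field_derivative_transform_within_open[where S = "{0<..}"])
  next
    case 2
    have "((\<lambda>x. 0) has_real_derivative 0) (at x)" by simp
    then have "(flat_exp P has_real_derivative 0) (at x)"
      by (rule has_field_derivative_transform_within_open[where S = "{..<0}"]) (use 2 in \<open>auto simp: flat_exp_def\<close>)
    then show ?thesis using 2 by (simp add: flat_exp_def)
  next
    case 3
    have "((\<lambda>h. flat_exp P h / h) \<longlongrightarrow> 0) (at 0)"
    proof (rule filterlim_split_at)
      have "\<forall>\<^sub>F h in at_left 0. flat_exp P h / h = 0"
        by (auto simp: flat_exp_def intro!: eventually_at_leftI[of "-1"])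
      then show "((\<lambda>h. flat_exp P h / h) \<longlongrightarrow> 0) (at_left 0)" by (rule tendsto_eventually)
      have lim: "((\<lambda>h. poly (pCons 0 P) (inverse h) * exp (- inverse h)) \<longlongrightarrow> 0) (at_right 0)"
        by (rule filterlim_compose[OF poly_exp_decay filterlim_inverse_at_top_right])
      have "\<forall>\<^sub>F h in at_right 0. poly (pCons 0 P) (inverse h) * exp (- inverse h) = flat_exp P h / h"
        by (auto simp: flat_exp_def inverse_eq_divide intro!: eventually_at_rightI[of _ 1])
      from Lim_transform_eventually[OF lim this]
      show "((\<lambda>h. flat_exp P h / h) \<longlongrightarrow> 0) (at_right 0)" .
    qed
    then show ?thesis using 3 by (simp add: DERIV_def flat_exp_def)
  qed
qed

lemma flat_exp_smooth: "smooth_upto n (flat_exp P)"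
proof (induct n arbitrary: P)
  case (Suc n)
  have "deriv (flat_exp P) = flat_exp (monom 1 2 * (P - pderiv P))"
    by (rule ext) (rule DERIV_imp_deriv[OF flat_exp_deriv])
  then show ?case using Suc has_real_derivative_differentiable[OF flat_exp_deriv] by simp
qed (auto intro: has_real_derivative_differentiable[OF flat_exp_deriv])

text \<open>A flat function rising from \<open>x\<close> times one falling to \<open>y\<close>, with
  arguments scaled by \<open>n + 1\<close>. As \<open>n\<close> grows the bumps tend to the
  indicator of the open interval while staying below one.\<close>

definition bump :: "real \<Rightarrow> real \<Rightarrow> nat \<Rightarrow> real \<Rightarrow> real" where
  "bump x y n s = flat_exp 1 (real (Suc n) * s + (- (real (Suc n) * x))) * flat_exp 1 ((- real (Suc n)) * s + real (Suc n) * y)"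

lemma bump_eq:
  "bump x y n s = (if x < s \<and> s < y then exp (- (1 / (real (Suc n) * (s - x)))) * exp (- (1 / (real (Suc n) * (y - s)))) else 0)"
proof -
  have "real (Suc n) * s + (- (real (Suc n) * x)) = real (Suc n) * (s - x)"
    "(- real (Suc n)) * s + real (Suc n) * y = real (Suc n) * (y - s)" by (simp_all only: algebra_simps)
  then show ?thesis unfolding bump_def flat_exp_def by (simp add: zero_less_mult_iff del: of_nat_Suc)
qed

lemma bump_bounds: "0 \<le> bump x y n s" "bump x y n s \<le> 1"
proof -
  show "0 \<le> bump x y n s" unfolding bump_eq by simp
  have "exp (- (1 / (real (Suc n) * (s - x)))) * exp (- (1 / (real (Suc n) * (y - s)))) \<le> 1 * 1" if "x < s" "s < y"
    using that by (intro mult_mono) auto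
  then show "bump x y n s \<le> 1" unfolding bump_eq by auto
qed

lemma bump_limit: 
  assumes "x < s" "s < y" shows "(\<lambda>n. bump x y n s) \<longlonglongrightarrow> 1"
proof -
  have "(\<lambda>n. exp (- (inverse (real (Suc n)) * (1 / c)))) \<longlonglongrightarrow> exp (- (0 * (1 / c)))" for c :: real
    by (intro tendsto_intros LIMSEQ_inverse_real_of_nat)
  then have *: "(\<lambda>n. exp (- (1 / (real (Suc n) * c)))) \<longlonglongrightarrow> 1" for c :: real
    by (simp add: inverse_eq_divide del: of_nat_Suc)
  show ?thesis unfolding bump_eq using assms tendsto_mult[OF *[of "s - x"] *[of "y - s"]] by simp
qed

lemma bump_support: "{s. bump x y n s \<noteq> 0} \<subseteq> {x..y}"
  unfolding bump_eq by auto

lemma bump_zero: "s \<notin> {x..y} \<Longrightarrow> bump x y n s = 0"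
  unfolding bump_eq by auto

lemma bump_test_fun:
  assumes "0 < x" shows "test_fun (bump x y n)"
proof -
  have "smooth_upto m (bump x y n)" for m
    unfolding bump_def[abs_def] by (intro smooth_upto_mult smooth_upto_affine flat_exp_smooth)
  moreover have "closure {s. bump x y n s \<noteq> 0} \<subseteq> {x..y}"
    by (rule closure_minimal[OF bump_support]) simp
  moreover from this have "compact (closure {s. bump x y n s \<noteq> 0})"
    using compact_Int_closed[OF compact_Icc closed_closure, of x y "{s. bump x y n s \<noteq> 0}"]
    by (simp add: Int_absorb1)
  ultimately show ?thesis unfolding test_fun_def using assms
    by (auto intro: smooth_upto_iter)
qed

section \<open>Weak derivatives and densities\<close>

lemma Lloc_one_iff: "Lloc 1 f \<longleftrightarrow> L1loc f"
proof -
  have e: "nnI {x..y} (\<lambda>t. \<bar>f t\<bar> powr 1) = (\<integral>\<^sup>+t. ennreal (norm (indicator {x..y} t *\<^sub>R f t)) \<partial>lebesgue)" for x y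
    unfolding nnI_def by (intro nn_integral_cong) (simp add: indicator_def)
  have m: "f absolutely_integrable_on {x..y} \<longleftrightarrow> nnI {x..y} (\<lambda>t. \<bar>f t\<bar> powr 1) < \<infinity>"
    if "f \<in> borel_measurable (lebesgue_on {0<..})" "0 < x" for x y
  proof -
    have "f \<in> borel_measurable (lebesgue_on {x..y})" by (rule meas_sub[OF that(1)]) (use that(2) in auto)
    then have "(\<lambda>t. indicator {x..y} t *\<^sub>R f t) \<in> borel_measurable lebesgue"
      by (subst (asm) borel_measurable_restrict_space_iff) auto
    then show ?thesis unfolding e set_integrable_def integrable_iff_bounded by simp
  qed
  show ?thesis
  proof
    assume l: "Lloc 1 f"
    then have f: "f \<in> borel_measurable (lebesgue_on {0<..})" by (simp add: Lloc_def)
    show "L1loc f" unfolding L1loc_def using l m[OF f] by (simp add: Lloc_def)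
  next
    assume l: "L1loc f"
    then have f: "f \<in> borel_measurable (lebesgue_on {0<..})" by (rule L1loc_measurable)
    show "Lloc 1 f" unfolding Lloc_def using f l m[OF f] by (simp add: L1loc_def)
  qed
qed

lemma LINT_pos_eq:
  fixes k :: "real \<Rightarrow> real"
  assumes "0 < x" "k absolutely_integrable_on {x..y}" "\<And>t. 0 < t \<Longrightarrow> t \<notin> {x..y} \<Longrightarrow> k t = 0"
  shows "(LINT t:{0<..}|lebesgue. k t) = integral {x..y} k"
proof -
  have "(LINT t:{0<..}|lebesgue. k t) = (LINT t:{x..y}|lebesgue. k t)"
    unfolding set_lebesgue_integral_def
  proof (rule Bochner_Integration.integral_cong[OF refl])
    fix t show "indicator {0<..} t *\<^sub>R k t = indicator {x..y} t *\<^sub>R k t"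
      using assms(3)[of t] assms(1) by (cases "t \<in> {x..y}") (auto simp: indicator_def)
  qed
  then show ?thesis using set_lebesgue_integral_eq_integral(2)[OF assms(2)] by simp
qed

lemma cont_deriv_prim:
  assumes "\<And>x. 0 < x \<Longrightarrow> (F has_real_derivative f x) (at x)" "continuous_on {0<..} f"
  shows "prim F f"
proof (rule primI)
  show "L1loc f" by (rule L1loc_cont[OF assms(2)])
  fix x y :: real assume xy: "0 < x" "x \<le> y"
  have "(f has_integral (F y - F x)) {x..y}"
  proof (rule fundamental_theorem_of_calculus[OF xy(2)])
    fix t assume "t \<in> {x..y}"
    then have "(F has_real_derivative f t) (at t within {x..y})"
      using assms(1)[of t] xy by (auto intro: has_field_derivative_at_within)
    then show "(F has_vector_derivative f t) (at t within {x..y})"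
      by (simp add: has_real_derivative_iff_has_vector_derivative)
  qed
  then show "integral {x..y} f = F y - F x" by (rule integral_unique)
qed

lemma test_fun_facts:
  assumes "test_fun \<phi>"
  shows "prim \<phi> (deriv \<phi>)" "continuous_on {0<..} (deriv \<phi>)"
    "\<exists>x y. 0 < x \<and> x < y \<and> (\<forall>s. s \<notin> {x<..<y} \<longrightarrow> \<phi> s = 0 \<and> deriv \<phi> s = 0)"
proof -
  have d: "(deriv ^^ n) \<phi> differentiable (at x)" for n x using assms unfolding test_fun_def by simp
  have d0: "(\<phi> has_real_derivative deriv \<phi> x) (at x)" for x
    using d[of 0 x] by (intro differentiable_has_deriv) simp
  have d1: "isCont (deriv \<phi>) x" for x
    using d[of 1 x] by (simp add: differentiable_imp_continuous_within)
  show c: "continuous_on {0<..} (deriv \<phi>)" using d1 by (simp add: continuous_at_imp_continuous_on)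
  show "prim \<phi> (deriv \<phi>)" by (rule cont_deriv_prim[OF d0 c])
  define K where "K = closure {x. \<phi> x \<noteq> 0}"
  have K: "compact K" "K \<subseteq> {0<..}" using assms unfolding test_fun_def K_def by auto
  have z: "\<phi> s = 0 \<and> deriv \<phi> s = 0" if "s \<notin> K" for s
  proof -
    have op: "open (- K)" unfolding K_def by auto
    have z: "\<phi> t = 0" if "t \<in> - K" for t using that closure_subset[of "{x. \<phi> x \<noteq> 0}"] unfolding K_def by auto
    have "((\<lambda>_. 0) has_real_derivative 0) (at s)" by simp
    then have "(\<phi> has_real_derivative 0) (at s)"
      by (rule has_field_derivative_transform_within_open[OF _ op]) (use that z in auto)
    then show ?thesis using z that by (simp add: DERIV_imp_deriv)
  qed
  show "\<exists>x y. 0 < x \<and> x < y \<and> (\<forall>s. s \<notin> {x<..<y} \<longrightarrow> \<phi> s = 0 \<and> deriv \<phi> s = 0)"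
  proof (cases "K = {}")
    case True then show ?thesis using z by (intro exI[of _ 1] exI[of _ 2]) auto
  next
    case False
    obtain m where m: "m \<in> K" "\<forall>t\<in>K. m \<le> t" using compact_attains_inf[OF K(1) False] by auto
    obtain M where M: "M \<in> K" "\<forall>t\<in>K. t \<le> M" using compact_attains_sup[OF K(1) False] by auto
    have "0 < m" "m \<le> M" using m M K by auto
    moreover have "s \<notin> K" if "s \<notin> {m/2<..<M+1}" for s
    proof
      assume "s \<in> K" then have "m \<le> s" "s \<le> M" using m M by auto
      with that \<open>0 < m\<close> show False by auto
    qed
    ultimately show ?thesis using z by (intro exI[of _ "m/2"] exI[of _ "M+1"]) auto
  qed
qed

lemma prim_weak_deriv:
  assumes "prim f h" shows "weak_deriv f h"
  unfolding weak_deriv_def Lloc_one_iff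
proof (intro conjI allI impI)
  show "L1loc f" by (rule L1loc_cont[OF prim_continuous[OF assms]])
  show "L1loc h" by (rule prim_L1[OF assms])
  fix \<phi> assume t: "test_fun \<phi>"
  note tf = test_fun_facts[OF t]
  obtain x y where xy: "0 < x" "x < y" "\<And>s. s \<notin> {x<..<y} \<Longrightarrow> \<phi> s = 0 \<and> deriv \<phi> s = 0" using tf(3) by blast
  have a1: "L1loc (\<lambda>t. f t * deriv \<phi> t)"
    by (rule L1loc_cont_mult[OF prim_continuous[OF assms] L1loc_cont[OF tf(2)]])
  have a2: "L1loc (\<lambda>t. h t * \<phi> t)"
    using L1loc_cont_mult[OF prim_continuous[OF tf(1)] prim_L1[OF assms]] by (simp add: mult.commute)
  have "integral {x..y} (\<lambda>t. h t * \<phi> t + f t * deriv \<phi> t) = f y * \<phi> y - f x * \<phi> x"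
    using primD[OF prim_mult[OF assms tf(1)], of x y] xy(1,2) by simp
  also have "\<dots> = 0" using xy(3)[of x] xy(3)[of y] by simp
  finally have "integral {x..y} (\<lambda>t. h t * \<phi> t) + integral {x..y} (\<lambda>t. f t * deriv \<phi> t) = 0"
    using L1loc_integrable[OF a1] L1loc_integrable[OF a2] xy by (simp add: integral_add)
  moreover have "(LINT t:{0<..}|lebesgue. f t * deriv \<phi> t) = integral {x..y} (\<lambda>t. f t * deriv \<phi> t)"
    by (rule LINT_pos_eq[OF xy(1) L1locD[OF a1 xy(1)]]) (use xy(3) in auto)
  moreover have "(LINT t:{0<..}|lebesgue. h t * \<phi> t) = integral {x..y} (\<lambda>t. h t * \<phi> t)"
    by (rule LINT_pos_eq[OF xy(1) L1locD[OF a2 xy(1)]]) (use xy(3) in auto)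
  ultimately show "(LINT x:{0<..}|lebesgue. f x * deriv \<phi> x) = - (LINT x:{0<..}|lebesgue. h x * \<phi> x)" by simp
qed

text \<open>Bumps converge boundedly to the indicator of an interval, so \<open>k\<close> has
  integral zero over every interval. Then \<open>k\<close> and \<open>0\<close> are both densities
  of the zero function, and densities are unique almost everywhere.\<close>

lemma bump_orthogonal_AE_zero:
  assumes k: "L1loc k" and o: "\<And>x y n. 0 < x \<Longrightarrow> x < y \<Longrightarrow> (LINT t:{0<..}|lebesgue. k t * bump x y n t) = 0"
  shows "AE x in lebesgue. 0 < x \<longrightarrow> k x = 0"
proof -
  have ik: "integral {x..y} k = 0" if xy: "0 < x" "x < y" for x y
  proof -
    have pb: "prim (bump x y n) (deriv (bump x y n))" for n
      using test_fun_facts(1)[OF bump_test_fun[OF xy(1)]] .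
    have lk: "L1loc (\<lambda>t. k t * bump x y n t)" for n
      using L1loc_cont_mult[OF prim_continuous[OF pb] k] by (simp add: mult.commute)
    have i0: "integral {x..y} (\<lambda>t. k t * bump x y n t) = 0" for n
    proof -
      have "(LINT t:{0<..}|lebesgue. k t * bump x y n t) = integral {x..y} (\<lambda>t. k t * bump x y n t)"
        by (rule LINT_pos_eq[OF xy(1) L1locD[OF lk xy(1)]]) (simp add: bump_zero)
      then show ?thesis using o[OF xy] by simp
    qed
    have ii: "integral {x<..<y} (\<lambda>t. k t * bump x y n t) = 0" for n
      using i0[of n] by (simp add: integral_open_interval_real)
    have "(\<lambda>n. integral {x<..<y} (\<lambda>t. k t * bump x y n t)) \<longlonglongrightarrow> integral {x<..<y} k"
    proof (rule dominated_convergence(2))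
      show "(\<lambda>t. k t * bump x y n t) integrable_on {x<..<y}" for n
        using L1loc_integrable[OF lk[of n] xy(1), of y] by (simp add: integrable_on_open_interval_real)
      show "(\<lambda>t. \<bar>k t\<bar>) integrable_on {x<..<y}"
        using L1loc_integrable[OF L1loc_abs[OF k] xy(1), of y] by (simp add: integrable_on_open_interval_real)
      fix n t assume "t \<in> {x<..<y}"
      have "0 \<le> bump x y n t" "bump x y n t \<le> 1" by (rule bump_bounds)+
      then show "norm (k t * bump x y n t) \<le> \<bar>k t\<bar>" by (simp add: abs_mult mult_left_le)
    next
      fix t assume t: "t \<in> {x<..<y}"
      show "(\<lambda>n. k t * bump x y n t) \<longlonglongrightarrow> k t"
      proof -
        from t have "(\<lambda>n. bump x y n t) \<longlonglongrightarrow> 1" by (intro bump_limit) auto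
        from tendsto_mult_left[OF this, of "k t"] show ?thesis by simp
      qed
    qed
    then have "integral {x<..<y} k = 0" unfolding ii by (simp add: LIMSEQ_const_iff)
    then show ?thesis by (simp add: integral_open_interval_real)
  qed
  have "prim (\<lambda>_. 0) k"
  proof (intro primI k)
    fix x y :: real assume "0 < x" "x \<le> y" 
    then show "integral {x..y} k = 0 - 0" using ik[of x y] by (cases "x = y") auto
  qed
  then show ?thesis by (rule prim_unique_AE[OF _ prim_const])
qed

lemma weak_deriv_AE_eq:
  assumes "weak_deriv f g" "prim f h" shows "AE x in lebesgue. 0 < x \<longrightarrow> g x = h x"
proof -
  note w2 = prim_weak_deriv[OF assms(2)]
  have L: "L1loc g" "L1loc h" using assms w2 unfolding weak_deriv_def Lloc_one_iff by auto
  have "AE x in lebesgue. 0 < x \<longrightarrow> g x - h x = 0"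
  proof (rule bump_orthogonal_AE_zero[OF L1loc_diff[OF L]])
    fix x y :: real and n assume xy: "0 < x" "x < y"
    have t: "test_fun (bump x y n)" by (rule bump_test_fun[OF xy(1)])
    have z: "bump x y n s = 0" if "s \<notin> {x..y}" for s using that by (rule bump_zero)
    have lk: "L1loc (\<lambda>t. k t * bump x y n t)" if "L1loc k" for k
      using L1loc_cont_mult[OF prim_continuous[OF test_fun_facts(1)[OF t]] that] by (simp add: mult.commute)
    have e: "(LINT t:{0<..}|lebesgue. k t * bump x y n t) = integral {x..y} (\<lambda>t. k t * bump x y n t)" if "L1loc k" for k
      by (rule LINT_pos_eq[OF xy(1) L1locD[OF lk[OF that] xy(1)]]) (use z in auto)
    have "(LINT t:{0<..}|lebesgue. g t * bump x y n t) = (LINT t:{0<..}|lebesgue. h t * bump x y n t)"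
    proof -
      have "- (LINT t:{0<..}|lebesgue. g t * bump x y n t) = - (LINT t:{0<..}|lebesgue. h t * bump x y n t)"
        using assms(1) w2 t unfolding weak_deriv_def by simp
      then show ?thesis by simp
    qed
    then show "(LINT t:{0<..}|lebesgue. (g t - h t) * bump x y n t) = 0"
      unfolding e[OF L(1)] e[OF L(2)] e[OF L1loc_diff[OF L]]
      using L1loc_integrable[OF lk[OF L(1)] xy(1)] L1loc_integrable[OF lk[OF L(2)] xy(1)]
      by (simp add: left_diff_distrib integral_diff)
  qed
  then show ?thesis by simp
qed

text \<open>\<open>Dw\<close> picks an arbitrary weak derivative, so it is determined only almost
  everywhere; this is enough because it enters only through integrals.\<close>

lemma Dw_AE_eq:
  assumes "prim f h" shows "AE x in lebesgue. 0 < x \<longrightarrow> Dw f x = h x"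
proof -
  have "weak_deriv f (Dw f)" unfolding Dw_def by (rule someI[of "weak_deriv f", OF prim_weak_deriv[OF assms]])
  then show ?thesis by (rule weak_deriv_AE_eq[OF _ assms])
qed

section \<open>Integral inequalities\<close>

lemma sigma_finite_lebesgue: "sigma_finite_measure (lebesgue :: real measure)"
proof (rule sigma_finite_measure.intro)
  obtain A :: "real set set" where A: "countable A" "A \<subseteq> sets lborel" "\<Union>A = space lborel" "\<forall>a\<in>A. emeasure lborel a \<noteq> \<infinity>"
    using sigma_finite_measure.sigma_finite_countable[OF sigma_finite_lborel] by auto
  show "\<exists>A::real set set. countable A \<and> A \<subseteq> sets lebesgue \<and> \<Union>A = space lebesgue \<and> (\<forall>a\<in>A. emeasure lebesgue a \<noteq> \<infinity>)"
    by (intro exI[of _ A]) (use A in auto)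
qed

lemma tonelli_region:
  fixes k1 k2 :: "real \<Rightarrow> ennreal" and L :: "real \<Rightarrow> real"
  assumes [measurable]: "k1 \<in> borel_measurable lebesgue" "k2 \<in> borel_measurable lebesgue" "L \<in> borel_measurable lebesgue"
  shows "(\<integral>\<^sup>+t. k1 t * (\<integral>\<^sup>+x. k2 x * (if L x \<le> t \<and> t \<le> x then 1 else 0) \<partial>lebesgue) \<partial>lebesgue) =
         (\<integral>\<^sup>+x. k2 x * (\<integral>\<^sup>+t. k1 t * (if L x \<le> t \<and> t \<le> x then 1 else 0) \<partial>lebesgue) \<partial>lebesgue)"
proof -
  have pf: "pair_sigma_finite (lebesgue :: real measure) (lebesgue :: real measure)"
    using sigma_finite_lebesgue by (rule pair_sigma_finite.intro) (rule sigma_finite_lebesgue)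
  have id[measurable]: "(\<lambda>x::real. x) \<in> borel_measurable lebesgue"
    by (rule measurable_completion) simp
  have m: "(\<lambda>(t, x). k1 t * (k2 x * (if L x \<le> t \<and> t \<le> x then 1 else 0))) \<in> borel_measurable (lebesgue \<Otimes>\<^sub>M lebesgue)"
    by measurable
  have "(\<integral>\<^sup>+x. \<integral>\<^sup>+t. (k1 t * (k2 x * (if L x \<le> t \<and> t \<le> x then 1 else 0))) \<partial>lebesgue \<partial>lebesgue) =
     (\<integral>\<^sup>+t. \<integral>\<^sup>+x. (k1 t * (k2 x * (if L x \<le> t \<and> t \<le> x then 1 else 0))) \<partial>lebesgue \<partial>lebesgue)"
    using pair_sigma_finite.Fubini'[OF pf m] by simp
  moreover have "(\<integral>\<^sup>+x. (k1 t * (k2 x * (if L x \<le> t \<and> t \<le> x then 1 else 0))) \<partial>lebesgue) = 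
      k1 t * (\<integral>\<^sup>+x. k2 x * (if L x \<le> t \<and> t \<le> x then 1 else 0) \<partial>lebesgue)" for t
    by (rule nn_integral_cmult) measurable
  moreover have "(\<integral>\<^sup>+t. (k1 t * (k2 x * (if L x \<le> t \<and> t \<le> x then 1 else 0))) \<partial>lebesgue) = 
      k2 x * (\<integral>\<^sup>+t. k1 t * (if L x \<le> t \<and> t \<le> x then 1 else 0) \<partial>lebesgue)" for x
    by (subst nn_integral_cmult[symmetric]) (measurable, auto intro!: nn_integral_cong simp: ac_simps)
  ultimately show ?thesis by simp
qed

text \<open>The factor \<open>2 powr p\<close> comes from \<open>a + b \<le> 2 * max a b\<close>. It
  is valid for exponents below one as well, and roots \<open>1 / p\<close> of sums are taken
  later.\<close>

lemma powr_add_le: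
  fixes a b p :: real assumes "0 \<le> a" "0 \<le> b" "0 \<le> p"
  shows "(a + b) powr p \<le> 2 powr p * (a powr p + b powr p)"
proof -
  have "(a + b) powr p \<le> (2 * max a b) powr p" using assms by (intro powr_mono2) auto
  also have "\<dots> = 2 powr p * max a b powr p" using assms by (simp add: powr_mult)
  also have "\<dots> \<le> 2 powr p * (a powr p + b powr p)"
    by (intro mult_left_mono) (auto simp: max_def)
  finally show ?thesis .
qed

lemma abs_powr_deriv:
  fixes p :: real assumes p: "1 < p"
  shows "((\<lambda>x. \<bar>x\<bar> powr p) has_real_derivative p * sgn x * \<bar>x\<bar> powr (p - 1)) (at x)"
proof -
  consider "0 < x" | "x < 0" | "x = 0" by linarith
  then show ?thesis
  proof cases
    case 1
    have "((\<lambda>x. x powr p) has_real_derivative p * x powr (p - 1)) (at x)"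
      using 1 by (rule has_real_derivative_powr)
    then have "((\<lambda>x. \<bar>x\<bar> powr p) has_real_derivative p * x powr (p - 1)) (at x)"
      by (rule has_field_derivative_transform_within_open[where S = "{0<..}"]) (use 1 in auto)
    then show ?thesis using 1 by simp
  next
    case 2
    have "((\<lambda>x. (- x) powr p) has_real_derivative (p * (- x) powr (p - 1)) * (- 1)) (at x)"
      by (rule DERIV_chain2[where f = "\<lambda>y. y powr p" and g = uminus])
        (use 2 in \<open>auto intro!: has_real_derivative_powr derivative_eq_intros\<close>)
    then have "((\<lambda>x. \<bar>x\<bar> powr p) has_real_derivative (p * (- x) powr (p - 1)) * (- 1)) (at x)"
      by (rule has_field_derivative_transform_within_open[where S = "{..<0}"]) (use 2 in auto)
    then show ?thesis using 2 by simp
  next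
    case 3
    have "((\<lambda>h::real. \<bar>h\<bar> powr (p - 1)) \<longlongrightarrow> \<bar>0\<bar> powr (p - 1)) (at 0)"
      using p by (intro tendsto_powr' tendsto_rabs tendsto_ident_at) auto
    then have l: "((\<lambda>h::real. \<bar>h\<bar> powr (p - 1)) \<longlongrightarrow> 0) (at 0)" by simp
    have "((\<lambda>h::real. \<bar>h\<bar> powr p / h) \<longlongrightarrow> 0) (at 0)"
    proof (rule Lim_null_comparison[OF _ l])
      have "norm (\<bar>h\<bar> powr p / h) \<le> \<bar>h\<bar> powr (p - 1)" if "h \<noteq> 0" for h :: real
        using that by (simp add: powr_diff)
      then show "\<forall>\<^sub>F h::real in at 0. norm (\<bar>h\<bar> powr p / h) \<le> \<bar>h\<bar> powr (p - 1)"
        by (simp add: eventually_at_filter)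
    qed
    then show ?thesis using 3 by (simp add: DERIV_def)
  qed
qed

lemma abs_powr_deriv_continuous:
  fixes p :: real assumes p: "1 < p" shows "continuous_on UNIV (\<lambda>x. p * sgn x * \<bar>x\<bar> powr (p - 1))"
proof (rule continuous_at_imp_continuous_on, rule ballI)
  fix x :: real
  show "isCont (\<lambda>x. p * sgn x * \<bar>x\<bar> powr (p - 1)) x"
  proof (cases "x = 0")
    case False
    then show ?thesis unfolding isCont_def by (intro tendsto_intros) auto
  next
    case True
    have "((\<lambda>h::real. \<bar>h\<bar> powr (p - 1)) \<longlongrightarrow> \<bar>0\<bar> powr (p - 1)) (at 0)"
      using p by (intro tendsto_powr' tendsto_rabs tendsto_ident_at) auto
    then have l: "((\<lambda>h::real. p * \<bar>h\<bar> powr (p - 1)) \<longlongrightarrow> 0) (at 0)" using tendsto_mult_right_zero by fastforce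
    have "((\<lambda>x. p * sgn x * \<bar>x\<bar> powr (p - 1)) \<longlongrightarrow> 0) (at 0)"
      by (rule Lim_null_comparison[OF _ l]) (use p in \<open>auto simp: abs_mult abs_sgn_eq\<close>)
    then show ?thesis using True by (simp add: isCont_def)
  qed
qed



text \<open>Young's inequality after dividing by \<open>\<alpha>\<close> and \<open>\<beta>\<close>,
  the roots of \<open>A\<close> and \<open>B\<close>. Real bounds \<open>A\<close> and
  \<open>B\<close> stand in place of the integrals, which keeps the result among real numbers; if
  one of them is zero, the corresponding factor vanishes almost everywhere.\<close>

lemma holder_nn:
  fixes F G :: "'a \<Rightarrow> real"
  assumes pq: "1 < p" "1 < q" "1 / p + 1 / q = 1"
    and [measurable]: "F \<in> borel_measurable M" "G \<in> borel_measurable M"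
    and nn: "\<And>x. 0 \<le> F x" "\<And>x. 0 \<le> G x" "0 \<le> A" "0 \<le> B"
    and A: "(\<integral>\<^sup>+x. ennreal (F x powr p) \<partial>M) \<le> ennreal A" and B: "(\<integral>\<^sup>+x. ennreal (G x powr q) \<partial>M) \<le> ennreal B"
  shows "(\<integral>\<^sup>+x. ennreal (F x * G x) \<partial>M) \<le> ennreal (A powr (1 / p) * B powr (1 / q))"
proof -
  consider "A = 0" | "B = 0" | "0 < A" "0 < B" using nn(3,4) by linarith
  then show ?thesis
  proof cases
    case 1
    then have "AE x in M. ennreal (F x powr p) = 0" using A by (subst nn_integral_0_iff_AE[symmetric]) auto
    then have "AE x in M. ennreal (F x * G x) = 0" by (rule AE_mp) (use nn in \<open>auto simp: powr_eq_0_iff\<close>)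
    then have "(\<integral>\<^sup>+x. ennreal (F x * G x) \<partial>M) = 0" by (subst nn_integral_0_iff_AE) auto
    then show ?thesis by simp
  next
    case 2
    then have "AE x in M. ennreal (G x powr q) = 0" using B by (subst nn_integral_0_iff_AE[symmetric]) auto
    then have "AE x in M. ennreal (F x * G x) = 0" by (rule AE_mp) (use nn in \<open>auto simp: powr_eq_0_iff\<close>)
    then have "(\<integral>\<^sup>+x. ennreal (F x * G x) \<partial>M) = 0" by (subst nn_integral_0_iff_AE) auto
    then show ?thesis by simp
  next
    case 3
    define \<alpha> where "\<alpha> = A powr (1 / p)"
    define \<beta> where "\<beta> = B powr (1 / q)"
    have ab: "0 < \<alpha>" "0 < \<beta>" "\<alpha> powr p = A" "\<beta> powr q = B" using 3 pq by (auto simp: \<alpha>_def \<beta>_def powr_powr)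
    have pt: "F x * G x \<le> (\<alpha> * \<beta> / (p * A)) * F x powr p + (\<alpha> * \<beta> / (q * B)) * G x powr q" for x
    proof -
      have "(F x / \<alpha>) * (G x / \<beta>) \<le> (F x / \<alpha>) powr p / p + (G x / \<beta>) powr q / q"
        using nn ab by (intro Youngs_inequality pq) auto
      also have "\<dots> = F x powr p / A / p + G x powr q / B / q"
        using nn ab by (simp add: powr_divide)
      finally have "(\<alpha> * \<beta>) * ((F x / \<alpha>) * (G x / \<beta>)) \<le> (\<alpha> * \<beta>) * (F x powr p / A / p + G x powr q / B / q)"
        using ab by (intro mult_left_mono) auto
      then show ?thesis using ab by (simp add: field_simps)
    qed
    have "(\<integral>\<^sup>+x. ennreal (F x * G x) \<partial>M) \<le>
       (\<integral>\<^sup>+x. ennreal (\<alpha> * \<beta> / (p * A)) * ennreal (F x powr p) + ennreal (\<alpha> * \<beta> / (q * B)) * ennreal (G x powr q) \<partial>M)"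
    proof (rule nn_integral_mono)
      fix x
      have c: "0 \<le> \<alpha> * \<beta> / (p * A)" "0 \<le> \<alpha> * \<beta> / (q * B)" using ab 3 pq by auto
      have split: "ennreal (c * X + d * Y) = ennreal c * ennreal X + ennreal d * ennreal Y"
        if "0 \<le> c" "0 \<le> d" "0 \<le> X" "0 \<le> Y" for c d X Y
        using that by (simp add: ennreal_mult)
      have "ennreal (F x * G x) \<le> ennreal ((\<alpha> * \<beta> / (p * A)) * F x powr p + (\<alpha> * \<beta> / (q * B)) * G x powr q)"
        by (intro ennreal_leI pt)
      also have "\<dots> = ennreal (\<alpha> * \<beta> / (p * A)) * ennreal (F x powr p) + ennreal (\<alpha> * \<beta> / (q * B)) * ennreal (G x powr q)"
        using c by (intro split) auto
      finally show "ennreal (F x * G x) \<le> ennreal (\<alpha> * \<beta> / (p * A)) * ennreal (F x powr p) + ennreal (\<alpha> * \<beta> / (q * B)) * ennreal (G x powr q)" .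
    qed
    also have "\<dots> = ennreal (\<alpha> * \<beta> / (p * A)) * (\<integral>\<^sup>+x. ennreal (F x powr p) \<partial>M) + ennreal (\<alpha> * \<beta> / (q * B)) * (\<integral>\<^sup>+x. ennreal (G x powr q) \<partial>M)"
      by (subst nn_integral_add) (auto simp: nn_integral_cmult)
    also have "\<dots> \<le> ennreal (\<alpha> * \<beta> / (p * A)) * ennreal A + ennreal (\<alpha> * \<beta> / (q * B)) * ennreal B"
      by (intro add_mono mult_left_mono A B) auto
    also have "\<dots> = ennreal ((\<alpha> * \<beta> / (p * A)) * A + (\<alpha> * \<beta> / (q * B)) * B)"
    proof -
      have split: "ennreal c * ennreal X + ennreal d * ennreal Y = ennreal (c * X + d * Y)"
        if "0 \<le> c" "0 \<le> d" "0 \<le> X" "0 \<le> Y" for c d X Y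
        using that by (simp add: ennreal_mult)
      show ?thesis using ab 3 pq by (intro split) auto
    qed
    also have "(\<alpha> * \<beta> / (p * A)) * A + (\<alpha> * \<beta> / (q * B)) * B = \<alpha> * \<beta> * (1 / p + 1 / q)"
      using 3 pq by (simp add: field_simps)
    finally show ?thesis unfolding pq(3) \<alpha>_def \<beta>_def by simp
  qed
qed

lemma nnI_mono: "(\<And>x. x \<in> A \<Longrightarrow> h x \<le> k x) \<Longrightarrow> nnI A h \<le> nnI A k"
  unfolding nnI_def by (intro nn_integral_mono) (auto simp: indicator_def intro: ennreal_leI)

lemma nnI_subset: "A \<subseteq> B \<Longrightarrow> nnI A h \<le> nnI B h"
  unfolding nnI_def by (intro nn_integral_mono) (auto simp: indicator_def)

lemma nnI_AE_cong: 
  assumes "AE x in lebesgue. x \<in> A \<longrightarrow> h x = k x" shows "nnI A h = nnI A k"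
  unfolding nnI_def
  by (rule nn_integral_cong_AE, rule eventually_mono[OF assms]) (auto simp: indicator_def)

lemma nnI_integral:
  assumes "h absolutely_integrable_on A" "\<And>x. x \<in> A \<Longrightarrow> 0 \<le> h x"
  shows "nnI A h = ennreal (integral A h)"
proof -
  have "h integrable_on A" using assms(1) set_lebesgue_integral_eq_integral(1) by blast
  then have "(h has_integral integral A h) A" by (rule integrable_integral)
  from nn_integral_has_integral_lebesgue'[OF assms(2) this]
  show ?thesis unfolding nnI_def by (simp add: nn_integral_completion)
qed

lemma nnI_finite_integrable:
  assumes "h \<in> borel_measurable (lebesgue_on A)" "A \<in> sets lebesgue" "\<And>x. x \<in> A \<Longrightarrow> 0 \<le> h x" "nnI A h < \<infinity>"
  shows "h absolutely_integrable_on A"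
  unfolding set_integrable_def integrable_iff_bounded
proof
  show "(\<lambda>x. indicator A x *\<^sub>R h x) \<in> borel_measurable lebesgue"
    using assms(1,2) by (subst (asm) borel_measurable_restrict_space_iff) auto
  have "(\<integral>\<^sup>+ x. ennreal (norm (indicator A x *\<^sub>R h x)) \<partial>lebesgue) = nnI A h"
    unfolding nnI_def using assms(3) by (intro nn_integral_cong) (auto simp: indicator_def)
  with assms(4) show "(\<integral>\<^sup>+ x. ennreal (norm (indicator A x *\<^sub>R h x)) \<partial>lebesgue) < \<infinity>" by simp
qed

text \<open>The weight is distributed as \<open>k powr (1 / p) * k powr (1 / q)\<close> over the two
  factors. Integrability of the product comes out of the bound on its absolute value.\<close>

lemma holder_integral:
  fixes k u v :: "real \<Rightarrow> real"
  assumes pq: "1 < p" "1 < q" "1 / p + 1 / q = 1"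
    and k: "k \<in> borel_measurable (lebesgue_on {x..y})" "u \<in> borel_measurable (lebesgue_on {x..y})" "v \<in> borel_measurable (lebesgue_on {x..y})"
    and nn: "\<And>t. t \<in> {x..y} \<Longrightarrow> 0 \<le> k t" "0 \<le> A" "0 \<le> B"
    and A: "nnI {x..y} (\<lambda>t. k t * \<bar>u t\<bar> powr p) \<le> ennreal A" and B: "nnI {x..y} (\<lambda>t. k t * \<bar>v t\<bar> powr q) \<le> ennreal B"
  shows "(\<lambda>t. k t * (u t * v t)) absolutely_integrable_on {x..y}"
    "\<bar>integral {x..y} (\<lambda>t. k t * (u t * v t))\<bar> \<le> A powr (1 / p) * B powr (1 / q)"
proof -
  let ?S = "{x..y}"
  have ms: "(\<lambda>t. indicator ?S t * f t) \<in> borel_measurable lebesgue" if "f \<in> borel_measurable (lebesgue_on ?S)" for f :: "real \<Rightarrow> real"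
    using that by (subst (asm) borel_measurable_restrict_space_iff) auto
  define F where "F t = indicator ?S t * (k t powr (1 / p) * \<bar>u t\<bar>)" for t
  define G where "G t = indicator ?S t * (k t powr (1 / q) * \<bar>v t\<bar>)" for t
  have mF: "F \<in> borel_measurable lebesgue" "G \<in> borel_measurable lebesgue"
    unfolding F_def G_def using k by (intro ms; simp)+
  have e1: "ennreal (F t powr p) = ennreal (k t * \<bar>u t\<bar> powr p) * indicator ?S t" for t
    using nn(1)[of t] pq by (auto simp: F_def indicator_def powr_mult powr_powr)
  have e2: "ennreal (G t powr q) = ennreal (k t * \<bar>v t\<bar> powr q) * indicator ?S t" for t
    using nn(1)[of t] pq by (auto simp: G_def indicator_def powr_mult powr_powr)
  have H: "(\<integral>\<^sup>+t. ennreal (F t * G t) \<partial>lebesgue) \<le> ennreal (A powr (1 / p) * B powr (1 / q))"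
  proof (rule holder_nn[OF pq mF])
    show "(\<integral>\<^sup>+t. ennreal (F t powr p) \<partial>lebesgue) \<le> ennreal A" using A unfolding e1 nnI_def .
    show "(\<integral>\<^sup>+t. ennreal (G t powr q) \<partial>lebesgue) \<le> ennreal B" using B unfolding e2 nnI_def .
  qed (auto simp: F_def G_def indicator_def nn)
  have e3: "ennreal (F t * G t) = ennreal \<bar>k t * (u t * v t)\<bar> * indicator ?S t" for t
  proof (cases "t \<in> ?S")
    case True
    have "k t powr (1 / p) * k t powr (1 / q) = k t" using nn(1)[OF True] pq by (simp add: powr_add[symmetric])
    moreover have "k t powr (1 / p) * \<bar>u t\<bar> * (k t powr (1 / q) * \<bar>v t\<bar>) = (k t powr (1 / p) * k t powr (1 / q)) * (\<bar>u t\<bar> * \<bar>v t\<bar>)"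
      by (simp only: ac_simps)
    ultimately have "k t powr (1 / p) * \<bar>u t\<bar> * (k t powr (1 / q) * \<bar>v t\<bar>) = k t * (\<bar>u t\<bar> * \<bar>v t\<bar>)" by simp
    then show ?thesis using True nn(1)[OF True] by (simp add: F_def G_def abs_mult)
  qed (simp add: F_def)
  have nI: "nnI ?S (\<lambda>t. \<bar>k t * (u t * v t)\<bar>) \<le> ennreal (A powr (1 / p) * B powr (1 / q))"
    using H unfolding e3 nnI_def .
  have "(\<lambda>t. \<bar>k t * (u t * v t)\<bar>) absolutely_integrable_on ?S"
    using k by (intro nnI_finite_integrable le_less_trans[OF nI]) auto
  moreover have "(\<lambda>t. k t * (u t * v t)) \<in> borel_measurable (lebesgue_on ?S)" using k by simp
  ultimately show ai: "(\<lambda>t. k t * (u t * v t)) absolutely_integrable_on ?S"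
    unfolding absolutely_integrable_measurable_real[of ?S, simplified] by simp
  then have "\<bar>integral ?S (\<lambda>t. k t * (u t * v t))\<bar> \<le> integral ?S (\<lambda>t. \<bar>k t * (u t * v t)\<bar>)"
    using Henstock_Kurzweil_Integration.integral_norm_bound_integral[OF set_lebesgue_integral_eq_integral(1)[OF ai]
      set_lebesgue_integral_eq_integral(1)[OF set_integrable_abs[OF ai]]] by simp
  also have "\<dots> \<le> A powr (1 / p) * B powr (1 / q)"
    using nI nnI_integral[OF set_integrable_abs[OF ai]] by simp
  finally show "\<bar>integral ?S (\<lambda>t. k t * (u t * v t))\<bar> \<le> A powr (1 / p) * B powr (1 / q)" .
qed

text \<open>Hoelder's inequality for \<open>1\<close> and \<open>\<Theta>\<close> with weight
  \<open>k\<close>, raised to the power \<open>q\<close>. In this form it pulls the power inside the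
  integral at the cost of the mass of \<open>k\<close>.\<close>

lemma power_mean_integral:
  fixes k \<Theta> :: "real \<Rightarrow> real"
  assumes q: "1 < q" and k: "k absolutely_integrable_on {x..y}" and kq: "(\<lambda>t. k t * \<Theta> t powr q) absolutely_integrable_on {x..y}"
    and m: "\<Theta> \<in> borel_measurable (lebesgue_on {x..y})"
    and nn: "\<And>t. t \<in> {x..y} \<Longrightarrow> 0 \<le> k t" "\<And>t. t \<in> {x..y} \<Longrightarrow> 0 \<le> \<Theta> t"
  shows "(\<lambda>t. k t * \<Theta> t) absolutely_integrable_on {x..y}"
    "(integral {x..y} (\<lambda>t. k t * \<Theta> t)) powr q \<le> (integral {x..y} k) powr (q - 1) * integral {x..y} (\<lambda>t. k t * \<Theta> t powr q)"
proof -
  define p where "p = q / (q - 1)"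
  have p: "1 < p" "1 / p + 1 / q = 1" "q / p = q - 1" using q by (auto simp: p_def field_simps)
  define K where "K = integral {x..y} k"
  define Q where "Q = integral {x..y} (\<lambda>t. k t * \<Theta> t powr q)"
  have A: "nnI {x..y} (\<lambda>t. k t * \<bar>1\<bar> powr p) \<le> ennreal K" unfolding K_def using nnI_integral[OF k nn(1)] by simp
  have "nnI {x..y} (\<lambda>t. k t * \<bar>\<Theta> t\<bar> powr q) = nnI {x..y} (\<lambda>t. k t * \<Theta> t powr q)"
    unfolding nnI_def by (rule nn_integral_cong) (simp add: nn indicator_def)
  also have "\<dots> = ennreal Q" unfolding Q_def by (rule nnI_integral[OF kq]) (simp add: nn)
  finally have B: "nnI {x..y} (\<lambda>t. k t * \<bar>\<Theta> t\<bar> powr q) \<le> ennreal Q" by simp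
  have KQ: "0 \<le> K" "0 \<le> Q" unfolding K_def Q_def
    using k kq nn by (auto intro!: Henstock_Kurzweil_Integration.integral_nonneg set_lebesgue_integral_eq_integral(1))
  note h = holder_integral[OF p(1) q p(2) absolutely_integrable_imp_borel_measurable[OF k] borel_measurable_const m nn(1) KQ A B]
  show ai: "(\<lambda>t. k t * \<Theta> t) absolutely_integrable_on {x..y}" using h(1) by simp
  have "0 \<le> integral {x..y} (\<lambda>t. k t * \<Theta> t)"
    using nn by (intro Henstock_Kurzweil_Integration.integral_nonneg set_lebesgue_integral_eq_integral(1)[OF ai]) auto
  then have "(integral {x..y} (\<lambda>t. k t * \<Theta> t)) powr q \<le> (K powr (1 / p) * Q powr (1 / q)) powr q"
    using h(2) q by (intro powr_mono2) auto
  also have "\<dots> = K powr (q - 1) * Q" using p q KQ by (simp add: powr_mult powr_powr)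
  finally show "(integral {x..y} (\<lambda>t. k t * \<Theta> t)) powr q \<le> (integral {x..y} k) powr (q - 1) * integral {x..y} (\<lambda>t. k t * \<Theta> t powr q)"
    unfolding K_def Q_def .
qed

section \<open>The weight and its oscillating intervals\<close>

lemma powr_L1loc:
  assumes "Lloc r v" "\<And>x. 0 < x \<Longrightarrow> 0 \<le> v x" shows "L1loc (\<lambda>x. v x powr r)"
  unfolding L1loc_def
proof (intro allI impI)
  fix x y :: real assume xy: "0 < x" "x \<le> y"
  have m: "v \<in> borel_measurable (lebesgue_on {x..y})"
    by (rule meas_sub) (use assms xy in \<open>auto simp: Lloc_def\<close>)
  show "(\<lambda>x. v x powr r) absolutely_integrable_on {x..y}"
  proof (rule nnI_finite_integrable)
    show "(\<lambda>x. v x powr r) \<in> borel_measurable (lebesgue_on {x..y})" using m by measurable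
    have "nnI {x..y} (\<lambda>t. v t powr r) \<le> nnI {x..y} (\<lambda>t. \<bar>v t\<bar> powr r)"
      by (rule nnI_mono) (use assms(2) xy in auto)
    also have "\<dots> < \<infinity>" using assms(1) xy unfolding Lloc_def by blast
    finally show "nnI {x..y} (\<lambda>t. v t powr r) < \<infinity>" .
  qed auto
qed

lemma abs_cont_dominated:
  assumes "loc_abs_cont G" and d: "\<And>x y. 0 < x \<Longrightarrow> x \<le> y \<Longrightarrow> \<bar>F y - F x\<bar> \<le> C * \<bar>G y - G x\<bar>" and C: "0 < C"
  shows "loc_abs_cont F"
  unfolding loc_abs_cont_def abs_cont_on_fam
proof (intro allI impI)
  fix x y \<epsilon> :: real assume xy: "0 < x" "x < y" and e: "0 < \<epsilon>"
  have "abs_cont_on x y G" using assms(1) xy unfolding loc_abs_cont_def by simp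
  then obtain \<delta> where dl: "\<delta> > 0" "\<And>I. fam x y I \<Longrightarrow> (\<Sum>(x, y)\<in>I. y - x) < \<delta> \<Longrightarrow> (\<Sum>(x, y)\<in>I. \<bar>G y - G x\<bar>) < \<epsilon> / C"
    unfolding abs_cont_on_fam using e C by (metis divide_pos_pos)
  show "\<exists>\<delta>>0. \<forall>I. fam x y I \<and> (\<Sum>(x, y)\<in>I. y - x) < \<delta> \<longrightarrow> (\<Sum>(x, y)\<in>I. \<bar>F y - F x\<bar>) < \<epsilon>"
  proof (intro exI[of _ \<delta>] conjI dl(1) allI impI, elim conjE)
    fix I assume I: "fam x y I" "(\<Sum>(x, y)\<in>I. y - x) < \<delta>"
    have "(\<Sum>(x, y)\<in>I. \<bar>F y - F x\<bar>) \<le> (\<Sum>(x, y)\<in>I. C * \<bar>G y - G x\<bar>)"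
    proof (rule sum_mono, clarify)
      fix u v assume "(u, v) \<in> I"
      from famD[OF I(1) this] show "\<bar>F v - F u\<bar> \<le> C * \<bar>G v - G u\<bar>" using xy by (intro d) auto
    qed
    also have "\<dots> = C * (\<Sum>(x, y)\<in>I. \<bar>G y - G x\<bar>)" by (simp add: sum_distrib_left case_prod_unfold)
    also have "\<dots> < C * (\<epsilon> / C)" using dl(2)[OF I] C by (intro mult_strict_left_mono)
    finally show "(\<Sum>(x, y)\<in>I. \<bar>F y - F x\<bar>) < \<epsilon>" using C by simp
  qed
qed

lemma integral_pos_strict:
  assumes "L1loc w" "\<And>x. 0 \<le> w x" "AE x in lebesgue. 0 < x \<longrightarrow> 0 < w x" "0 < x" "x < y"
  shows "0 < integral {x..y} w"
proof -
  have i: "nnI {x..y} w = ennreal (integral {x..y} w)"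
    by (rule nnI_integral[OF L1locD[OF assms(1,4)]]) (rule assms(2))
  have "nnI {x..y} w \<noteq> 0"
  proof
    assume z: "nnI {x..y} w = 0"
    have "w \<in> borel_measurable (lebesgue_on {x..y})" 
      by (rule meas_sub[OF L1loc_measurable[OF assms(1)]]) (use assms in auto)
    then have "(\<lambda>t. indicator {x..y} t * w t) \<in> borel_measurable lebesgue"
      by (subst (asm) borel_measurable_restrict_space_iff) auto
    then have "(\<lambda>t. ennreal (indicator {x..y} t * w t)) \<in> borel_measurable lebesgue" by measurable
    also have "(\<lambda>t. ennreal (indicator {x..y} t * w t)) = (\<lambda>t. ennreal (w t) * indicator {x..y} t)"
      by (auto simp: indicator_def fun_eq_iff)
    finally have "AE t in lebesgue. ennreal (w t) * indicator {x..y} t = 0"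
      using z unfolding nnI_def by (subst (asm) nn_integral_0_iff_AE)
    then have "AE t in lebesgue. t \<notin> {x..y}" using assms(3)
      by eventually_elim (use assms(4) in \<open>auto simp: indicator_def split: if_splits\<close>)
    then have "{x..y} \<in> null_sets lebesgue" by (subst AE_iff_null_sets) auto
    then have "emeasure lebesgue {x..y} = 0" by auto
    then show False using assms(5) by simp
  qed
  moreover have "0 \<le> integral {x..y} w"
    using assms by (intro Henstock_Kurzweil_Integration.integral_nonneg L1loc_integrable) auto
  ultimately show ?thesis unfolding i by (simp add: less_le)
qed

section \<open>Windows, their midpoints, and the regularity of \<open>V\<close>\<close>

locale oscillation =
  fixes p :: real and v0 v1 :: "real \<Rightarrow> real" and c :: real and a b :: "real \<Rightarrow> real"
  assumes p1: "1 < p" and st: "standing p v0 v1 c a b"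
begin

definition q :: real where "q = conj_exp p"
abbreviation w :: "real \<Rightarrow> real" where "w \<equiv> wgt p v1"
definition Om :: "real \<Rightarrow> real" where "Om = (SOME F. prim F w)"
abbreviation V :: "real \<Rightarrow> real" where "V \<equiv> V1 p v1 a b"
abbreviation A :: "real \<Rightarrow> real" where "A \<equiv> inv_into {0<..} a"
definition al :: "real \<Rightarrow> real" where "al t = Om (a t)"
definition be :: "real \<Rightarrow> real" where "be t = Om (b t)"

lemma q1: "1 < q" and pq: "1 / p + 1 / q = 1" and pq': "(p - 1) * q = p" "(q - 1) * p = q" "p / q = p - 1" "q / p = q - 1"
  "(p - 1) * (q - 1) = 1" "p * q = p + q"
  using p1 by (auto simp: q_def conj_exp_def field_simps)

lemma w_nonneg: "0 \<le> w x" by (simp add: wgt_def)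

lemma v1_nonneg: "0 < x \<Longrightarrow> 0 \<le> v1 x" using st unfolding standing_def weight_def by blast
lemma v0_nonneg: "0 < x \<Longrightarrow> 0 \<le> v0 x" using st unfolding standing_def weight_def by blast

lemma v1_pos_AE: "AE x in lebesgue. 0 < x \<longrightarrow> 0 < v1 x" using st unfolding standing_def by blast

lemma w_pos_AE: "AE x in lebesgue. 0 < x \<longrightarrow> 0 < w x"
  using v1_pos_AE by eventually_elim (auto simp: wgt_def)

lemma w_L1: "L1loc w"
  unfolding wgt_def[abs_def]
  by (rule powr_L1loc) (use st v1_nonneg in \<open>auto simp: standing_def\<close>)

lemma Lloc_p_v0: "Lloc p v0" and Lloc_p_v1: "Lloc p v1"
  using st unfolding standing_def weight_def by blast+

lemma v0p_L1: "L1loc (\<lambda>x. v0 x powr p)" by (rule powr_L1loc[OF Lloc_p_v0 v0_nonneg])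
lemma v1p_L1: "L1loc (\<lambda>x. v1 x powr p)" by (rule powr_L1loc[OF Lloc_p_v1 v1_nonneg])


lemma v1_w_AE: "AE x in lebesgue. 0 < x \<longrightarrow> v1 x powr p = w x powr (1 - p)"
  using v1_pos_AE
proof eventually_elim
  case (elim x)
  have "- q * (1 - p) = p" using pq'(1) by (simp add: algebra_simps)
  then show ?case using elim by (auto simp: wgt_def q_def[symmetric] powr_powr powr_minus[symmetric] inverse_powr)
qed

lemma Om_prim: "prim Om w"
  unfolding Om_def using prim_exists[OF w_L1] by (rule someI_ex)

lemmas Om_cont = prim_continuous[OF Om_prim]

lemma Om_strict: "0 < x \<Longrightarrow> x < y \<Longrightarrow> Om x < Om y"
  using integral_pos_strict[OF w_L1 w_nonneg w_pos_AE, of x y] primD[OF Om_prim, of x y] by simp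

lemma Om_mono: "0 < x \<Longrightarrow> x \<le> y \<Longrightarrow> Om x \<le> Om y"
  using Om_strict[of x y] by (cases "x = y") auto


lemma nnI_w: "0 < x \<Longrightarrow> x \<le> y \<Longrightarrow> nnI {x..y} w = ennreal (Om y - Om x)"
  using nnI_integral[OF L1locD[OF w_L1], of x y] w_nonneg primD[OF Om_prim, of x y] by simp

lemma a_strict: "0 < x \<Longrightarrow> x < y \<Longrightarrow> a x < a y" and b_strict: "0 < x \<Longrightarrow> x < y \<Longrightarrow> b x < b y"
  using st unfolding standing_def strict_mono_on_def by auto

lemma a_less: "0 < t \<Longrightarrow> a t < t" and b_greater: "0 < t \<Longrightarrow> t < b t"
  using st unfolding standing_def by auto

lemma a_lim0: "(a \<longlongrightarrow> 0) (at_right 0)" and a_top: "filterlim a at_top at_top"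
  using st unfolding standing_def by auto

lemma a_mono: "0 < x \<Longrightarrow> x \<le> y \<Longrightarrow> a x \<le> a y" and b_mono: "0 < x \<Longrightarrow> x \<le> y \<Longrightarrow> b x \<le> b y"
  using a_strict[of x y] b_strict[of x y] by (cases "x = y"; simp)+

text \<open>\<open>a\<close> tends to zero at the left end and increases strictly, so
  \<open>a t\<close> exceeds \<open>a (t/2)\<close>, which is at least the limit.\<close>

lemma a_pos: assumes t: "0 < t" shows "0 < a t"
proof -
  have "0 \<le> a (t/2)"
  proof (rule tendsto_upperbound[OF a_lim0])
    show "\<forall>\<^sub>F s in at_right 0. a s \<le> a (t/2)"
      using t a_mono[of _ "t/2"] by (intro eventually_at_rightI[of 0 "t/2"]) auto
  qed simp
  also have "a (t/2) < a t" using t by (intro a_strict) auto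
  finally show ?thesis .
qed

lemma b_pos: "0 < t \<Longrightarrow> 0 < b t" using b_greater by fastforce

lemma a_cont: "continuous_on {0<..} a" and b_cont: "continuous_on {0<..} b"
proof -
  have "loc_abs_cont a" "loc_abs_cont b" using st unfolding standing_def by auto
  then show "continuous_on {0<..} a" "continuous_on {0<..} b"
    using loc_abs_cont_prim prim_continuous by meson+
qed

lemma a_surj: assumes s: "0 < s" shows "\<exists>t>0. a t = s"
proof -
  have "\<forall>\<^sub>F t in at_right 0. a t < s" by (rule order_tendstoD(2)[OF a_lim0 s])
  then obtain d where d: "0 < d" "\<And>t. 0 < t \<Longrightarrow> t < d \<Longrightarrow> a t < s"
    unfolding eventually_at_right_field by auto
  have "\<forall>\<^sub>F t in at_top. s \<le> a t" using a_top unfolding filterlim_at_top by auto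
  then obtain N where N: "\<And>t. N \<le> t \<Longrightarrow> s \<le> a t" unfolding eventually_at_top_linorder by auto
  have "\<exists>x\<ge>d/2. x \<le> max N d \<and> a x = s"
  proof (rule IVT')
    show "a (d/2) \<le> s" using d(2)[of "d/2"] d(1) by simp
    show "continuous_on {d/2..max N d} a" by (rule cont_sub[OF a_cont]) (use d in auto)
  qed (use N d in auto)
  then show ?thesis using d(1) by (metis half_gt_zero less_le_trans)
qed

lemma A_pos: "0 < s \<Longrightarrow> 0 < A s" and a_A: "0 < s \<Longrightarrow> a (A s) = s"
proof -
  assume s: "0 < s"
  have "s \<in> a ` {0<..}" using a_surj[OF s] by auto
  then show "0 < A s" "a (A s) = s" using inv_into_into[of s a "{0<..}"] f_inv_into_f[of s a "{0<..}"] by auto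
qed

lemma a_le_iff: "0 < x \<Longrightarrow> 0 < y \<Longrightarrow> a x \<le> a y \<longleftrightarrow> x \<le> y"
  using a_strict[of y x] a_mono[of x y] by force

lemma A_a: "0 < t \<Longrightarrow> A (a t) = t"
  using a_A[OF a_pos] A_pos[OF a_pos] a_le_iff[of t "A (a t)"] a_le_iff[of "A (a t)" t] by simp

lemma a_le_A: "0 < x \<Longrightarrow> 0 < t \<Longrightarrow> a x \<le> t \<longleftrightarrow> x \<le> A t"
  using a_le_iff[of x "A t"] A_pos[of t] a_A[of t] by simp

lemma A_mono: "0 < x \<Longrightarrow> x \<le> y \<Longrightarrow> A x \<le> A y"
  using a_le_A[of "A x" y] A_pos[of x] a_A[of x] by simp

lemma A_greater: "0 < t \<Longrightarrow> t < A t"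
  using a_less[of "A t"] A_pos[of t] a_A[of t] by simp

lemma A_cont: "continuous_on {0<..} A"
  unfolding continuous_on_iff
proof (intro ballI allI impI)
  fix s e :: real assume "s \<in> {0<..}" and e: "0 < e"
  then have s: "0 < s" by simp
  define l where "l = max (A s / 2) (A s - e)"
  define r where "r = A s + e"
  note As = A_pos[OF s]
  have l: "0 < l" "l < A s" "A s - e \<le> l" unfolding l_def using As e by auto
  have la: "a l < s" using a_strict[OF l(1,2)] a_A[OF s] by simp
  have ra: "s < a r" using a_strict[of "A s" r] As e a_A[OF s] unfolding r_def by simp
  show "\<exists>d>0. \<forall>x'\<in>{0<..}. dist x' s < d \<longrightarrow> dist (A x') (A s) < e"
  proof (intro exI[of _ "min (s - a l) (a r - s)"] conjI ballI impI)
    fix x assume "x \<in> {0<..}" and d: "dist x s < min (s - a l) (a r - s)"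
    then have x: "0 < x" "a l < x" "x < a r" by (auto simp: dist_real_def)
    have "l < A x"
    proof (rule ccontr)
      assume "\<not> l < A x"
      then have "a (A x) \<le> a l" using A_pos[OF x(1)] by (intro a_mono) auto
      then show False using a_A[OF x(1)] x by simp
    qed
    moreover have "A x < r"
    proof (rule ccontr)
      assume "\<not> A x < r"
      then have "a r \<le> a (A x)" using As e by (intro a_mono) (auto simp: r_def)
      then show False using a_A[OF x(1)] x by simp
    qed
    ultimately show "dist (A x) (A s) < e" using l(3) by (auto simp: r_def dist_real_def)
  qed (use la ra in auto)
qed

text \<open>Balance of the two halves of a window means that \<open>Om t\<close> is the midpoint of
  \<open>al t\<close> and \<open>be t\<close>. In this coordinate the window has length
  \<open>V t\<close>, so either half has length \<open>V t / 2\<close>.\<close>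

lemma al_be: assumes t: "0 < t" shows "Om t - al t = be t - Om t" "V t = be t - al t" "0 < V t"
proof -
  have at: "0 < a t" "a t < t" "t < b t" using a_pos a_less b_greater t by auto
  have "nnI {a t..t} w = nnI {t..b t} w" using st t unfolding standing_def by blast
  then have "ennreal (Om t - al t) = ennreal (be t - Om t)"
    using nnI_w[of "a t" t] nnI_w[of t "b t"] at t by (simp add: al_def be_def)
  moreover have pos: "0 < Om t - al t" "0 < be t - Om t" using Om_strict[of "a t" t] Om_strict[of t "b t"] at t
    by (auto simp: al_def be_def)
  ultimately show e: "Om t - al t = be t - Om t" by simp
  have "V t = enn2real (nnI {a t..b t} w)" by (simp add: V1_def)
  also have "\<dots> = be t - al t" using nnI_w[of "a t" "b t"] at pos by (simp add: al_def be_def)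
  finally show "V t = be t - al t" .
  then show "0 < V t" using pos by linarith
qed

lemma V_al: "0 < t \<Longrightarrow> V t = 2 * (Om t - al t)" and V_be: "0 < t \<Longrightarrow> V t = 2 * (be t - Om t)"
  using al_be(1,2)[of t] by simp_all

lemma V_pos: "0 < t \<Longrightarrow> 0 < V t" using al_be(3) .

lemma al_mono: "0 < x \<Longrightarrow> x \<le> y \<Longrightarrow> al x \<le> al y" and be_mono: "0 < x \<Longrightarrow> x \<le> y \<Longrightarrow> be x \<le> be y"
  unfolding al_def be_def by (intro Om_mono a_mono b_mono a_pos b_pos; simp)+

text \<open>\<open>al + be\<close> is \<open>2 * Om\<close> and \<open>be\<close> increases, hence
  \<open>al\<close> cannot grow faster than \<open>2 * Om\<close>. The absolute continuity of
  \<open>al\<close> and \<open>V\<close>, with bounds for their densities, rests on this.\<close>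

lemma al_lipschitz: "0 < x \<Longrightarrow> x \<le> y \<Longrightarrow> al y - al x \<le> 2 * (Om y - Om x)"
  using be_mono[of x y] al_be(1)[of x] al_be(1)[of y] by simp

lemma al_cont: "continuous_on {0<..} al"
  unfolding al_def[abs_def] by (rule continuous_on_compose2[OF Om_cont a_cont]) (auto simp: a_pos)

lemma V_cont: "continuous_on {0<..} V"
proof -
  have "continuous_on {0<..} (\<lambda>t. 2 * (Om t - al t))" by (intro continuous_intros Om_cont al_cont)
  then show ?thesis by (rule continuous_on_eq) (simp add: V_al)
qed

text \<open>The condition on \<open>s\<close> says that \<open>y\<close> lies in the left half of
  the window of \<open>s\<close>, so \<open>al s \<le> Om y\<close>. Both estimates then compare
  endpoints of windows in the coordinate \<open>Om\<close>.\<close>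

lemma V_le_right:
  assumes "0 < y" "y \<le> s" "s \<le> A y" shows "V y \<le> 2 * V s" "2 * (Om s - Om y) \<le> V s"
proof -
  have s: "0 < s" using assms by simp
  have "a s \<le> y" using a_le_A[OF s assms(1)] assms by simp
  then have as: "al s \<le> Om y" unfolding al_def by (intro Om_mono a_pos s)
  show "V y \<le> 2 * V s" using as be_mono[OF assms(1,2)] V_be[OF assms(1)] al_be(2)[OF s] by simp
  show "2 * (Om s - Om y) \<le> V s" using as V_al[OF s] by simp
qed

lemma V_le_left:
  assumes "0 < s" "s \<le> e" "e \<le> b s" shows "V e \<le> 2 * V s" "2 * (Om e - Om s) \<le> V s"
proof -
  have e: "0 < e" using assms by simp
  have bs: "Om e \<le> be s" unfolding be_def using assms e by (intro Om_mono)
  show "V e \<le> 2 * V s" using bs al_mono[OF assms(1,2)] V_al[OF e] al_be(2)[OF assms(1)] by simp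
  show "2 * (Om e - Om s) \<le> V s" using bs V_be[OF assms(1)] by simp
qed

lemma V_upper:
  assumes "0 < t" "t \<le> s" "s \<le> b t" shows "V s \<le> 2 * V t"
proof -
  have s: "0 < s" using assms by simp
  have "Om s \<le> be t" unfolding be_def using assms s by (intro Om_mono)
  then show ?thesis using V_al[OF s] V_be[OF assms(1)] V_al[OF assms(1)] al_mono[OF assms(1,2)] by simp
qed

text \<open>The normalization of the window raised to the power \<open>p\<close>, with
  \<open>p / q = p - 1\<close>.\<close>

lemma v0_mass: assumes t: "0 < t" shows "integral {a t..b t} (\<lambda>x. v0 x powr p) = V t powr (1 - p)"
proof -
  let ?M = "integral {a t..b t} (\<lambda>x. v0 x powr p)"
  have at: "0 < a t" using a_pos[OF t] .
  have M0: "0 \<le> ?M" by (intro Henstock_Kurzweil_Integration.integral_nonneg L1loc_integrable[OF v0p_L1 at]) auto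
  have "nnI {a t..b t} (\<lambda>x. v0 x powr p) = ennreal ?M"
    by (rule nnI_integral[OF L1locD[OF v0p_L1 at]]) auto
  moreover have "enn2real (nnI {a t..b t} w) powr (1 / conj_exp p) * enn2real (nnI {a t..b t} (\<lambda>x. v0 x powr p)) powr (1 / p) = 1"
    using st t unfolding standing_def by blast
  ultimately have e: "V t powr (1 / q) * ?M powr (1 / p) = 1" using M0 by (simp add: V1_def q_def)
  have Vt: "0 < V t" by (rule V_pos[OF t])
  have "(V t powr (1 / q) * ?M powr (1 / p)) powr p = V t powr (p - 1) * ?M"
    using Vt M0 p1 pq'(3) by (simp add: powr_mult powr_powr)
  then have "V t powr (p - 1) * ?M = 1" unfolding e by simp
  then have "V t powr (1 - p) * (V t powr (p - 1) * ?M) = V t powr (1 - p)" by simp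
  then show ?thesis using Vt by (simp add: mult.assoc[symmetric] powr_add[symmetric])
qed

text \<open>A density of \<open>al\<close> satisfies the bounds only almost everywhere; truncating
  it between \<open>0\<close> and \<open>2 * w\<close> changes it on a null set and makes them hold
  everywhere. As \<open>V\<close> is \<open>2 * (Om - al)\<close>, its density then has modulus at
  most \<open>2 * w\<close>.\<close>

lemma al_prim_ex: "\<exists>\<rho>. prim al \<rho> \<and> (\<forall>x. 0 \<le> \<rho> x \<and> \<rho> x \<le> 2 * w x)"
proof -
  have "loc_abs_cont al"
  proof (rule abs_cont_dominated[OF prim_loc_abs_cont[OF Om_prim], of _ 2])
    fix x y :: real assume xy: "0 < x" "x \<le> y"
    then show "\<bar>al y - al x\<bar> \<le> 2 * \<bar>Om y - Om x\<bar>" using al_lipschitz[OF xy] al_mono[OF xy] Om_mono[OF xy] by simp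
  qed simp
  from loc_abs_cont_prim[OF this] obtain r where r: "prim al r" by auto
  have "AE x in lebesgue. 0 < x \<longrightarrow> 0 \<le> r x"
    by (rule prim_mono_density[OF prim_const[of 0] r]) (use al_mono in auto)
  moreover have "AE x in lebesgue. 0 < x \<longrightarrow> r x \<le> 2 * w x"
    by (rule prim_mono_density[OF r prim_cmult[OF Om_prim]]) (use al_lipschitz in \<open>auto simp: right_diff_distrib\<close>)
  ultimately have "AE x in lebesgue. 0 < x \<longrightarrow> max 0 (min (r x) (2 * w x)) = r x"
    by eventually_elim auto
  from prim_cong_AE[OF r this] show ?thesis
    by (intro exI[of _ "\<lambda>x. max 0 (min (r x) (2 * w x))"]) (auto simp: w_nonneg)
qed

definition \<rho> :: "real \<Rightarrow> real" where "\<rho> = (SOME r. prim al r \<and> (\<forall>x. 0 \<le> r x \<and> r x \<le> 2 * w x))"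

lemma al_prim: "prim al \<rho>" and rho_bounds: "0 \<le> \<rho> x" "\<rho> x \<le> 2 * w x"
  using someI_ex[OF al_prim_ex] unfolding \<rho>_def by auto

lemma V_prim: "prim V (\<lambda>x. 2 * (w x - \<rho> x))"
  by (rule prim_cong_on[OF prim_cmult[OF prim_diff[OF Om_prim al_prim], of 2]]) (auto simp: V_al)

lemma comp_A_cont: "continuous_on {0<..} K \<Longrightarrow> continuous_on {0<..} (\<lambda>s. K (A s))"
  by (rule continuous_on_compose2[OF _ A_cont]) (auto simp: A_pos)

lemma wA_L1: "continuous_on {0<..} K \<Longrightarrow> L1loc (\<lambda>s. K (A s) * w s)"
  by (rule L1loc_cont_mult[OF comp_A_cont w_L1])

text \<open>Substitution along \<open>a\<close>: since \<open>al\<close> is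
  \<open>Om \<circ> a\<close>, the measure with density \<open>w\<close> is the image of the one
  with density \<open>\<rho>\<close>. No derivative of \<open>a\<close> is involved. On a short
  interval \<open>K\<close> is nearly constant, both integrals are close to
  \<open>K t * (al v - al u)\<close>, and the error is dominated by the integral of \<open>w\<close>
  because \<open>al\<close> grows at most twice as fast as \<open>Om\<close>.\<close>

lemma al_substitution:
  assumes K: "continuous_on {0<..} K" and xy: "0 < x" "x \<le> y"
  shows "integral {a x..a y} (\<lambda>s. K (A s) * w s) = integral {x..y} (\<lambda>s. K s * \<rho> s)"
proof -
  have L1: "L1loc (\<lambda>s. K (A s) * w s)" by (rule wA_L1[OF K])
  have L2: "L1loc (\<lambda>s. K s * \<rho> s)" by (rule L1loc_cont_mult[OF K prim_L1[OF al_prim]])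
  define D where "D u v = integral {a u..a v} (\<lambda>s. K (A s) * w s) - integral {u..v} (\<lambda>s. K s * \<rho> s)" for u v
  have "D x y = 0"
  proof (rule additive_local_zero[OF w_L1 xy])
    fix u v r :: real assume uvr: "0 < u" "u \<le> v" "v \<le> r"
    then show "D u r = D u v + D v r"
      using integral_combine_pos[OF L1, of "a u" "a v" "a r"] integral_combine_pos[OF L2, of u v r] a_pos[of u] a_mono[of u v] a_mono[of v r]
      by (simp add: D_def)
  next
    fix \<epsilon> t :: real assume e: "0 < \<epsilon>" and t: "0 < t"
    obtain d where d: "0 < d" "\<And>s. 0 < s \<Longrightarrow> \<bar>s - t\<bar> < d \<Longrightarrow> \<bar>K s - K t\<bar> < \<epsilon>/4"
      using cont_pos_ball[OF K t, of "\<epsilon>/4"] e by auto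
    show "\<exists>d>0. \<forall>u v. 0 < u \<longrightarrow> u \<le> t \<longrightarrow> t \<le> v \<longrightarrow> v - u < d \<longrightarrow> \<bar>D u v\<bar> \<le> \<epsilon> * integral {u..v} w"
    proof (intro exI[of _ d] conjI d(1) allI impI)
      fix u v assume uv: "0 < u" "u \<le> t" "t \<le> v" "v - u < d"
      have au: "0 < a u" "a u \<le> a v" using uv a_pos[of u] a_mono[of u v] by auto
      have Kb: "\<bar>K s - K t\<bar> \<le> \<epsilon>/4" if "u \<le> s" "s \<le> v" for s using d(2)[of s] that uv by force
      have KA: "\<bar>K (A s) - K t\<bar> \<le> \<epsilon>/4" if "a u \<le> s" "s \<le> a v" for s
      proof (rule Kb)
        have s: "0 < s" using that au by simp
        show "u \<le> A s" using A_mono[OF au(1) that(1)] A_a[OF uv(1)] by simp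
        show "A s \<le> v" using A_mono[OF s that(2)] A_a[of v] uv by simp
      qed
      have Lw: "L1loc (\<lambda>s. K t * w s)" "L1loc (\<lambda>s. K t * \<rho> s)" by (intro L1loc_cmult w_L1 prim_L1[OF al_prim])+
      have e1: "K t * (al v - al u) = integral {a u..a v} (\<lambda>s. K t * w s)"
        using primD[OF Om_prim, of "a u" "a v"] au by (simp add: al_def)
      have e2: "K t * (al v - al u) = integral {u..v} (\<lambda>s. K t * \<rho> s)"
        using primD[OF al_prim, of u v] uv by simp
      have uv': "u \<le> v" using uv by linarith
      have ald: "al v - al u \<le> 2 * (Om v - Om u)" using al_lipschitz[OF uv(1) uv'] .
      have "\<bar>integral {a u..a v} (\<lambda>s. K (A s) * w s) - K t * (al v - al u)\<bar> = \<bar>integral {a u..a v} (\<lambda>s. K (A s) * w s - K t * w s)\<bar>"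
        unfolding e1 using L1loc_integrable[OF L1 au(1)] L1loc_integrable[OF Lw(1) au(1)] by (subst integral_diff) auto
      also have "\<dots> \<le> integral {a u..a v} (\<lambda>s. \<epsilon>/4 * w s)"
      proof (rule integral_abs_bound[OF L1loc_diff[OF L1 Lw(1)] L1loc_cmult[OF w_L1] au(1)])
        fix s assume "a u \<le> s" "s \<le> a v"
        then show "\<bar>K (A s) * w s - K t * w s\<bar> \<le> \<epsilon>/4 * w s"
          using KA[of s] w_nonneg[of s] by (simp add: left_diff_distrib[symmetric] abs_mult mult_right_mono del: times_divide_eq_left)
      qed
      also have "\<dots> = \<epsilon>/4 * (al v - al u)" using primD[OF Om_prim, of "a u" "a v"] au by (simp add: al_def)
      finally have b1: "\<bar>integral {a u..a v} (\<lambda>s. K (A s) * w s) - K t * (al v - al u)\<bar> \<le> \<epsilon>/4 * (al v - al u)" .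
      have "\<bar>integral {u..v} (\<lambda>s. K s * \<rho> s) - K t * (al v - al u)\<bar> = \<bar>integral {u..v} (\<lambda>s. K s * \<rho> s - K t * \<rho> s)\<bar>"
        unfolding e2 using L1loc_integrable[OF L2 uv(1)] L1loc_integrable[OF Lw(2) uv(1)] by (subst integral_diff) auto
      also have "\<dots> \<le> integral {u..v} (\<lambda>s. \<epsilon>/4 * \<rho> s)"
      proof (rule integral_abs_bound[OF L1loc_diff[OF L2 Lw(2)] L1loc_cmult[OF prim_L1[OF al_prim]] uv(1)])
        fix s assume "u \<le> s" "s \<le> v"
        then show "\<bar>K s * \<rho> s - K t * \<rho> s\<bar> \<le> \<epsilon>/4 * \<rho> s"
          using Kb[of s] rho_bounds[of s] by (simp add: left_diff_distrib[symmetric] abs_mult mult_right_mono del: times_divide_eq_left)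
      qed
      also have "\<dots> = \<epsilon>/4 * (al v - al u)" using primD[OF al_prim, of u v] uv by simp
      finally have b2: "\<bar>integral {u..v} (\<lambda>s. K s * \<rho> s) - K t * (al v - al u)\<bar> \<le> \<epsilon>/4 * (al v - al u)" .
      have "\<bar>D u v\<bar> \<le> \<epsilon>/2 * (al v - al u)" using b1 b2 unfolding D_def by linarith
      also have "\<dots> \<le> \<epsilon>/2 * (2 * (Om v - Om u))" using ald e by (intro mult_left_mono) auto
      also have "\<dots> = \<epsilon> * integral {u..v} w" using primD[OF Om_prim uv(1) uv'] by simp
      finally show "\<bar>D u v\<bar> \<le> \<epsilon> * integral {u..v} w" .
    qed
  qed
  then show ?thesis by (simp add: D_def)
qed

end

section \<open>Bounds for the norm of \<open>W\<close>\<close>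

lemma L1loc_restrict:
  assumes "L1loc w" "S \<in> sets lebesgue" shows "L1loc (\<lambda>s. if s \<in> S then w s else 0)"
  unfolding L1loc_def
proof (intro allI impI)
  fix x y :: real assume xy: "0 < x" "x \<le> y"
  have "w absolutely_integrable_on (S \<inter> {x..y})"
    by (rule set_integrable_subset[OF L1locD[OF assms(1) xy(1), of y]]) (use assms in auto)
  then have "(\<lambda>s. if s \<in> (S \<inter> {x..y}) then w s else 0) absolutely_integrable_on UNIV"
    by (subst absolutely_integrable_restrict_UNIV)
  moreover have "(\<lambda>s. if s \<in> (S \<inter> {x..y}) then w s else 0) = (\<lambda>s. if s \<in> {x..y} then (if s \<in> S then w s else 0) else 0)"
    by (auto simp: fun_eq_iff)
  ultimately have "(\<lambda>s. if s \<in> {x..y} then (if s \<in> S then w s else 0) else 0) absolutely_integrable_on UNIV"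
    by (simp only:)
  then show "(\<lambda>s. if s \<in> S then w s else 0) absolutely_integrable_on {x..y}" by (subst (asm) absolutely_integrable_restrict_UNIV)
qed

text \<open>Stopping a primitive at \<open>t\<close> cuts off its density there. Stopped primitives
  serve as comparison functions that stay positive on the whole half line, and as ramps.\<close>

lemma prim_max_min:
  assumes F: "prim F f" and t: "0 < t"
  shows "prim (\<lambda>s. F (max t s)) (\<lambda>s. if s \<in> {t..} then f s else 0)" (is ?A)
    "prim (\<lambda>s. F (min t s)) (\<lambda>s. if s \<in> {..t} then f s else 0)" (is ?B)
proof -
  let ?h = "\<lambda>s. if s \<in> {t..} then f s else 0"
  have L: "L1loc ?h" by (rule L1loc_restrict[OF prim_L1[OF F]]) auto
  show A: ?A
  proof (rule primI[OF L])
    fix x y :: real assume xy: "0 < x" "x \<le> y"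
    have e1: "integral {u..v} ?h = F v - F u" if "t \<le> u" "u \<le> v" for u v
    proof -
      have "integral {u..v} ?h = integral {u..v} f" by (rule integral_cong) (use that in auto)
      then show ?thesis using primD[OF F, of u v] that t by simp
    qed
    have e2: "integral {u..v} ?h = 0" if "v \<le> t" for u v
    proof -
      have "integral {u..v} ?h = integral {u..v} (\<lambda>_. 0)"
        by (rule integral_spike[of "{t}"]) (use that in auto)
      then show ?thesis by simp
    qed
    consider "t \<le> x" | "x < t" "y \<le> t" | "x < t" "t < y" by linarith
    then show "integral {x..y} ?h = F (max t y) - F (max t x)"
    proof cases
      case 1 then show ?thesis using e1[of x y] xy by (simp add: max_def)
    next
      case 2 then show ?thesis using e2[of y x] by (auto simp: max_def)
    next
      case 3 then show ?thesis
        using e1[of t y] e2[of t x] integral_combine_pos[OF L, of x t y] xy by (simp add: max_def)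
    qed
  qed
  have "prim (\<lambda>s. (F s - F (max t s)) + F t) (\<lambda>s. f s - ?h s)"
    by (rule prim_shift[OF prim_diff[OF F A]])
  then have "prim (\<lambda>s. F (min t s)) (\<lambda>s. f s - ?h s)"
    by (rule prim_cong_on) (auto simp: min_def max_def)
  moreover have "AE s in lebesgue. 0 < s \<longrightarrow> (if s \<in> {..t} then f s else 0) = f s - ?h s"
  proof -
    have "AE s in lebesgue. s \<notin> {t}" by (rule AE_not_in) (simp add: negligible_iff_null_sets[symmetric])
    then show ?thesis by eventually_elim auto
  qed
  ultimately show ?B by (rule prim_cong_AE)
qed

lemma pos_indicator_measurable:
  fixes f :: "real \<Rightarrow> real"
  shows "f \<in> borel_measurable (lebesgue_on {0<..}) \<Longrightarrow> (\<lambda>t. indicator {0<..} t * f t :: real) \<in> borel_measurable lebesgue"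
  by (subst (asm) borel_measurable_restrict_space_iff) auto

lemma nnI_restrict: "A \<in> sets lebesgue \<Longrightarrow> nnI A h = (\<integral>\<^sup>+x. ennreal (h x) \<partial>lebesgue_on A)"
  unfolding nnI_def by (subst nn_integral_restrict_space) auto

lemma nnI_cong: "(\<And>x. x \<in> A \<Longrightarrow> h x = k x) \<Longrightarrow> nnI A h = nnI A k"
  unfolding nnI_def by (intro nn_integral_cong) (auto simp: indicator_def)

lemma nnI_cmult:
  assumes "h \<in> borel_measurable (lebesgue_on A)" "A \<in> sets lebesgue" "0 \<le> c"
  shows "nnI A (\<lambda>x. c * h x) = ennreal c * nnI A h"
  unfolding nnI_restrict[OF assms(2)] using assms(1,3)
  by (subst nn_integral_cmult[symmetric]) (auto simp: ennreal_mult')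

lemma nnI_add:
  assumes "h \<in> borel_measurable (lebesgue_on A)" "k \<in> borel_measurable (lebesgue_on A)" "A \<in> sets lebesgue"
    "\<And>x. x \<in> A \<Longrightarrow> 0 \<le> h x" "\<And>x. x \<in> A \<Longrightarrow> 0 \<le> k x"
  shows "nnI A (\<lambda>x. h x + k x) = nnI A h + nnI A k"
  unfolding nnI_restrict[OF assms(3)] using assms(1,2,4,5)
  by (subst nn_integral_add[symmetric]) (auto intro!: nn_integral_cong)

lemma nnI_fatou:
  fixes k :: "nat \<Rightarrow> real \<Rightarrow> real"
  assumes m: "\<And>n. k n \<in> borel_measurable (lebesgue_on {0<..})" and B: "\<And>n. nnI {0<..} (k n) \<le> B"
    and lim: "\<And>x. 0 < x \<Longrightarrow> (\<lambda>n. k n x) \<longlonglongrightarrow> g x"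
  shows "nnI {0<..} g \<le> B"
proof -
  have S: "{0<..} \<in> sets (lebesgue :: real measure)" by simp
  have "nnI {0<..} g = (\<integral>\<^sup>+x. liminf (\<lambda>n. ennreal (k n x)) \<partial>lebesgue_on {0<..})"
    unfolding nnI_restrict[OF S]
  proof (rule nn_integral_cong)
    fix x :: real assume "x \<in> space (lebesgue_on {0<..})"
    then have "0 < x" by (simp add: space_restrict_space)
    then have "(\<lambda>n. ennreal (k n x)) \<longlonglongrightarrow> ennreal (g x)" by (intro tendsto_ennrealI lim)
    then show "ennreal (g x) = liminf (\<lambda>n. ennreal (k n x))" by (simp add: lim_imp_Liminf)
  qed
  also have "\<dots> \<le> liminf (\<lambda>n. \<integral>\<^sup>+x. ennreal (k n x) \<partial>lebesgue_on {0<..})"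
    by (rule nn_integral_liminf) (use m in measurable)
  also have "\<dots> \<le> B" 
  proof (rule Liminf_le)
    show "\<forall>\<^sub>F n in sequentially. (\<integral>\<^sup>+x. ennreal (k n x) \<partial>lebesgue_on {0<..}) \<le> B"
      using B unfolding nnI_restrict[OF S] by simp
  qed simp
  finally show ?thesis .
qed

lemma nnI_limit:
  assumes h: "h \<in> borel_measurable (lebesgue_on {0<..})" and B: "\<And>x y. 0 < x \<Longrightarrow> x \<le> y \<Longrightarrow> nnI {x..y} h \<le> B"
  shows "nnI {0<..} h \<le> B"
proof (rule nnI_fatou)
  let ?k = "\<lambda>n x. if x \<in> {1 / real (Suc n)..real (Suc n)} then h x else 0"
  show "?k n \<in> borel_measurable (lebesgue_on {0<..})" for n
  proof (rule measurable_If_set[OF h])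
    show "{1 / real (Suc n)..real (Suc n)} \<inter> space (lebesgue_on {0<..}) \<in> sets (lebesgue_on {0<..})"
      by (auto simp: sets_restrict_space space_restrict_space)
  qed simp
  show "nnI {0<..} (?k n) \<le> B" for n
  proof -
    have "nnI {0<..} (?k n) \<le> nnI {1 / real (Suc n)..real (Suc n)} h"
      unfolding nnI_def by (rule nn_integral_mono) (auto simp: indicator_def)
    also have "\<dots> \<le> B" by (rule B) (auto simp: field_simps)
    finally show ?thesis .
  qed
  fix x :: real assume "0 < x"
  from exhaust_pos[OF this] have "\<forall>\<^sub>F n in sequentially. ?k n x = h x" by eventually_elim simp
  then show "(\<lambda>n. ?k n x) \<longlonglongrightarrow> h x" by (rule tendsto_eventually)
qed

lemma L1loc_nnI:
  assumes "k \<in> borel_measurable (lebesgue_on {0<..})" "\<And>x. 0 < x \<Longrightarrow> 0 \<le> k x" "nnI {0<..} k < \<infinity>"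
  shows "L1loc k"
  unfolding L1loc_def
proof (intro allI impI)
  fix x y :: real assume xy: "0 < x" "x \<le> y"
  have sub: "{x..y} \<subseteq> {0<..}" using xy by auto
  show "k absolutely_integrable_on {x..y}"
    by (rule nnI_finite_integrable[OF meas_sub[OF assms(1) sub] _ _ le_less_trans[OF nnI_subset[OF sub] assms(3)]]) (use assms(2) xy in auto)
qed

context oscillation
begin

lemma V_meas[measurable]: "V \<in> borel_measurable (lebesgue_on {0<..})" by (rule cont_meas[OF V_cont])
lemma w_meas[measurable]: "w \<in> borel_measurable (lebesgue_on {0<..})" by (rule L1loc_measurable[OF w_L1])

lemma powr_V_cont: "continuous_on {0<..} (\<lambda>x. V x powr r)"
  using V_cont V_pos by (intro continuous_intros) (auto simp: less_imp_neq[THEN not_sym])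

lemma div_V_L1: "L1loc g \<Longrightarrow> L1loc (\<lambda>x. g x / V x)"
  using L1loc_cont_mult[of "\<lambda>x. inverse (V x)" g] V_cont V_pos
  by (auto simp: divide_inverse mult.commute intro!: continuous_intros less_imp_neq[THEN not_sym])

lemma Gcal_eq:
  assumes "L1loc g"
  shows "Gcal_pow p v1 a b g = nnI {0<..} (\<lambda>t. w t * V t powr q * \<bar>integral {t..A t} (\<lambda>x. g x / V x)\<bar> powr q)"
  unfolding Gcal_pow_def q_def[symmetric] nnI_def
proof (rule nn_integral_cong)
  fix t :: real
  show "ennreal (w t * V t powr q * \<bar>LINT x:{t..A t}|lebesgue. g x / V x\<bar> powr q) * indicator {0<..} t =
     ennreal (w t * V t powr q * \<bar>integral {t..A t} (\<lambda>x. g x / V x)\<bar> powr q) * indicator {0<..} t"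
    using set_lebesgue_integral_eq_integral(2)[OF L1locD[OF div_V_L1[OF assms], of t "A t"]]
    by (cases "0 < t") auto
qed

text \<open>For \<open>x\<close> in \<open>{t..A t}\<close> the point \<open>a x\<close> lies to the
  left of \<open>t\<close>, so the inner mass equals \<open>Om t - al x\<close>, a kernel that
  vanishes at \<open>x = A t\<close>.\<close>

lemma Gbb_eq:
  assumes "L1loc g"
  shows "Gbb_pow p v1 a b g = nnI {0<..} (\<lambda>t. w t * \<bar>integral {t..A t} (\<lambda>x. g x / V x * (Om t - al x))\<bar> powr q)"
  unfolding Gbb_pow_def q_def[symmetric]
proof (rule nnI_cong)
  fix t :: real assume "t \<in> {0<..}"
  then have t: "0 < t" by simp
  show "w t * \<bar>LINT x:{t..A t}|lebesgue. g x / V x * enn2real (nnI {a x..t} w)\<bar> powr q =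
     w t * \<bar>integral {t..A t} (\<lambda>x. g x / V x * (Om t - al x))\<bar> powr q"
  proof -
    have pt: "g x / V x * enn2real (nnI {a x..t} w) = g x / V x * (Om t - al x)" if x: "x \<in> {t..A t}" for x
    proof -
      have x0: "0 < x" "a x \<le> t" using t x a_le_A[of x t] by auto
      then have "nnI {a x..t} w = ennreal (Om t - al x)" unfolding al_def by (intro nnI_w a_pos)
      moreover have "al x \<le> Om t" unfolding al_def using x0 by (intro Om_mono a_pos)
      ultimately show ?thesis by simp
    qed
    have c: "continuous_on {0<..} (\<lambda>x. Om t - al x)" by (intro continuous_intros al_cont)
    have ai: "(\<lambda>x. g x / V x * (Om t - al x)) absolutely_integrable_on {t..A t}"
      using L1locD[OF L1loc_cont_mult[OF c div_V_L1[OF assms]] t, of "A t"] by (simp add: mult.commute)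
    have "(LINT x:{t..A t}|lebesgue. g x / V x * enn2real (nnI {a x..t} w)) = (LINT x:{t..A t}|lebesgue. g x / V x * (Om t - al x))"
      unfolding set_lebesgue_integral_def
    proof (rule Bochner_Integration.integral_cong[OF refl])
      fix x show "indicat_real {t..A t} x *\<^sub>R (g x / V x * enn2real (nnI {a x..t} w)) = indicat_real {t..A t} x *\<^sub>R (g x / V x * (Om t - al x))"
      proof (cases "x \<in> {t..A t}")
        case True show ?thesis unfolding pt[OF True] ..
      qed simp
    qed
    also have "\<dots> = integral {t..A t} (\<lambda>x. g x / V x * (Om t - al x))"
      using set_lebesgue_integral_eq_integral(2)[OF ai] .
    finally show ?thesis by simp
  qed
qed

text \<open>\<open>t \<le> x \<le> A t\<close> and \<open>a x \<le> t \<le> x\<close> describe the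
  same region, as \<open>A\<close> inverts the increasing function \<open>a\<close>.\<close>

lemma tonelli_A:
  assumes k1: "L1loc k1" "\<And>t. 0 < t \<Longrightarrow> 0 \<le> k1 t"
    and k2: "L1loc k2" "\<And>t. 0 < t \<Longrightarrow> 0 \<le> k2 t"
  shows "nnI {0<..} (\<lambda>t. k1 t * integral {t..A t} k2) = nnI {0<..} (\<lambda>x. k2 x * integral {a x..x} k1)"
    (is "?L = ?R")
proof -
  define K1 where "K1 t = ennreal (indicator {0<..} t * k1 t)" for t
  define K2 where "K2 t = ennreal (indicator {0<..} t * k2 t)" for t
  define L where "L t = indicator {0<..} t * a t" for t
  have m: "K1 \<in> borel_measurable lebesgue" "K2 \<in> borel_measurable lebesgue" "L \<in> borel_measurable lebesgue"
    unfolding K1_def K2_def L_def using pos_indicator_measurable[OF L1loc_measurable[OF k1(1)]] pos_indicator_measurable[OF L1loc_measurable[OF k2(1)]] pos_indicator_measurable[OF cont_meas[OF a_cont]]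
    by measurable
  have iff: "(L x \<le> t \<and> t \<le> x) \<longleftrightarrow> x \<in> {t..A t}" if "0 < t" for x t
    using that a_le_A[of x t] by (auto simp: L_def)
  have "?L = (\<integral>\<^sup>+t. K1 t * (\<integral>\<^sup>+x. K2 x * (if L x \<le> t \<and> t \<le> x then 1 else 0) \<partial>lebesgue) \<partial>lebesgue)"
    unfolding nnI_def
  proof (rule nn_integral_cong)
    fix t :: real
    show "ennreal (k1 t * integral {t..A t} k2) * indicator {0<..} t =
      K1 t * (\<integral>\<^sup>+x. K2 x * (if L x \<le> t \<and> t \<le> x then 1 else 0) \<partial>lebesgue)"
    proof (cases "0 < t")
      case t: True
      have "(\<integral>\<^sup>+x. K2 x * (if L x \<le> t \<and> t \<le> x then 1 else 0) \<partial>lebesgue) = nnI {t..A t} k2"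
        unfolding nnI_def using t iff[OF t] by (intro nn_integral_cong) (auto simp: K2_def indicator_def)
      also have "\<dots> = ennreal (integral {t..A t} k2)"
        by (rule nnI_integral[OF L1locD[OF k2(1) t]]) (use k2(2) t in auto)
      finally show ?thesis using t k1(2)[OF t] by (simp add: K1_def ennreal_mult')
    qed (simp add: K1_def)
  qed
  also have "\<dots> = (\<integral>\<^sup>+x. K2 x * (\<integral>\<^sup>+t. K1 t * (if L x \<le> t \<and> t \<le> x then 1 else 0) \<partial>lebesgue) \<partial>lebesgue)"
    by (rule tonelli_region[OF m])
  also have "\<dots> = ?R"
    unfolding nnI_def
  proof (rule nn_integral_cong)
    fix x :: real
    show "K2 x * (\<integral>\<^sup>+t. K1 t * (if L x \<le> t \<and> t \<le> x then 1 else 0) \<partial>lebesgue) = ennreal (k2 x * integral {a x..x} k1) * indicator {0<..} x"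
    proof (cases "0 < x")
      case x: True
      have "(\<integral>\<^sup>+t. K1 t * (if L x \<le> t \<and> t \<le> x then 1 else 0) \<partial>lebesgue) = nnI {a x..x} k1"
        unfolding nnI_def using x a_pos[OF x] by (intro nn_integral_cong) (auto simp: K1_def L_def indicator_def)
      also have "\<dots> = ennreal (integral {a x..x} k1)"
        by (rule nnI_integral[OF L1locD[OF k1(1) a_pos[OF x]]]) (use k1(2) a_pos[OF x] in auto)
      finally show ?thesis using x k2(2)[OF x] by (simp add: K2_def ennreal_mult')
    qed (simp add: K2_def)
  qed
  finally show ?thesis .
qed

text \<open>The function \<open>X\<close> lies below \<open>V\<close> on \<open>{t..A t}\<close>: it
  is the mean of the two lower bounds \<open>V t / 2\<close> and \<open>2 * (Om s - Om t)\<close>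
  for \<open>V s\<close>. Its density is \<open>w\<close>, so \<open>w / X\<^sup>2\<close>
  integrates to at most \<open>1 / X t\<close>, which is \<open>4 / V t\<close>.\<close>

lemma row_bound:
  assumes t: "0 < t" shows "integral {t..A t} (\<lambda>x. w x / V x powr 2) \<le> 4 / V t"
proof -
  define X where "X s = Om s + (V t / 4 - Om t)" for s
  have vt: "0 < V t" by (rule V_pos[OF t])
  have pX: "prim X w" unfolding X_def by (rule prim_shift[OF Om_prim])
  have Xpos: "V t / 4 \<le> X s" if "t \<le> s" for s using Om_mono[OF t that] by (simp add: X_def)
  \<comment> \<open>Stopped to the left of \<open>t\<close>, where \<open>X\<close> may be
    negative.\<close>
  define Y where "Y s = X (max t s)" for s
  have pY: "prim Y (\<lambda>s. if s \<in> {t..} then w s else 0)" unfolding Y_def by (rule prim_max_min(1)[OF pX t])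
  have Ypos: "0 < Y s" for s using Xpos[of "max t s"] vt by (simp add: Y_def)
  have pZ: "prim (\<lambda>s. - inverse (Y s)) (\<lambda>s. (inverse (Y s) ^ 2) * (if s \<in> {t..} then w s else 0))"
  proof (rule prim_chain[OF pY, of "{0<..}" "\<lambda>z. - inverse z" "\<lambda>z. inverse z ^ 2"])
    show "((\<lambda>z. - inverse z) has_real_derivative inverse z ^ 2) (at z within {0<..})" if "z \<in> {0<..}" for z :: real
      using that by (auto intro!: derivative_eq_intros simp: power2_eq_square)
    show "continuous_on {0<..} (\<lambda>z::real. inverse z ^ 2)" by (intro continuous_intros) auto
  qed (use Ypos in auto)
  have tA: "t \<le> A t" using A_greater[OF t] by simp
  have L2: "L1loc (\<lambda>x. w x / V x powr 2)"
    using L1loc_cont_mult[OF powr_V_cont w_L1, of "-2"] by (simp add: powr_minus divide_inverse mult.commute)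
  have "integral {t..A t} (\<lambda>x. w x / V x powr 2) \<le> integral {t..A t} (\<lambda>s. (inverse (Y s) ^ 2) * (if s \<in> {t..} then w s else 0))"
  proof (rule integral_le[OF L1loc_integrable[OF L2 t] L1loc_integrable[OF prim_L1[OF pZ] t]])
    fix s assume s: "s \<in> {t..A t}"
    have s0: "0 < s" using s t by simp
    have "X s \<le> V s" using V_le_right[OF t, of s] s by (simp add: X_def)
    moreover have "0 < X s" using Xpos[of s] s vt by simp
    ultimately have XV: "(X s)\<^sup>2 \<le> (V s)\<^sup>2" "0 < (V s)\<^sup>2 * (X s)\<^sup>2" using V_pos[OF s0] by (auto intro: power_mono)
    have "w s / (V s)\<^sup>2 \<le> w s / (X s)\<^sup>2" by (rule divide_left_mono[OF XV(1) w_nonneg XV(2)])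
    then show "w s / V s powr 2 \<le> (inverse (Y s) ^ 2) * (if s \<in> {t..} then w s else 0)"
      using s V_pos[OF s0] by (simp add: Y_def max_def powr_numeral power_inverse divide_inverse mult.commute)
  qed
  also have "\<dots> = inverse (Y t) - inverse (Y (A t))" using primD[OF pZ t tA] by simp
  also have "\<dots> \<le> inverse (Y t)" using Ypos[of "A t"] by simp
  also have "Y t = V t / 4" by (simp add: Y_def X_def)
  also have "inverse (V t / 4) = 4 / V t" by simp
  finally show ?thesis .
qed

text \<open>A Schur test. The inner integral is raised to the power \<open>q\<close> against the
  measure with density \<open>w / V\<^sup>2\<close>, whose mass over \<open>{t..A t}\<close> is at
  most \<open>4 / V t\<close>. After interchanging the integrations, the mass of
  \<open>w * V\<close> over \<open>{a x..x}\<close>, at most \<open>(V x)\<^sup>2\<close>, cancels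
  the factor \<open>1 / V\<^sup>2\<close>. The same majorant \<open>I\<close> serves both parts of
  the norm, since the kernel \<open>Om t - al x\<close> does not exceed \<open>V t\<close>.\<close>

lemma W_est_weighted:
  assumes \<psi>: "\<psi> \<in> borel_measurable (lebesgue_on {0<..})"
    and L: "L1loc (\<lambda>x. w x * \<psi> x)" and Lq: "L1loc (\<lambda>x. w x * (\<bar>\<psi> x\<bar> * V x) powr q)"
  shows "Gcal_pow p v1 a b (\<lambda>x. w x * \<psi> x) \<le> ennreal (4 powr q) * nnI {0<..} (\<lambda>x. w x * (\<bar>\<psi> x\<bar> * V x) powr q)"
    "Gbb_pow p v1 a b (\<lambda>x. w x * \<psi> x) \<le> ennreal (4 powr q) * nnI {0<..} (\<lambda>x. w x * (\<bar>\<psi> x\<bar> * V x) powr q)"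
proof -
  define \<Theta> where "\<Theta> x = \<bar>\<psi> x\<bar> * V x" for x
  define k where "k x = w x / V x powr 2" for x
  define I where "I t = integral {t..A t} (\<lambda>x. k x * \<Theta> x)" for t
  have Lk: "L1loc k"
    using L1loc_cont_mult[OF powr_V_cont w_L1, of "-2"] by (simp add: k_def[abs_def] powr_minus divide_inverse mult.commute)
  have Lkq: "L1loc (\<lambda>x. k x * \<Theta> x powr q)"
    using L1loc_cont_mult[OF powr_V_cont Lq, of "-2"] by (simp add: k_def \<Theta>_def powr_minus divide_inverse ac_simps)
  have LwV: "L1loc (\<lambda>t. 4 powr (q - 1) * (w t * V t))"
    using L1loc_cmult[OF L1loc_cont_mult[OF V_cont w_L1], of "4 powr (q - 1)"] by (simp add: mult.commute)
  have mT: "\<Theta> \<in> borel_measurable (lebesgue_on {0<..})" unfolding \<Theta>_def using \<psi> V_meas by measurable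
  have nn: "0 \<le> k x" "0 < x \<Longrightarrow> 0 \<le> \<Theta> x" for x using w_nonneg V_pos[of x] by (auto simp: k_def \<Theta>_def)
  have Iq: "I t powr q \<le> (4 / V t) powr (q - 1) * integral {t..A t} (\<lambda>x. k x * \<Theta> x powr q)"
    and Ia: "(\<lambda>x. k x * \<Theta> x) absolutely_integrable_on {t..A t}" if t: "0 < t" for t
  proof -
    have pm: "(\<lambda>x. k x * \<Theta> x) absolutely_integrable_on {t..A t}"
       "I t powr q \<le> (integral {t..A t} k) powr (q - 1) * integral {t..A t} (\<lambda>x. k x * \<Theta> x powr q)"
    proof -
      have sub: "{t..A t} \<subseteq> {0<..}" using t by auto
      have n2: "0 \<le> \<Theta> x" if "x \<in> {t..A t}" for x using nn(2)[of x] that t by simp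
      note pm = power_mean_integral[OF q1 L1locD[OF Lk t] L1locD[OF Lkq t] meas_sub[OF mT sub] nn(1) n2]
      show "(\<lambda>x. k x * \<Theta> x) absolutely_integrable_on {t..A t}" by (rule pm(1))
      show "I t powr q \<le> (integral {t..A t} k) powr (q - 1) * integral {t..A t} (\<lambda>x. k x * \<Theta> x powr q)"
        unfolding I_def by (rule pm(2))
    qed
    show "(\<lambda>x. k x * \<Theta> x) absolutely_integrable_on {t..A t}" by (rule pm(1))
    have "(integral {t..A t} k) powr (q - 1) \<le> (4 / V t) powr (q - 1)"
      using row_bound[OF t] q1 L1loc_integrable[OF Lk t] nn
      by (intro powr_mono2 Henstock_Kurzweil_Integration.integral_nonneg) (auto simp: k_def[abs_def])
    moreover have "0 \<le> integral {t..A t} (\<lambda>x. k x * \<Theta> x powr q)"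
      using L1loc_integrable[OF Lkq t] nn by (intro Henstock_Kurzweil_Integration.integral_nonneg) auto
    ultimately show "I t powr q \<le> (4 / V t) powr (q - 1) * integral {t..A t} (\<lambda>x. k x * \<Theta> x powr q)"
      using pm(2) by (meson mult_right_mono order_trans)
  qed
  have kT: "k x * \<Theta> x = w x * \<bar>\<psi> x\<bar> / V x" if "0 < x" for x
    using V_pos[OF that] by (simp add: k_def \<Theta>_def powr_numeral power2_eq_square)
  have main: "nnI {0<..} (\<lambda>t. w t * V t powr q * I t powr q) \<le> ennreal (4 powr (q - 1)) * nnI {0<..} (\<lambda>x. w x * \<Theta> x powr q)"
  proof -
    have "nnI {0<..} (\<lambda>t. w t * V t powr q * I t powr q) \<le> nnI {0<..} (\<lambda>t. (4 powr (q - 1) * (w t * V t)) * integral {t..A t} (\<lambda>x. k x * \<Theta> x powr q))"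
    proof (rule nnI_mono)
      fix t :: real assume "t \<in> {0<..}"
      then have t: "0 < t" by simp
      have vt: "0 < V t" by (rule V_pos[OF t])
      let ?Z = "integral {t..A t} (\<lambda>x. k x * \<Theta> x powr q)"
      have "w t * V t powr q * I t powr q = w t * (V t powr q * I t powr q)" by (simp only: mult.assoc)
      also have "\<dots> \<le> w t * (V t powr q * ((4 / V t) powr (q - 1) * ?Z))"
        by (intro mult_left_mono Iq t w_nonneg) auto
      also have "\<dots> = (V t powr q * (4 / V t) powr (q - 1)) * (w t * ?Z)" by (simp only: ac_simps)
      also have "V t powr q * (4 / V t) powr (q - 1) = 4 powr (q - 1) * V t"
        using vt by (simp add: powr_divide powr_diff)
      also have "4 powr (q - 1) * V t * (w t * ?Z) = (4 powr (q - 1) * (w t * V t)) * ?Z" by (simp only: ac_simps)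
      finally show "w t * V t powr q * I t powr q \<le> (4 powr (q - 1) * (w t * V t)) * ?Z" .
    qed
    also have "\<dots> = nnI {0<..} (\<lambda>x. (k x * \<Theta> x powr q) * integral {a x..x} (\<lambda>t. 4 powr (q - 1) * (w t * V t)))"
      by (rule tonelli_A[OF LwV _ Lkq]) (use nn V_pos w_nonneg in \<open>auto simp: less_imp_le\<close>)
    also have "\<dots> \<le> nnI {0<..} (\<lambda>x. 4 powr (q - 1) * (w x * \<Theta> x powr q))"
    proof (rule nnI_mono)
      fix x :: real assume "x \<in> {0<..}"
      then have x: "0 < x" by simp
      have vx: "0 < V x" by (rule V_pos[OF x])
      have ax: "0 < a x" "a x \<le> x" using a_pos[OF x] a_less[OF x] by auto
      have "integral {a x..x} (\<lambda>t. 4 powr (q - 1) * (w t * V t)) \<le> integral {a x..x} (\<lambda>t. (4 powr (q - 1) * (2 * V x)) * w t)"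
      proof (rule integral_le[OF L1loc_integrable[OF LwV ax(1)] L1loc_integrable[OF L1loc_cmult[OF w_L1] ax(1)]])
        fix t assume t: "t \<in> {a x..x}"
        have "V t \<le> 2 * V x"
          by (rule V_le_right(1)) (use t ax a_le_A[OF x, of t] in auto)
        then have "w t * V t \<le> w t * (2 * V x)" using w_nonneg by (rule mult_left_mono)
        then have "4 powr (q - 1) * (w t * V t) \<le> 4 powr (q - 1) * (w t * (2 * V x))" by (rule mult_left_mono) simp
        then show "4 powr (q - 1) * (w t * V t) \<le> 4 powr (q - 1) * (2 * V x) * w t" by (simp only: ac_simps)
      qed
      also have "\<dots> = (4 powr (q - 1) * (2 * V x)) * (V x / 2)"
        using primD[OF Om_prim ax] V_al[OF x] by (simp add: al_def)
      also have "\<dots> = 4 powr (q - 1) * V x powr 2" using vx by (simp add: powr_numeral power2_eq_square)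
      finally have "(k x * \<Theta> x powr q) * integral {a x..x} (\<lambda>t. 4 powr (q - 1) * (w t * V t)) \<le>
         (k x * \<Theta> x powr q) * (4 powr (q - 1) * V x powr 2)" using nn by (intro mult_left_mono) auto
      also have "\<dots> = 4 powr (q - 1) * (w x * \<Theta> x powr q)" using vx by (simp add: k_def)
      finally show "(k x * \<Theta> x powr q) * integral {a x..x} (\<lambda>t. 4 powr (q - 1) * (w t * V t)) \<le> 4 powr (q - 1) * (w x * \<Theta> x powr q)" .
    qed
    also have "\<dots> = ennreal (4 powr (q - 1)) * nnI {0<..} (\<lambda>x. w x * \<Theta> x powr q)"
      using mT w_meas by (intro nnI_cmult) auto
    finally show ?thesis .
  qed
  have le4: "ennreal (4 powr (q - 1)) * N \<le> ennreal (4 powr q) * N" for N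
    by (intro mult_right_mono ennreal_leI powr_mono) auto
  have cal: "\<bar>integral {t..A t} (\<lambda>x. w x * \<psi> x / V x)\<bar> \<le> I t" if t: "0 < t" for t
  proof -
    have "norm (integral {t..A t} (\<lambda>x. w x * \<psi> x / V x)) \<le> I t"
      unfolding I_def
    proof (rule Henstock_Kurzweil_Integration.integral_norm_bound_integral[OF L1loc_integrable[OF div_V_L1[OF L] t]])
      show "(\<lambda>x. k x * \<Theta> x) integrable_on {t..A t}" by (rule set_lebesgue_integral_eq_integral(1)[OF Ia[OF t]])
      fix x assume "x \<in> {t..A t}"
      then have x: "0 < x" using t by simp
      show "norm (w x * \<psi> x / V x) \<le> k x * \<Theta> x" using kT[OF x] w_nonneg V_pos[OF x] by (simp add: abs_mult)
    qed
    then show ?thesis by simp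
  qed
  have bb: "\<bar>integral {t..A t} (\<lambda>x. w x * \<psi> x / V x * (Om t - al x))\<bar> \<le> V t * I t" if t: "0 < t" for t
  proof -
    have c: "continuous_on {0<..} (\<lambda>x. Om t - al x)" by (intro continuous_intros al_cont)
    have Li: "L1loc (\<lambda>x. w x * \<psi> x / V x * (Om t - al x))"
      using L1loc_cont_mult[OF c div_V_L1[OF L]] by (simp add: mult.commute)
    have ki: "(\<lambda>x. k x * \<Theta> x) integrable_on {t..A t}" by (rule set_lebesgue_integral_eq_integral(1)[OF Ia[OF t]])
    have "norm (integral {t..A t} (\<lambda>x. w x * \<psi> x / V x * (Om t - al x))) \<le> integral {t..A t} (\<lambda>x. V t * (k x * \<Theta> x))"
    proof (rule Henstock_Kurzweil_Integration.integral_norm_bound_integral[OF L1loc_integrable[OF Li t]])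
      show "(\<lambda>x. V t * (k x * \<Theta> x)) integrable_on {t..A t}" using ki by (rule integrable_on_mult_right)
      fix x assume xx: "x \<in> {t..A t}"
      then have x: "0 < x" using t by simp
      have "a x \<le> t" using xx a_le_A[OF x t] by auto
      then have "al x \<le> Om t" unfolding al_def by (intro Om_mono a_pos x)
      moreover have "Om t - al x \<le> V t" using al_mono[OF t, of x] xx V_al[OF t] V_pos[OF t] by simp
      ultimately have d: "\<bar>Om t - al x\<bar> \<le> V t" by simp
      have "norm (w x * \<psi> x / V x * (Om t - al x)) = (k x * \<Theta> x) * \<bar>Om t - al x\<bar>"
        unfolding kT[OF x] using w_nonneg V_pos[OF x] by (simp add: abs_mult)
      also have "\<dots> \<le> (k x * \<Theta> x) * V t" using d nn x by (intro mult_left_mono) auto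
      finally show "norm (w x * \<psi> x / V x * (Om t - al x)) \<le> V t * (k x * \<Theta> x)" by (simp add: mult.commute)
    qed
    also have "\<dots> = V t * I t" by (simp add: I_def)
    finally show ?thesis by simp
  qed
  have qge: "0 \<le> q" using q1 by simp
  have "Gcal_pow p v1 a b (\<lambda>x. w x * \<psi> x) \<le> nnI {0<..} (\<lambda>t. w t * V t powr q * I t powr q)"
    unfolding Gcal_eq[OF L] by (intro nnI_mono mult_left_mono powr_mono2 cal) (auto simp: w_nonneg qge)
  then show "Gcal_pow p v1 a b (\<lambda>x. w x * \<psi> x) \<le> ennreal (4 powr q) * nnI {0<..} (\<lambda>x. w x * (\<bar>\<psi> x\<bar> * V x) powr q)"
    using main le4 unfolding \<Theta>_def by (meson order_trans)
  have "Gbb_pow p v1 a b (\<lambda>x. w x * \<psi> x) \<le> nnI {0<..} (\<lambda>t. w t * V t powr q * I t powr q)"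
    unfolding Gbb_eq[OF L]
  proof (rule nnI_mono)
    fix t :: real assume "t \<in> {0<..}"
    then have t: "0 < t" by simp
    have It: "0 \<le> I t" using cal[OF t] by linarith
    have "\<bar>integral {t..A t} (\<lambda>x. w x * \<psi> x / V x * (Om t - al x))\<bar> powr q \<le> (V t * I t) powr q"
      by (intro powr_mono2 bb t) (auto simp: qge)
    also have "\<dots> = V t powr q * I t powr q" using V_pos[OF t] It by (simp add: powr_mult)
    finally show "w t * \<bar>integral {t..A t} (\<lambda>x. w x * \<psi> x / V x * (Om t - al x))\<bar> powr q \<le> w t * V t powr q * I t powr q"
      using mult_left_mono[OF _ w_nonneg[of t]] by (simp add: mult.assoc)
  qed
  then show "Gbb_pow p v1 a b (\<lambda>x. w x * \<psi> x) \<le> ennreal (4 powr q) * nnI {0<..} (\<lambda>x. w x * (\<bar>\<psi> x\<bar> * V x) powr q)"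
    using main le4 unfolding \<Theta>_def by (meson order_trans)
qed

text \<open>Substitution along \<open>a\<close> turns \<open>w\<close> into \<open>\<rho>\<close>,
  and \<open>\<rho> \<le> 2 * w\<close>.\<close>

lemma pushforward_A:
  assumes K: "continuous_on {0<..} K" and nn: "\<And>x. 0 < x \<Longrightarrow> 0 \<le> K x"
  shows "nnI {0<..} (\<lambda>s. w s * K (A s)) \<le> 2 * nnI {0<..} (\<lambda>s. w s * K s)"
proof (rule nnI_limit)
  have L: "L1loc (\<lambda>s. w s * K (A s))" using wA_L1[OF K] by (simp add: mult.commute)
  show "(\<lambda>s. w s * K (A s)) \<in> borel_measurable (lebesgue_on {0<..})" by (rule L1loc_measurable[OF L])
  have Lw: "L1loc (\<lambda>s. w s * K s)" using L1loc_cont_mult[OF K w_L1] by (simp add: mult.commute)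
  fix x y :: real assume xy: "0 < x" "x \<le> y"
  then have y: "0 < y" by simp
  have Ax: "0 < A x" "A x \<le> A y" using A_pos A_mono xy by auto
  have "nnI {x..y} (\<lambda>s. w s * K (A s)) = ennreal (integral {x..y} (\<lambda>s. w s * K (A s)))"
    by (rule nnI_integral[OF L1locD[OF L xy(1)]]) (use xy nn A_pos w_nonneg in auto)
  also have "integral {x..y} (\<lambda>s. w s * K (A s)) = integral {A x..A y} (\<lambda>s. K s * \<rho> s)"
    using al_substitution[OF K Ax] a_A xy y by (simp add: mult.commute)
  also have "ennreal (integral {A x..A y} (\<lambda>s. K s * \<rho> s)) \<le> ennreal (integral {A x..A y} (\<lambda>s. 2 * (w s * K s)))"
  proof (rule ennreal_leI, rule integral_le[OF L1loc_integrable[OF L1loc_cont_mult[OF K prim_L1[OF al_prim]] Ax(1)] L1loc_integrable[OF L1loc_cmult[OF Lw] Ax(1)]])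
    fix s assume "s \<in> {A x..A y}"
    then have s: "0 < s" using Ax by auto
    have "K s * \<rho> s \<le> K s * (2 * w s)" by (intro mult_left_mono rho_bounds nn s)
    then show "K s * \<rho> s \<le> 2 * (w s * K s)" by (simp only: ac_simps)
  qed
  also have "\<dots> = ennreal (2 * integral {A x..A y} (\<lambda>s. w s * K s))" by simp
  also have "\<dots> = 2 * ennreal (integral {A x..A y} (\<lambda>s. w s * K s))"
    by (simp add: ennreal_mult' del: ennreal_numeral flip: ennreal_numeral)
  also have "ennreal (integral {A x..A y} (\<lambda>s. w s * K s)) = nnI {A x..A y} (\<lambda>s. w s * K s)"
    by (rule nnI_integral[symmetric, OF L1locD[OF Lw Ax(1)]]) (use Ax nn w_nonneg in auto)
  also have "2 * nnI {A x..A y} (\<lambda>s. w s * K s) \<le> 2 * nnI {0<..} (\<lambda>s. w s * K s)"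
    by (intro mult_left_mono nnI_subset) (use Ax in auto)
  finally show "nnI {x..y} (\<lambda>s. w s * K (A s)) \<le> 2 * nnI {0<..} (\<lambda>s. w s * K s)" .
qed

lemma al_A: "0 < t \<Longrightarrow> al (A t) = Om t" by (simp add: al_def a_A)

text \<open>Integration by parts moves the derivative from \<open>U\<close> to the kernel, which
  vanishes at \<open>A t\<close>; substitution along \<open>a\<close> then carries the integral over
  \<open>{t..A t}\<close> to one over \<open>{a t..t}\<close>. Only \<open>U\<close> is left on the
  right, so fast oscillation of \<open>u\<close> does no harm.\<close>

lemma E1_identity:
  assumes U: "prim U u" and t: "0 < t"
  shows "integral {t..A t} (\<lambda>x. u x * (Om t - al x)) = integral {a t..t} (\<lambda>s. w s * (U (A s) - U t))"
proof -
  note cU = prim_continuous[OF U] and Lu = prim_L1[OF U]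
  have tA: "t \<le> A t" "0 < A t" "0 < a t" "a t \<le> t" using A_greater[OF t] A_pos[OF t] a_pos[OF t] a_less[OF t] by auto
  have L1: "L1loc (\<lambda>x. u x * al x)" using L1loc_cont_mult[OF al_cont Lu] by (simp add: mult.commute)
  have L2: "L1loc (\<lambda>x. U x * \<rho> x)" by (rule L1loc_cont_mult[OF cU prim_L1[OF al_prim]])
  have LA: "L1loc (\<lambda>s. U (A s) * w s)" by (rule wA_L1[OF cU])
  note i1 = L1loc_integrable[OF L1 t] and i2 = L1loc_integrable[OF L2 t] and iu = L1loc_integrable[OF Lu t]
  have "integral {t..A t} (\<lambda>x. u x * (Om t - al x)) = integral {t..A t} (\<lambda>x. Om t * u x - u x * al x)"
    by (simp add: algebra_simps)
  also have "\<dots> = Om t * integral {t..A t} u - integral {t..A t} (\<lambda>x. u x * al x)"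
    using iu i1 by (subst integral_diff) (auto intro: integrable_on_mult_right)
  also have "integral {t..A t} (\<lambda>x. u x * al x) = (U (A t) * al (A t) - U t * al t) - integral {t..A t} (\<lambda>x. U x * \<rho> x)"
    using primD[OF prim_mult[OF U al_prim] t tA(1)] i1 i2 by (subst (asm) integral_add) auto
  also have "integral {t..A t} (\<lambda>x. U x * \<rho> x) = integral {a t..t} (\<lambda>s. U (A s) * w s)"
    using al_substitution[OF cU t tA(1)] a_A[OF t] by simp
  also have "integral {t..A t} u = U (A t) - U t" by (rule primD[OF U t tA(1)])
  finally have e: "integral {t..A t} (\<lambda>x. u x * (Om t - al x)) = integral {a t..t} (\<lambda>s. U (A s) * w s) - U t * (Om t - al t)"
    unfolding al_A[OF t] by (simp add: algebra_simps)
  have "integral {a t..t} (\<lambda>s. w s * (U (A s) - U t)) = integral {a t..t} (\<lambda>s. U (A s) * w s - U t * w s)"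
    by (simp add: algebra_simps)
  also have "\<dots> = integral {a t..t} (\<lambda>s. U (A s) * w s) - U t * integral {a t..t} w"
    using L1loc_integrable[OF LA tA(3)] L1loc_integrable[OF w_L1 tA(3)]
    by (subst integral_diff) (auto intro: integrable_on_mult_right)
  also have "integral {a t..t} w = Om t - al t" using primD[OF Om_prim tA(3,4)] by (simp add: al_def)
  finally show ?thesis using e by simp
qed

text \<open>Rounding up to a pure power makes the \<open>q\<close>-th root equal to 16, whatever
  \<open>q\<close> is.\<close>

lemma const_bound: "2 * 4 powr q + 2 powr q \<le> (16::real) powr q" 
proof -
  have "(2::real) powr q \<le> 4 powr q" using q1 by (intro powr_mono2) auto
  moreover have "(4::real) powr 1 \<le> 4 powr q" using q1 by (intro powr_mono) auto
  moreover have "(16::real) powr q = 4 powr q * 4 powr q" by (simp add: powr_mult[symmetric])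
  moreover have "4 * 4 powr q \<le> (4::real) powr q * 4 powr q" using calculation(2) by (intro mult_right_mono) auto
  moreover have "(0::real) \<le> 4 powr q" by simp
  ultimately show ?thesis by linarith
qed

lemma two_term_bound:
  assumes "X \<le> ennreal (4 powr q) * (2 * N) + ennreal (2 powr q) * N" shows "X \<le> ennreal (16 powr q) * N"
proof -
  have "ennreal (4 powr q) * (2 * N) + ennreal (2 powr q) * N = ennreal (2 * 4 powr q + 2 powr q) * N"
    by (subst ennreal_plus) (auto simp: ennreal_mult' distrib_left ac_simps)
  also have "\<dots> \<le> ennreal (16 powr q) * N" by (intro mult_right_mono ennreal_leI const_bound) auto
  finally show ?thesis using assms by (rule order_trans[rotated])
qed

text \<open>In \<open>Gcal_pow\<close> the inner integral is \<open>U (A t) - U t\<close>; the term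
  at \<open>A t\<close> is brought back to \<open>t\<close> by \<open>V t \<le> 2 * V (A t)\<close>
  and the pushforward along \<open>A\<close>. In \<open>Gbb_pow\<close> the rewriting of the kernel
  integral through \<open>U\<close>, and the power mean inequality on \<open>{a t..t}\<close>, where
  \<open>w\<close> has mass \<open>V t / 2\<close>, lead to the same two terms.\<close>

lemma W_est_prim:
  assumes U: "prim U u"
  shows "Gcal_pow p v1 a b (\<lambda>x. V x * u x) \<le> ennreal (16 powr q) * nnI {0<..} (\<lambda>x. w x * (V x * \<bar>U x\<bar>) powr q)"
    "Gbb_pow p v1 a b (\<lambda>x. V x * u x) \<le> ennreal (16 powr q) * nnI {0<..} (\<lambda>x. w x * (V x * \<bar>U x\<bar>) powr q)"
proof -
  note cU = prim_continuous[OF U] and Lu = prim_L1[OF U]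
  have LV: "L1loc (\<lambda>x. V x * u x)" by (rule L1loc_cont_mult[OF V_cont Lu])
  have qge: "0 \<le> q" using q1 by simp
  define K where "K x = (V x * \<bar>U x\<bar>) powr q" for x
  have cK: "continuous_on {0<..} K"
    unfolding K_def using V_cont cU q1 V_pos
    by (intro continuous_on_powr' continuous_intros) (auto simp: less_imp_le)
  have Kn: "0 \<le> K x" for x by (simp add: K_def)
  have cKA: "continuous_on {0<..} (\<lambda>s. K (A s))" by (rule comp_A_cont[OF cK])
  define N where "N = nnI {0<..} (\<lambda>x. w x * K x)"
  have NA: "nnI {0<..} (\<lambda>s. w s * K (A s)) \<le> 2 * N" unfolding N_def by (rule pushforward_A[OF cK Kn])
  have mK: "(\<lambda>x. w x * K x) \<in> borel_measurable (lebesgue_on {0<..})" "(\<lambda>x. w x * K (A x)) \<in> borel_measurable (lebesgue_on {0<..})"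
    using w_meas cont_meas[OF cK] cont_meas[OF cKA] by measurable
  have gV: "integral {t..A t} (\<lambda>x. (V x * u x) / V x * m x) = integral {t..A t} (\<lambda>x. u x * m x)" if "0 < t" for t m
    by (rule integral_cong) (use V_pos that in \<open>auto simp: less_imp_neq[THEN not_sym]\<close>)
  have cal: "Gcal_pow p v1 a b (\<lambda>x. V x * u x) \<le> ennreal (4 powr q) * (2 * N) + ennreal (2 powr q) * N"
  proof -
    have "Gcal_pow p v1 a b (\<lambda>x. V x * u x) \<le> nnI {0<..} (\<lambda>t. 4 powr q * (w t * K (A t)) + 2 powr q * (w t * K t))"
      unfolding Gcal_eq[OF LV]
    proof (rule nnI_mono)
      fix t :: real assume "t \<in> {0<..}"
      then have t: "0 < t" by simp
      have tA: "t \<le> A t" "0 < A t" using A_greater[OF t] A_pos[OF t] by auto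
      have "integral {t..A t} (\<lambda>x. (V x * u x) / V x) = U (A t) - U t"
        using gV[OF t, of "\<lambda>_. 1"] primD[OF U t tA(1)] by simp
      moreover have "V t powr q * \<bar>U (A t) - U t\<bar> powr q \<le> 4 powr q * K (A t) + 2 powr q * K t"
      proof -
        have V2: "V t \<le> 2 * V (A t)" by (rule V_le_right(1)[OF t tA(1)]) simp
        have "V t powr q * \<bar>U (A t) - U t\<bar> powr q = (V t * \<bar>U (A t) - U t\<bar>) powr q" using V_pos[OF t] by (simp add: powr_mult)
        also have "\<dots> \<le> (2 * V (A t) * \<bar>U (A t)\<bar> + V t * \<bar>U t\<bar>) powr q"
        proof (rule powr_mono2[OF qge])
          show "0 \<le> V t * \<bar>U (A t) - U t\<bar>" using V_pos[OF t] by simp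
          have "V t * \<bar>U (A t) - U t\<bar> \<le> V t * (\<bar>U (A t)\<bar> + \<bar>U t\<bar>)" using V_pos[OF t] by (intro mult_left_mono) auto
          also have "\<dots> = V t * \<bar>U (A t)\<bar> + V t * \<bar>U t\<bar>" by (rule distrib_left)
          also have "\<dots> \<le> 2 * V (A t) * \<bar>U (A t)\<bar> + V t * \<bar>U t\<bar>" using V2 by (intro add_right_mono mult_right_mono) auto
          finally show "V t * \<bar>U (A t) - U t\<bar> \<le> 2 * V (A t) * \<bar>U (A t)\<bar> + V t * \<bar>U t\<bar>" .
        qed
        also have "\<dots> \<le> 2 powr q * ((2 * V (A t) * \<bar>U (A t)\<bar>) powr q + (V t * \<bar>U t\<bar>) powr q)"
          using V_pos[OF t] V_pos[OF tA(2)] qge by (intro powr_add_le) auto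
        also have "(2 * V (A t) * \<bar>U (A t)\<bar>) powr q = 2 powr q * K (A t)"
          using V_pos[OF tA(2)] by (simp add: K_def powr_mult mult.assoc)
        also have "2 powr q * (2 powr q * K (A t) + (V t * \<bar>U t\<bar>) powr q) = (2 powr q * 2 powr q) * K (A t) + 2 powr q * K t"
          by (simp add: K_def distrib_left)
        also have "(2::real) powr q * 2 powr q = 4 powr q" by (simp add: powr_mult[symmetric])
        finally show ?thesis .
      qed
      ultimately show "w t * V t powr q * \<bar>integral {t..A t} (\<lambda>x. (V x * u x) / V x)\<bar> powr q \<le> 4 powr q * (w t * K (A t)) + 2 powr q * (w t * K t)"
        using mult_left_mono[OF _ w_nonneg[of t], of "V t powr q * \<bar>U (A t) - U t\<bar> powr q" "4 powr q * K (A t) + 2 powr q * K t"]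
        by (simp add: distrib_left ac_simps)
    qed
    also have "\<dots> = nnI {0<..} (\<lambda>t. 4 powr q * (w t * K (A t))) + nnI {0<..} (\<lambda>t. 2 powr q * (w t * K t))"
      using mK Kn w_nonneg by (intro nnI_add) auto
    also have "\<dots> = ennreal (4 powr q) * nnI {0<..} (\<lambda>t. w t * K (A t)) + ennreal (2 powr q) * N"
      unfolding N_def using mK by (subst (1 2) nnI_cmult) auto
    also have "\<dots> \<le> ennreal (4 powr q) * (2 * N) + ennreal (2 powr q) * N" by (intro add_right_mono mult_left_mono NA) auto
    finally show ?thesis .
  qed
  then show "Gcal_pow p v1 a b (\<lambda>x. V x * u x) \<le> ennreal (16 powr q) * nnI {0<..} (\<lambda>x. w x * (V x * \<bar>U x\<bar>) powr q)"
    using two_term_bound unfolding N_def K_def by blast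
  define UA where "UA s = \<bar>U (A s)\<bar> powr q" for s
  have cUA: "continuous_on {0<..} UA"
    unfolding UA_def using q1 by (intro continuous_on_powr' continuous_intros comp_A_cont[OF cU]) auto
  have LUA: "L1loc (\<lambda>s. w s * UA s)" using L1loc_cont_mult[OF cUA w_L1] by (simp add: mult.commute)
  have UAn: "0 \<le> UA s" for s by (simp add: UA_def)
  define J where "J t = integral {a t..t} (\<lambda>s. w s * UA s)" for t
  have Lk2: "L1loc (\<lambda>t. w t * V t powr (q - 1))" using L1loc_cont_mult[OF powr_V_cont w_L1, of "q - 1"] by (simp add: mult.commute)
  have Jn: "0 \<le> J t" if "0 < t" for t unfolding J_def
    by (intro Henstock_Kurzweil_Integration.integral_nonneg L1loc_integrable[OF LUA a_pos[OF that]]) (use w_nonneg UAn in auto)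
  have pw: "\<bar>integral {t..A t} (\<lambda>x. u x * (Om t - al x))\<bar> powr q \<le> V t powr (q - 1) * (2 powr q * J t + 2 powr q * (\<bar>U t\<bar> powr q * V t))"
    if t: "0 < t" for t
  proof -
    have at: "0 < a t" "a t \<le> t" using a_pos[OF t] a_less[OF t] by auto
    define \<Theta> where "\<Theta> s = \<bar>U (A s) - U t\<bar>" for s
    have cT: "continuous_on {0<..} \<Theta>" unfolding \<Theta>_def by (intro continuous_intros comp_A_cont[OF cU])
    have cTq: "continuous_on {0<..} (\<lambda>s. \<Theta> s powr q)" using q1 by (intro continuous_on_powr' cT continuous_intros) (auto simp: \<Theta>_def)
    have LT: "L1loc (\<lambda>s. w s * \<Theta> s powr q)" using L1loc_cont_mult[OF cTq w_L1] by (simp add: mult.commute)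
    have sub: "{a t..t} \<subseteq> {0<..}" using at by auto
    have pm: "(\<lambda>s. w s * \<Theta> s) absolutely_integrable_on {a t..t}"
      "(integral {a t..t} (\<lambda>s. w s * \<Theta> s)) powr q \<le> (integral {a t..t} w) powr (q - 1) * integral {a t..t} (\<lambda>s. w s * \<Theta> s powr q)"
      by (rule power_mean_integral[OF q1 L1locD[OF w_L1 at(1)] L1locD[OF LT at(1)] meas_sub[OF cont_meas[OF cT] sub]]; simp add: w_nonneg \<Theta>_def)+
    have Lw: "L1loc (\<lambda>s. w s * (U (A s) - U t))"
      using L1loc_cont_mult[OF continuous_on_diff[OF comp_A_cont[OF cU] continuous_on_const] w_L1, of "U t"] by (simp add: mult.commute)
    have "norm (integral {a t..t} (\<lambda>s. w s * (U (A s) - U t))) \<le> integral {a t..t} (\<lambda>s. w s * \<Theta> s)"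
      by (rule Henstock_Kurzweil_Integration.integral_norm_bound_integral[OF L1loc_integrable[OF Lw at(1)] set_lebesgue_integral_eq_integral(1)[OF pm(1)]])
        (simp add: \<Theta>_def abs_mult w_nonneg)
    then have "\<bar>integral {a t..t} (\<lambda>s. w s * (U (A s) - U t))\<bar> powr q \<le> (integral {a t..t} (\<lambda>s. w s * \<Theta> s)) powr q"
      using qge by (intro powr_mono2) auto
    also have "\<dots> \<le> (integral {a t..t} w) powr (q - 1) * integral {a t..t} (\<lambda>s. w s * \<Theta> s powr q)" by (rule pm(2))
    also have "\<dots> \<le> V t powr (q - 1) * (2 powr q * J t + 2 powr q * (\<bar>U t\<bar> powr q * V t))"
    proof (rule mult_mono)
      have iw: "integral {a t..t} w = V t / 2" using primD[OF Om_prim at] V_al[OF t] by (simp add: al_def)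
      then show "(integral {a t..t} w) powr (q - 1) \<le> V t powr (q - 1)" using V_pos[OF t] q1 by (intro powr_mono2) auto
      have i3: "(\<lambda>s. 2 powr q * (w s * UA s) + (2 powr q * \<bar>U t\<bar> powr q) * w s) integrable_on {a t..t}"
        using L1loc_integrable[OF LUA at(1)] L1loc_integrable[OF w_L1 at(1)] by (intro integrable_add integrable_on_mult_right)
      have "integral {a t..t} (\<lambda>s. w s * \<Theta> s powr q) \<le> integral {a t..t} (\<lambda>s. 2 powr q * (w s * UA s) + (2 powr q * \<bar>U t\<bar> powr q) * w s)"
      proof (rule integral_le[OF L1loc_integrable[OF LT at(1)] i3])
        fix s
        have "\<Theta> s powr q \<le> (\<bar>U (A s)\<bar> + \<bar>U t\<bar>) powr q" unfolding \<Theta>_def by (intro powr_mono2 qge) auto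
        also have "\<dots> \<le> 2 powr q * (UA s + \<bar>U t\<bar> powr q)" unfolding UA_def by (intro powr_add_le qge) auto
        finally have "w s * \<Theta> s powr q \<le> w s * (2 powr q * (UA s + \<bar>U t\<bar> powr q))" by (intro mult_left_mono w_nonneg)
        then show "w s * \<Theta> s powr q \<le> 2 powr q * (w s * UA s) + (2 powr q * \<bar>U t\<bar> powr q) * w s"
          by (simp add: distrib_left ac_simps)
      qed
      also have "\<dots> = 2 powr q * J t + (2 powr q * \<bar>U t\<bar> powr q) * (V t / 2)"
        unfolding J_def iw[symmetric] using L1loc_integrable[OF LUA at(1)] L1loc_integrable[OF w_L1 at(1)]
        by (subst integral_add) (auto intro: integrable_on_mult_right)
      also have "\<dots> \<le> 2 powr q * J t + 2 powr q * (\<bar>U t\<bar> powr q * V t)" using V_pos[OF t] by simp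
      finally show "integral {a t..t} (\<lambda>s. w s * \<Theta> s powr q) \<le> 2 powr q * J t + 2 powr q * (\<bar>U t\<bar> powr q * V t)" .
      show "0 \<le> integral {a t..t} (\<lambda>s. w s * \<Theta> s powr q)"
        by (intro Henstock_Kurzweil_Integration.integral_nonneg L1loc_integrable[OF LT at(1)]) (simp add: w_nonneg)
    qed simp
    finally show ?thesis unfolding E1_identity[OF U t] .
  qed
  \<comment> \<open>Interchanging the integrations leaves the integral of
    \<open>w * V powr (q - 1)\<close> over \<open>{s..A s}\<close>. This interval is the left half
    of the window of \<open>A s\<close>, so there \<open>V \<le> 2 * V (A s)\<close> and the mass of
    \<open>w\<close> is \<open>V (A s) / 2\<close>.\<close>
  have T: "nnI {0<..} (\<lambda>t. (w t * V t powr (q - 1)) * J t) \<le> ennreal (2 powr q) * (2 * N)"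
  proof -
    have "nnI {0<..} (\<lambda>t. (w t * V t powr (q - 1)) * J t) = nnI {0<..} (\<lambda>s. (w s * UA s) * integral {s..A s} (\<lambda>t. w t * V t powr (q - 1)))"
      unfolding J_def by (rule tonelli_A[symmetric, OF LUA _ Lk2]) (auto simp: w_nonneg UAn)
    also have "\<dots> \<le> nnI {0<..} (\<lambda>s. 2 powr q * (w s * K (A s)))"
    proof (rule nnI_mono)
      fix s :: real assume "s \<in> {0<..}"
      then have s: "0 < s" by simp
      have As: "0 < A s" "s \<le> A s" using A_pos[OF s] A_greater[OF s] by auto
      have vA: "0 < V (A s)" by (rule V_pos[OF As(1)])
      have "integral {s..A s} (\<lambda>t. w t * V t powr (q - 1)) \<le> integral {s..A s} (\<lambda>t. (2 * V (A s)) powr (q - 1) * w t)"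
      proof (rule integral_le[OF L1loc_integrable[OF Lk2 s] L1loc_integrable[OF L1loc_cmult[OF w_L1] s]])
        fix t assume t: "t \<in> {s..A s}"
        have t0: "0 < t" using t s by auto
        have "A s \<le> A t" using A_mono[OF s, of t] t by auto
        then have "V t \<le> 2 * V (A s)" using t by (intro V_le_right(1)[OF t0]) auto
        then have "V t powr (q - 1) \<le> (2 * V (A s)) powr (q - 1)" using V_pos[OF t0] q1 by (intro powr_mono2) auto
        then have "w t * V t powr (q - 1) \<le> w t * (2 * V (A s)) powr (q - 1)" by (intro mult_left_mono w_nonneg)
        then show "w t * V t powr (q - 1) \<le> (2 * V (A s)) powr (q - 1) * w t" by (simp only: ac_simps)
      qed
      also have "\<dots> = (2 * V (A s)) powr (q - 1) * (V (A s) / 2)"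
        using primD[OF Om_prim s As(2)] V_al[OF As(1)] al_A[OF s] by simp
      also have "\<dots> = 2 powr (q - 1) / 2 * V (A s) powr q"
        using vA by (simp add: powr_mult powr_diff)
      also have "\<dots> \<le> 2 powr q * V (A s) powr q"
      proof (rule mult_right_mono)
        have "(2::real) powr (q - 1) \<le> 2 powr q" by (intro powr_mono) auto
        moreover have "(0::real) \<le> 2 powr (q - 1)" by simp
        ultimately show "(2::real) powr (q - 1) / 2 \<le> 2 powr q" by linarith
      qed simp
      finally have "(w s * UA s) * integral {s..A s} (\<lambda>t. w t * V t powr (q - 1)) \<le> (w s * UA s) * (2 powr q * V (A s) powr q)"
        by (intro mult_left_mono mult_nonneg_nonneg w_nonneg UAn)
      also have "\<dots> = 2 powr q * (w s * K (A s))" using vA by (simp add: K_def UA_def powr_mult)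
      finally show "(w s * UA s) * integral {s..A s} (\<lambda>t. w t * V t powr (q - 1)) \<le> 2 powr q * (w s * K (A s))" .
    qed
    also have "\<dots> = ennreal (2 powr q) * nnI {0<..} (\<lambda>s. w s * K (A s))" using mK by (intro nnI_cmult) auto
    also have "\<dots> \<le> ennreal (2 powr q) * (2 * N)" by (intro mult_left_mono NA) auto
    finally show ?thesis .
  qed
  have mJ: "(\<lambda>t. (w t * V t powr (q - 1)) * J t) \<in> borel_measurable (lebesgue_on {0<..})"
  proof -
    obtain P where P: "prim P (\<lambda>s. w s * UA s)" using prim_exists[OF LUA] by blast
    have "continuous_on {0<..} (\<lambda>t. P t - P (a t))"
      by (intro continuous_intros prim_continuous[OF P] continuous_on_compose2[OF prim_continuous[OF P] a_cont]) (auto simp: a_pos)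
    then have "continuous_on {0<..} J"
      by (rule continuous_on_eq) (use primD[OF P a_pos] a_less in \<open>auto simp: J_def less_imp_le\<close>)
    then show ?thesis using w_meas V_meas cont_meas by measurable
  qed
  have "Gbb_pow p v1 a b (\<lambda>x. V x * u x) \<le> nnI {0<..} (\<lambda>t. 2 powr q * ((w t * V t powr (q - 1)) * J t) + 2 powr q * (w t * K t))"
    unfolding Gbb_eq[OF LV]
  proof (rule nnI_mono)
    fix t :: real assume "t \<in> {0<..}"
    then have t: "0 < t" by simp
    have VU: "V t powr (q - 1) * (\<bar>U t\<bar> powr q * V t) = K t"
      using V_pos[OF t] by (simp add: K_def powr_mult powr_diff)
    have "w t * \<bar>integral {t..A t} (\<lambda>x. V x * u x / V x * (Om t - al x))\<bar> powr q \<le>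
       w t * (V t powr (q - 1) * (2 powr q * J t + 2 powr q * (\<bar>U t\<bar> powr q * V t)))"
      unfolding gV[OF t] by (intro mult_left_mono pw t w_nonneg)
    also have "\<dots> = 2 powr q * ((w t * V t powr (q - 1)) * J t) + 2 powr q * (w t * (V t powr (q - 1) * (\<bar>U t\<bar> powr q * V t)))"
      by (simp add: distrib_left ac_simps)
    finally show "w t * \<bar>integral {t..A t} (\<lambda>x. V x * u x / V x * (Om t - al x))\<bar> powr q \<le>
       2 powr q * ((w t * V t powr (q - 1)) * J t) + 2 powr q * (w t * K t)" unfolding VU .
  qed
  also have "\<dots> = nnI {0<..} (\<lambda>t. 2 powr q * ((w t * V t powr (q - 1)) * J t)) + nnI {0<..} (\<lambda>t. 2 powr q * (w t * K t))"
    using mK mJ Kn w_nonneg Jn by (intro nnI_add) auto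
  also have "\<dots> = ennreal (2 powr q) * nnI {0<..} (\<lambda>t. (w t * V t powr (q - 1)) * J t) + ennreal (2 powr q) * N"
    unfolding N_def using mK mJ by (simp add: nnI_cmult)
  also have "\<dots> \<le> ennreal (2 powr q) * (ennreal (2 powr q) * (2 * N)) + ennreal (2 powr q) * N" by (intro add_right_mono mult_left_mono T) auto
  also have "ennreal (2 powr q) * (ennreal (2 powr q) * (2 * N)) = ennreal (4 powr q) * (2 * N)"
    by (simp add: mult.assoc[symmetric] ennreal_mult[symmetric] powr_mult[symmetric])
  finally show "Gbb_pow p v1 a b (\<lambda>x. V x * u x) \<le> ennreal (16 powr q) * nnI {0<..} (\<lambda>x. w x * (V x * \<bar>U x\<bar>) powr q)"
    using two_term_bound unfolding N_def K_def by blast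
qed

text \<open>By \<open>E1_identity\<close> the function equals
  \<open>P t - P (a t) - U t * (Om t - al t)\<close>, where \<open>P\<close> is a primitive of
  \<open>U (A s) * w s\<close>. In the derivative the two terms with \<open>\<rho>\<close> cancel,
  and \<open>Om t - al t = V t / 2\<close> leaves the factor one half.\<close>

lemma E1_prim:
  assumes U: "prim U u"
  shows "prim (\<lambda>t. integral {t..A t} (\<lambda>x. u x * (Om t - al x))) (\<lambda>t. w t * (U (A t) - U t) - V t * u t / 2)"
proof -
  note cU = prim_continuous[OF U]
  have LA: "L1loc (\<lambda>s. U (A s) * w s)" by (rule wA_L1[OF cU])
  obtain P where P: "prim P (\<lambda>s. U (A s) * w s)" using prim_exists[OF LA] by blast
  have Pa: "prim (\<lambda>t. P (a t)) (\<lambda>t. U t * \<rho> t)"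
  proof (rule primI)
    show "L1loc (\<lambda>t. U t * \<rho> t)" by (rule L1loc_cont_mult[OF cU prim_L1[OF al_prim]])
    fix x y :: real assume xy: "0 < x" "x \<le> y"
    show "integral {x..y} (\<lambda>t. U t * \<rho> t) = P (a y) - P (a x)"
      unfolding al_substitution[OF cU xy, symmetric] by (rule primD[OF P a_pos[OF xy(1)] a_mono[OF xy]])
  qed
  show ?thesis
  proof (rule prim_cong_on[OF prim_diff[OF prim_diff[OF P Pa] prim_mult[OF U prim_diff[OF Om_prim al_prim]]]])
    fix t :: real assume t: "0 < t"
    have at: "0 < a t" "a t \<le> t" using a_pos[OF t] a_less[OF t] by auto
    have "integral {a t..t} (\<lambda>s. w s * (U (A s) - U t)) = integral {a t..t} (\<lambda>s. U (A s) * w s - U t * w s)"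
      by (simp add: algebra_simps)
    also have "\<dots> = integral {a t..t} (\<lambda>s. U (A s) * w s) - U t * integral {a t..t} w"
      using L1loc_integrable[OF LA at(1)] L1loc_integrable[OF w_L1 at(1)]
      by (subst integral_diff) (auto intro: integrable_on_mult_right)
    also have "\<dots> = P t - P (a t) - U t * (Om t - al t)" using primD[OF Om_prim at] primD[OF P at] by (simp add: al_def)
    finally show "integral {t..A t} (\<lambda>x. u x * (Om t - al x)) = P t - P (a t) - U t * (Om t - al t)"
      unfolding E1_identity[OF U t] .
    show "w t * (U (A t) - U t) - V t * u t / 2 = U (A t) * w t - U t * \<rho> t - (u t * (Om t - al t) + U t * (w t - \<rho> t))"
      using arg_cong[OF V_al[OF t], of "\<lambda>z. u t * z"] by (simp add: algebra_simps)
  qed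
qed

section \<open>The duality pairing and the Hardy inequality\<close>

lemma v1_w: "0 < v1 x \<Longrightarrow> v1 x powr p = w x powr (1 - p)"
proof -
  assume v: "0 < v1 x"
  have "- q * (1 - p) = p" using pq'(1) by (simp add: algebra_simps)
  then show ?thesis using v by (auto simp: wgt_def q_def[symmetric] powr_powr powr_minus[symmetric] inverse_powr)
qed

lemma nnI_v1_pos: 
  assumes hz: "\<And>x. w x = 0 \<Longrightarrow> h x = 0"
  shows "nnI {0<..} (\<lambda>x. \<bar>v1 x * h x\<bar> powr p) = nnI {0<..} (\<lambda>x. w x powr (1 - p) * \<bar>h x\<bar> powr p)"
proof (rule nnI_cong)
  fix x :: real assume "x \<in> {0<..}"
  then have x: "0 < x" by simp
  show "\<bar>v1 x * h x\<bar> powr p = w x powr (1 - p) * \<bar>h x\<bar> powr p"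
  proof (cases "h x = 0")
    case False
    then have "w x \<noteq> 0" using hz by blast
    then have "0 < v1 x" using v1_nonneg[OF x] by (cases "v1 x = 0") (auto simp: wgt_def)
    then show ?thesis using v1_w[of x] by (simp add: abs_mult powr_mult)
  qed simp
qed

text \<open>\<open>w\<close> vanishes exactly where \<open>v1\<close> does, as
  \<open>inverse 0 = 0\<close>; within the half line this is a null set. Setting the density to zero
  there lets identities with the quotient \<open>h / w\<close> and with
  \<open>w powr (1 - p)\<close> hold everywhere instead of almost everywhere.\<close>

lemma good_density:
  assumes "prim f h"
  obtains h' where "prim f h'" "\<And>x. w x = 0 \<Longrightarrow> h' x = 0" "AE x in lebesgue. 0 < x \<longrightarrow> h' x = h x"
proof -
  have "AE x in lebesgue. 0 < x \<longrightarrow> (if w x = 0 then 0 else h x) = h x"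
    using w_pos_AE by eventually_elim auto
  from prim_cong_AE[OF assms this] this show ?thesis
    by (intro that[of "\<lambda>x. if w x = 0 then 0 else h x"]) auto
qed

lemma w_mult_quot: 
  assumes "\<And>x. w x = 0 \<Longrightarrow> h x = 0"
  shows "w x * (h x / w x) = h x" "w x * \<bar>h x / w x\<bar> powr r = w x powr (1 - r) * \<bar>h x\<bar> powr r"
proof -
  show "w x * (h x / w x) = h x" using assms[of x] by (cases "w x = 0") auto
  show "w x * \<bar>h x / w x\<bar> powr r = w x powr (1 - r) * \<bar>h x\<bar> powr r"
    using assms[of x] w_nonneg[of x] by (cases "w x = 0") (auto simp: abs_divide powr_divide powr_diff)
qed

text \<open>With \<open>u = g / V\<close> the last term in the density of \<open>E1\<close> is
  \<open>g / 2\<close>, hence the factor 2. The boundary terms vanish because \<open>f\<close> is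
  zero at \<open>\<alpha>\<close> and \<open>\<beta>\<close>. The two remaining integrals are
  written with weight \<open>w\<close> as \<open>(h / w) * E1\<close> and
  \<open>(f / V) * (V * E2)\<close>; here \<open>E1\<close> and \<open>V * E2\<close> are what the
  two parts of the norm measure.\<close>

lemma duality_pairing:
  assumes f: "prim f h" and hz: "\<And>x. w x = 0 \<Longrightarrow> h x = 0" and g: "L1loc g"
    and ab: "0 < \<alpha>" "\<alpha> < \<beta>" and supp: "\<And>x. 0 < x \<Longrightarrow> x \<notin> {\<alpha><..<\<beta>} \<Longrightarrow> f x = 0"
    and D: "nnI {0<..} (\<lambda>x. w x powr (1 - p) * \<bar>h x\<bar> powr p) \<le> ennreal D" "0 \<le> D"
    and H: "nnI {0<..} (\<lambda>x. w x * \<bar>f x / V x\<bar> powr p) \<le> ennreal H" "0 \<le> H"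
    and G1: "Gbb_pow p v1 a b g \<le> ennreal G1" "0 \<le> G1" and G2: "Gcal_pow p v1 a b g \<le> ennreal G2" "0 \<le> G2"
  shows "\<bar>LINT x:{0<..}|lebesgue. f x * g x\<bar> \<le> 2 * (D powr (1 / p) * G1 powr (1 / q) + H powr (1 / p) * G2 powr (1 / q))"
proof -
  define u where "u x = g x / V x" for x
  have Lu: "L1loc u" unfolding u_def[abs_def] by (rule div_V_L1[OF g])
  obtain U where U: "prim U u" using prim_exists[OF Lu] by blast
  note cU = prim_continuous[OF U] and cf = prim_continuous[OF f]
  define E1 where "E1 t = integral {t..A t} (\<lambda>x. u x * (Om t - al x))" for t
  define E2 where "E2 t = U (A t) - U t" for t
  have pE: "prim E1 (\<lambda>t. w t * E2 t - V t * u t / 2)" unfolding E1_def E2_def by (rule E1_prim[OF U])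
  have cE2: "continuous_on {0<..} E2" unfolding E2_def by (intro continuous_intros comp_A_cont[OF cU] cU)
  note cE1 = prim_continuous[OF pE]
  have Vu: "V t * u t = g t" if "0 < t" for t using V_pos[OF that] by (simp add: u_def)
  have L1: "L1loc (\<lambda>t. h t * E1 t)" using L1loc_cont_mult[OF cE1 prim_L1[OF f]] by (simp add: mult.commute)
  have L2: "L1loc (\<lambda>t. f t * (w t * E2 t))"
    using L1loc_cont_mult[OF continuous_on_mult[OF cf cE2] w_L1] by (simp add: ac_simps)
  have L3: "L1loc (\<lambda>t. f t * g t)" by (rule L1loc_cont_mult[OF cf g])
  note i = L1loc_integrable[OF L1 ab(1)] L1loc_integrable[OF L2 ab(1)] L1loc_integrable[OF L3 ab(1)]
  have "f \<beta> * E1 \<beta> - f \<alpha> * E1 \<alpha> = 0" using supp[of \<alpha>] supp[of \<beta>] ab by simp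
  then have "0 = integral {\<alpha>..\<beta>} (\<lambda>t. h t * E1 t + f t * (w t * E2 t - V t * u t / 2))"
    using primD[OF prim_mult[OF f pE] ab(1), of \<beta>] ab by simp
  also have "\<dots> = integral {\<alpha>..\<beta>} (\<lambda>t. (h t * E1 t + f t * (w t * E2 t)) - (1/2) * (f t * g t))"
    by (rule integral_cong) (use Vu ab in \<open>auto simp: algebra_simps\<close>)
  also have "\<dots> = integral {\<alpha>..\<beta>} (\<lambda>t. h t * E1 t) + integral {\<alpha>..\<beta>} (\<lambda>t. f t * (w t * E2 t)) - (1/2) * integral {\<alpha>..\<beta>} (\<lambda>t. f t * g t)"
  proof -
    have "integral {\<alpha>..\<beta>} (\<lambda>t. (h t * E1 t + f t * (w t * E2 t)) - (1/2) * (f t * g t)) =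
      integral {\<alpha>..\<beta>} (\<lambda>t. h t * E1 t + f t * (w t * E2 t)) - integral {\<alpha>..\<beta>} (\<lambda>t. (1/2) * (f t * g t))"
      by (rule integral_diff) (intro integrable_add i integrable_on_mult_right)+
    moreover have "integral {\<alpha>..\<beta>} (\<lambda>t. h t * E1 t + f t * (w t * E2 t)) = integral {\<alpha>..\<beta>} (\<lambda>t. h t * E1 t) + integral {\<alpha>..\<beta>} (\<lambda>t. f t * (w t * E2 t))"
      by (rule integral_add) (intro i)+
    moreover have "integral {\<alpha>..\<beta>} (\<lambda>t. (1/2) * (f t * g t)) = (1/2) * integral {\<alpha>..\<beta>} (\<lambda>t. f t * g t)"
      by (rule integral_mult_right)
    ultimately show ?thesis by simp
  qed
  finally have id: "integral {\<alpha>..\<beta>} (\<lambda>t. f t * g t) = 2 * integral {\<alpha>..\<beta>} (\<lambda>t. h t * E1 t) + 2 * integral {\<alpha>..\<beta>} (\<lambda>t. f t * (w t * E2 t))" by simp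
  have sub: "{\<alpha>..\<beta>} \<subseteq> {0<..}" using ab by auto
  have m: "w \<in> borel_measurable (lebesgue_on {\<alpha>..\<beta>})" "V \<in> borel_measurable (lebesgue_on {\<alpha>..\<beta>})" "h \<in> borel_measurable (lebesgue_on {\<alpha>..\<beta>})"
    "f \<in> borel_measurable (lebesgue_on {\<alpha>..\<beta>})" "E1 \<in> borel_measurable (lebesgue_on {\<alpha>..\<beta>})" "E2 \<in> borel_measurable (lebesgue_on {\<alpha>..\<beta>})"
    by (intro meas_sub[OF _ sub] w_meas V_meas L1loc_measurable[OF prim_L1[OF f]] cont_meas cf cE1 cE2)+
  have wq: "w t * \<bar>h t / w t\<bar> powr r = w t powr (1 - r) * \<bar>h t\<bar> powr r" for t r
    by (rule w_mult_quot(2)) (rule hz)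
  have wq1: "w t * (h t / w t) = h t" for t by (rule w_mult_quot(1)) (rule hz)
  have b1: "\<bar>integral {\<alpha>..\<beta>} (\<lambda>t. w t * (h t / w t * E1 t))\<bar> \<le> D powr (1 / p) * G1 powr (1 / q)"
  proof (rule holder_integral(2)[OF p1 q1 pq m(1) _ m(5)])
    show "(\<lambda>t. h t / w t) \<in> borel_measurable (lebesgue_on {\<alpha>..\<beta>})" using m by measurable
    show "nnI {\<alpha>..\<beta>} (\<lambda>t. w t * \<bar>h t / w t\<bar> powr p) \<le> ennreal D"
      unfolding wq using nnI_subset[OF sub] D(1) by (rule order_trans)
    show "nnI {\<alpha>..\<beta>} (\<lambda>t. w t * \<bar>E1 t\<bar> powr q) \<le> ennreal G1"
      using order_trans[OF nnI_subset[OF sub] G1(1)[unfolded Gbb_eq[OF g]]] unfolding E1_def u_def .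
  qed (use w_nonneg D G1 in auto)
  have b2: "\<bar>integral {\<alpha>..\<beta>} (\<lambda>t. w t * (f t / V t * (V t * E2 t)))\<bar> \<le> H powr (1 / p) * G2 powr (1 / q)"
  proof (rule holder_integral(2)[OF p1 q1 pq m(1)])
    show "(\<lambda>t. f t / V t) \<in> borel_measurable (lebesgue_on {\<alpha>..\<beta>})" "(\<lambda>t. V t * E2 t) \<in> borel_measurable (lebesgue_on {\<alpha>..\<beta>})" using m by measurable
    show "nnI {\<alpha>..\<beta>} (\<lambda>t. w t * \<bar>f t / V t\<bar> powr p) \<le> ennreal H"
      using nnI_subset[OF sub] H(1) by (rule order_trans)
    have "nnI {\<alpha>..\<beta>} (\<lambda>t. w t * \<bar>V t * E2 t\<bar> powr q) = nnI {\<alpha>..\<beta>} (\<lambda>t. w t * V t powr q * \<bar>integral {t..A t} (\<lambda>x. g x / V x)\<bar> powr q)"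
    proof (rule nnI_cong)
      fix t assume "t \<in> {\<alpha>..\<beta>}"
      then have t: "0 < t" using ab by auto
      have "integral {t..A t} u = E2 t" unfolding E2_def by (rule primD[OF U t]) (use A_greater[OF t] in simp)
      then show "w t * \<bar>V t * E2 t\<bar> powr q = w t * V t powr q * \<bar>integral {t..A t} (\<lambda>x. g x / V x)\<bar> powr q"
        using V_pos[OF t] by (simp add: u_def[abs_def] abs_mult powr_mult)
    qed
    also have "\<dots> \<le> ennreal G2" using order_trans[OF nnI_subset[OF sub] G2(1)[unfolded Gcal_eq[OF g]]] .
    finally show "nnI {\<alpha>..\<beta>} (\<lambda>t. w t * \<bar>V t * E2 t\<bar> powr q) \<le> ennreal G2" .
  qed (use w_nonneg H G2 in auto)
  have e1: "integral {\<alpha>..\<beta>} (\<lambda>t. w t * (h t / w t * E1 t)) = integral {\<alpha>..\<beta>} (\<lambda>t. h t * E1 t)"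
    by (rule integral_cong) (simp only: mult.assoc[symmetric] wq1)
  have e2: "integral {\<alpha>..\<beta>} (\<lambda>t. w t * (f t / V t * (V t * E2 t))) = integral {\<alpha>..\<beta>} (\<lambda>t. f t * (w t * E2 t))"
  proof (rule integral_cong)
    fix t assume "t \<in> {\<alpha>..\<beta>}"
    then have "0 < V t" using V_pos[of t] ab by auto
    then show "w t * (f t / V t * (V t * E2 t)) = f t * (w t * E2 t)" by simp
  qed
  have "(LINT x:{0<..}|lebesgue. f x * g x) = integral {\<alpha>..\<beta>} (\<lambda>t. f t * g t)"
    by (rule LINT_pos_eq[OF ab(1) L1locD[OF L3 ab(1)]]) (use supp in auto)
  then show ?thesis using b1 b2 unfolding e1 e2 id by simp
qed

section \<open>The Hardy inequality on one interval\<close>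

lemma young_split:
  assumes "0 < W" "0 \<le> F" "0 < Y" "0 \<le> Z"
  shows "p * (F powr (p - 1) * Z * Y powr (1 - p)) \<le> 2 powr (p - 1) * (W powr (1 - p) * Z powr p) + (p - 1) / 2 * (W * F powr p * Y powr (- p))"
proof -
  \<comment> \<open>Scaling by \<open>l\<close>, where \<open>l powr q = 2\<close>, halves the
    second term of Young's inequality so that it can be absorbed; the first term pays with
    \<open>2 powr (p - 1)\<close>.\<close>
  define l where "l = (2::real) powr (1 / q)"
  define P where "P = W powr (- (1 / q)) * Z"
  define Q where "Q = W powr (1 / q) * (F / Y) powr (p - 1)"
  have FY: "(F / Y) powr s = F powr s * Y powr (- s)" for s
    using assms by (simp add: powr_divide powr_minus_divide)
  have l: "0 < l" "l powr p = 2 powr (p - 1)" "l powr q = 2" using pq'(3) q1 by (auto simp: l_def powr_powr)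
  have "(l * P) * (Q / l) \<le> (l * P) powr p / p + (Q / l) powr q / q"
    using assms l by (intro Youngs_inequality p1 q1 pq) (auto simp: P_def Q_def)
  moreover have "(l * P) powr p = 2 powr (p - 1) * (W powr (1 - p) * Z powr p)"
  proof -
    have "(W powr (- (1 / q))) powr p = W powr (1 - p)" using pq'(3) by (simp add: powr_powr)
    then show ?thesis using assms l by (simp add: P_def powr_mult)
  qed
  moreover have "(Q / l) powr q = W * F powr p * Y powr (- p) / 2"
  proof -
    have "(W powr (1 / q)) powr q = W" using q1 assms by (simp add: powr_powr)
    moreover have "((F / Y) powr (p - 1)) powr q = F powr p * Y powr (- p)"
      unfolding powr_powr pq'(1) by (rule FY)
    moreover have "(Q / l) powr q = (W powr (1 / q)) powr q * ((F / Y) powr (p - 1)) powr q / l powr q"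
      unfolding Q_def using assms l(1) by (simp only: powr_divide powr_mult powr_ge_zero zero_le_mult_iff less_imp_le simp_thms)
    ultimately show ?thesis using l(3) by simp
  qed
  moreover have "(l * P) * (Q / l) = F powr (p - 1) * Z * Y powr (1 - p)"
  proof -
    have "(W powr (- (1 / q))) * (W powr (1 / q)) = 1" using assms by (simp add: powr_add[symmetric])
    moreover have "(F / Y) powr (p - 1) = F powr (p - 1) * Y powr (1 - p)"
      using FY[of "p - 1"] by simp
    moreover have "(l * P) * (Q / l) = P * Q" using l by simp
    moreover have "P * Q = (W powr (- (1 / q)) * W powr (1 / q)) * ((F / Y) powr (p - 1) * Z)"
      unfolding P_def Q_def by (simp only: ac_simps)
    ultimately show ?thesis by simp
  qed
  ultimately have "p * (F powr (p - 1) * Z * Y powr (1 - p)) \<le>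
     p * (2 powr (p - 1) * (W powr (1 - p) * Z powr p) / p + W * F powr p * Y powr (- p) / 2 / q)"
    using p1 by (intro mult_left_mono) auto
  also have "\<dots> = 2 powr (p - 1) * (W powr (1 - p) * Z powr p) + (p / q) / 2 * (W * F powr p * Y powr (- p))"
    using p1 by (simp add: distrib_left)
  finally show ?thesis unfolding pq'(3) .
qed

text \<open>Differentiating \<open>\<bar>f\<bar> powr p * Y powr (1 - p)\<close> produces
  \<open>T\<close> with the factor \<open>p - 1\<close> and a mixed term \<open>R\<close>. Young's
  inequality bounds \<open>R\<close> by half of \<open>(p - 1) * T\<close> plus the energy, and that
  half is absorbed. The sign of the density of \<open>Y\<close> decides which boundary value
  survives: the one at \<open>e\<close>, where \<open>Y\<close> is smallest. The other one has the
  favourable sign and is dropped.\<close>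

lemma hardy_by_parts:
  assumes f: "prim f h" and hz: "\<And>x. w x = 0 \<Longrightarrow> h x = 0" and LD: "L1loc (\<lambda>x. w x powr (1 - p) * \<bar>h x\<bar> powr p)"
    and Y: "prim Y y" "\<And>x. 0 < x \<Longrightarrow> 0 < Y x" and lr: "0 < l" "l \<le> r"
    and e: "(e = l \<and> (\<forall>s\<in>{l..r}. y s = w s)) \<or> (e = r \<and> (\<forall>s\<in>{l..r}. y s = - w s))"
  shows "integral {l..r} (\<lambda>x. w x * \<bar>f x\<bar> powr p * Y x powr (- p)) \<le>
    2 / (p - 1) * (\<bar>f e\<bar> powr p * Y e powr (1 - p) + 2 powr (p - 1) * integral {l..r} (\<lambda>x. w x powr (1 - p) * \<bar>h x\<bar> powr p))"
proof -
  note cf = prim_continuous[OF f] and cY = prim_continuous[OF Y(1)]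
  have cYr: "continuous_on {0<..} (\<lambda>x. Y x powr s)" for s
    using cY Y(2) by (intro continuous_intros) (auto simp: less_imp_neq[THEN not_sym])
  have cfp: "continuous_on {0<..} (\<lambda>x. \<bar>f x\<bar> powr s)" if "0 < s" for s
    using cf that by (intro continuous_on_powr' continuous_intros) auto
  have pf: "prim (\<lambda>x. \<bar>f x\<bar> powr p) (\<lambda>x. (p * sgn (f x) * \<bar>f x\<bar> powr (p - 1)) * h x)"
    by (rule prim_chain[OF f, of UNIV "\<lambda>z. \<bar>z\<bar> powr p" "\<lambda>z. p * sgn z * \<bar>z\<bar> powr (p - 1)"])
      (auto intro: abs_powr_deriv[OF p1] abs_powr_deriv_continuous[OF p1])
  have pY: "prim (\<lambda>x. Y x powr (1 - p)) (\<lambda>x. ((1 - p) * Y x powr (- p)) * y x)"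
  proof (rule prim_chain[OF Y(1), of "{0<..}" "\<lambda>z. z powr (1 - p)" "\<lambda>z. (1 - p) * z powr (- p)"])
    show "((\<lambda>z. z powr (1 - p)) has_real_derivative (1 - p) * z powr (- p)) (at z within {0<..})" if "z \<in> {0<..}" for z :: real
      using has_real_derivative_powr[of z "1 - p"] that by (auto intro: has_field_derivative_at_within)
    show "continuous_on {0<..} (\<lambda>z::real. (1 - p) * z powr (- p))" by (intro continuous_intros) auto
  qed (use Y in auto)
  define \<Psi> where "\<Psi> x = \<bar>f x\<bar> powr p * Y x powr (1 - p)" for x
  define T where "T x = w x * \<bar>f x\<bar> powr p * Y x powr (- p)" for x
  define R where "R x = (p * sgn (f x) * \<bar>f x\<bar> powr (p - 1)) * h x * Y x powr (1 - p)" for x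
  define I where "I = integral {l..r} T"
  define D where "D = integral {l..r} (\<lambda>x. w x powr (1 - p) * \<bar>h x\<bar> powr p)"
  have LT: "L1loc T" unfolding T_def[abs_def]
    using L1loc_cont_mult[OF continuous_on_mult[OF cfp[of p] cYr[of "- p"]] w_L1] p1 by (simp add: ac_simps)
  have LR: "L1loc R" unfolding R_def[abs_def]
    using L1loc_cont_mult[OF cYr[of "1 - p"] prim_L1[OF pf]] by (simp add: ac_simps)
  note iT = L1loc_integrable[OF LT lr(1)] and iR = L1loc_integrable[OF LR lr(1)] and iD = L1loc_integrable[OF LD lr(1)]
  have I0: "\<Psi> r - \<Psi> l = integral {l..r} (\<lambda>x. R x + \<bar>f x\<bar> powr p * (((1 - p) * Y x powr (- p)) * y x))"
    using primD[OF prim_mult[OF pf pY] lr] unfolding \<Psi>_def R_def by simp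
  have Psin: "0 \<le> \<Psi> x" for x by (simp add: \<Psi>_def)
  have Rb: "\<bar>R x\<bar> \<le> 2 powr (p - 1) * (w x powr (1 - p) * \<bar>h x\<bar> powr p) + (p - 1) / 2 * T x" if "x \<in> {l..r}" for x
  proof (cases "w x = 0")
    case True then show ?thesis using hz[of x] by (simp add: R_def T_def)
  next
    case False
    then have W: "0 < w x" using w_nonneg[of x] by simp
    have Yx: "0 < Y x" using Y(2)[of x] that lr by simp
    have "\<bar>R x\<bar> \<le> p * (\<bar>f x\<bar> powr (p - 1) * \<bar>h x\<bar> * Y x powr (1 - p))"
      using p1 by (simp add: R_def abs_mult abs_sgn_eq)
    also have "\<dots> \<le> 2 powr (p - 1) * (w x powr (1 - p) * \<bar>h x\<bar> powr p) + (p - 1) / 2 * T x"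
      unfolding T_def by (rule young_split[OF W _ Yx]) auto
    finally show ?thesis .
  qed
  have "(p - 1) * I \<le> integral {l..r} (\<lambda>x. \<bar>R x\<bar>) + \<Psi> e"
  proof -
    have ab: "\<bar>integral {l..r} R\<bar> \<le> integral {l..r} (\<lambda>x. \<bar>R x\<bar>)"
      by (rule integral_abs_bound[OF LR L1loc_abs[OF LR] lr(1)]) simp
    from e show ?thesis
    proof
      assume h: "e = l \<and> (\<forall>s\<in>{l..r}. y s = w s)"
      have "\<Psi> r - \<Psi> l = integral {l..r} (\<lambda>x. R x - (p - 1) * T x)"
        unfolding I0 by (rule integral_cong) (use h in \<open>auto simp: T_def algebra_simps\<close>)
      also have "\<dots> = integral {l..r} R - (p - 1) * I"
        unfolding I_def using iR iT by (subst integral_diff) (auto intro: integrable_on_mult_right)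
      finally show ?thesis using ab Psin[of r] h by simp
    next
      assume h: "e = r \<and> (\<forall>s\<in>{l..r}. y s = - w s)"
      have "\<Psi> r - \<Psi> l = integral {l..r} (\<lambda>x. R x + (p - 1) * T x)"
        unfolding I0 by (rule integral_cong) (use h in \<open>auto simp: T_def algebra_simps\<close>)
      also have "\<dots> = integral {l..r} R + (p - 1) * I"
        unfolding I_def using iR iT by (subst integral_add) (auto intro: integrable_on_mult_right)
      finally show ?thesis using ab Psin[of l] h by simp
    qed
  qed
  moreover have "integral {l..r} (\<lambda>x. \<bar>R x\<bar>) \<le> 2 powr (p - 1) * D + (p - 1) / 2 * I"
  proof -
    have "integral {l..r} (\<lambda>x. \<bar>R x\<bar>) \<le> integral {l..r} (\<lambda>x. 2 powr (p - 1) * (w x powr (1 - p) * \<bar>h x\<bar> powr p) + (p - 1) / 2 * T x)"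
      by (rule integral_le[OF L1loc_integrable[OF L1loc_abs[OF LR] lr(1)] _ Rb]) (intro integrable_add integrable_on_mult_right iD iT)+
    also have "\<dots> = 2 powr (p - 1) * D + (p - 1) / 2 * I"
      unfolding D_def I_def using iD iT by (subst integral_add) (auto intro: integrable_on_mult_right)
    finally show ?thesis .
  qed
  ultimately have "(p - 1) * I \<le> 2 powr (p - 1) * D + (p - 1) / 2 * I + \<Psi> e" by linarith
  then have "(p - 1) / 2 * I \<le> \<Psi> e + 2 powr (p - 1) * D" by (simp add: field_simps)
  then have "2 / (p - 1) * ((p - 1) / 2 * I) \<le> 2 / (p - 1) * (\<Psi> e + 2 powr (p - 1) * D)"
    using p1 by (intro mult_left_mono) auto
  then have "I \<le> 2 / (p - 1) * (\<Psi> e + 2 powr (p - 1) * D)" using p1 by simp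
  then show ?thesis unfolding I_def D_def \<Psi>_def T_def[abs_def] .
qed

text \<open>Windows laid end to end: the window of \<open>A e\<close> starts at
  \<open>a (A e) = e\<close> and ends at \<open>b (A e)\<close>, which is the next point.\<close>

primrec tile :: "real \<Rightarrow> nat \<Rightarrow> real" where
  "tile e 0 = e"
| "tile e (Suc n) = b (A (tile e n))"

lemma tile_pos: "0 < e \<Longrightarrow> 0 < tile e n"
  by (induct n) (auto intro: b_pos A_pos)

lemma tile_step: assumes "0 < e" shows "tile e n < A (tile e n)" "A (tile e n) < tile e (Suc n)" "b (tile e n) \<le> tile e (Suc n)"
  "a (A (tile e n)) = tile e n"
proof -
  have t: "0 < tile e n" by (rule tile_pos[OF assms])
  show 1: "tile e n < A (tile e n)" by (rule A_greater[OF t])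
  show "A (tile e n) < tile e (Suc n)" using b_greater[OF A_pos[OF t]] by simp
  show "b (tile e n) \<le> tile e (Suc n)" using b_mono[OF t less_imp_le[OF 1]] by simp
  show "a (A (tile e n)) = tile e n" by (rule a_A[OF t])
qed

lemma tile_less: "0 < e \<Longrightarrow> tile e n < tile e (Suc n)"
  using tile_step(1,2)[of e n] by linarith

lemma tile_mono: assumes "0 < e" "n \<le> m" shows "tile e n \<le> tile e m"
  by (rule lift_Suc_mono_le[of "tile e"]) (use tile_less[OF assms(1)] assms(2) in \<open>auto simp del: tile.simps intro: less_imp_le\<close>)

text \<open>A finite limit \<open>L\<close> would satisfy \<open>b L \<le> L\<close>, since
  \<open>b\<close> of each tile point does not exceed the next one.\<close>

lemma tile_unbounded: assumes e: "0 < e" shows "\<exists>n. \<beta> \<le> tile e n"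
proof (rule ccontr)
  assume "\<not> (\<exists>n. \<beta> \<le> tile e n)"
  then have ub: "tile e n \<le> \<beta>" for n by (meson linear)
  have inc: "incseq (tile e)" using tile_mono[OF e] by (simp add: incseq_def)
  obtain L where L: "tile e \<longlonglongrightarrow> L" "\<And>n. tile e n \<le> L"
    using incseq_convergent[OF inc, of \<beta>] ub by blast
  have L0: "0 < L" using L(2)[of 0] e by simp
  have "isCont b L" using b_cont L0 by (simp add: continuous_on_eq_continuous_at)
  then have "(\<lambda>n. b (tile e n)) \<longlonglongrightarrow> b L" using L(1) by (rule isCont_tendsto_compose)
  moreover have "b (tile e n) \<le> L" for n using tile_step(3)[OF e, of n] L(2)[of "Suc n"] by linarith
  ultimately have "b L \<le> L" by (intro LIMSEQ_le_const2) auto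
  then show False using b_greater[OF L0] by simp
qed

text \<open>Windows centred at the tile points themselves extend over the two adjacent tiles only,
  so that sums over them count everything at most twice.\<close>

lemma tile_overlap: assumes e: "0 < e" shows "tile e n \<le> a (tile e (Suc n))" "b (tile e (Suc n)) \<le> tile e (Suc (Suc n))"
proof -
  have t: "0 < A (tile e n)" by (rule A_pos[OF tile_pos[OF e]])
  have "a (A (tile e n)) \<le> a (tile e (Suc n))" by (rule a_mono[OF t]) (use tile_step(2)[OF e, of n] in simp)
  then show "tile e n \<le> a (tile e (Suc n))" using tile_step(4)[OF e, of n] by simp
  show "b (tile e (Suc n)) \<le> tile e (Suc (Suc n))" by (rule tile_step(3)[OF e])
qed

text \<open>Three densities are to be compared: \<open>Gdens\<close> is the energy
  \<open>\<bar>v1 * h\<bar> powr p\<close> expressed through \<open>w\<close>, \<open>Hdens\<close>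
  is the Hardy term, and \<open>Vdens\<close> is the \<open>v0\<close> part of the Sobolev
  norm.\<close>

definition Gdens :: "(real \<Rightarrow> real) \<Rightarrow> real \<Rightarrow> real" where "Gdens h x = w x powr (1 - p) * \<bar>h x\<bar> powr p"
definition Hdens :: "(real \<Rightarrow> real) \<Rightarrow> real \<Rightarrow> real" where "Hdens f x = w x * \<bar>f x / V x\<bar> powr p"
definition Vdens :: "(real \<Rightarrow> real) \<Rightarrow> real \<Rightarrow> real" where "Vdens f x = v0 x powr p * \<bar>f x\<bar> powr p"

definition K0 :: real where "K0 = 2 / (p - 1) * 4 powr (p - 1)"

lemma K0_pos: "0 < K0" using p1 by (simp add: K0_def)

section \<open>Estimates on single windows and their summation over the tiles\<close>

context
  fixes f h :: "real \<Rightarrow> real"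
  assumes f: "prim f h" and hz: "\<And>x. w x = 0 \<Longrightarrow> h x = 0" and LD: "L1loc (\<lambda>x. w x powr (1 - p) * \<bar>h x\<bar> powr p)"
begin

abbreviation Gd :: "real \<Rightarrow> real" where "Gd \<equiv> Gdens h"
abbreviation Hd :: "real \<Rightarrow> real" where "Hd \<equiv> Hdens f"
abbreviation Vd :: "real \<Rightarrow> real" where "Vd \<equiv> Vdens f"

lemma f_continuous: "continuous_on {0<..} f" by (rule prim_continuous[OF f])

lemma f_powr_continuous: "continuous_on {0<..} (\<lambda>x. \<bar>f x\<bar> powr p)"
  using f_continuous p1 by (intro continuous_on_powr' continuous_intros) auto

lemma Gdens_L1: "L1loc Gd" using LD unfolding Gdens_def[abs_def] .
lemma Vdens_L1: "L1loc Vd" unfolding Vdens_def[abs_def] using L1loc_cont_mult[OF f_powr_continuous v0p_L1] by (simp add: mult.commute)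

lemma Hd_eq: "0 < x \<Longrightarrow> Hd x = w x * \<bar>f x\<bar> powr p * V x powr (- p)"
  using V_pos[of x] by (simp add: Hdens_def abs_divide powr_divide powr_minus_divide)

lemma Hdens_L1: "L1loc Hd"
proof -
  have L: "L1loc (\<lambda>x. w x * \<bar>f x\<bar> powr p * V x powr (- p))"
    using L1loc_cont_mult[OF continuous_on_mult[OF f_powr_continuous powr_V_cont[of "- p"]] w_L1] by (simp add: ac_simps)
  obtain F where "prim F (\<lambda>x. w x * \<bar>f x\<bar> powr p * V x powr (- p))" using prim_exists[OF L] by blast
  then have "prim F Hd" by (rule prim_cong_on) (auto simp: Hd_eq)
  then show ?thesis by (rule prim_L1)
qed

lemma dens_nonneg: "0 \<le> Gd x" "0 \<le> Hd x" "0 \<le> Vd x" by (auto simp: Gdens_def Hdens_def Vdens_def w_nonneg)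

lemma integral_subset_mono:
  assumes "L1loc k" "\<And>x. 0 \<le> k x" "0 < x'" "x' \<le> x" "x \<le> y" "y \<le> y'" shows "integral {x..y} k \<le> integral {x'..y'} k"
  by (rule integral_subset_le) (use assms L1loc_integrable[OF assms(1)] in auto)

lemma integral_nonneg_pos: "L1loc k \<Longrightarrow> (\<And>x. 0 \<le> k x) \<Longrightarrow> 0 < x \<Longrightarrow> 0 \<le> integral {x..y} k"
  by (intro Henstock_Kurzweil_Integration.integral_nonneg L1loc_integrable) auto

lemma integral_le_nnI:
  assumes "L1loc k" "\<And>x. 0 \<le> k x" "nnI {0<..} k \<le> ennreal C" "0 \<le> C" "0 < x"
  shows "integral {x..y} k \<le> C"
proof -
  have "{x..y} \<subseteq> {0<..}" using assms(5) by auto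
  then have "nnI {x..y} k \<le> ennreal C" using assms(3) nnI_subset order_trans by blast
  then show ?thesis using nnI_integral[OF L1locD[OF assms(1,5)], of y] assms(2,4) by (simp add: ennreal_le_iff)
qed

lemma increment_bound:
  assumes xy: "0 < x" "x \<le> y"
  shows "\<bar>f y - f x\<bar> powr p \<le> (Om y - Om x) powr (p - 1) * integral {x..y} Gd"
proof -
  have Lh: "L1loc h" by (rule prim_L1[OF f])
  have sub: "{x..y} \<subseteq> {0<..}" using xy by auto
  define \<Theta> where "\<Theta> t = \<bar>h t / w t\<bar>" for t
  have mh: "h \<in> borel_measurable (lebesgue_on {x..y})" "w \<in> borel_measurable (lebesgue_on {x..y})"
    by (intro meas_sub[OF _ sub] w_meas L1loc_measurable[OF Lh])+
  have m: "\<Theta> \<in> borel_measurable (lebesgue_on {x..y})" unfolding \<Theta>_def using mh by measurable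
  have wq: "w t * \<Theta> t powr r = w t powr (1 - r) * \<bar>h t\<bar> powr r" for t r unfolding \<Theta>_def
    by (rule w_mult_quot(2)) (rule hz)
  have wq1: "w t * \<Theta> t = \<bar>h t\<bar>" for t
    using hz[of t] w_nonneg[of t] by (cases "w t = 0") (auto simp: \<Theta>_def)
  have Gi: "(\<lambda>t. w t * \<Theta> t powr p) absolutely_integrable_on {x..y}"
    unfolding wq using L1locD[OF LD xy(1)] .
  have pm: "(integral {x..y} (\<lambda>t. w t * \<Theta> t)) powr p \<le> (integral {x..y} w) powr (p - 1) * integral {x..y} (\<lambda>t. w t * \<Theta> t powr p)"
    by (rule power_mean_integral(2)[OF p1 L1locD[OF w_L1 xy(1)] Gi m w_nonneg]) (simp add: \<Theta>_def)
  have "\<bar>f y - f x\<bar> \<le> integral {x..y} (\<lambda>t. \<bar>h t\<bar>)"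
    using integral_abs_bound[OF Lh L1loc_abs[OF Lh] xy(1), of y] primD[OF f xy] by simp
  then have "\<bar>f y - f x\<bar> powr p \<le> (integral {x..y} (\<lambda>t. \<bar>h t\<bar>)) powr p" using p1 by (intro powr_mono2) auto
  also have "\<dots> \<le> (Om y - Om x) powr (p - 1) * integral {x..y} Gd"
    using pm unfolding wq wq1 primD[OF Om_prim xy] Gdens_def[abs_def] .
  finally show ?thesis .
qed

text \<open>Within a window the coordinate \<open>Om\<close> varies by at most \<open>V t\<close>,
  so Hoelder's inequality bounds the difference of two values of \<open>f\<close>, in
  \<open>p\<close>-th power, by \<open>V t powr (p - 1)\<close> times the energy of the
  window.\<close>

lemma window_bound:
  assumes t: "0 < t" and y: "a t \<le> y" "y \<le> b t" and s: "a t \<le> s" "s \<le> b t"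
  shows "\<bar>f y\<bar> powr p \<le> 2 powr p * (\<bar>f s\<bar> powr p + V t powr (p - 1) * integral {a t..b t} Gd)"
proof -
  have at: "0 < a t" by (rule a_pos[OF t])
  have main: "\<bar>f v - f u\<bar> powr p \<le> V t powr (p - 1) * integral {a t..b t} Gd" if uv: "a t \<le> u" "u \<le> v" "v \<le> b t" for u v
  proof -
    have u: "0 < u" using at uv by simp
    have "\<bar>f v - f u\<bar> powr p \<le> (Om v - Om u) powr (p - 1) * integral {u..v} Gd" by (rule increment_bound[OF u uv(2)])
    also have "\<dots> \<le> V t powr (p - 1) * integral {a t..b t} Gd"
    proof (rule mult_mono)
      have "al t \<le> Om u" unfolding al_def by (rule Om_mono[OF at uv(1)])
      moreover have "Om v \<le> be t" unfolding be_def using u uv by (intro Om_mono) auto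
      ultimately have "Om v - Om u \<le> V t" using al_be(2)[OF t] by simp
      then show "(Om v - Om u) powr (p - 1) \<le> V t powr (p - 1)" using p1 Om_mono[OF u uv(2)] by (intro powr_mono2) auto
      show "integral {u..v} Gd \<le> integral {a t..b t} Gd" by (rule integral_subset_mono[OF Gdens_L1 dens_nonneg(1) at uv])
      show "0 \<le> integral {u..v} Gd" by (rule integral_nonneg_pos[OF Gdens_L1 dens_nonneg(1) u])
    qed simp
    finally show ?thesis .
  qed
  have d: "\<bar>f y - f s\<bar> powr p \<le> V t powr (p - 1) * integral {a t..b t} Gd"
  proof (cases "s \<le> y")
    case True then show ?thesis using main[OF s(1) True y(2)] by simp
  next
    case False then show ?thesis using main[OF y(1) _ s(2)] by (simp add: abs_minus_commute)
  qed
  have "\<bar>f y\<bar> powr p \<le> (\<bar>f s\<bar> + \<bar>f y - f s\<bar>) powr p" using p1 by (intro powr_mono2) auto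
  also have "\<dots> \<le> 2 powr p * (\<bar>f s\<bar> powr p + \<bar>f y - f s\<bar> powr p)" using p1 by (intro powr_add_le) auto
  also have "\<dots> \<le> 2 powr p * (\<bar>f s\<bar> powr p + V t powr (p - 1) * integral {a t..b t} Gd)"
    using d by (intro mult_left_mono add_left_mono) auto
  finally show ?thesis .
qed

lemma V_mass: "0 < t \<Longrightarrow> V t powr (1 - p) * (V t powr (p - 1) * X) = X"
  using V_pos[of t] by (simp add: mult.assoc[symmetric] powr_add[symmetric])

text \<open>The comparison of \<open>f e\<close> with \<open>f y\<close> is averaged over
  \<open>y\<close> in the window with respect to \<open>v0 powr p\<close>. The mass of that measure
  is \<open>V e powr (1 - p)\<close>, the inverse of the factor in front of the energy.\<close>

lemma point_bound:
  assumes e: "0 < e"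
  shows "\<bar>f e\<bar> powr p * V e powr (1 - p) \<le> 2 powr p * (integral {a e..b e} Vd + integral {a e..b e} Gd)"
proof -
  let ?I = "{a e..b e}"
  have ae: "0 < a e" by (rule a_pos[OF e])
  have ee: "a e \<le> e" "e \<le> b e" using a_less[OF e] b_greater[OF e] by auto
  define X where "X = V e powr (p - 1) * integral ?I Gd"
  have i0: "(\<lambda>y. v0 y powr p) integrable_on ?I" by (rule L1loc_integrable[OF v0p_L1 ae])
  have iV: "Vd integrable_on ?I" by (rule L1loc_integrable[OF Vdens_L1 ae])
  have "integral ?I (\<lambda>y. \<bar>f e\<bar> powr p * v0 y powr p) \<le> integral ?I (\<lambda>y. 2 powr p * Vd y + (2 powr p * X) * v0 y powr p)"
  proof (rule integral_le)
    show "(\<lambda>y. \<bar>f e\<bar> powr p * v0 y powr p) integrable_on ?I" by (rule integrable_on_mult_right[OF i0])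
    show "(\<lambda>y. 2 powr p * Vd y + (2 powr p * X) * v0 y powr p) integrable_on ?I"
      by (intro integrable_add integrable_on_mult_right i0 iV)
    fix y assume "y \<in> ?I"
    then have "\<bar>f e\<bar> powr p * v0 y powr p \<le> (2 powr p * (\<bar>f y\<bar> powr p + X)) * v0 y powr p"
      unfolding X_def by (intro mult_right_mono window_bound[OF e ee]) auto
    then show "\<bar>f e\<bar> powr p * v0 y powr p \<le> 2 powr p * Vd y + (2 powr p * X) * v0 y powr p"
      by (simp add: Vdens_def algebra_simps)
  qed
  also have "\<dots> = 2 powr p * integral ?I Vd + (2 powr p * X) * V e powr (1 - p)"
    unfolding v0_mass[OF e, symmetric] using i0 iV by (subst integral_add) (auto intro: integrable_on_mult_right)
  also have "(2 powr p * X) * V e powr (1 - p) = 2 powr p * (V e powr (1 - p) * (V e powr (p - 1) * integral ?I Gd))"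
    unfolding X_def by (simp only: ac_simps)
  also have "\<dots> = 2 powr p * integral ?I Gd" by (simp only: V_mass[OF e])
  also have "integral ?I (\<lambda>y. \<bar>f e\<bar> powr p * v0 y powr p) = \<bar>f e\<bar> powr p * V e powr (1 - p)"
    unfolding v0_mass[OF e, symmetric] by simp
  finally show ?thesis by (simp add: distrib_left)
qed

text \<open>The transfer in the opposite direction: the comparison of values is averaged with
  respect to \<open>w\<close> over the right half of the window, where \<open>w\<close> has mass
  \<open>V t / 2\<close> and \<open>V s \<le> 2 * V t\<close>.\<close>

lemma tile_v0_bound:
  assumes t: "0 < t"
  shows "integral {a t..b t} Vd \<le> 2 powr p * (2 * 2 powr p * integral {t..b t} Hd + integral {a t..b t} Gd)"
proof -
  let ?I = "{a t..b t}"
  have at: "0 < a t" by (rule a_pos[OF t])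
  have tt: "a t \<le> t" "t \<le> b t" using a_less[OF t] b_greater[OF t] by auto
  have Vt: "0 < V t" by (rule V_pos[OF t])
  define D where "D = integral ?I Gd"
  define B where "B = integral ?I Vd"
  have i0: "(\<lambda>y. v0 y powr p) integrable_on ?I" by (rule L1loc_integrable[OF v0p_L1 at])
  have iV: "Vd integrable_on ?I" by (rule L1loc_integrable[OF Vdens_L1 at])
  have pt: "B \<le> 2 powr p * (\<bar>f s\<bar> powr p * V t powr (1 - p) + D)" if s: "a t \<le> s" "s \<le> b t" for s
  proof -
    have "B \<le> integral ?I (\<lambda>y. (2 powr p * (\<bar>f s\<bar> powr p + V t powr (p - 1) * D)) * v0 y powr p)"
      unfolding B_def
    proof (rule integral_le[OF iV integrable_on_mult_right[OF i0]])
      fix y assume "y \<in> ?I"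
      then have "v0 y powr p * \<bar>f y\<bar> powr p \<le> v0 y powr p * (2 powr p * (\<bar>f s\<bar> powr p + V t powr (p - 1) * D))"
        unfolding D_def by (intro mult_left_mono window_bound[OF t _ _ s]) auto
      then show "Vd y \<le> (2 powr p * (\<bar>f s\<bar> powr p + V t powr (p - 1) * D)) * v0 y powr p"
        unfolding Vdens_def by (simp only: ac_simps)
    qed
    also have "\<dots> = (2 powr p * (\<bar>f s\<bar> powr p + V t powr (p - 1) * D)) * V t powr (1 - p)"
      unfolding v0_mass[OF t, symmetric] by (rule integral_mult_right)
    also have "\<dots> = 2 powr p * (\<bar>f s\<bar> powr p * V t powr (1 - p) + V t powr (1 - p) * (V t powr (p - 1) * D))"
      by (simp add: algebra_simps)
    also have "\<dots> = 2 powr p * (\<bar>f s\<bar> powr p * V t powr (1 - p) + D)" by (simp only: V_mass[OF t])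
    finally show ?thesis .
  qed
  have iw: "w integrable_on {t..b t}" by (rule L1loc_integrable[OF w_L1 t])
  have iH: "Hd integrable_on {t..b t}" by (rule L1loc_integrable[OF Hdens_L1 t])
  have wI: "integral {t..b t} w = V t / 2" using primD[OF Om_prim t tt(2)] V_be[OF t] by (simp add: be_def)
  have "integral {t..b t} (\<lambda>s. B * w s) \<le> integral {t..b t} (\<lambda>s. (2 powr p * 2 powr p * V t) * Hd s + (2 powr p * D) * w s)"
  proof (rule integral_le)
    show "(\<lambda>s. B * w s) integrable_on {t..b t}" by (rule integrable_on_mult_right[OF iw])
    show "(\<lambda>s. (2 powr p * 2 powr p * V t) * Hd s + (2 powr p * D) * w s) integrable_on {t..b t}"
      by (intro integrable_add integrable_on_mult_right iw iH)
    fix s assume s: "s \<in> {t..b t}"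
    have s0: "0 < s" using s t by auto
    have Vs: "0 < V s" "V s \<le> 2 * V t" using V_pos[OF s0] V_upper[OF t, of s] s by auto
    have "V t powr (- p) \<le> 2 powr p * V s powr (- p)"
    proof -
      have "(2 * V t) powr (- p) \<le> V s powr (- p)" using Vs p1 by (intro powr_mono2') auto
      then have "2 powr p * (2 * V t) powr (- p) \<le> 2 powr p * V s powr (- p)" by (intro mult_left_mono) auto
      moreover have "2 powr p * (2 * V t) powr (- p) = V t powr (- p)"
        using Vt by (simp add: powr_mult mult.assoc[symmetric] powr_add[symmetric])
      ultimately show ?thesis by simp
    qed
    then have "(\<bar>f s\<bar> powr p * w s * V t) * V t powr (- p) \<le> (\<bar>f s\<bar> powr p * w s * V t) * (2 powr p * V s powr (- p))"
      using Vt w_nonneg by (intro mult_left_mono mult_nonneg_nonneg) auto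
    moreover have "V t powr (1 - p) = V t * V t powr (- p)" using Vt powr_add[of "V t" 1 "- p"] by simp
    ultimately have "w s * (\<bar>f s\<bar> powr p * V t powr (1 - p)) \<le> 2 powr p * V t * Hd s"
      unfolding Hd_eq[OF s0] by (simp add: ac_simps)
    then have x: "2 powr p * (w s * (\<bar>f s\<bar> powr p * V t powr (1 - p))) \<le> 2 powr p * (2 powr p * V t * Hd s)"
      by (rule mult_left_mono) simp
    have "B * w s \<le> (2 powr p * (\<bar>f s\<bar> powr p * V t powr (1 - p) + D)) * w s"
      by (intro mult_right_mono pt w_nonneg) (use s tt in auto)
    also have "\<dots> = 2 powr p * (w s * (\<bar>f s\<bar> powr p * V t powr (1 - p))) + (2 powr p * D) * w s"
      by (simp add: algebra_simps)
    also have "\<dots> \<le> 2 powr p * (2 powr p * V t * Hd s) + (2 powr p * D) * w s" using x by simp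
    finally show "B * w s \<le> (2 powr p * 2 powr p * V t) * Hd s + (2 powr p * D) * w s" by (simp only: ac_simps)
  qed
  also have "\<dots> = (2 powr p * 2 powr p * V t) * integral {t..b t} Hd + (2 powr p * D) * (V t / 2)"
    unfolding wI[symmetric] using iw iH by (subst integral_add) (auto intro: integrable_on_mult_right)
  also have "integral {t..b t} (\<lambda>s. B * w s) = B * (V t / 2)" unfolding wI[symmetric] by (rule integral_mult_right)
  finally have "(V t / 2) * B \<le> (V t / 2) * (2 powr p * (2 * 2 powr p * integral {t..b t} Hd + D))"
    by (simp add: algebra_simps)
  then have "B \<le> 2 powr p * (2 * 2 powr p * integral {t..b t} Hd + D)" using Vt by (simp only: mult_le_cancel_left_pos half_gt_zero)
  then show ?thesis unfolding B_def D_def .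
qed

text \<open>\<open>Y\<close> takes the place of \<open>V\<close>, whose density has no fixed sign.
  It lies below \<open>V\<close>, so replacing \<open>V\<close> only increases the Hardy term; its
  value \<open>V e / 4\<close> at the endpoint accounts for \<open>4 powr (p - 1)\<close> in
  \<open>K0\<close>.\<close>

lemma hardy_half:
  assumes Y: "prim Y y" "\<And>x. 0 < x \<Longrightarrow> 0 < Y x" and lr: "0 < l" "l \<le> r"
    and e: "(e = l \<and> (\<forall>s\<in>{l..r}. y s = w s)) \<or> (e = r \<and> (\<forall>s\<in>{l..r}. y s = - w s))"
    and YV: "\<And>s. s \<in> {l..r} \<Longrightarrow> Y s \<le> V s" "Y e = V e / 4"
  shows "integral {l..r} Hd \<le> K0 * (\<bar>f e\<bar> powr p * V e powr (1 - p) + integral {l..r} Gd)"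
proof -
  have e0: "0 < e" using e lr by auto
  have cYr: "continuous_on {0<..} (\<lambda>x. Y x powr s)" for s
    using prim_continuous[OF Y(1)] Y(2) by (intro continuous_intros) (auto simp: less_imp_neq[THEN not_sym])
  have LY: "L1loc (\<lambda>x. w x * \<bar>f x\<bar> powr p * Y x powr (- p))"
    using L1loc_cont_mult[OF continuous_on_mult[OF f_powr_continuous cYr[of "- p"]] w_L1] by (simp add: ac_simps)
  have "integral {l..r} Hd \<le> integral {l..r} (\<lambda>x. w x * \<bar>f x\<bar> powr p * Y x powr (- p))"
  proof (rule integral_le[OF L1loc_integrable[OF Hdens_L1 lr(1)] L1loc_integrable[OF LY lr(1)]])
    fix x assume x: "x \<in> {l..r}"
    then have x0: "0 < x" using lr by auto
    have "V x powr (- p) \<le> Y x powr (- p)" using YV(1)[OF x] Y(2)[OF x0] p1 by (intro powr_mono2') auto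
    then show "Hd x \<le> w x * \<bar>f x\<bar> powr p * Y x powr (- p)" unfolding Hd_eq[OF x0]
      by (intro mult_left_mono mult_nonneg_nonneg w_nonneg) auto
  qed
  also have "\<dots> \<le> 2 / (p - 1) * (\<bar>f e\<bar> powr p * Y e powr (1 - p) + 2 powr (p - 1) * integral {l..r} Gd)"
    unfolding Gdens_def[abs_def] by (rule hardy_by_parts[OF f hz LD Y lr e])
  also have "\<dots> \<le> 2 / (p - 1) * (4 powr (p - 1) * (\<bar>f e\<bar> powr p * V e powr (1 - p)) + 4 powr (p - 1) * integral {l..r} Gd)"
  proof (intro mult_left_mono add_mono mult_right_mono)
    have "(V e / 4) powr (1 - p) = 4 powr (p - 1) * V e powr (1 - p)"
      using V_pos[OF e0] powr_minus_divide[of 4 "p - 1"] by (simp add: powr_divide)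
    then show "\<bar>f e\<bar> powr p * Y e powr (1 - p) \<le> 4 powr (p - 1) * (\<bar>f e\<bar> powr p * V e powr (1 - p))" unfolding YV(2) by simp
    show "(2::real) powr (p - 1) \<le> 4 powr (p - 1)" using p1 by (intro powr_mono2) auto
    show "0 \<le> integral {l..r} Gd" by (rule integral_nonneg_pos[OF Gdens_L1 dens_nonneg(1) lr(1)])
  qed (use p1 in auto)
  also have "\<dots> = K0 * (\<bar>f e\<bar> powr p * V e powr (1 - p) + integral {l..r} Gd)" by (simp add: K0_def distrib_left)
  finally show ?thesis .
qed

text \<open>The comparison function is \<open>Om\<close> shifted to the value \<open>V e / 4\<close>
  at \<open>e\<close>, as in \<open>row_bound\<close>, and stopped to the left of
  \<open>e\<close>.\<close>

lemma hardy_right: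
  assumes e: "0 < e"
  shows "integral {e..A e} Hd \<le> K0 * (\<bar>f e\<bar> powr p * V e powr (1 - p) + integral {e..A e} Gd)"
proof (rule hardy_half)
  show "prim (\<lambda>s. Om (max e s) + (V e / 4 - Om e)) (\<lambda>s. if s \<in> {e..} then w s else 0)"
    by (rule prim_shift[OF prim_max_min(1)[OF Om_prim e]])
  show "0 < Om (max e x) + (V e / 4 - Om e)" for x using Om_mono[OF e, of "max e x"] V_pos[OF e] by simp
  show "e \<le> A e" using A_greater[OF e] by simp
  show "Om (max e s) + (V e / 4 - Om e) \<le> V s" if "s \<in> {e..A e}" for s
    using V_le_right[OF e, of s] that by (simp add: max_def)
qed (use e in auto)

text \<open>Mirror image of the estimate from the left: the comparison function decreases towards
  the right endpoint of the window and is constant beyond it.\<close>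

lemma hardy_left:
  assumes t: "0 < t"
  shows "integral {t..b t} Hd \<le> K0 * (\<bar>f (b t)\<bar> powr p * V (b t) powr (1 - p) + integral {t..b t} Gd)"
proof (rule hardy_half)
  let ?e = "b t"
  have e: "0 < ?e" by (rule b_pos[OF t])
  show "prim (\<lambda>s. - Om (min ?e s) + (V ?e / 4 + Om ?e)) (\<lambda>s. - (if s \<in> {..?e} then w s else 0))"
    by (rule prim_shift[OF prim_minus[OF prim_max_min(2)[OF Om_prim e]]])
  show "0 < - Om (min ?e x) + (V ?e / 4 + Om ?e)" if "0 < x" for x using Om_mono[of "min ?e x" ?e] e that V_pos[OF e] by simp
  show "t \<le> ?e" using b_greater[OF t] by simp
  show "- Om (min ?e s) + (V ?e / 4 + Om ?e) \<le> V s" if s: "s \<in> {t..?e}" for s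
  proof -
    have "0 < s" "s \<le> ?e" "?e \<le> b s" using s t b_mono[OF t, of s] by auto
    from V_le_left[OF this] show ?thesis using \<open>s \<le> ?e\<close> V_pos[OF \<open>0 < s\<close>] by (auto simp: min_def)
  qed
qed (use t b_greater in auto)

text \<open>Each tile is split at its centre \<open>A (e n)\<close>; the left half is estimated from
  the value of \<open>f\<close> at \<open>e n\<close>, the right half from the value at the next
  tile point. The value at the first point is zero by the support condition, and
  \<open>point_bound\<close> takes care of the others.\<close>

lemma hardy_total:
  assumes ab: "0 < \<alpha>" "\<alpha> < \<beta>" and supp: "\<And>x. 0 < x \<Longrightarrow> x \<notin> {\<alpha><..<\<beta>} \<Longrightarrow> f x = 0"
    and T: "nnI {0<..} Vd \<le> ennreal T0" "nnI {0<..} Gd \<le> ennreal D" "0 \<le> T0" "0 \<le> D"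
  shows "nnI {0<..} Hd \<le> ennreal (K0 * (2 powr (p + 2) + 1) * (T0 + D))"
proof -
  obtain PV PG where PV: "prim PV Vd" and PG: "prim PG Gd" using prim_exists[OF Vdens_L1] prim_exists[OF Gdens_L1] by blast
  define \<Phi> where "\<Phi> x = PV x + PG x" for x
  have Phi: "\<Phi> y - \<Phi> x = integral {x..y} Vd + integral {x..y} Gd" if "0 < x" "x \<le> y" for x y
    using primD[OF PV that] primD[OF PG that] by (simp add: \<Phi>_def)
  have Phi_mono: "\<Phi> x \<le> \<Phi> y" if "0 < x" "x \<le> y" for x y
    using Phi[OF that] integral_nonneg_pos[OF Vdens_L1 dens_nonneg(3) that(1), of y] integral_nonneg_pos[OF Gdens_L1 dens_nonneg(1) that(1), of y] by linarith
  have Phi_T: "\<Phi> y - \<Phi> x \<le> T0 + D" if xy: "0 < x" "x \<le> y" for x y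
  proof -
    have "integral {x..y} Vd \<le> T0" "integral {x..y} Gd \<le> D"
      by (rule integral_le_nnI[OF Vdens_L1 dens_nonneg(3) T(1,3) xy(1)], rule integral_le_nnI[OF Gdens_L1 dens_nonneg(1) T(2,4) xy(1)])
    then show ?thesis using Phi[OF xy] by linarith
  qed
  define e where "e = tile \<alpha>"
  have e0: "e 0 = \<alpha>" by (simp add: e_def)
  have ep: "0 < e n" for n unfolding e_def by (rule tile_pos[OF ab(1)])
  have es: "e n \<le> e (Suc n)" for n unfolding e_def using tile_less[OF ab(1), of n] by simp
  define P where "P n = \<bar>f (e n)\<bar> powr p * V (e n) powr (1 - p)" for n
  have P0: "P 0 = 0" using supp[of \<alpha>] ab by (simp add: P_def e0)
  \<comment> \<open>Windows centred at tile points reach over two tiles. \<open>G\<close> adds two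
    consecutive values of \<open>\<Phi>\<close>, so that the estimates telescope in spite of the
    overlap.\<close>
  define G where "G n = \<Phi> (e n) + \<Phi> (e (Suc n))" for n
  have PS: "P (Suc n) \<le> 2 powr p * (G (Suc n) - G n)" for n
  proof -
    have o: "e n \<le> a (e (Suc n))" "b (e (Suc n)) \<le> e (Suc (Suc n))" unfolding e_def by (rule tile_overlap[OF ab(1)])+
    have ae: "0 < a (e (Suc n))" "a (e (Suc n)) \<le> b (e (Suc n))"
      using a_pos[OF ep] a_less[OF ep[of "Suc n"]] b_greater[OF ep[of "Suc n"]] by auto
    have "P (Suc n) \<le> 2 powr p * (\<Phi> (b (e (Suc n))) - \<Phi> (a (e (Suc n))))"
      unfolding P_def Phi[OF ae] by (rule point_bound[OF ep])
    also have "\<dots> \<le> 2 powr p * (\<Phi> (e (Suc (Suc n))) - \<Phi> (e n))"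
    proof (intro mult_left_mono)
      show "\<Phi> (b (e (Suc n))) - \<Phi> (a (e (Suc n))) \<le> \<Phi> (e (Suc (Suc n))) - \<Phi> (e n)"
        using Phi_mono[OF ep o(1)] Phi_mono[OF _ o(2)] ae by simp
    qed simp
    also have "\<Phi> (e (Suc (Suc n))) - \<Phi> (e n) = G (Suc n) - G n" by (simp add: G_def)
    finally show ?thesis .
  qed
  have step: "integral {e n..e (Suc n)} Hd \<le> K0 * (P n + P (Suc n) + (\<Phi> (e (Suc n)) - \<Phi> (e n)))" for n
  proof -
    let ?t = "A (e n)"
    have t: "0 < ?t" "e n \<le> ?t" "?t \<le> e (Suc n)" "b ?t = e (Suc n)"
      using A_pos[OF ep] tile_step(1,2)[OF ab(1), of n] by (auto simp: e_def)
    have "integral {e n..e (Suc n)} Hd = integral {e n..?t} Hd + integral {?t..e (Suc n)} Hd"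
      by (rule integral_combine_pos[OF Hdens_L1 ep t(2,3)])
    also have "\<dots> \<le> K0 * (P n + integral {e n..?t} Gd) + K0 * (P (Suc n) + integral {?t..e (Suc n)} Gd)"
      using hardy_right[OF ep, of n] hardy_left[OF t(1)] unfolding P_def t(4) by (rule add_mono)
    also have "\<dots> = K0 * (P n + P (Suc n) + integral {e n..e (Suc n)} Gd)"
      unfolding integral_combine_pos[OF Gdens_L1 ep t(2,3)] by (simp add: algebra_simps)
    also have "\<dots> \<le> K0 * (P n + P (Suc n) + (\<Phi> (e (Suc n)) - \<Phi> (e n)))"
      unfolding Phi[OF ep es] using K0_pos integral_nonneg_pos[OF Vdens_L1 dens_nonneg(3) ep, of n "e (Suc n)"] by (intro mult_left_mono) auto
    finally show ?thesis .
  qed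
  \<comment> \<open>The term \<open>K0 * P n\<close> on the left is kept in reserve, because the
    value at \<open>e n\<close> is used once more by the next tile.\<close>
  have ind: "integral {\<alpha>..e n} Hd + K0 * P n \<le> K0 * (2 * 2 powr p * (G n - G 0) + (\<Phi> (e n) - \<Phi> (e 0)))" for n
  proof (induct n)
    case 0 then show ?case by (simp add: e0 P0)
  next
    case (Suc n)
    have an: "\<alpha> \<le> e n" using tile_mono[OF ab(1), of 0 n] by (simp add: e_def)
    have "integral {\<alpha>..e (Suc n)} Hd + K0 * P (Suc n) = integral {\<alpha>..e n} Hd + integral {e n..e (Suc n)} Hd + K0 * P (Suc n)"
      by (subst integral_combine_pos[OF Hdens_L1 ab(1) an es]) simp
    also have "\<dots> \<le> (integral {\<alpha>..e n} Hd + K0 * P n) + K0 * (2 * P (Suc n) + (\<Phi> (e (Suc n)) - \<Phi> (e n)))"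
      using step[of n] by (simp add: algebra_simps)
    also have "\<dots> \<le> K0 * (2 * 2 powr p * (G n - G 0) + (\<Phi> (e n) - \<Phi> (e 0))) + K0 * (2 * (2 powr p * (G (Suc n) - G n)) + (\<Phi> (e (Suc n)) - \<Phi> (e n)))"
      using Suc PS[of n] K0_pos by (intro add_mono mult_left_mono) auto
    also have "\<dots> = K0 * (2 * 2 powr p * (G (Suc n) - G 0) + (\<Phi> (e (Suc n)) - \<Phi> (e 0)))"
      by (simp add: algebra_simps)
    finally show ?case .
  qed
  obtain n where n: "\<beta> \<le> e n" using tile_unbounded[OF ab(1), of \<beta>] unfolding e_def by blast
  have TD: "G n - G 0 \<le> 2 * (T0 + D)" "\<Phi> (e n) - \<Phi> (e 0) \<le> T0 + D"
  proof -
    have m: "e 0 \<le> e n" "e 1 \<le> e (Suc n)" using tile_mono[OF ab(1)] by (auto simp: e_def simp del: tile.simps)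
    show "\<Phi> (e n) - \<Phi> (e 0) \<le> T0 + D" by (rule Phi_T[OF ep m(1)])
    then show "G n - G 0 \<le> 2 * (T0 + D)" using Phi_T[OF ep m(2)] by (simp add: G_def)
  qed
  have "integral {\<alpha>..e n} Hd \<le> K0 * (2 * 2 powr p * (G n - G 0) + (\<Phi> (e n) - \<Phi> (e 0)))"
  proof -
    have "0 \<le> K0 * P n" using K0_pos by (simp add: P_def)
    then show ?thesis using ind[of n] by linarith
  qed
  also have "\<dots> \<le> K0 * (2 * 2 powr p * (2 * (T0 + D)) + (T0 + D))"
    using TD K0_pos by (intro mult_left_mono add_mono) auto
  also have "\<dots> = K0 * (2 powr (p + 2) + 1) * (T0 + D)" by (simp add: powr_add algebra_simps)
  finally have main: "integral {\<alpha>..e n} Hd \<le> K0 * (2 powr (p + 2) + 1) * (T0 + D)" .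
  have "nnI {0<..} Hd \<le> nnI {\<alpha>..e n} Hd"
    unfolding nnI_def
  proof (rule nn_integral_mono)
    fix x :: real
    show "ennreal (Hd x) * indicator {0<..} x \<le> ennreal (Hd x) * indicator {\<alpha>..e n} x"
      using supp[of x] n by (cases "x \<in> {\<alpha><..<\<beta>}") (auto simp: indicator_def Hdens_def)
  qed
  also have "\<dots> = ennreal (integral {\<alpha>..e n} Hd)" by (rule nnI_integral[OF L1locD[OF Hdens_L1 ab(1)] dens_nonneg(2)])
  also have "\<dots> \<le> ennreal (K0 * (2 powr (p + 2) + 1) * (T0 + D))" by (rule ennreal_leI[OF main])
  finally show ?thesis .
qed

text \<open>No values at tile points are involved, so the bounds on single tiles simply add up. This
  recovers the \<open>v0\<close> part of the Sobolev norm from the energy and the Hardy term, which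
  are what a bounded functional gives directly.\<close>

lemma v0_total:
  assumes ab: "0 < \<alpha>" "\<alpha> < \<beta>" and supp: "\<And>x. 0 < x \<Longrightarrow> x \<notin> {\<alpha><..<\<beta>} \<Longrightarrow> f x = 0"
    and T: "nnI {0<..} Hd \<le> ennreal H" "nnI {0<..} Gd \<le> ennreal D" "0 \<le> H" "0 \<le> D"
  shows "nnI {0<..} Vd \<le> ennreal (2 * 4 powr p * (H + D))"
proof -
  define e where "e = tile \<alpha>"
  have e0: "e 0 = \<alpha>" by (simp add: e_def)
  have ep: "0 < e n" for n unfolding e_def by (rule tile_pos[OF ab(1)])
  have es: "e n \<le> e (Suc n)" for n unfolding e_def using tile_less[OF ab(1), of n] by simp
  have step: "integral {e n..e (Suc n)} Vd \<le> 2 * 4 powr p * (integral {e n..e (Suc n)} Hd + integral {e n..e (Suc n)} Gd)" for n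
  proof -
    let ?t = "A (e n)"
    have t: "0 < ?t" "e n \<le> ?t" "?t \<le> e (Suc n)" "b ?t = e (Suc n)" "a ?t = e n"
      using A_pos[OF ep] tile_step(1,2)[OF ab(1), of n] a_A[OF ep] by (auto simp: e_def)
    have G0: "0 \<le> integral {e n..e (Suc n)} Gd" by (rule integral_nonneg_pos[OF Gdens_L1 dens_nonneg(1) ep])
    have "integral {e n..e (Suc n)} Vd \<le> 2 powr p * (2 * 2 powr p * integral {?t..e (Suc n)} Hd + integral {e n..e (Suc n)} Gd)"
      using tile_v0_bound[OF t(1)] unfolding t(4,5) .
    also have "\<dots> \<le> 2 powr p * (2 * 2 powr p * integral {e n..e (Suc n)} Hd + 2 * 2 powr p * integral {e n..e (Suc n)} Gd)"
    proof (intro mult_left_mono add_mono)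
      show "integral {?t..e (Suc n)} Hd \<le> integral {e n..e (Suc n)} Hd"
        by (rule integral_subset_mono[OF Hdens_L1 dens_nonneg(2) ep t(2,3)]) simp
      have "(2::real) powr 0 \<le> 2 powr p" using p1 by (intro powr_mono) auto
      then have "1 \<le> 2 * (2::real) powr p" by simp
      from mult_right_mono[OF this G0] show "integral {e n..e (Suc n)} Gd \<le> 2 * 2 powr p * integral {e n..e (Suc n)} Gd" by simp
    qed auto
    also have "\<dots> = 2 * (2 powr p * 2 powr p) * (integral {e n..e (Suc n)} Hd + integral {e n..e (Suc n)} Gd)"
      by (simp add: algebra_simps)
    also have "(2::real) powr p * 2 powr p = 4 powr p" by (simp add: powr_mult[symmetric])
    finally show ?thesis .
  qed
  have ind: "integral {\<alpha>..e n} Vd \<le> 2 * 4 powr p * (integral {\<alpha>..e n} Hd + integral {\<alpha>..e n} Gd)" for n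
  proof (induct n)
    case 0 then show ?case by (simp add: e0)
  next
    case (Suc n)
    have an: "\<alpha> \<le> e n" using tile_mono[OF ab(1), of 0 n] by (simp add: e_def)
    show ?case using Suc step[of n]
      unfolding integral_combine_pos[OF Hdens_L1 ab(1) an es] integral_combine_pos[OF Gdens_L1 ab(1) an es] integral_combine_pos[OF Vdens_L1 ab(1) an es]
      by (simp add: algebra_simps)
  qed
  obtain n where n: "\<beta> \<le> e n" using tile_unbounded[OF ab(1), of \<beta>] unfolding e_def by blast
  have "integral {\<alpha>..e n} Hd \<le> H" "integral {\<alpha>..e n} Gd \<le> D"
    by (rule integral_le_nnI[OF Hdens_L1 dens_nonneg(2) T(1,3) ab(1)], rule integral_le_nnI[OF Gdens_L1 dens_nonneg(1) T(2,4) ab(1)])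
  then have "2 * 4 powr p * (integral {\<alpha>..e n} Hd + integral {\<alpha>..e n} Gd) \<le> 2 * 4 powr p * (H + D)" by (intro mult_left_mono) auto
  then have main: "integral {\<alpha>..e n} Vd \<le> 2 * 4 powr p * (H + D)" using ind[of n] by linarith
  have "nnI {0<..} Vd \<le> nnI {\<alpha>..e n} Vd"
    unfolding nnI_def
  proof (rule nn_integral_mono)
    fix x :: real
    show "ennreal (Vd x) * indicator {0<..} x \<le> ennreal (Vd x) * indicator {\<alpha>..e n} x"
      using supp[of x] n by (cases "x \<in> {\<alpha><..<\<beta>}") (auto simp: indicator_def Vdens_def)
  qed
  also have "\<dots> = ennreal (integral {\<alpha>..e n} Vd)" by (rule nnI_integral[OF L1locD[OF Vdens_L1 ab(1)] dens_nonneg(3)])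
  also have "\<dots> \<le> ennreal (2 * 4 powr p * (H + D))" by (rule ennreal_leI[OF main])
  finally show ?thesis .
qed

end

end






section \<open>Elements of the dual have compact support\<close>

text \<open>The frequencies are such that each dyadic interval holds a whole number of periods. The
  primitives then vanish at all dyadic points, and the pieces fit together although their amplitudes
  \<open>M n\<close> are unrelated. Two phases are provided since one alone has zeros.\<close>

lemma dyadic_oscillation:
  fixes M :: "int \<Rightarrow> real" and j :: "int \<Rightarrow> nat"
  assumes j: "\<And>n. 1 \<le> j n"
  defines "\<kappa> \<equiv> \<lambda>n. 2 * pi * real (j n) / dy n"
  shows "prim (\<lambda>x. M \<lfloor>log 2 x\<rfloor> / \<kappa> \<lfloor>log 2 x\<rfloor> * sin (\<kappa> \<lfloor>log 2 x\<rfloor> * x)) (\<lambda>x. M \<lfloor>log 2 x\<rfloor> * cos (\<kappa> \<lfloor>log 2 x\<rfloor> * x))"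
    "prim (\<lambda>x. M \<lfloor>log 2 x\<rfloor> / \<kappa> \<lfloor>log 2 x\<rfloor> * (1 - cos (\<kappa> \<lfloor>log 2 x\<rfloor> * x))) (\<lambda>x. M \<lfloor>log 2 x\<rfloor> * sin (\<kappa> \<lfloor>log 2 x\<rfloor> * x))"
proof -
  have kp: "0 < \<kappa> n" for n using j[of n] dy_pos[of n] pi_gt_zero by (simp add: \<kappa>_def)
  have k0: "\<kappa> n * dy n = 2 * pi * real (j n)" for n using dy_pos[of n] by (simp add: \<kappa>_def)
  have k1: "\<kappa> n * dy (n + 1) = 2 * pi * real (2 * j n)" for n
  proof -
    have "\<kappa> n * dy (n + 1) = 2 * (\<kappa> n * dy n)" unfolding dy_Suc by simp
    then show ?thesis unfolding k0 by simp
  qed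
  have sc: "sin (2 * pi * real m) = 0" "cos (2 * pi * real m) = 1" for m :: nat
    using sin_int_2pin[of "int m"] cos_int_2pin[of "int m"] by (simp_all add: mult.commute)
  have e: "sin (\<kappa> n * dy n) = 0" "cos (\<kappa> n * dy n) = 1" "sin (\<kappa> n * dy (n + 1)) = 0" "cos (\<kappa> n * dy (n + 1)) = 1" for n
    unfolding k0 k1 using sc by blast+
  have lev: "\<lfloor>log 2 (dy n)\<rfloor> = n" for n by (rule dy_level[OF order_refl dy_less])
  have nxt: "\<lfloor>log 2 s\<rfloor> = n \<or> s = dy (n + 1)" if "s \<in> {dy n..dy (n + 1)}" for s n
    using dy_level[of n s] that by force
  have gen: "prim (\<lambda>x. M \<lfloor>log 2 x\<rfloor> / \<kappa> \<lfloor>log 2 x\<rfloor> * S (\<kappa> \<lfloor>log 2 x\<rfloor> * x)) (\<lambda>x. M \<lfloor>log 2 x\<rfloor> * S' (\<kappa> \<lfloor>log 2 x\<rfloor> * x))"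
    if d: "\<And>z. (S has_real_derivative S' z) (at z)" and z: "\<And>n. S (\<kappa> n * dy n) = 0" "\<And>n. S (\<kappa> n * dy (n + 1)) = 0" and c: "continuous_on UNIV S'" for S S'
  proof (rule dyadic_prim[where H = "\<lambda>n x. M n * S' (\<kappa> n * x)"])
    fix n
    have cc: "continuous_on X (\<lambda>x. M n * S' (\<kappa> n * x))" for X
      by (intro continuous_intros continuous_on_compose2[OF c]) auto
    show "(\<lambda>x. M n * S' (\<kappa> n * x)) absolutely_integrable_on {dy n..dy (n+1)}"
      by (rule absolutely_integrable_continuous_real[OF cc])
    fix s assume s: "s \<in> {dy n..dy (n + 1)}"
    have "((\<lambda>x. M n * S' (\<kappa> n * x)) has_integral (M n / \<kappa> n * S (\<kappa> n * s) - M n / \<kappa> n * S (\<kappa> n * dy n))) {dy n..s}"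
    proof (rule fundamental_theorem_of_calculus)
      fix x assume "x \<in> {dy n..s}"
      have "((\<lambda>x. S (\<kappa> n * x)) has_real_derivative S' (\<kappa> n * x) * \<kappa> n) (at x)"
        by (rule DERIV_chain2[where f = S and g = "\<lambda>x. \<kappa> n * x", OF d]) (auto intro!: derivative_eq_intros)
      then have "((\<lambda>x. M n / \<kappa> n * S (\<kappa> n * x)) has_real_derivative M n / \<kappa> n * (S' (\<kappa> n * x) * \<kappa> n)) (at x)"
        by (rule DERIV_cmult)
      moreover have "M n / \<kappa> n * (S' (\<kappa> n * x) * \<kappa> n) = M n * S' (\<kappa> n * x)" using kp[of n] by simp
      ultimately have "((\<lambda>x. M n / \<kappa> n * S (\<kappa> n * x)) has_real_derivative M n * S' (\<kappa> n * x)) (at x within {dy n..s})"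
        by (auto intro: has_field_derivative_at_within)
      then show "((\<lambda>x. M n / \<kappa> n * S (\<kappa> n * x)) has_vector_derivative M n * S' (\<kappa> n * x)) (at x within {dy n..s})"
        by (simp add: has_real_derivative_iff_has_vector_derivative)
    qed (use s in auto)
    from integral_unique[OF this] have i: "integral {dy n..s} (\<lambda>x. M n * S' (\<kappa> n * x)) = M n / \<kappa> n * S (\<kappa> n * s)"
      unfolding z by simp
    have e1: "M \<lfloor>log 2 s\<rfloor> / \<kappa> \<lfloor>log 2 s\<rfloor> * S (\<kappa> \<lfloor>log 2 s\<rfloor> * s) = M n / \<kappa> n * S (\<kappa> n * s)"
    proof -
      consider "\<lfloor>log 2 s\<rfloor> = n" | "s = dy (n + 1)" using nxt[OF s] by blast
      then show ?thesis
      proof cases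
        case 2 show ?thesis unfolding 2 lev z by simp
      qed simp
    qed
    show "integral {dy n..s} (\<lambda>x. M n * S' (\<kappa> n * x)) = M \<lfloor>log 2 s\<rfloor> / \<kappa> \<lfloor>log 2 s\<rfloor> * S (\<kappa> \<lfloor>log 2 s\<rfloor> * s) -
       M \<lfloor>log 2 (dy n)\<rfloor> / \<kappa> \<lfloor>log 2 (dy n)\<rfloor> * S (\<kappa> \<lfloor>log 2 (dy n)\<rfloor> * dy n)"
      unfolding i e1 lev z by simp
  qed
  show "prim (\<lambda>x. M \<lfloor>log 2 x\<rfloor> / \<kappa> \<lfloor>log 2 x\<rfloor> * sin (\<kappa> \<lfloor>log 2 x\<rfloor> * x)) (\<lambda>x. M \<lfloor>log 2 x\<rfloor> * cos (\<kappa> \<lfloor>log 2 x\<rfloor> * x))"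
    by (rule gen) (auto intro!: derivative_eq_intros continuous_intros simp: e)
  show "prim (\<lambda>x. M \<lfloor>log 2 x\<rfloor> / \<kappa> \<lfloor>log 2 x\<rfloor> * (1 - cos (\<kappa> \<lfloor>log 2 x\<rfloor> * x))) (\<lambda>x. M \<lfloor>log 2 x\<rfloor> * sin (\<kappa> \<lfloor>log 2 x\<rfloor> * x))"
    by (rule gen[of "\<lambda>z. 1 - cos z"]) (auto intro!: derivative_eq_intros continuous_intros simp: e)
qed

lemma dyadic_integral_Suc:
  assumes k: "L1loc k"
  shows "integral {dy (- int (Suc N))..dy (int (Suc N) + 1)} k = integral {dy (- int N - 1)..dy (- int N - 1 + 1)} k +
    integral {dy (- int N)..dy (int N + 1)} k + integral {dy (int N + 1)..dy (int N + 1 + 1)} k"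
proof -
  have e: "- int (Suc N) = - int N - 1" "int (Suc N) + 1 = int N + 1 + 1" "- int N - 1 + 1 = - int N" by simp_all
  have m: "dy (- int N - 1) \<le> dy (- int N)" "dy (- int N) \<le> dy (int N + 1)" "dy (int N + 1) \<le> dy (int N + 1 + 1)"
    by (rule dy_mono, simp)+
  have "integral {dy (- int N - 1)..dy (- int N)} k + integral {dy (- int N)..dy (int N + 1 + 1)} k = integral {dy (- int N - 1)..dy (int N + 1 + 1)} k"
    by (rule integral_combine_pos[OF k dy_pos m(1) order_trans[OF m(2,3)], symmetric])
  moreover have "integral {dy (- int N)..dy (int N + 1)} k + integral {dy (int N + 1)..dy (int N + 1 + 1)} k = integral {dy (- int N)..dy (int N + 1 + 1)} k"
    by (rule integral_combine_pos[OF k dy_pos m(2,3), symmetric])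
  ultimately show ?thesis unfolding e by linarith
qed

text \<open>The right side is the sum of the bounds \<open>(1/2) ^ nat \<bar>n\<bar>\<close> over
  \<open>\<bar>n\<bar> \<le> N\<close>, so that 3 bounds all these integrals.\<close>

lemma dyadic_integral_le:
  assumes k: "L1loc k" and b: "\<And>n. integral {dy n..dy (n + 1)} k \<le> (1/2) ^ nat \<bar>n\<bar>"
  shows "integral {dy (- int N)..dy (int N + 1)} k \<le> 3 - 2 * (1/2) ^ N"
proof (induct N)
  case 0 show ?case using b[of 0] by simp
next
  case (Suc N)
  have n: "nat \<bar>int N + 1\<bar> = Suc N" "nat \<bar>- int N - 1\<bar> = Suc N" by simp_all
  have "(1/2::real) ^ Suc N = (1/2) ^ N / 2" by simp
  then show ?case using Suc b[of "int N + 1"] b[of "- int N - 1"] unfolding dyadic_integral_Suc[OF k] n by linarith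
qed

lemma dyadic_cover: "0 < x \<Longrightarrow> \<exists>N. dy (- int N) \<le> x \<and> y \<le> dy (int N + 1)"
proof -
  assume x: "0 < x"
  define N where "N = nat (max \<bar>\<lfloor>log 2 x\<rfloor>\<bar> \<bar>\<lfloor>log 2 (max x y)\<rfloor>\<bar>)"
  have "dy (- int N) \<le> dy \<lfloor>log 2 x\<rfloor>" by (rule dy_mono) (auto simp: N_def)
  moreover have "dy (\<lfloor>log 2 (max x y)\<rfloor> + 1) \<le> dy (int N + 1)" by (rule dy_mono) (auto simp: N_def)
  ultimately have "dy (- int N) \<le> x \<and> y \<le> dy (int N + 1)"
    using dy_bounds[OF x] dy_bounds[of "max x y"] x by linarith
  then show ?thesis by (rule exI)
qed

context oscillation
begin

lemma Wnorm_le: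
  assumes g: "L1loc g" and b: "Gcal_pow p v1 a b g \<le> ennreal (K powr q * N)" "Gbb_pow p v1 a b g \<le> ennreal (K powr q * N)" and K: "0 \<le> K" "0 \<le> N"
  shows "g \<in> Wset p v1 a b" "Wnorm p v1 a b g \<le> 2 * K * N powr (1 / q)"
proof -
  have "ennreal (K powr q * N) < \<infinity>" by simp
  then show "g \<in> Wset p v1 a b" unfolding Wset_def Lloc_one_iff using g b by (auto intro: le_less_trans)
  have e: "enn2real X powr (1 / q) \<le> K * N powr (1 / q)" if "X \<le> ennreal (K powr q * N)" for X
  proof -
    have "enn2real X \<le> K powr q * N" using that K enn2real_mono[OF that] by simp
    then have "enn2real X powr (1 / q) \<le> (K powr q * N) powr (1 / q)" using q1 by (intro powr_mono2) auto
    also have "\<dots> = K * N powr (1 / q)" using K q1 by (simp add: powr_mult powr_powr)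
    finally show ?thesis .
  qed
  show "Wnorm p v1 a b g \<le> 2 * K * N powr (1 / q)"
    unfolding Wnorm_def q_def[symmetric] using e[OF b(1)] e[OF b(2)] by simp
qed

lemma W_prim:
  assumes U: "prim U u" and N: "nnI {0<..} (\<lambda>x. w x * (V x * \<bar>U x\<bar>) powr q) \<le> ennreal N" "0 \<le> N"
  shows "(\<lambda>x. V x * u x) \<in> Wset p v1 a b" "Wnorm p v1 a b (\<lambda>x. V x * u x) \<le> 32 * N powr (1 / q)"
proof -
  have L: "L1loc (\<lambda>x. V x * u x)" by (rule L1loc_cont_mult[OF V_cont prim_L1[OF U]])
  have "ennreal (16 powr q) * nnI {0<..} (\<lambda>x. w x * (V x * \<bar>U x\<bar>) powr q) \<le> ennreal (16 powr q * N)"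
    using N by (simp add: ennreal_mult' mult_left_mono)
  with W_est_prim[OF U] have "Gcal_pow p v1 a b (\<lambda>x. V x * u x) \<le> ennreal (16 powr q * N)" "Gbb_pow p v1 a b (\<lambda>x. V x * u x) \<le> ennreal (16 powr q * N)"
    by (auto intro: order_trans)
  from Wnorm_le[OF L this] N show "(\<lambda>x. V x * u x) \<in> Wset p v1 a b" "Wnorm p v1 a b (\<lambda>x. V x * u x) \<le> 32 * N powr (1 / q)" by auto
qed

lemma W_weighted:
  assumes \<psi>: "\<psi> \<in> borel_measurable (lebesgue_on {0<..})"
    and L: "L1loc (\<lambda>x. w x * \<psi> x)" and Lq: "L1loc (\<lambda>x. w x * (\<bar>\<psi> x\<bar> * V x) powr q)"
    and N: "nnI {0<..} (\<lambda>x. w x * (\<bar>\<psi> x\<bar> * V x) powr q) \<le> ennreal N" "0 \<le> N"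
  shows "(\<lambda>x. w x * \<psi> x) \<in> Wset p v1 a b" "Wnorm p v1 a b (\<lambda>x. w x * \<psi> x) \<le> 8 * N powr (1 / q)"
proof -
  have "ennreal (4 powr q) * nnI {0<..} (\<lambda>x. w x * (\<bar>\<psi> x\<bar> * V x) powr q) \<le> ennreal (4 powr q * N)"
    using N by (simp add: ennreal_mult' mult_left_mono)
  with W_est_weighted[OF \<psi> L Lq] have "Gcal_pow p v1 a b (\<lambda>x. w x * \<psi> x) \<le> ennreal (4 powr q * N)" "Gbb_pow p v1 a b (\<lambda>x. w x * \<psi> x) \<le> ennreal (4 powr q * N)"
    by (auto intro: order_trans)
  from Wnorm_le[OF L this] N show "(\<lambda>x. w x * \<psi> x) \<in> Wset p v1 a b" "Wnorm p v1 a b (\<lambda>x. w x * \<psi> x) \<le> 8 * N powr (1 / q)" by auto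
qed

text \<open>The weight in which the size of a primitive \<open>U\<close> of \<open>u\<close>
  controls the norm of \<open>V * u\<close>.\<close>

definition Wd :: "real \<Rightarrow> real" where "Wd x = w x * V x powr q"

lemma Wd_L1: "L1loc Wd" unfolding Wd_def[abs_def] using L1loc_cont_mult[OF powr_V_cont w_L1, of q] by (simp add: mult.commute)
lemma Wd_nonneg: "0 \<le> Wd x" by (simp add: Wd_def w_nonneg)

text \<open>The primitive of an oscillation of amplitude \<open>M n\<close> and frequency
  \<open>\<kappa> n\<close> has size at most \<open>2 * M n / \<kappa> n\<close>. Frequencies that
  are high enough, depending on the level, put \<open>V * u\<close> into the space however fast
  \<open>M\<close> grows, and integrability of its product with \<open>f\<close> is then contained
  in the hypothesis on \<open>f\<close>.\<close>

lemma dual_oscillation: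
  assumes f: "f \<in> Dset (Wset p v1 a b)" and M: "\<And>n. 0 \<le> M n"
  shows "nnI {0<..} (\<lambda>x. M \<lfloor>log 2 x\<rfloor> * (V x * \<bar>f x\<bar>)) < \<infinity>"
proof -
  define \<mu> where "\<mu> n = integral {dy n..dy (n + 1)} Wd" for n
  have mu: "0 \<le> \<mu> n" for n unfolding \<mu>_def
    by (intro Henstock_Kurzweil_Integration.integral_nonneg L1loc_integrable[OF Wd_L1 dy_pos] Wd_nonneg)
  have "\<exists>j::nat. 1 \<le> j \<and> (2 * M n / (2 * pi * real j / dy n)) powr q * \<mu> n \<le> (1/2) ^ nat \<bar>n\<bar>" for n
  proof -
    \<comment> \<open>Chosen such that \<open>e powr q * \<mu> n\<close> stays below
      \<open>(1/2) ^ nat \<bar>n\<bar>\<close>; the summand 1 in the denominator covers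
      \<open>\<mu> n = 0\<close>.\<close>
    define e where "e = ((1/2) ^ nat \<bar>n\<bar> / (\<mu> n + 1)) powr (1 / q)"
    have e0: "0 < e" unfolding e_def using mu[of n] by simp
    obtain j where j: "M n * dy n / e < real j" using reals_Archimedean2 by blast
    define j' where "j' = max 1 j"
    have j1: "1 \<le> j'" "M n * dy n / e < real j'" using j by (auto simp: j'_def)
    have "2 * M n / (2 * pi * real j' / dy n) = (M n * dy n / real j') / pi" using dy_pos[of n] by simp
    also have "\<dots> \<le> (M n * dy n / real j') / 1" using M[of n] dy_pos[of n] pi_gt3 j1 by (intro divide_left_mono) auto
    also have "\<dots> \<le> e" using j1 e0 by (simp add: field_simps)
    finally have le: "2 * M n / (2 * pi * real j' / dy n) \<le> e" .
    have nn: "0 \<le> 2 * M n / (2 * pi * real j' / dy n)" using M[of n] dy_pos[of n] by simp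
    have "(2 * M n / (2 * pi * real j' / dy n)) powr q \<le> e powr q" using q1 by (intro powr_mono2 le nn) auto
    also have "e powr q = (1/2) ^ nat \<bar>n\<bar> / (\<mu> n + 1)" unfolding e_def using mu[of n] q1 by (simp add: powr_powr)
    finally have "(2 * M n / (2 * pi * real j' / dy n)) powr q * \<mu> n \<le> (1/2) ^ nat \<bar>n\<bar> / (\<mu> n + 1) * \<mu> n"
      using mu[of n] by (rule mult_right_mono)
    also have "\<dots> = (1/2) ^ nat \<bar>n\<bar> * (\<mu> n / (\<mu> n + 1))" by simp
    also have "\<dots> \<le> (1/2) ^ nat \<bar>n\<bar> * 1" using mu[of n] by (intro mult_left_mono) auto
    finally show ?thesis using j1 by auto
  qed
  then obtain j :: "int \<Rightarrow> nat" where j: "\<And>n. 1 \<le> j n"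
     "\<And>n. (2 * M n / (2 * pi * real (j n) / dy n)) powr q * \<mu> n \<le> (1/2) ^ nat \<bar>n\<bar>" by metis
  define \<kappa> where "\<kappa> n = 2 * pi * real (j n) / dy n" for n
  have kp: "0 < \<kappa> n" for n using j(1)[of n] dy_pos[of n] pi_gt_zero by (simp add: \<kappa>_def)
  have os: "prim (\<lambda>x. M \<lfloor>log 2 x\<rfloor> / \<kappa> \<lfloor>log 2 x\<rfloor> * sin (\<kappa> \<lfloor>log 2 x\<rfloor> * x)) (\<lambda>x. M \<lfloor>log 2 x\<rfloor> * cos (\<kappa> \<lfloor>log 2 x\<rfloor> * x))"
    "prim (\<lambda>x. M \<lfloor>log 2 x\<rfloor> / \<kappa> \<lfloor>log 2 x\<rfloor> * (1 - cos (\<kappa> \<lfloor>log 2 x\<rfloor> * x))) (\<lambda>x. M \<lfloor>log 2 x\<rfloor> * sin (\<kappa> \<lfloor>log 2 x\<rfloor> * x))"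
    using dyadic_oscillation[of j M, OF j(1)] unfolding \<kappa>_def .
  have fin: "nnI {0<..} (\<lambda>x. \<bar>V x * u x * f x\<bar>) < \<infinity>"
    if U: "prim U u" and Ub: "\<And>x. 0 < x \<Longrightarrow> \<bar>U x\<bar> \<le> 2 * M \<lfloor>log 2 x\<rfloor> / \<kappa> \<lfloor>log 2 x\<rfloor>" for U u
  proof -
    define k where "k x = w x * (V x * \<bar>U x\<bar>) powr q" for x
    have ck: "continuous_on {0<..} (\<lambda>x. (V x * \<bar>U x\<bar>) powr q)"
      using V_cont prim_continuous[OF U] q1 V_pos by (intro continuous_on_powr' continuous_intros) (auto simp: less_imp_le)
    have Lk: "L1loc k" unfolding k_def[abs_def] using L1loc_cont_mult[OF ck w_L1] by (simp add: mult.commute)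
    have kn: "0 \<le> k x" for x by (simp add: k_def w_nonneg)
    have kb: "integral {dy n..dy (n + 1)} k \<le> (1/2) ^ nat \<bar>n\<bar>" for n
    proof -
      let ?c = "(2 * M n / \<kappa> n) powr q"
      have "integral {dy n..dy (n + 1)} k \<le> integral {dy n..dy (n + 1)} (\<lambda>x. if x = dy (n + 1) then k x else ?c * Wd x)"
      proof (rule integral_le[OF L1loc_integrable[OF Lk dy_pos]])
        have "(\<lambda>x. ?c * Wd x) integrable_on {dy n..dy (n + 1)}" by (intro integrable_on_mult_right L1loc_integrable[OF Wd_L1 dy_pos])
        then show "(\<lambda>x. if x = dy (n + 1) then k x else ?c * Wd x) integrable_on {dy n..dy (n + 1)}"
          by (rule integrable_spike[of _ _ "{dy (n + 1)}"]) auto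
        fix x assume x: "x \<in> {dy n..dy (n + 1)}"
        have x0: "0 < x" using x dy_pos[of n] by auto
        show "k x \<le> (if x = dy (n + 1) then k x else ?c * Wd x)"
        proof (cases "x = dy (n + 1)")
          case False
          then have "\<lfloor>log 2 x\<rfloor> = n" using dy_level[of n x] x by auto
          then have "\<bar>U x\<bar> \<le> 2 * M n / \<kappa> n" using Ub[OF x0] by simp
          then have "(V x * \<bar>U x\<bar>) powr q \<le> (V x * (2 * M n / \<kappa> n)) powr q"
            using V_pos[OF x0] q1 by (intro powr_mono2 mult_left_mono) auto
          also have "\<dots> = V x powr q * ?c" by (rule powr_mult)
          finally have "w x * (V x * \<bar>U x\<bar>) powr q \<le> w x * (V x powr q * ?c)" by (intro mult_left_mono w_nonneg)
          then show ?thesis using False by (simp add: k_def Wd_def ac_simps)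
        qed simp
      qed
      also have "\<dots> = integral {dy n..dy (n + 1)} (\<lambda>x. ?c * Wd x)"
        by (rule integral_spike[of "{dy (n + 1)}"]) auto
      also have "\<dots> = ?c * \<mu> n" by (simp add: \<mu>_def)
      finally show ?thesis using j(2)[of n] by (simp add: \<kappa>_def)
    qed
    have "nnI {0<..} k \<le> ennreal 3"
    proof (rule nnI_limit[OF L1loc_measurable[OF Lk]])
      fix x y :: real assume xy: "0 < x" "x \<le> y"
      obtain N where N: "dy (- int N) \<le> x" "y \<le> dy (int N + 1)" using dyadic_cover[OF xy(1)] by blast
      have "nnI {x..y} k \<le> nnI {dy (- int N)..dy (int N + 1)} k" by (rule nnI_subset) (use N in auto)
      also have "\<dots> = ennreal (integral {dy (- int N)..dy (int N + 1)} k)" by (rule nnI_integral[OF L1locD[OF Lk dy_pos] kn])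
      also have "\<dots> \<le> ennreal 3"
      proof (rule ennreal_leI)
        have "(0::real) \<le> (1/2) ^ N" by simp
        then show "integral {dy (- int N)..dy (int N + 1)} k \<le> 3" using dyadic_integral_le[OF Lk kb, of N] by linarith
      qed
      finally show "nnI {x..y} k \<le> ennreal 3" .
    qed
    then have "(\<lambda>x. V x * u x) \<in> Wset p v1 a b" using W_prim(1)[OF U, of 3] unfolding k_def by simp
    moreover have "\<forall>g\<in>Wset p v1 a b. nnI {0<..} (\<lambda>x. \<bar>g x * f x\<bar>) < \<infinity>" using f by (simp add: Dset_def)
    ultimately show ?thesis by (rule bspec[rotated])
  qed
  let ?u1 = "\<lambda>x. M \<lfloor>log 2 x\<rfloor> * cos (\<kappa> \<lfloor>log 2 x\<rfloor> * x)" and ?u2 = "\<lambda>x. M \<lfloor>log 2 x\<rfloor> * sin (\<kappa> \<lfloor>log 2 x\<rfloor> * x)"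
  have ub: "\<bar>M n / \<kappa> n * z\<bar> \<le> 2 * M n / \<kappa> n" if "\<bar>z\<bar> \<le> 2" for n z
  proof -
    have "M n / \<kappa> n * \<bar>z\<bar> \<le> M n / \<kappa> n * 2" using that M[of n] kp[of n] by (intro mult_left_mono) auto
    then show ?thesis using M[of n] kp[of n] by (simp add: abs_mult mult.commute)
  qed
  have f1: "nnI {0<..} (\<lambda>x. \<bar>V x * ?u1 x * f x\<bar>) < \<infinity>"
  proof (rule fin[OF os(1)], rule ub)
    fix x show "\<bar>sin (\<kappa> \<lfloor>log 2 x\<rfloor> * x)\<bar> \<le> 2" using abs_sin_le_one[of "\<kappa> \<lfloor>log 2 x\<rfloor> * x"] by linarith
  qed
  have f2: "nnI {0<..} (\<lambda>x. \<bar>V x * ?u2 x * f x\<bar>) < \<infinity>"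
  proof (rule fin[OF os(2)], rule ub)
    fix x show "\<bar>1 - cos (\<kappa> \<lfloor>log 2 x\<rfloor> * x)\<bar> \<le> 2" using cos_ge_minus_one[of "\<kappa> \<lfloor>log 2 x\<rfloor> * x"] cos_le_one[of "\<kappa> \<lfloor>log 2 x\<rfloor> * x"] by linarith
  qed
  have mf: "f \<in> borel_measurable (lebesgue_on {0<..})" using f by (simp add: Dset_def)
  have m: "(\<lambda>x. \<bar>V x * ?u1 x * f x\<bar>) \<in> borel_measurable (lebesgue_on {0<..})" "(\<lambda>x. \<bar>V x * ?u2 x * f x\<bar>) \<in> borel_measurable (lebesgue_on {0<..})"
    using mf V_meas L1loc_measurable[OF prim_L1[OF os(1)]] L1loc_measurable[OF prim_L1[OF os(2)]] by measurable
  have "nnI {0<..} (\<lambda>x. M \<lfloor>log 2 x\<rfloor> * (V x * \<bar>f x\<bar>)) \<le> nnI {0<..} (\<lambda>x. \<bar>V x * ?u1 x * f x\<bar> + \<bar>V x * ?u2 x * f x\<bar>)"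
  proof (rule nnI_mono)
    fix x :: real assume "x \<in> {0<..}"
    then have x: "0 < x" by simp
    define z where "z = \<kappa> \<lfloor>log 2 x\<rfloor> * x"
    \<comment> \<open>Sine and cosine do not vanish together, so the two test functions jointly
      detect \<open>\<bar>f\<bar>\<close> everywhere.\<close>
    have "1 \<le> \<bar>cos z\<bar> + \<bar>sin z\<bar>"
    proof -
      have "\<bar>cos z\<bar> * \<bar>cos z\<bar> \<le> \<bar>cos z\<bar> * 1" "\<bar>sin z\<bar> * \<bar>sin z\<bar> \<le> \<bar>sin z\<bar> * 1" by (intro mult_left_mono abs_cos_le_one abs_sin_le_one abs_ge_zero)+
      moreover have "\<bar>cos z\<bar> * \<bar>cos z\<bar> + \<bar>sin z\<bar> * \<bar>sin z\<bar> = 1" using sin_cos_squared_add[of z] by (simp add: power2_eq_square)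
      ultimately show ?thesis by linarith
    qed
    then have "M \<lfloor>log 2 x\<rfloor> * (V x * \<bar>f x\<bar>) * 1 \<le> M \<lfloor>log 2 x\<rfloor> * (V x * \<bar>f x\<bar>) * (\<bar>cos z\<bar> + \<bar>sin z\<bar>)"
      using M V_pos[OF x] by (intro mult_left_mono) auto
    moreover have "\<bar>V x * (M \<lfloor>log 2 x\<rfloor> * y) * f x\<bar> = M \<lfloor>log 2 x\<rfloor> * (V x * \<bar>f x\<bar>) * \<bar>y\<bar>" for y
      using M[of "\<lfloor>log 2 x\<rfloor>"] V_pos[OF x] by (simp add: abs_mult ac_simps)
    ultimately show "M \<lfloor>log 2 x\<rfloor> * (V x * \<bar>f x\<bar>) \<le> \<bar>V x * ?u1 x * f x\<bar> + \<bar>V x * ?u2 x * f x\<bar>"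
      unfolding z_def[symmetric] by (simp add: distrib_left)
  qed
  also have "\<dots> = nnI {0<..} (\<lambda>x. \<bar>V x * ?u1 x * f x\<bar>) + nnI {0<..} (\<lambda>x. \<bar>V x * ?u2 x * f x\<bar>)"
    by (rule nnI_add[OF m]) auto
  also have "\<dots> < \<infinity>" using f1 f2 by simp
  finally show ?thesis .
qed

lemma dual_L1loc:
  assumes f: "f \<in> Dset (Wset p v1 a b)" shows "L1loc (\<lambda>x. V x * \<bar>f x\<bar>)"
proof (rule L1loc_nnI)
  have "f \<in> borel_measurable (lebesgue_on {0<..})" using f by (simp add: Dset_def)
  then show "(\<lambda>x. V x * \<bar>f x\<bar>) \<in> borel_measurable (lebesgue_on {0<..})" using V_meas by measurable
  show "0 \<le> V x * \<bar>f x\<bar>" if "0 < x" for x using V_pos[OF that] by simp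
  show "nnI {0<..} (\<lambda>x. V x * \<bar>f x\<bar>) < \<infinity>" using dual_oscillation[OF f, of "\<lambda>_. 1"] by simp
qed

text \<open>If infinitely many dyadic intervals carried mass, amplitudes inverse to these masses
  would give each of them the integral one, contradicting the finiteness for every choice of
  amplitudes.\<close>

lemma dual_compact_support:
  assumes f: "f \<in> Dset (Wset p v1 a b)"
  shows "\<exists>\<alpha> \<beta>. 0 < \<alpha> \<and> \<alpha> < \<beta> \<and> (AE x in lebesgue. 0 < x \<longrightarrow> x \<notin> {\<alpha><..<\<beta>} \<longrightarrow> f x = 0)"
proof -
  note LV = dual_L1loc[OF f]
  define k where "k x = V x * \<bar>f x\<bar>" for x
  have Lk: "L1loc k" unfolding k_def[abs_def] by (rule LV)
  have kn: "0 \<le> k x" if "0 < x" for x using V_pos[OF that] by (simp add: k_def)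
  define \<delta> where "\<delta> n = integral {dy n..dy (n + 1)} k" for n
  have dn: "nnI {dy n..dy (n + 1)} k = ennreal (\<delta> n)" for n unfolding \<delta>_def
    by (rule nnI_integral[OF L1locD[OF Lk dy_pos]]) (rule kn, use dy_pos[of n] in auto)
  have d0: "0 \<le> \<delta> n" for n unfolding \<delta>_def
    by (intro Henstock_Kurzweil_Integration.integral_nonneg L1loc_integrable[OF Lk dy_pos]) (rule kn, use dy_pos[of n] in auto)
  define S where "S = {n. \<delta> n \<noteq> 0}"
  \<comment> \<open>Division by zero gives the amplitude zero on intervals without mass.\<close>
  define M where "M n = 1 / \<delta> n" for n
  have M0: "0 \<le> M n" for n using d0[of n] by (simp add: M_def)
  define k2 where "k2 x = M \<lfloor>log 2 x\<rfloor> * k x" for x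
  have fin: "nnI {0<..} k2 < \<infinity>" using dual_oscillation[OF f, of M] M0 unfolding k2_def k_def by simp
  have k2n: "0 \<le> k2 x" if "0 < x" for x using kn[OF that] M0 by (simp add: k2_def)
  have mk2: "k2 \<in> borel_measurable (lebesgue_on {0<..})"
  proof -
    have "(\<lambda>x::real. M \<lfloor>log 2 x\<rfloor>) \<in> borel_measurable borel" by measurable
    then have "(\<lambda>x::real. M \<lfloor>log 2 x\<rfloor>) \<in> borel_measurable lebesgue" by (intro measurable_completion) simp
    then have "(\<lambda>x::real. M \<lfloor>log 2 x\<rfloor>) \<in> borel_measurable (lebesgue_on {0<..})" by (rule measurable_restrict_space1)
    then show ?thesis unfolding k2_def[abs_def] using L1loc_measurable[OF Lk] by measurable
  qed
  have Lk2: "L1loc k2" by (rule L1loc_nnI[OF mk2 k2n fin])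
  have piece: "integral {dy n..dy (n + 1)} k2 = (if n \<in> S then 1 else 0)" for n
  proof -
    have "integral {dy n..dy (n + 1)} k2 = integral {dy n..dy (n + 1)} (\<lambda>x. M n * k x)"
    proof (rule integral_spike[of "{dy (n + 1)}"])
      fix x assume "x \<in> {dy n..dy (n + 1)} - {dy (n + 1)}"
      then have "\<lfloor>log 2 x\<rfloor> = n" by (intro dy_level) auto
      then show "M n * k x = k2 x" by (simp add: k2_def)
    qed simp
    also have "\<dots> = M n * \<delta> n" by (simp add: \<delta>_def)
    finally show ?thesis by (simp add: M_def S_def)
  qed
  have cnt: "integral {dy (- int N)..dy (int N + 1)} k2 = real (card (S \<inter> {- int N..int N}))" for N
  proof (induct N)
    case 0 show ?case using piece[of 0] by (auto simp: Int_insert_right)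
  next
    case (Suc N)
    have "{- int (Suc N)..int (Suc N)} = insert (- int N - 1) (insert (int N + 1) {- int N..int N})" by auto
    then have "S \<inter> {- int (Suc N)..int (Suc N)} = ({- int N - 1} \<inter> S) \<union> (({int N + 1} \<inter> S) \<union> (S \<inter> {- int N..int N}))" by auto
    moreover have "card (({- int N - 1} \<inter> S) \<union> (({int N + 1} \<inter> S) \<union> (S \<inter> {- int N..int N}))) = card ({- int N - 1} \<inter> S) + (card ({int N + 1} \<inter> S) + card (S \<inter> {- int N..int N}))"
      by (subst card_Un_disjoint, simp, simp, force, subst card_Un_disjoint) auto
    moreover have "real (card ({n} \<inter> S)) = (if n \<in> S then 1 else 0)" for n by simp
    ultimately show ?case using Suc unfolding dyadic_integral_Suc[OF Lk2] piece by simp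
  qed
  obtain C where C: "nnI {0<..} k2 = ennreal C" "0 \<le> C" using fin by (cases "nnI {0<..} k2") auto
  have cb: "card (S \<inter> {- int N..int N}) \<le> nat \<lceil>C\<rceil>" for N
  proof -
    have "{dy (- int N)..dy (int N + 1)} \<subseteq> {0<..}" using dy_pos[of "- int N"] by auto
    then have "nnI {dy (- int N)..dy (int N + 1)} k2 \<le> ennreal C" using nnI_subset C(1) by metis
    moreover have "nnI {dy (- int N)..dy (int N + 1)} k2 = ennreal (integral {dy (- int N)..dy (int N + 1)} k2)"
      by (rule nnI_integral[OF L1locD[OF Lk2 dy_pos]]) (rule k2n, use dy_pos[of "- int N"] in auto)
    ultimately have "real (card (S \<inter> {- int N..int N})) \<le> C" unfolding cnt using C(2) by (simp add: ennreal_le_iff)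
    then show ?thesis by linarith
  qed
  have "finite S"
  proof (rule finite_if_finite_subsets_card_bdd[of _ "nat \<lceil>C\<rceil>", THEN conjunct1])
    show "\<And>G. G \<subseteq> S \<Longrightarrow> finite G \<Longrightarrow> card G \<le> nat \<lceil>C\<rceil>"
    proof -
      fix G assume G: "G \<subseteq> S" "finite G"
      define N where "N = nat (Max (insert 0 (abs ` G)))"
      have "G \<subseteq> S \<inter> {- int N..int N}"
      proof
        fix n assume n: "n \<in> G"
        have "\<bar>n\<bar> \<le> Max (insert 0 (abs ` G))" using G n by (intro Max_ge) auto
        then have "\<bar>n\<bar> \<le> int N" unfolding N_def by linarith
        then show "n \<in> S \<inter> {- int N..int N}" using n G by auto
      qed
      then have "card G \<le> card (S \<inter> {- int N..int N})" by (intro card_mono) auto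
      then show "card G \<le> nat \<lceil>C\<rceil>" using cb[of N] by simp
    qed
  qed
  then obtain N where N: "\<And>n. n \<in> S \<Longrightarrow> \<bar>n\<bar> \<le> int N"
  proof -
    assume *: "\<And>N. (\<And>n. n \<in> S \<Longrightarrow> \<bar>n\<bar> \<le> int N) \<Longrightarrow> thesis" and fS: "finite S"
    have "\<bar>n\<bar> \<le> int (nat (Max (insert 0 (abs ` S))))" if "n \<in> S" for n
    proof -
      have "\<bar>n\<bar> \<le> Max (insert 0 (abs ` S))" using fS that by (intro Max_ge) auto
      then show ?thesis by linarith
    qed
    then show thesis by (rule *)
  qed
  have z: "AE x in lebesgue. x \<in> {dy n..dy (n + 1)} \<longrightarrow> f x = 0" if "n \<notin> S" for n
  proof -
    have "nnI {dy n..dy (n + 1)} k = 0" using dn[of n] that by (simp add: S_def)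
    moreover have "(\<lambda>x. indicator {dy n..dy (n + 1)} x * k x) \<in> borel_measurable lebesgue"
    proof -
      have "{dy n..dy (n + 1)} \<subseteq> {0<..}" using dy_pos[of n] by auto
      from meas_sub[OF L1loc_measurable[OF Lk] this] show ?thesis
        by (subst (asm) borel_measurable_restrict_space_iff) auto
    qed
    then have "(\<lambda>x. ennreal (indicator {dy n..dy (n + 1)} x * k x)) \<in> borel_measurable lebesgue" by measurable
    moreover have "(\<lambda>x. ennreal (indicator {dy n..dy (n + 1)} x * k x)) = (\<lambda>x. ennreal (k x) * indicator {dy n..dy (n + 1)} x)"
      by (auto simp: indicator_def fun_eq_iff)
    ultimately have "AE x in lebesgue. ennreal (k x) * indicator {dy n..dy (n + 1)} x = 0"
      unfolding nnI_def by (subst (asm) nn_integral_0_iff_AE) auto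
    then show ?thesis
    proof eventually_elim
      case (elim x)
      show ?case
      proof
        assume x: "x \<in> {dy n..dy (n + 1)}"
        then have x0: "0 < x" using dy_pos[of n] by auto
        have "ennreal (k x) = 0" using elim x by simp
        then have "k x \<le> 0" by (simp add: ennreal_eq_0_iff)
        then have "V x * \<bar>f x\<bar> \<le> 0" by (simp add: k_def)
        then show "f x = 0" using V_pos[OF x0] by (simp add: mult_le_0_iff)
      qed
    qed
  qed
  have "AE x in lebesgue. \<forall>n. n \<notin> S \<longrightarrow> x \<in> {dy n..dy (n + 1)} \<longrightarrow> f x = 0"
    unfolding AE_all_countable using z by (auto intro: AE_impI)
  then have "AE x in lebesgue. 0 < x \<longrightarrow> x \<notin> {dy (- int N - 1)<..<dy (int N + 2)} \<longrightarrow> f x = 0"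
  proof eventually_elim
    case (elim x)
    show ?case
    proof (intro impI)
      assume x: "0 < x" "x \<notin> {dy (- int N - 1)<..<dy (int N + 2)}"
      let ?n = "\<lfloor>log 2 x\<rfloor>"
      have "?n \<notin> S"
      proof
        assume "?n \<in> S"
        then have "\<bar>?n\<bar> \<le> int N" by (rule N)
        then have "dy (- int N - 1) < dy (- int N - 1 + 1)" "dy (- int N) \<le> dy ?n" "dy (?n + 1) \<le> dy (int N + 2)"
          by (intro dy_less, intro dy_mono, linarith, intro dy_mono, linarith)
        moreover have "- int N - 1 + 1 = - int N" by simp
        ultimately show False using x dy_bounds[OF x(1)] by auto
      qed
      then show "f x = 0" using elim dy_bounds[OF x(1)] by auto
    qed
  qed
  moreover have "dy (- int N - 1) < dy (int N + 2)" using dy_less[of "- int N - 1"] dy_mono[of "- int N" "int N + 2"] by simp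
  ultimately show ?thesis using dy_pos by blast
qed

end


lemma nnI_supp:
  assumes k: "L1loc k" "\<And>x. 0 < x \<Longrightarrow> 0 \<le> k x" and l: "0 < l" and z: "\<And>x. 0 < x \<Longrightarrow> x \<notin> {l..r} \<Longrightarrow> k x = 0"
  shows "nnI {0<..} k = ennreal (integral {l..r} k)"
proof -
  have "nnI {0<..} k = nnI {l..r} k" unfolding nnI_def
    by (rule nn_integral_cong) (use z l in \<open>auto simp: indicator_def\<close>)
  also have "\<dots> = ennreal (integral {l..r} k)" by (rule nnI_integral[OF L1locD[OF k(1) l]]) (use k(2) l in auto)
  finally show ?thesis .
qed


section \<open>Functionals on \<open>W\<close>\<close>

lemma LINT_AE_zero:
  assumes "AE x in lebesgue. 0 < x \<longrightarrow> k x = (0::real)" shows "(LINT x:{0<..}|lebesgue. k x) = 0"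
  unfolding set_lebesgue_integral_def
proof (rule integral_eq_zero_AE)
  show "AE x in lebesgue. indicat_real {0<..} x *\<^sub>R k x = 0" using assms by eventually_elim (auto simp: indicator_def)
qed

text \<open>The supremum in \<open>Jfun\<close> omits elements of norm zero; for these the
  hypothesis \<open>z\<close> makes the pairing vanish.\<close>

lemma Jfun_pairing:
  assumes fin: "Jfun X N f < \<infinity>" and g: "g \<in> X" "0 \<le> N g"
    and z: "N g = 0 \<Longrightarrow> AE x in lebesgue. 0 < x \<longrightarrow> g x = 0"
  shows "\<bar>LINT x:{0<..}|lebesgue. g x * f x\<bar> \<le> enn2real (Jfun X N f) * N g"
proof (cases "N g = 0")
  case True
  have "AE x in lebesgue. 0 < x \<longrightarrow> g x * f x = 0" using z[OF True] by eventually_elim simp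
  from LINT_AE_zero[OF this] True show ?thesis by simp
next
  case False
  let ?L = "\<bar>LINT x:{0<..}|lebesgue. g x * f x\<bar>"
  have "ennreal (?L / N g) \<le> Jfun X N f" unfolding Jfun_def by (rule SUP_upper) (use g False in auto)
  then have "enn2real (ennreal (?L / N g)) \<le> enn2real (Jfun X N f)" using fin by (intro enn2real_mono) auto
  then have "?L / N g \<le> enn2real (Jfun X N f)" using g by simp
  then show ?thesis using g False by (simp add: divide_le_eq)
qed

lemma Jfun_le:
  assumes "\<And>g. g \<in> X \<Longrightarrow> \<bar>LINT x:{0<..}|lebesgue. g x * f x\<bar> \<le> C * N g" "\<And>g. g \<in> X \<Longrightarrow> 0 \<le> N g"
  shows "Jfun X N f \<le> ennreal C"
  unfolding Jfun_def
proof (rule SUP_least)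
  fix g assume "g \<in> {f \<in> X. N f \<noteq> 0}"
  then have g: "g \<in> X" "0 < N g" using assms(2)[of g] by auto
  then show "ennreal (\<bar>LINT x:{0<..}|lebesgue. g x * f x\<bar> / N g) \<le> ennreal C"
    using assms(1)[OF g(1)] by (intro ennreal_leI) (simp add: divide_le_eq)
qed

text \<open>Divide by \<open>I powr (1 / q)\<close>. This closes duality arguments in which the test
  function is built from the function to be estimated: truncation makes \<open>I\<close> finite, and
  the division is legitimate.\<close>

lemma self_bound:
  fixes I K p q :: real
  assumes pq: "1 < p" "1 / p + 1 / q = 1" and I: "0 \<le> I" "I \<le> K * I powr (1 / q)" and K: "0 \<le> K"
  shows "I \<le> K powr p"
proof (cases "I = 0")
  case False
  then have I0: "0 < I" using I by simp
  have "I powr (1 / p) * I powr (1 / q) = I" using I0 pq by (simp flip: powr_add)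
  then have "I powr (1 / p) * I powr (1 / q) \<le> K * I powr (1 / q)" using I by simp
  then have "I powr (1 / p) \<le> K" using I0 by simp
  then have "(I powr (1 / p)) powr p \<le> K powr p" using pq by (intro powr_mono2) auto
  then show ?thesis using pq I0 by (simp add: powr_powr)
qed simp

context oscillation
begin

lemma Wnorm_nonneg: "0 \<le> Wnorm p v1 a b g" by (simp add: Wnorm_def)

lemma Wnorm_D:
  assumes "g \<in> Wset p v1 a b"
  shows "L1loc g" "Gbb_pow p v1 a b g \<le> ennreal (Wnorm p v1 a b g powr q)" "Gcal_pow p v1 a b g \<le> ennreal (Wnorm p v1 a b g powr q)"
proof -
  show "L1loc g" using assms by (simp add: Wset_def Lloc_one_iff)
  have e: "X \<le> ennreal (Y powr q)" if X: "X < \<infinity>" "enn2real X powr (1 / q) \<le> Y" for X Y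
  proof -
    have "(enn2real X powr (1 / q)) powr q \<le> Y powr q" using X q1 by (intro powr_mono2) auto
    then have "enn2real X \<le> Y powr q" using q1 by (simp add: powr_powr)
    then show ?thesis using X by (cases X) (auto intro: ennreal_leI)
  qed
  show "Gbb_pow p v1 a b g \<le> ennreal (Wnorm p v1 a b g powr q)"
    by (rule e) (use assms in \<open>auto simp: Wset_def Wnorm_def q_def\<close>)
  show "Gcal_pow p v1 a b g \<le> ennreal (Wnorm p v1 a b g powr q)"
    by (rule e) (use assms in \<open>auto simp: Wset_def Wnorm_def q_def\<close>)
qed

lemma duality_W:
  assumes f: "prim f h" and hz: "\<And>x. w x = 0 \<Longrightarrow> h x = 0" and g: "g \<in> Wset p v1 a b"
    and ab: "0 < \<alpha>" "\<alpha> < \<beta>" and supp: "\<And>x. 0 < x \<Longrightarrow> x \<notin> {\<alpha><..<\<beta>} \<Longrightarrow> f x = 0"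
    and D: "nnI {0<..} (\<lambda>x. w x powr (1 - p) * \<bar>h x\<bar> powr p) \<le> ennreal D" "0 \<le> D"
    and H: "nnI {0<..} (\<lambda>x. w x * \<bar>f x / V x\<bar> powr p) \<le> ennreal H" "0 \<le> H"
  shows "\<bar>LINT x:{0<..}|lebesgue. g x * f x\<bar> \<le> 2 * (D powr (1 / p) + H powr (1 / p)) * Wnorm p v1 a b g"
proof -
  have "\<bar>LINT x:{0<..}|lebesgue. f x * g x\<bar> \<le> 2 * (D powr (1 / p) * (Wnorm p v1 a b g powr q) powr (1 / q) + H powr (1 / p) * (Wnorm p v1 a b g powr q) powr (1 / q))"
    by (rule duality_pairing[OF f hz Wnorm_D(1)[OF g] ab supp D H Wnorm_D(2)[OF g] _ Wnorm_D(3)[OF g]]) auto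
  moreover have "(Wnorm p v1 a b g powr q) powr (1 / q) = Wnorm p v1 a b g" using q1 Wnorm_nonneg[of g] by (simp add: powr_powr)
  ultimately show ?thesis by (simp add: algebra_simps)
qed


end

text \<open>Here \<open>f\<close> has already been changed on a null set so as to vanish everywhere
  outside an interval, and \<open>J\<close> is any bound for the functional. This separates the
  regularity argument from the definition of \<open>Jfun\<close>.\<close>

locale dual_element = oscillation +
  fixes f :: "real \<Rightarrow> real" and J \<alpha> \<beta> :: real
  assumes fD: "f \<in> Dset (Wset p v1 a b)" and J0: "0 \<le> J"
    and JB: "\<And>g. g \<in> Wset p v1 a b \<Longrightarrow> \<bar>LINT x:{0<..}|lebesgue. g x * f x\<bar> \<le> J * Wnorm p v1 a b g"
    and ab: "0 < \<alpha>" "\<alpha> < \<beta>" and fz: "\<And>x. 0 < x \<Longrightarrow> x \<notin> {\<alpha><..<\<beta>} \<Longrightarrow> f x = 0"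
begin

lemma f_meas: "f \<in> borel_measurable (lebesgue_on {0<..})" using fD by (simp add: Dset_def)

lemma gf_finite: "g \<in> Wset p v1 a b \<Longrightarrow> nnI {0<..} (\<lambda>x. \<bar>g x * f x\<bar>) < \<infinity>" using fD by (simp add: Dset_def)

lemma gf_L1: assumes g: "g \<in> Wset p v1 a b" shows "L1loc (\<lambda>x. g x * f x)"
proof -
  have m: "(\<lambda>x. g x * f x) \<in> borel_measurable (lebesgue_on {0<..})"
    using f_meas L1loc_measurable[OF Wnorm_D(1)[OF g]] by measurable
  have "L1loc (\<lambda>x. \<bar>g x * f x\<bar>)" by (rule L1loc_nnI[OF borel_measurable_abs[OF m] _ gf_finite[OF g]]) simp
  then show ?thesis by (rule L1loc_dom[OF _ m]) (intro exI[of _ 1], simp)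
qed

lemma gf_LINT: assumes g: "g \<in> Wset p v1 a b" and l: "0 < l" "l \<le> \<alpha>" "\<beta> \<le> r"
  shows "(LINT x:{0<..}|lebesgue. g x * f x) = integral {l..r} (\<lambda>x. g x * f x)"
  by (rule LINT_pos_eq[OF l(1) L1locD[OF gf_L1[OF g] l(1)]]) (use fz l in auto)

text \<open>Weighted \<open>L\<^sup>p\<close> duality: the test function is
  \<open>w * sgn f * \<bar>f\<bar> powr (p - 1) * V powr (- p)\<close> with
  \<open>\<bar>f\<bar>\<close> truncated at \<open>n\<close> in the power. Its norm is governed by
  an integral that the pairing dominates, so \<open>self_bound\<close> applies, and Fatou's lemma
  removes the truncation. The 8 is that of \<open>W_weighted\<close>.\<close>

lemma weighted_bound:
  "nnI {0<..} (\<lambda>x. w x * \<bar>f x / V x\<bar> powr p) \<le> ennreal ((8 * J) powr p)"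
proof (rule nnI_fatou)
  define T where "T n x = min \<bar>f x\<bar> (real n)" for n x
  define k where "k n x = w x * (T n x powr p * V x powr (- p))" for n x
  define \<psi> where "\<psi> n x = sgn (f x) * T n x powr (p - 1) * V x powr (- p)" for n x
  have T: "0 \<le> T n x" "T n x \<le> real n" "T n x \<le> \<bar>f x\<bar>" for n x by (auto simp: T_def)
  have Tm: "T n \<in> borel_measurable (lebesgue_on {0<..})" for n unfolding T_def[abs_def] using f_meas by measurable
  have km: "k n \<in> borel_measurable (lebesgue_on {0<..})" for n unfolding k_def[abs_def] using Tm by measurable
  have \<psi>m: "\<psi> n \<in> borel_measurable (lebesgue_on {0<..})" for n unfolding \<psi>_def[abs_def] using Tm f_meas by measurable
  have kn: "0 \<le> k n x" for n x by (simp add: k_def w_nonneg)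
  have LwV: "L1loc (\<lambda>x. C * (w x * V x powr r))" for C r
    using L1loc_cmult[OF L1loc_cont_mult[OF powr_V_cont w_L1, of r], of C] by (simp add: mult.commute)
  have Lk: "L1loc (k n)" for n
  proof (rule L1loc_dom[OF LwV[of "real n powr p" "- p"] km], intro exI[of _ 1] ballI)
    fix t
    have "T n t powr p \<le> real n powr p" using T p1 by (intro powr_mono2) auto
    then have "T n t powr p * (w t * V t powr (- p)) \<le> real n powr p * (w t * V t powr (- p))"
      by (intro mult_right_mono) (auto simp: w_nonneg)
    then show "\<bar>k n t\<bar> \<le> 1 * \<bar>real n powr p * (w t * V t powr - p)\<bar>" by (simp add: k_def abs_mult w_nonneg ac_simps)
  qed
  have L\<psi>: "L1loc (\<lambda>x. w x * \<psi> n x)" for n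
  proof (rule L1loc_dom[OF LwV[of "real n powr (p - 1)" "- p"]], goal_cases)
    case 1 show ?case using \<psi>m[of n] by measurable
  next
    case (2 x y)
    show ?case
    proof (intro exI[of _ 1] ballI)
      fix t
      have "\<bar>sgn (f t)\<bar> * T n t powr (p - 1) \<le> 1 * real n powr (p - 1)"
        using T p1 by (intro mult_mono powr_mono2) (auto simp: sgn_if)
      then have "\<bar>sgn (f t)\<bar> * T n t powr (p - 1) * (w t * V t powr (- p)) \<le> real n powr (p - 1) * (w t * V t powr (- p))"
        by (intro mult_right_mono) (auto simp: w_nonneg)
      then show "\<bar>w t * \<psi> n t\<bar> \<le> 1 * \<bar>real n powr (p - 1) * (w t * V t powr - p)\<bar>" by (simp add: \<psi>_def abs_mult w_nonneg ac_simps)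
    qed
  qed
  have e: "w x * (\<bar>\<psi> n x\<bar> * V x) powr q = k n x" if x: "0 < x" for n x
  proof (cases "f x = 0")
    case True then show ?thesis using q1 p1 by (simp add: \<psi>_def k_def T_def)
  next
    case False
    have "\<bar>\<psi> n x\<bar> * V x = T n x powr (p - 1) * (V x * V x powr (- p))"
      using False V_pos[OF x] by (simp add: \<psi>_def abs_mult abs_sgn_eq)
    also have "\<dots> = T n x powr (p - 1) * V x powr (1 - p)" using V_pos[OF x] by (simp add: powr_mult_base)
    finally have "(\<bar>\<psi> n x\<bar> * V x) powr q = (T n x powr (p - 1)) powr q * (V x powr (1 - p)) powr q"
      by (simp add: powr_mult)
    also have "\<dots> = T n x powr p * V x powr (- p)"
    proof -
      have "(1 - p) * q = - p" using pq'(1) by (simp add: algebra_simps)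
      then show ?thesis by (simp add: powr_powr pq'(1))
    qed
    finally show ?thesis by (simp add: k_def)
  qed
  have Lq: "L1loc (\<lambda>x. w x * (\<bar>\<psi> n x\<bar> * V x) powr q)" for n
  proof (rule L1loc_dom[OF Lk[of n]])
    show "(\<lambda>x. w x * (\<bar>\<psi> n x\<bar> * V x) powr q) \<in> borel_measurable (lebesgue_on {0<..})" using \<psi>m[of n] by measurable
  qed (intro exI[of _ 1], simp add: e)
  show "k n \<in> borel_measurable (lebesgue_on {0<..})" for n by (rule km)
  show "nnI {0<..} (k n) \<le> ennreal ((8 * J) powr p)" for n
  proof -
    define I where "I = integral {\<alpha>..\<beta>} (k n)"
    have I0: "0 \<le> I" unfolding I_def by (intro Henstock_Kurzweil_Integration.integral_nonneg L1loc_integrable[OF Lk ab(1)] kn)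
    have kI: "nnI {0<..} (k n) = ennreal I" unfolding I_def
      by (rule nnI_supp[OF Lk kn ab(1)]) (use fz p1 in \<open>auto simp: k_def T_def\<close>)
    have "nnI {0<..} (\<lambda>x. w x * (\<bar>\<psi> n x\<bar> * V x) powr q) = nnI {0<..} (k n)" by (rule nnI_cong) (use e in auto)
    with kI have eI: "nnI {0<..} (\<lambda>x. w x * (\<bar>\<psi> n x\<bar> * V x) powr q) \<le> ennreal I" by simp
    note W = W_weighted[OF \<psi>m L\<psi> Lq eI I0]
    have "I \<le> integral {\<alpha>..\<beta>} (\<lambda>x. w x * \<psi> n x * f x)" unfolding I_def
    proof (rule integral_le[OF L1loc_integrable[OF Lk ab(1)] L1loc_integrable[OF gf_L1[OF W(1)] ab(1)]])
      fix x
      have "w x * \<psi> n x * f x = w x * V x powr (- p) * (T n x powr (p - 1) * \<bar>f x\<bar>)" by (simp add: \<psi>_def sgn_if)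
      moreover have "T n x powr (p - 1) * T n x \<le> T n x powr (p - 1) * \<bar>f x\<bar>" using T by (intro mult_left_mono) auto
      then have "T n x powr p \<le> T n x powr (p - 1) * \<bar>f x\<bar>" using powr_mult_base[OF T(1)[of n x], of "p - 1"] by (simp add: mult.commute)
      then have "w x * V x powr (- p) * T n x powr p \<le> w x * V x powr (- p) * (T n x powr (p - 1) * \<bar>f x\<bar>)"
        by (intro mult_left_mono) (auto simp: w_nonneg)
      moreover have "k n x = w x * V x powr (- p) * T n x powr p" by (simp add: k_def)
      ultimately show "k n x \<le> w x * \<psi> n x * f x" by linarith
    qed
    also have "\<dots> = (LINT x:{0<..}|lebesgue. w x * \<psi> n x * f x)" by (rule gf_LINT[OF W(1) ab(1), symmetric]) auto
    also have "\<dots> \<le> J * Wnorm p v1 a b (\<lambda>x. w x * \<psi> n x)" using JB[OF W(1)] by simp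
    also have "\<dots> \<le> J * (8 * I powr (1 / q))" by (rule mult_left_mono[OF W(2) J0])
    finally have "I \<le> (8 * J) powr p" using self_bound[OF p1 pq I0, of "8 * J"] J0 by (simp add: ac_simps)
    then show ?thesis unfolding kI by (rule ennreal_leI)
  qed
  fix x :: real assume x: "0 < x"
  obtain m where m: "\<bar>f x\<bar> \<le> real m" using real_arch_simple by blast
  have "k n x = w x * \<bar>f x / V x\<bar> powr p" if "m \<le> n" for n
  proof -
    have "T n x = \<bar>f x\<bar>" using m that by (simp add: T_def)
    then show ?thesis using V_pos[OF x] by (simp add: k_def powr_divide powr_minus_divide abs_divide)
  qed
  then have "\<forall>\<^sub>F n in sequentially. k n x = w x * \<bar>f x / V x\<bar> powr p" by (auto simp: eventually_sequentially intro!: exI[of _ m])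
  then show "(\<lambda>n. k n x) \<longlonglongrightarrow> w x * \<bar>f x / V x\<bar> powr p" by (rule tendsto_eventually)
qed

lemma F_L1: "L1loc (\<lambda>x. V x * f x)"
proof -
  have m: "(\<lambda>x. V x * f x) \<in> borel_measurable (lebesgue_on {0<..})" using f_meas by measurable
  show ?thesis
  proof (rule L1loc_dom[OF dual_L1loc[OF fD] m], intro exI[of _ 1] ballI)
    fix x y t :: real assume "0 < x" "t \<in> {x..y}"
    then show "\<bar>V t * f t\<bar> \<le> 1 * \<bar>V t * \<bar>f t\<bar>\<bar>" by (simp add: abs_mult)
  qed
qed

lemma prim_pairing:
  assumes U: "prim U u" and N: "nnI {0<..} (\<lambda>x. Wd x * \<bar>U x\<bar> powr q) \<le> ennreal N" "0 \<le> N"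
    and l: "0 < l" "l \<le> \<alpha>" "\<beta> \<le> r"
  shows "\<bar>integral {l..r} (\<lambda>x. V x * f x * u x)\<bar> \<le> 32 * J * N powr (1 / q)"
proof -
  have "nnI {0<..} (\<lambda>x. w x * (V x * \<bar>U x\<bar>) powr q) = nnI {0<..} (\<lambda>x. Wd x * \<bar>U x\<bar> powr q)"
    by (rule nnI_cong) (simp add: Wd_def powr_mult)
  with N have "nnI {0<..} (\<lambda>x. w x * (V x * \<bar>U x\<bar>) powr q) \<le> ennreal N" by simp
  note W = W_prim[OF U this N(2)]
  have "\<bar>integral {l..r} (\<lambda>x. V x * u x * f x)\<bar> \<le> J * Wnorm p v1 a b (\<lambda>x. V x * u x)"
    using JB[OF W(1)] unfolding gf_LINT[OF W(1) l] .
  also have "\<dots> \<le> J * (32 * N powr (1 / q))" by (rule mult_left_mono[OF W(2) J0])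
  finally show ?thesis by (simp add: ac_simps)
qed

end

section \<open>Regularity of elements of the dual\<close>

text \<open>The sequence \<open>1 / (n + 1)\<close> identifies the limit, and the Cauchy condition
  for all small arguments transfers it to the whole filter.\<close>

lemma tendsto_at_right_Cauchy:
  fixes g :: "real \<Rightarrow> real"
  assumes C: "\<And>\<eta>. 0 < \<eta> \<Longrightarrow> \<exists>M>0. \<forall>d e. 0 < d \<longrightarrow> d \<le> M \<longrightarrow> 0 < e \<longrightarrow> e \<le> M \<longrightarrow> \<bar>g d - g e\<bar> \<le> \<eta>"
  shows "\<exists>L. (g \<longlongrightarrow> L) (at_right 0)"
proof -
  define s where "s n = 1 / real (Suc n)" for n
  have s0: "0 < s n" for n by (simp add: s_def)
  have sl: "s \<longlonglongrightarrow> 0" unfolding s_def by (rule LIMSEQ_Suc[OF lim_1_over_n])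
  have small: "\<exists>N. \<forall>n\<ge>N. s n \<le> M" if "0 < M" for M
    using order_tendstoD(2)[OF sl that] by (auto simp: eventually_sequentially intro: less_imp_le)
  have "Cauchy (\<lambda>n. g (s n))"
  proof (rule metric_CauchyI)
    fix \<eta> :: real assume "0 < \<eta>"
    then obtain M where M: "0 < M" "\<forall>d e. 0 < d \<longrightarrow> d \<le> M \<longrightarrow> 0 < e \<longrightarrow> e \<le> M \<longrightarrow> \<bar>g d - g e\<bar> \<le> \<eta> / 2" using C[of "\<eta> / 2"] by auto
    obtain N where N: "\<forall>n\<ge>N. s n \<le> M" using small[OF M(1)] by blast
    show "\<exists>N. \<forall>m\<ge>N. \<forall>n\<ge>N. dist (g (s m)) (g (s n)) < \<eta>"
    proof (intro exI[of _ N] allI impI)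
      fix m n assume "N \<le> m" "N \<le> n"
      then have "\<bar>g (s m) - g (s n)\<bar> \<le> \<eta> / 2" using M(2) N s0 by simp
      then show "dist (g (s m)) (g (s n)) < \<eta>" using \<open>0 < \<eta>\<close> by (simp add: dist_real_def)
    qed
  qed
  from Cauchy_convergent[OF this] obtain L where L: "(\<lambda>n. g (s n)) \<longlonglongrightarrow> L" by (auto simp: convergent_def)
  have "(g \<longlongrightarrow> L) (at_right 0)"
  proof (rule tendstoI)
    fix \<eta> :: real assume e: "0 < \<eta>"
    then obtain M where M: "0 < M" "\<forall>d e. 0 < d \<longrightarrow> d \<le> M \<longrightarrow> 0 < e \<longrightarrow> e \<le> M \<longrightarrow> \<bar>g d - g e\<bar> \<le> \<eta> / 2" using C[of "\<eta> / 2"] by auto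
    have "dist (g d) L < \<eta>" if d: "0 < d" "d < M" for d
    proof -
      obtain N where N: "\<forall>n\<ge>N. s n \<le> M" using small[OF M(1)] by blast
      have "\<bar>g d - L\<bar> \<le> \<eta> / 2"
      proof (rule tendsto_upperbound)
        show "(\<lambda>n. \<bar>g d - g (s n)\<bar>) \<longlonglongrightarrow> \<bar>g d - L\<bar>" by (intro tendsto_intros L)
        show "\<forall>\<^sub>F n in sequentially. \<bar>g d - g (s n)\<bar> \<le> \<eta> / 2"
          unfolding eventually_sequentially using M(2) N s0 d by (intro exI[of _ N]) auto
      qed simp
      then show ?thesis using e by (simp add: dist_real_def)
    qed
    then show "\<forall>\<^sub>F d in at_right 0. dist (g d) L < \<eta>"
      unfolding eventually_at_right_field using M(1) by blast
  qed
  then show ?thesis by (rule exI)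
qed

section \<open>Ramps, averages and the continuous representative\<close>

definition ramp :: "real \<Rightarrow> real \<Rightarrow> real \<Rightarrow> real" where
  "ramp e x s = (max x (min (x + e) s) - x) / e"

lemma ramp_prim:
  assumes "0 < x" "0 < e"
  shows "prim (ramp e x) (\<lambda>s. if s \<in> {x..x + e} then 1 / e else 0)"
proof -
  have "prim (\<lambda>s. s) (\<lambda>s. 1)" by (rule cont_deriv_prim) (auto intro!: derivative_eq_intros)
  from prim_max_min(2)[OF prim_max_min(1)[OF this assms(1)], of "x + e"] assms
  have "prim (\<lambda>s. max x (min (x + e) s)) (\<lambda>s. if s \<in> {..x + e} then if s \<in> {x..} then 1 else 0 else 0)" by simp
  from prim_cmult[OF prim_shift[OF this, of "- x"], of "1 / e"] show ?thesis
    by (rule prim_cong_on) (auto simp: ramp_def)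
qed

lemma ramp_simps: 
  assumes "0 < e" shows "0 \<le> ramp e x s" "ramp e x s \<le> 1" "s \<le> x \<Longrightarrow> ramp e x s = 0" "x + e \<le> s \<Longrightarrow> ramp e x s = 1"
  using assms by (auto simp: ramp_def divide_le_eq)

lemma window_integrable: "(\<lambda>t. if t \<in> {u..v} then 1 else 0 :: real) integrable_on {x..y::real}"
  unfolding Henstock_Kurzweil_Integration.integrable_restrict_Int by (simp add: integrable_const_ivl)

text \<open>A trapezoid is a moving average of the indicator of \<open>{x..y}\<close>. In this form
  it is visibly nonnegative, and trapezoids over non-overlapping intervals add up to at most
  one.\<close>

lemma ramp_diff:
  assumes "0 < e" "x < y"
  shows "ramp e x s - ramp e y s = integral {x..y} (\<lambda>t. if t \<in> {s - e..s} then 1 else 0) / e"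
proof -
  have "integral {x..y} (\<lambda>t. if t \<in> {s - e..s} then 1 else 0) = integral ({s - e..s} \<inter> {x..y}) (\<lambda>t. 1 :: real)"
    by (rule Henstock_Kurzweil_Integration.integral_restrict_Int)
  also have "\<dots> = max x (min (x + e) s) - x - (max y (min (y + e) s) - y)"
    using assms by (auto simp: max_def min_def)
  finally show ?thesis by (simp add: ramp_def diff_divide_distrib)
qed

context dual_element
begin

definition \<Phi> :: "real \<Rightarrow> real" where "\<Phi> = (SOME P. prim P (\<lambda>x. V x * f x))"
definition \<Theta> :: "real \<Rightarrow> real" where "\<Theta> = (SOME P. prim P Wd)"
lemma Phi_prim: "prim \<Phi> (\<lambda>x. V x * f x)" unfolding \<Phi>_def by (rule someI_ex[OF prim_exists[OF F_L1]])
lemma Theta_prim: "prim \<Theta> Wd" unfolding \<Theta>_def by (rule someI_ex[OF prim_exists[OF Wd_L1]])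

text \<open>The pairing of \<open>V * f\<close> with the derivative of a ramp. Values of
  \<open>V * f\<close> at points carry no information yet, but these averages do.\<close>

definition avg :: "real \<Rightarrow> real \<Rightarrow> real" where "avg e x = (\<Phi> (x + e) - \<Phi> x) / e"

lemma avg_integral:
  assumes l: "0 < l" "l \<le> x" "x + e \<le> r" and e: "0 < e"
  shows "((\<lambda>s. V s * f s * (if s \<in> {x..x + e} then 1 / e else 0)) has_integral avg e x) {l..r}"
proof -
  have "((\<lambda>s. V s * f s) has_integral (\<Phi> (x + e) - \<Phi> x)) {x..x + e}" by (rule prim_has_integral[OF Phi_prim]) (use l e in auto)
  from has_integral_mult_right[OF this, of "1 / e"]
  have "((\<lambda>s. 1 / e * (V s * f s)) has_integral avg e x) {x..x + e}" by (simp add: avg_def)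
  then have "((\<lambda>s. if s \<in> {x..x + e} then 1 / e * (V s * f s) else 0) has_integral avg e x) {l..r}"
    by (subst has_integral_restrict) (use l in auto)
  then show ?thesis by (rule has_integral_eq[rotated]) auto
qed

text \<open>Differences of averages are pairings of \<open>f\<close> with \<open>V * u\<close>,
  where \<open>u\<close> is the density of a combination of differences of ramps. The size of that
  combination in the weight \<open>Wd\<close> therefore controls them.\<close>

lemma avg_pairing:
  fixes x y d e C :: "'i \<Rightarrow> real"
  assumes I: "finite I" and l: "0 < l" "l \<le> \<alpha>" "\<beta> \<le> r"
    and xy: "\<And>i. i \<in> I \<Longrightarrow> l \<le> x i \<and> x i + e i \<le> r \<and> 0 < e i \<and> l \<le> y i \<and> y i + d i \<le> r \<and> 0 < d i"
    and N: "nnI {0<..} (\<lambda>s. Wd s * \<bar>\<Sum>i\<in>I. C i * (ramp (e i) (x i) s - ramp (d i) (y i) s)\<bar> powr q) \<le> ennreal N" "0 \<le> N"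
  shows "\<bar>\<Sum>i\<in>I. C i * (avg (e i) (x i) - avg (d i) (y i))\<bar> \<le> 32 * J * N powr (1 / q)"
proof -
  let ?u = "\<lambda>i s. C i * ((if s \<in> {x i..x i + e i} then 1 / e i else 0) - (if s \<in> {y i..y i + d i} then 1 / d i else 0))"
  have U: "prim (\<lambda>s. \<Sum>i\<in>I. C i * (ramp (e i) (x i) s - ramp (d i) (y i) s)) (\<lambda>s. \<Sum>i\<in>I. ?u i s)"
    by (intro prim_sum prim_cmult prim_diff ramp_prim) (use xy l in fastforce)+
  have "((\<lambda>s. \<Sum>i\<in>I. C i * (V s * f s * (if s \<in> {x i..x i + e i} then 1 / e i else 0) - V s * f s * (if s \<in> {y i..y i + d i} then 1 / d i else 0)))
     has_integral (\<Sum>i\<in>I. C i * (avg (e i) (x i) - avg (d i) (y i)))) {l..r}"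
    by (intro has_integral_sum I has_integral_mult_right has_integral_diff avg_integral l) (use xy in auto)
  then have "((\<lambda>s. V s * f s * (\<Sum>i\<in>I. ?u i s)) has_integral (\<Sum>i\<in>I. C i * (avg (e i) (x i) - avg (d i) (y i)))) {l..r}"
    by (rule has_integral_eq[rotated]) (simp add: sum_distrib_left right_diff_distrib ac_simps)
  from integral_unique[OF this] prim_pairing[OF U N l] show ?thesis by simp
qed

lemma kernel_le:
  assumes U: "continuous_on {0<..} U" and l: "0 < l" and z: "\<And>s. 0 < s \<Longrightarrow> s \<notin> {l..r} \<Longrightarrow> U s = 0"
    and K: "K integrable_on {l..r}" "\<And>s. s \<in> {l..r} \<Longrightarrow> Wd s * \<bar>U s\<bar> powr q \<le> K s"
  shows "nnI {0<..} (\<lambda>s. Wd s * \<bar>U s\<bar> powr q) \<le> ennreal (integral {l..r} K)"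
proof -
  have "continuous_on {0<..} (\<lambda>s. \<bar>U s\<bar> powr q)" using U q1 by (intro continuous_on_powr' continuous_intros) auto
  from L1loc_cont_mult[OF this Wd_L1] have L: "L1loc (\<lambda>s. Wd s * \<bar>U s\<bar> powr q)" by (simp add: mult.commute)
  have "nnI {0<..} (\<lambda>s. Wd s * \<bar>U s\<bar> powr q) = ennreal (integral {l..r} (\<lambda>s. Wd s * \<bar>U s\<bar> powr q))"
    by (rule nnI_supp[OF L _ l]) (use z q1 Wd_nonneg in auto)
  also have "\<dots> \<le> ennreal (integral {l..r} K)"
    by (intro ennreal_leI integral_le L1loc_integrable[OF L l] K)
  finally show ?thesis .
qed

lemma powr_q_le: "0 \<le> u \<Longrightarrow> u \<le> 1 \<Longrightarrow> u powr q \<le> u"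
  using powr_mono'[of 1 q u] q1 by simp

lemma Theta_mono: "0 < x \<Longrightarrow> x \<le> y \<Longrightarrow> \<Theta> x \<le> \<Theta> y"
  using primD[OF Theta_prim, of x y] Henstock_Kurzweil_Integration.integral_nonneg[OF L1loc_integrable[OF Wd_L1, of x y]] Wd_nonneg by simp

text \<open>Two ramps starting at \<open>x\<close> differ only on \<open>{x..x + M}\<close>, and
  there by at most one.\<close>

lemma avg_Cauchy:
  assumes x: "0 < x" and d: "0 < d" "d \<le> M" and e: "0 < e" "e \<le> M"
  shows "\<bar>avg d x - avg e x\<bar> \<le> 32 * J * (\<Theta> (x + M) - \<Theta> x) powr (1 / q)"
proof -
  let ?U = "\<lambda>s. ramp d x s - ramp e x s"
  have c: "continuous_on {0<..} ?U" by (intro continuous_intros prim_continuous[OF ramp_prim] x d e)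
  have "nnI {0<..} (\<lambda>s. Wd s * \<bar>?U s\<bar> powr q) \<le> ennreal (integral {x..x + M} Wd)"
  proof (rule kernel_le[OF c x])
    fix s assume "s \<notin> {x..x + M}" then show "?U s = 0" using ramp_simps(3,4)[OF d(1), of s x] ramp_simps(3,4)[OF e(1), of s x] ramp_simps(4)[OF e(1), of x s] ramp_simps(4)[OF d(1), of x s] d e by (cases "s < x") auto
  next
    fix s
    have "\<bar>?U s\<bar> \<le> 1" using ramp_simps(1,2)[OF d(1), of x s] ramp_simps(1,2)[OF e(1), of x s] by linarith
    then have "\<bar>?U s\<bar> powr q \<le> 1" using powr_q_le[of "\<bar>?U s\<bar>"] by simp
    then show "Wd s * \<bar>?U s\<bar> powr q \<le> Wd s" using Wd_nonneg[of s] by (simp add: mult_left_le)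
  qed (rule L1loc_integrable[OF Wd_L1 x])
  also have "integral {x..x + M} Wd = \<Theta> (x + M) - \<Theta> x" by (rule primD[OF Theta_prim x]) (use d in simp)
  finally have N: "nnI {0<..} (\<lambda>s. Wd s * \<bar>?U s\<bar> powr q) \<le> ennreal (\<Theta> (x + M) - \<Theta> x)" .
  have N0: "0 \<le> \<Theta> (x + M) - \<Theta> x" using Theta_mono[OF x, of "x + M"] d by simp
  have "\<bar>\<Sum>i\<in>{()}. 1 * (avg d x - avg e x)\<bar> \<le> 32 * J * (\<Theta> (x + M) - \<Theta> x) powr (1 / q)"
    by (rule avg_pairing[where l = "min x \<alpha>" and r = "max (x + M) \<beta>" and x = "\<lambda>_. x" and y = "\<lambda>_. x" and C = "\<lambda>_. 1" and e = "\<lambda>_. d" and d = "\<lambda>_. e"])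
      (use N N0 x d e ab in auto)
  then show ?thesis by simp
qed

lemma Theta_right: "0 < x \<Longrightarrow> ((\<lambda>e. \<Theta> (x + e)) \<longlongrightarrow> \<Theta> x) (at_right 0)"
proof -
  assume x: "0 < x"
  have "isCont \<Theta> x" using prim_continuous[OF Theta_prim] x by (simp add: continuous_on_eq_continuous_at)
  then show ?thesis by (rule isCont_tendsto_compose) (auto intro!: tendsto_eq_intros)
qed

text \<open>The continuous representative of \<open>V * f\<close>. Boundedness of the functional
  makes the averages Cauchy, so their limit exists at every positive point and not merely at
  Lebesgue points.\<close>

definition Ft :: "real \<Rightarrow> real" where "Ft x = (SOME L. ((\<lambda>e. avg e x) \<longlongrightarrow> L) (at_right 0))"

lemma Ft_lim: assumes x: "0 < x" shows "((\<lambda>e. avg e x) \<longlongrightarrow> Ft x) (at_right 0)"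
  unfolding Ft_def
proof (rule someI_ex[of "\<lambda>L. ((\<lambda>e. avg e x) \<longlongrightarrow> L) (at_right 0)"], rule tendsto_at_right_Cauchy)
  fix \<eta> :: real assume \<eta>: "0 < \<eta>"
  have "((\<lambda>e. \<Theta> (x + e) - \<Theta> x) \<longlongrightarrow> \<Theta> x - \<Theta> x) (at_right 0)" by (intro tendsto_diff Theta_right x tendsto_const)
  then have "((\<lambda>e. \<Theta> (x + e) - \<Theta> x) \<longlongrightarrow> 0) (at_right 0)" by simp
  moreover have "0 < (\<eta> / (32 * J + 1)) powr q" using \<eta> J0 by simp
  ultimately have "\<forall>\<^sub>F e in at_right 0. \<Theta> (x + e) - \<Theta> x < (\<eta> / (32 * J + 1)) powr q" by (rule order_tendstoD(2))
  then obtain b where b: "0 < b" "\<And>e. 0 < e \<Longrightarrow> e < b \<Longrightarrow> \<Theta> (x + e) - \<Theta> x < (\<eta> / (32 * J + 1)) powr q"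
    unfolding eventually_at_right_field by auto
  have M: "\<Theta> (x + b / 2) - \<Theta> x < (\<eta> / (32 * J + 1)) powr q" using b by simp
  have M0: "0 \<le> \<Theta> (x + b / 2) - \<Theta> x" using Theta_mono[OF x, of "x + b / 2"] b by simp
  have "(\<Theta> (x + b / 2) - \<Theta> x) powr (1 / q) \<le> ((\<eta> / (32 * J + 1)) powr q) powr (1 / q)" using M M0 q1 by (intro powr_mono2) auto
  also have "\<dots> = \<eta> / (32 * J + 1)" using q1 \<eta> J0 by (simp add: powr_powr)
  finally have "32 * J * (\<Theta> (x + b / 2) - \<Theta> x) powr (1 / q) \<le> 32 * J * (\<eta> / (32 * J + 1))" using J0 by (intro mult_left_mono) auto
  also have "\<dots> \<le> \<eta>" using \<eta> J0 by (simp add: divide_le_eq algebra_simps)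
  finally have le: "32 * J * (\<Theta> (x + b / 2) - \<Theta> x) powr (1 / q) \<le> \<eta>" .
  show "\<exists>M>0. \<forall>d e. 0 < d \<longrightarrow> d \<le> M \<longrightarrow> 0 < e \<longrightarrow> e \<le> M \<longrightarrow> \<bar>avg d x - avg e x\<bar> \<le> \<eta>"
  proof (intro exI[of _ "b / 2"] conjI allI impI)
    fix d e assume "0 < d" "d \<le> b / 2" "0 < e" "e \<le> b / 2"
    from avg_Cauchy[OF x this] show "\<bar>avg d x - avg e x\<bar> \<le> \<eta>" using le by linarith
  qed (use b in simp)
qed

lemma Ft_AE: "AE x in lebesgue. 0 < x \<longrightarrow> Ft x = V x * f x"
  using prim_lebesgue_diff[OF Phi_prim]
proof eventually_elim
  case (elim x)
  show ?case
  proof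
    assume x: "0 < x"
    show "Ft x = V x * f x"
      by (rule tendsto_unique[OF _ Ft_lim[OF x]]) (use elim x in \<open>simp_all add: avg_def\<close>)
  qed
qed

text \<open>The averages look to the right. Hence \<open>\<beta>\<close> is included but
  \<open>\<alpha>\<close> is not: averages starting at \<open>\<alpha>\<close> see the
  support.\<close>

lemma Ft_zero: assumes x: "0 < x" "x < \<alpha> \<or> \<beta> \<le> x" shows "Ft x = 0"
proof (rule tendsto_unique[OF _ Ft_lim[OF x(1)]])
  define b where "b = (if x < \<alpha> then \<alpha> - x else 1)"
  have b: "0 < b" using x by (simp add: b_def)
  have "avg e x = 0" if e: "0 < e" "e < b" for e
  proof -
    have "integral {x..x + e} (\<lambda>s. V s * f s) = integral {x..x + e} (\<lambda>s. 0)"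
      by (rule integral_cong) (use fz x e in \<open>auto simp: b_def split: if_splits\<close>)
    then show ?thesis using primD[OF Phi_prim x(1), of "x + e"] e by (simp add: avg_def)
  qed
  then have "\<forall>\<^sub>F e in at_right 0. avg e x = 0" unfolding eventually_at_right_field using b by auto
  then show "((\<lambda>e. avg e x) \<longlongrightarrow> 0) (at_right 0)" by (rule tendsto_eventually)
qed simp

lemma ramp_fam_sum:
  assumes I: "fam l r I" and e: "0 < e" and lr: "l \<le> r"
  shows "(\<Sum>(x, y)\<in>I. ramp e x s - ramp e y s) \<le> 1"
proof -
  let ?h = "\<lambda>t. if t \<in> {s - e..s} then 1 else 0 :: real"
  have "(\<Sum>(x, y)\<in>I. ramp e x s - ramp e y s) = (\<Sum>(x, y)\<in>I. integral {x..y} ?h) / e"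
    unfolding sum_divide_distrib by (rule sum.cong) (use ramp_diff[OF e] famD[OF I] in auto)
  moreover have "(\<Sum>(x, y)\<in>I. integral {x..y} ?h) \<le> integral {l..r} ?h"
    by (rule fam_integral[OF I window_integrable]) simp
  moreover have "integral {l..r} ?h \<le> e"
    unfolding Henstock_Kurzweil_Integration.integral_restrict_Int using e by (auto simp: max_def min_def)
  ultimately show ?thesis using e by (simp add: divide_le_eq)
qed

text \<open>One functional tests all increments at once, the signs \<open>C\<close> turning the sum
  of pairings into a sum of moduli. The combination of trapezoids has modulus at most one and lives
  on the intervals \<open>{x..y + e}\<close>. As \<open>t powr q \<le> t\<close> for such values,
  its size is bounded by the sum of the \<open>Wd\<close>-masses of these intervals.\<close>

lemma avg_variation:
  assumes lo: "0 < lo" and I: "fam lo hi I" and e: "0 < e" "e \<le> 1" and lh: "lo \<le> hi"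
  shows "(\<Sum>(x, y)\<in>I. \<bar>avg e y - avg e x\<bar>) \<le> 32 * J * (\<Sum>(x, y)\<in>I. \<Theta> (y + e) - \<Theta> x) powr (1 / q)"
proof -
  define C where "C i = sgn (avg e (fst i) - avg e (snd i))" for i
  let ?\<tau> = "\<lambda>i s. ramp e (fst i) s - ramp e (snd i) s"
  let ?U = "\<lambda>s. \<Sum>i\<in>I. C i * ?\<tau> i s"
  let ?N = "\<Sum>(x, y)\<in>I. \<Theta> (y + e) - \<Theta> x"
  have fI: "finite I" by (rule fam_finite[OF I])
  have i: "lo \<le> fst i" "fst i < snd i" "snd i \<le> hi" if "i \<in> I" for i using famD[OF I, of "fst i" "snd i"] that by auto
  have \<tau>0: "0 \<le> ?\<tau> i s" if "i \<in> I" for i s unfolding ramp_diff[OF e(1) i(2)[OF that]]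
    by (intro divide_nonneg_pos Henstock_Kurzweil_Integration.integral_nonneg window_integrable e) simp
  have \<tau>s: "(\<Sum>i\<in>I. ?\<tau> i s) \<le> 1" for s using ramp_fam_sum[OF I e(1) lh] by (simp add: case_prod_beta)
  have ii: "(\<lambda>s. if s \<in> {fst i..snd i + e} then Wd s else 0) integrable_on {lo..hi + 1}"
    "integral {lo..hi + 1} (\<lambda>s. if s \<in> {fst i..snd i + e} then Wd s else 0) = \<Theta> (snd i + e) - \<Theta> (fst i)" if "i \<in> I" for i
  proof -
    have sub: "{fst i..snd i + e} \<inter> {lo..hi + 1} = {fst i..snd i + e}" using i[OF that] e by auto
    have x: "0 < fst i" using i[OF that] lo by simp
    show "(\<lambda>s. if s \<in> {fst i..snd i + e} then Wd s else 0) integrable_on {lo..hi + 1}"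
      unfolding Henstock_Kurzweil_Integration.integrable_restrict_Int sub by (rule L1loc_integrable[OF Wd_L1 x])
    show "integral {lo..hi + 1} (\<lambda>s. if s \<in> {fst i..snd i + e} then Wd s else 0) = \<Theta> (snd i + e) - \<Theta> (fst i)"
      unfolding Henstock_Kurzweil_Integration.integral_restrict_Int sub by (rule primD[OF Theta_prim x]) (use i[OF that] e in simp)
  qed
  have "nnI {0<..} (\<lambda>s. Wd s * \<bar>?U s\<bar> powr q) \<le> ennreal (integral {lo..hi + 1} (\<lambda>s. \<Sum>i\<in>I. if s \<in> {fst i..snd i + e} then Wd s else 0))"
  proof (rule kernel_le[OF _ lo])
    show "continuous_on {0<..} ?U"
      by (intro continuous_intros prim_continuous[OF ramp_prim] e) (use i lo in fastforce)+
    show "(\<lambda>s. \<Sum>i\<in>I. if s \<in> {fst i..snd i + e} then Wd s else 0) integrable_on {lo..hi + 1}"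
      by (rule integrable_sum[OF fI ii(1)])
  next
    fix s
    have z: "?\<tau> j s = 0" if "j \<in> I" "s \<notin> {fst j..snd j + e}" for j
      using that i[OF that(1)] ramp_simps(3,4)[OF e(1)] e by (cases "s < fst j") auto
    show "?U s = 0" if "s \<notin> {lo..hi + 1}"
      by (rule sum.neutral) (use z i e that in fastforce)
    have "\<bar>?U s\<bar> \<le> (\<Sum>i\<in>I. \<bar>C i * ?\<tau> i s\<bar>)" by (rule sum_abs)
    also have "\<dots> \<le> (\<Sum>i\<in>I. ?\<tau> i s)"
      by (rule sum_mono) (use \<tau>0 in \<open>auto simp: C_def abs_mult sgn_if\<close>)
    finally have U: "\<bar>?U s\<bar> \<le> (\<Sum>i\<in>I. ?\<tau> i s)" .
    have "\<bar>?U s\<bar> powr q \<le> \<bar>?U s\<bar>" by (rule powr_q_le) (use U \<tau>s[of s] in linarith)+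
    also have "\<dots> \<le> (\<Sum>i\<in>I. if s \<in> {fst i..snd i + e} then 1 else 0)"
    proof (rule order_trans[OF U], rule sum_mono)
      fix j assume j: "j \<in> I"
      show "?\<tau> j s \<le> (if s \<in> {fst j..snd j + e} then 1 else 0)"
        using z[OF j] ramp_simps(1)[OF e(1), of "snd j" s] ramp_simps(2)[OF e(1), of "fst j" s] by auto
    qed
    finally have "Wd s * \<bar>?U s\<bar> powr q \<le> Wd s * (\<Sum>i\<in>I. if s \<in> {fst i..snd i + e} then 1 else 0)"
      by (intro mult_left_mono Wd_nonneg)
    then show "Wd s * \<bar>?U s\<bar> powr q \<le> (\<Sum>i\<in>I. if s \<in> {fst i..snd i + e} then Wd s else 0)"
      by (simp add: sum_distrib_left if_distrib cong: if_cong)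
  qed
  also have "integral {lo..hi + 1} (\<lambda>s. \<Sum>i\<in>I. if s \<in> {fst i..snd i + e} then Wd s else 0) = ?N"
    using ii by (simp add: integral_sum[OF fI] case_prod_beta)
  finally have N: "nnI {0<..} (\<lambda>s. Wd s * \<bar>?U s\<bar> powr q) \<le> ennreal ?N" .
  have N0: "0 \<le> ?N"
  proof (rule sum_nonneg)
    fix j assume j: "j \<in> I"
    have "0 \<le> integral {lo..hi + 1} (\<lambda>s. if s \<in> {fst j..snd j + e} then Wd s else 0)"
      by (rule Henstock_Kurzweil_Integration.integral_nonneg[OF ii(1)[OF j]]) (simp add: Wd_nonneg)
    then show "0 \<le> (case j of (x, y) \<Rightarrow> \<Theta> (y + e) - \<Theta> x)" using ii(2)[OF j] by (simp add: case_prod_beta)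
  qed
  have "\<bar>\<Sum>i\<in>I. C i * (avg e (fst i) - avg e (snd i))\<bar> \<le> 32 * J * ?N powr (1 / q)"
    by (rule avg_pairing[OF fI, where l = "min lo \<alpha>" and r = "max (hi + 1) \<beta>" and x = fst and y = snd and C = C and e = "\<lambda>_. e" and d = "\<lambda>_. e"])
      (use N N0 i lo ab e in \<open>fastforce+\<close>)
  moreover have "(\<Sum>i\<in>I. C i * (avg e (fst i) - avg e (snd i))) = (\<Sum>(x, y)\<in>I. \<bar>avg e y - avg e x\<bar>)"
    by (rule sum.cong) (auto simp: C_def sgn_if)
  ultimately show ?thesis by linarith
qed

text \<open>The limit of the estimate for averages as their length tends to zero. It transfers
  absolute continuity from the primitive \<open>\<Theta>\<close> of \<open>Wd\<close> to
  \<open>Ft\<close>.\<close>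

lemma Ft_variation:
  assumes lo: "0 < lo" and I: "fam lo hi I" and lh: "lo \<le> hi"
  shows "(\<Sum>(x, y)\<in>I. \<bar>Ft y - Ft x\<bar>) \<le> 32 * J * (\<Sum>(x, y)\<in>I. \<Theta> y - \<Theta> x) powr (1 / q)"
proof (rule tendsto_le[where F = "at_right (0::real)"])
  have i: "0 < fst j" "fst j < snd j" "0 < snd j" if "j \<in> I" for j using famD[OF I, of "fst j" "snd j"] that lo by auto
  have ev: "\<forall>\<^sub>F e in at_right (0::real). 0 < e \<and> e \<le> 1" unfolding eventually_at_right_field by (intro exI[of _ 1]) auto
  show "((\<lambda>e. \<Sum>(x, y)\<in>I. \<bar>avg e y - avg e x\<bar>) \<longlongrightarrow> (\<Sum>(x, y)\<in>I. \<bar>Ft y - Ft x\<bar>)) (at_right 0)"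
    unfolding case_prod_beta by (intro tendsto_sum tendsto_rabs tendsto_diff Ft_lim i)
  show "((\<lambda>e. 32 * J * (\<Sum>(x, y)\<in>I. \<Theta> (y + e) - \<Theta> x) powr (1 / q)) \<longlongrightarrow> 32 * J * (\<Sum>(x, y)\<in>I. \<Theta> y - \<Theta> x) powr (1 / q)) (at_right 0)"
  proof (intro tendsto_mult tendsto_const tendsto_powr')
    show "((\<lambda>e. \<Sum>(x, y)\<in>I. \<Theta> (y + e) - \<Theta> x) \<longlongrightarrow> (\<Sum>(x, y)\<in>I. \<Theta> y - \<Theta> x)) (at_right 0)"
      unfolding case_prod_beta by (intro tendsto_sum tendsto_diff Theta_right tendsto_const i)
    have "\<forall>\<^sub>F e in at_right 0. 0 \<le> (\<Sum>(x, y)\<in>I. \<Theta> (y + e) - \<Theta> x)" using ev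
    proof eventually_elim
      case (elim e)
      show ?case unfolding case_prod_beta
      proof (rule sum_nonneg)
        fix j assume "j \<in> I"
        then show "0 \<le> \<Theta> (snd j + e) - \<Theta> (fst j)" using Theta_mono[of "fst j" "snd j + e"] i[of j] elim by simp
      qed
    qed
    then show "(\<Sum>(x, y)\<in>I. \<Theta> y - \<Theta> x) \<noteq> 0 \<or> 0 < 1 / q \<and> (\<forall>\<^sub>F e in at_right 0. 0 \<le> (\<Sum>(x, y)\<in>I. \<Theta> (y + e) - \<Theta> x))" using q1 by simp
  qed
  show "\<forall>\<^sub>F e in at_right 0. (\<Sum>(x, y)\<in>I. \<bar>avg e y - avg e x\<bar>) \<le> 32 * J * (\<Sum>(x, y)\<in>I. \<Theta> (y + e) - \<Theta> x) powr (1 / q)"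
    using ev by eventually_elim (rule avg_variation[OF lo I], use lh in auto)
qed simp

lemma Ft_abs_cont: "loc_abs_cont Ft"
  unfolding loc_abs_cont_def abs_cont_on_fam
proof (intro allI impI)
  fix x y \<eta> :: real assume xy: "0 < x" "x < y" and \<eta>: "0 < \<eta>"
  have k: "0 < (\<eta> / (32 * J + 1)) powr q" using \<eta> J0 by simp
  have "abs_cont_on x y \<Theta>" using prim_loc_abs_cont[OF Theta_prim] xy unfolding loc_abs_cont_def by blast
  then obtain \<delta> where \<delta>: "0 < \<delta>" "\<And>I. fam x y I \<Longrightarrow> (\<Sum>(x, y)\<in>I. y - x) < \<delta> \<Longrightarrow> (\<Sum>(x, y)\<in>I. \<bar>\<Theta> y - \<Theta> x\<bar>) < (\<eta> / (32 * J + 1)) powr q"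
    unfolding abs_cont_on_fam using k by meson
  show "\<exists>\<delta>>0. \<forall>I. fam x y I \<and> (\<Sum>(x, y)\<in>I. y - x) < \<delta> \<longrightarrow> (\<Sum>(x, y)\<in>I. \<bar>Ft y - Ft x\<bar>) < \<eta>"
  proof (intro exI[of _ \<delta>] conjI allI impI \<delta>(1))
    fix I assume I: "fam x y I \<and> (\<Sum>(x, y)\<in>I. y - x) < \<delta>"
    have "(\<Sum>(x, y)\<in>I. \<Theta> y - \<Theta> x) \<le> (\<Sum>(x, y)\<in>I. \<bar>\<Theta> y - \<Theta> x\<bar>)" by (rule sum_mono) auto
    also have "\<dots> < (\<eta> / (32 * J + 1)) powr q" using \<delta>(2) I by blast
    finally have s: "(\<Sum>(x, y)\<in>I. \<Theta> y - \<Theta> x) \<le> (\<eta> / (32 * J + 1)) powr q" by simp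
    have "0 \<le> (\<Sum>(x, y)\<in>I. \<Theta> y - \<Theta> x)"
    proof (rule sum_nonneg)
      fix j assume "j \<in> I"
      then show "0 \<le> (case j of (x, y) \<Rightarrow> \<Theta> y - \<Theta> x)" using famD[of x y I "fst j" "snd j"] I xy Theta_mono[of "fst j" "snd j"] by (auto simp: case_prod_beta)
    qed
    then have "(\<Sum>(x, y)\<in>I. \<Theta> y - \<Theta> x) powr (1 / q) \<le> ((\<eta> / (32 * J + 1)) powr q) powr (1 / q)" using s q1 by (intro powr_mono2) auto
    also have "\<dots> = \<eta> / (32 * J + 1)" using q1 \<eta> J0 by (simp add: powr_powr)
    finally have "32 * J * (\<Sum>(x, y)\<in>I. \<Theta> y - \<Theta> x) powr (1 / q) \<le> 32 * J * (\<eta> / (32 * J + 1))" using J0 by (intro mult_left_mono) auto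
    also have "\<dots> < \<eta>" using \<eta> J0 by (simp add: divide_less_eq algebra_simps)
    finally show "(\<Sum>(x, y)\<in>I. \<bar>Ft y - Ft x\<bar>) < \<eta>" using Ft_variation[OF xy(1), of y I] I xy by linarith
  qed
qed

end

lemma integral_AE_eq:
  assumes k: "L1loc k" and e: "AE x in lebesgue. 0 < x \<longrightarrow> k' x = k x" and l: "0 < l" "l \<le> r"
  shows "integral {l..r} k' = integral {l..r} k"
proof -
  obtain K where K: "prim K k" using prim_exists[OF k] by blast
  show ?thesis using primD[OF K l] primD[OF prim_cong_AE[OF K e] l] by simp
qed

lemma prim_translate:
  assumes P: "prim P k" and e: "0 \<le> e"
  shows "prim (\<lambda>x. P (x + e)) (\<lambda>x. k (x + e))"
proof (rule primI)
  show "L1loc (\<lambda>x. k (x + e))" unfolding L1loc_def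
  proof (intro allI impI)
    fix x y :: real assume xy: "0 < x" "x \<le> y"
    have i: "(\<lambda>x. h (x + e)) integrable_on {x..y}" if "L1loc h" for h
      using integrable_shift_real_ivl[OF L1loc_integrable[OF that, of "x + e" "y + e"], of e] xy e by simp
    show "(\<lambda>x. k (x + e)) absolutely_integrable_on {x..y}"
      using i[OF prim_L1[OF P]] i[OF L1loc_abs[OF prim_L1[OF P]]] by (simp add: absolutely_integrable_on_def)
  qed
  fix x y :: real assume xy: "0 < x" "x \<le> y"
  show "integral {x..y} (\<lambda>x. k (x + e)) = P (y + e) - P (x + e)"
    using integral_shift_real_ivl[of "x + e" e "y + e" k] primD[OF P, of "x + e" "y + e"] xy e by simp
qed

lemma dominated_convergence_AE_pos:
  fixes k :: "nat \<Rightarrow> real \<Rightarrow> real"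
  assumes k: "\<And>n. L1loc (k n)" and g: "L1loc g" and k': "k' \<in> borel_measurable (lebesgue_on {0<..})" and l: "0 < l"
    and b: "\<And>n t. t \<in> {l..r} \<Longrightarrow> \<bar>k n t\<bar> \<le> g t" and lim: "AE t in lebesgue. 0 < t \<longrightarrow> (\<lambda>n. k n t) \<longlonglongrightarrow> k' t"
  shows "(\<lambda>n. integral {l..r} (k n)) \<longlonglongrightarrow> integral {l..r} k'"
proof -
  have sub: "{l..r} \<subseteq> {0<..}" using l by auto
  have S: "{l..r} \<in> sets lebesgue" by simp
  let ?L = "lebesgue_on {l..r}"
  have gi: "integrable ?L g" using L1locD[OF g l, of r] by (simp add: set_integrable_def integrable_restrict_space)
  have lim': "AE t in ?L. (\<lambda>n. k n t) \<longlonglongrightarrow> k' t"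
  proof -
    have "AE t in lebesgue. t \<in> {l..r} \<longrightarrow> (\<lambda>n. k n t) \<longlonglongrightarrow> k' t" using lim by eventually_elim (use l in auto)
    then show ?thesis by (subst AE_restrict_space_iff) auto
  qed
  have b': "AE t in ?L. norm (k n t) \<le> g t" for n by (rule AE_I2) (use b in \<open>auto simp: space_restrict_space\<close>)
  note m = meas_sub[OF k' sub] meas_sub[OF L1loc_measurable[OF k] sub]
  have "(\<lambda>n. integral\<^sup>L ?L (k n)) \<longlonglongrightarrow> integral\<^sup>L ?L k'"
    by (rule integral_dominated_convergence[OF m(1) m(2) gi lim' b'])
  moreover have "integrable ?L k'" by (rule integrable_dominated_convergence[OF m(1) m(2) gi lim' b'])
  then have "integral\<^sup>L ?L k' = integral {l..r} k'" by (rule lebesgue_integral_eq_integral[OF _ S])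
  moreover have "integral\<^sup>L ?L (k n) = integral {l..r} (k n)" for n
  proof (rule lebesgue_integral_eq_integral[OF _ S])
    show "integrable ?L (k n)" using L1locD[OF k[of n] l, of r] by (simp add: set_integrable_def integrable_restrict_space)
  qed
  ultimately show ?thesis by simp
qed

lemma nnI_mono_AE: "AE x in lebesgue. x \<in> A \<longrightarrow> h x \<le> k x \<Longrightarrow> nnI A h \<le> nnI A k"
  unfolding nnI_def by (rule nn_integral_mono_AE) (auto simp: indicator_def ennreal_leI elim!: eventually_mono)

section \<open>Weighted integrability of the derivative\<close>

context dual_element
begin

text \<open>Leaves a margin to the left of the support: \<open>Ft_zero\<close> says nothing about
  \<open>\<alpha>\<close> itself, but applies to \<open>l0\<close>.\<close>

definition l0 :: real where "l0 = \<alpha> / 2"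
lemma l0: "0 < l0" "l0 < \<alpha>" "l0 < \<beta>" using ab by (auto simp: l0_def)

text \<open>Stopping \<open>Ft\<close> at \<open>l0\<close> and at \<open>\<beta>\<close> does not
  change it, since it is zero there and beyond. The density of the stopped function vanishes outside
  the interval everywhere, not just almost everywhere.\<close>

lemma Ft_density: "\<exists>H. prim Ft H \<and> (\<forall>x. x \<notin> {l0..\<beta>} \<longrightarrow> H x = 0)"
proof -
  obtain H where H: "prim Ft H" using loc_abs_cont_prim[OF Ft_abs_cont] by blast
  have b: "0 < \<beta>" using ab by simp
  have "prim Ft (\<lambda>s. if s \<in> {l0..} then if s \<in> {..\<beta>} then H s else 0 else 0)"
    using prim_max_min(1)[OF prim_max_min(2)[OF H b] l0(1)]
  proof (rule prim_cong_on)
    fix s :: real assume s: "0 < s"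
    show "Ft s = Ft (min \<beta> (max l0 s))"
      using Ft_zero[of s] Ft_zero[of l0] Ft_zero[of \<beta>] s l0 ab by (auto simp: min_def max_def)
  qed simp
  then show ?thesis by (intro exI conjI) auto
qed

definition H :: "real \<Rightarrow> real" where "H = (SOME H. prim Ft H \<and> (\<forall>x. x \<notin> {l0..\<beta>} \<longrightarrow> H x = 0))"
lemma H_prim: "prim Ft H" and H_zero: "x \<notin> {l0..\<beta>} \<Longrightarrow> H x = 0"
  using someI_ex[OF Ft_density] unfolding H_def[symmetric] by blast+

text \<open>Integration by parts moves the derivative from \<open>U\<close> to \<open>Ft\<close>,
  and \<open>Ft\<close> vanishes at \<open>l\<close> and at \<open>\<beta>\<close>.\<close>

lemma H_pairing:
  assumes U: "prim U u" and N: "nnI {0<..} (\<lambda>x. Wd x * \<bar>U x\<bar> powr q) \<le> ennreal N" "0 \<le> N" and l: "0 < l" "l \<le> l0"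
  shows "\<bar>integral {l..\<beta>} (\<lambda>x. H x * U x)\<bar> \<le> 32 * J * N powr (1 / q)"
proof -
  have lb: "l \<le> \<beta>" "l < \<alpha>" using l l0 by auto
  have L1: "L1loc (\<lambda>x. H x * U x)" using L1loc_cont_mult[OF prim_continuous[OF U] prim_L1[OF H_prim]] by (simp add: mult.commute)
  have L2: "L1loc (\<lambda>x. Ft x * u x)" by (rule L1loc_cont_mult[OF prim_continuous[OF H_prim] prim_L1[OF U]])
  have "integral {l..\<beta>} (\<lambda>x. H x * U x + Ft x * u x) = 0"
    using primD[OF prim_mult[OF H_prim U] l(1) lb(1)] Ft_zero[of l] Ft_zero[of \<beta>] l lb by simp
  then have "integral {l..\<beta>} (\<lambda>x. H x * U x) = - integral {l..\<beta>} (\<lambda>x. Ft x * u x)"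
    using integral_add[OF L1loc_integrable[OF L1 l(1)] L1loc_integrable[OF L2 l(1)], of \<beta>] by simp
  moreover have "integral {l..\<beta>} (\<lambda>x. V x * f x * u x) = integral {l..\<beta>} (\<lambda>x. Ft x * u x)"
    by (rule integral_AE_eq[OF L2 _ l(1) lb(1)]) (use Ft_AE in eventually_elim, simp)
  ultimately show ?thesis using prim_pairing[OF U N l(1), of \<beta>] lb by simp
qed

text \<open>The extremal functions of duality are only measurable, whereas the functional has been
  estimated on absolutely continuous \<open>U\<close>. The averages \<open>U n\<close> of
  \<open>\<psi>\<close> over short intervals to the right bridge the gap: they are absolutely
  continuous, inherit the bound \<open>B\<close> and converge almost everywhere, so both sides pass
  to the limit by dominated convergence.\<close>

lemma H_pairing_bounded:
  assumes m: "\<psi> \<in> borel_measurable (lebesgue_on {0<..})" and B: "\<And>x. \<bar>\<psi> x\<bar> \<le> B" and z: "\<And>x. x \<notin> {l0..\<beta>} \<Longrightarrow> \<psi> x = 0"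
  shows "\<bar>integral {l0 / 2..\<beta>} (\<lambda>x. H x * \<psi> x)\<bar> \<le> 32 * J * integral {l0 / 2..\<beta>} (\<lambda>x. Wd x * \<bar>\<psi> x\<bar> powr q) powr (1 / q)"
proof -
  let ?l = "l0 / 2"
  have l: "0 < ?l" using l0 by simp
  have B0: "0 \<le> B" using B[of 0] by simp
  have Lc: "L1loc (\<lambda>x. c)" for c by (intro L1loc_cont continuous_intros)
  have L\<psi>: "L1loc \<psi>"
    by (rule L1loc_dom[OF Lc[of B] m]) (intro exI[of _ 1], use B B0 in auto)
  obtain P where P: "prim P \<psi>" using prim_exists[OF L\<psi>] by blast
  \<comment> \<open>At most \<open>l0 / 2\<close>: averaging to the right extends the support to the
    left by this amount, and the averages still vanish below \<open>l0 / 2\<close>.\<close>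
  define e where "e n = ?l / real (Suc n)" for n
  have e: "0 < e n" "e n \<le> ?l" for n using l by (auto simp: e_def divide_le_eq mult_left_le)
  define U where "U n x = 1 / e n * (P (x + e n) - P x)" for n x
  have U: "prim (U n) (\<lambda>x. 1 / e n * (\<psi> (x + e n) - \<psi> x))" for n
    unfolding U_def using e[of n] by (intro prim_cmult prim_diff prim_translate P) auto
  have Ub: "\<bar>U n x\<bar> \<le> C" if "0 < x" "\<And>t. x \<le> t \<Longrightarrow> t \<le> x + e n \<Longrightarrow> \<bar>\<psi> t\<bar> \<le> C" for n x C
  proof -
    have "\<bar>integral {x..x + e n} \<psi>\<bar> \<le> integral {x..x + e n} (\<lambda>_. C)" by (rule integral_abs_bound[OF L\<psi> Lc that(1)]) (use that in auto)
    then have "\<bar>P (x + e n) - P x\<bar> \<le> C * e n" using primD[OF P that(1), of "x + e n"] e[of n] by (simp add: mult.commute)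
    then show ?thesis using e(1)[of n] by (simp add: U_def abs_mult divide_le_eq)
  qed
  have UB: "\<bar>U n x\<bar> \<le> B" if "0 < x" for n x using Ub[OF that B] .
  have Uz: "U n x = 0" if x: "0 < x" "x \<notin> {?l..\<beta>}" for n x
  proof -
    have "\<bar>\<psi> t\<bar> \<le> 0" if "x \<le> t" "t \<le> x + e n" for t
      using z[of t] that x e(2)[of n] by auto
    then have "\<bar>U n x\<bar> \<le> 0" by (rule Ub[OF x(1)])
    then show ?thesis by simp
  qed
  have cU: "continuous_on {0<..} (\<lambda>x. \<bar>U n x\<bar> powr q)" for n
    using prim_continuous[OF U] q1 by (intro continuous_on_powr' continuous_intros) auto
  have LW: "L1loc (\<lambda>x. Wd x * \<bar>U n x\<bar> powr q)" for n using L1loc_cont_mult[OF cU Wd_L1] by (simp add: mult.commute)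
  have LH: "L1loc (\<lambda>x. H x * U n x)" for n using L1loc_cont_mult[OF prim_continuous[OF U] prim_L1[OF H_prim]] by (simp add: mult.commute)
  have le: "\<bar>integral {?l..\<beta>} (\<lambda>x. H x * U n x)\<bar> \<le> 32 * J * integral {?l..\<beta>} (\<lambda>x. Wd x * \<bar>U n x\<bar> powr q) powr (1 / q)" for n
  proof (rule H_pairing[OF U _ _ l])
    have "nnI {0<..} (\<lambda>x. Wd x * \<bar>U n x\<bar> powr q) = ennreal (integral {?l..\<beta>} (\<lambda>x. Wd x * \<bar>U n x\<bar> powr q))"
      by (rule nnI_supp[OF LW _ l]) (use Uz Wd_nonneg q1 in auto)
    then show "nnI {0<..} (\<lambda>x. Wd x * \<bar>U n x\<bar> powr q) \<le> ennreal (integral {?l..\<beta>} (\<lambda>x. Wd x * \<bar>U n x\<bar> powr q))" by simp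
    show "0 \<le> integral {?l..\<beta>} (\<lambda>x. Wd x * \<bar>U n x\<bar> powr q)"
      by (rule Henstock_Kurzweil_Integration.integral_nonneg[OF L1loc_integrable[OF LW l]]) (simp add: Wd_nonneg)
  qed (use l0 in simp)
  have "(\<lambda>n. 1 / real (Suc n)) \<longlonglongrightarrow> 0" by (rule LIMSEQ_Suc[OF lim_1_over_n])
  from tendsto_mult_left[OF this, of ?l] have "e \<longlonglongrightarrow> 0" by (simp add: e_def[abs_def])
  then have er: "filterlim e (at_right 0) sequentially"
    unfolding filterlim_at using e(1) by (simp add: less_imp_neq[symmetric])
  have lim: "AE x in lebesgue. 0 < x \<longrightarrow> (\<lambda>n. U n x) \<longlonglongrightarrow> \<psi> x"
    using prim_lebesgue_diff[OF P]
  proof eventually_elim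
    case (elim x)
    show ?case
    proof
      assume "0 < x"
      with elim have "((\<lambda>h. (P (x + h) - P x) / h) \<longlongrightarrow> \<psi> x) (at_right 0)" by simp
      from filterlim_compose[OF this er] show "(\<lambda>n. U n x) \<longlonglongrightarrow> \<psi> x" by (simp add: U_def)
    qed
  qed
  have c1: "(\<lambda>n. integral {?l..\<beta>} (\<lambda>x. H x * U n x)) \<longlonglongrightarrow> integral {?l..\<beta>} (\<lambda>x. H x * \<psi> x)"
  proof (rule dominated_convergence_AE_pos[OF LH L1loc_cmult[OF L1loc_abs[OF prim_L1[OF H_prim]], of B] _ l])
    show "(\<lambda>x. H x * \<psi> x) \<in> borel_measurable (lebesgue_on {0<..})" using m L1loc_measurable[OF prim_L1[OF H_prim]] by measurable
    fix n t assume "t \<in> {?l..\<beta>}"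
    then have "\<bar>H t\<bar> * \<bar>U n t\<bar> \<le> \<bar>H t\<bar> * B" using UB[of t n] l by (intro mult_left_mono) auto
    then show "\<bar>H t * U n t\<bar> \<le> B * \<bar>H t\<bar>" by (simp add: abs_mult mult.commute)
  next
    show "AE t in lebesgue. 0 < t \<longrightarrow> (\<lambda>n. H t * U n t) \<longlonglongrightarrow> H t * \<psi> t"
      using lim by eventually_elim (auto intro: tendsto_mult_left)
  qed
  have c2: "(\<lambda>n. integral {?l..\<beta>} (\<lambda>x. Wd x * \<bar>U n x\<bar> powr q)) \<longlonglongrightarrow> integral {?l..\<beta>} (\<lambda>x. Wd x * \<bar>\<psi> x\<bar> powr q)"
  proof (rule dominated_convergence_AE_pos[OF LW L1loc_cmult[OF Wd_L1, of "B powr q"] _ l])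
    show "(\<lambda>x. Wd x * \<bar>\<psi> x\<bar> powr q) \<in> borel_measurable (lebesgue_on {0<..})" using m L1loc_measurable[OF Wd_L1] by measurable
    fix n t assume "t \<in> {?l..\<beta>}"
    then have "\<bar>U n t\<bar> powr q \<le> B powr q" using UB[of t n] l q1 by (intro powr_mono2) auto
    then show "\<bar>Wd t * \<bar>U n t\<bar> powr q\<bar> \<le> B powr q * Wd t" using Wd_nonneg[of t] by (simp add: abs_mult mult.commute[of "B powr q"] mult_left_mono)
  next
    show "AE t in lebesgue. 0 < t \<longrightarrow> (\<lambda>n. Wd t * \<bar>U n t\<bar> powr q) \<longlonglongrightarrow> Wd t * \<bar>\<psi> t\<bar> powr q"
      using lim by eventually_elim (use q1 in \<open>auto intro!: tendsto_mult_left tendsto_powr' tendsto_rabs\<close>)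
  qed
  show ?thesis
  proof (rule tendsto_le[OF _ _ tendsto_rabs[OF c1]])
    show "(\<lambda>n. 32 * J * integral {?l..\<beta>} (\<lambda>x. Wd x * \<bar>U n x\<bar> powr q) powr (1 / q)) \<longlonglongrightarrow> 32 * J * integral {?l..\<beta>} (\<lambda>x. Wd x * \<bar>\<psi> x\<bar> powr q) powr (1 / q)"
    proof (intro tendsto_mult_left tendsto_powr' c2 tendsto_const)
      have "0 \<le> integral {?l..\<beta>} (\<lambda>x. Wd x * \<bar>U n x\<bar> powr q)" for n
        by (rule Henstock_Kurzweil_Integration.integral_nonneg[OF L1loc_integrable[OF LW l]]) (simp add: Wd_nonneg)
      then show "integral {?l..\<beta>} (\<lambda>x. Wd x * \<bar>\<psi> x\<bar> powr q) \<noteq> 0 \<or> 0 < 1 / q \<and> (\<forall>\<^sub>F n in sequentially. 0 \<le> integral {?l..\<beta>} (\<lambda>x. Wd x * \<bar>U n x\<bar> powr q))"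
        using q1 by simp
    qed
  qed (use le in simp_all)
qed

text \<open>The extremal test function of weighted \<open>L\<^sup>p\<close> duality, restricted to
  the set where \<open>\<bar>H\<bar> \<le> n * Wd\<close> to make it bounded. Pairing and size of
  the test function are then the same finite integral, so \<open>self_bound\<close> gives a bound
  independent of \<open>n\<close>.\<close>

lemma H_bound: "nnI {0<..} (\<lambda>x. Wd x powr (1 - p) * \<bar>H x\<bar> powr p) \<le> ennreal ((32 * J) powr p)"
proof (rule nnI_fatou)
  define R where "R n x \<longleftrightarrow> \<bar>H x\<bar> \<le> real n * Wd x" for n :: nat and x
  define \<psi> where "\<psi> n x = (if R n x then sgn (H x) * (\<bar>H x\<bar> / Wd x) powr (p - 1) else 0)" for n x
  define k where "k n x = (if R n x then Wd x powr (1 - p) * \<bar>H x\<bar> powr p else 0)" for n x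
  note Hm = L1loc_measurable[OF prim_L1[OF H_prim]] and Wm = L1loc_measurable[OF Wd_L1]
  have \<psi>m: "\<psi> n \<in> borel_measurable (lebesgue_on {0<..})" for n unfolding \<psi>_def[abs_def] R_def using Hm Wm by measurable
  have km: "k n \<in> borel_measurable (lebesgue_on {0<..})" for n unfolding k_def[abs_def] R_def using Hm Wm by measurable
  have pos: "0 < Wd x \<and> H x \<noteq> 0 \<or> H x = 0" if "R n x" for n x
  proof (cases "Wd x = 0")
    case True then show ?thesis using that by (simp add: R_def)
  next
    case False
    then have "0 < Wd x" using Wd_nonneg[of x] by simp
    then show ?thesis by blast
  qed
  have quot: "\<bar>H x\<bar> / Wd x \<le> real n" if "R n x" for n x
    using pos[OF that]
  proof (elim disjE conjE)
    assume "0 < Wd x" then show ?thesis using that by (simp add: R_def divide_le_eq)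
  qed simp
  have k1: "H x * \<psi> n x = k n x" for n x
  proof (cases "R n x \<and> H x \<noteq> 0")
    case True
    then have W: "0 < Wd x" using pos by blast
    have "H x * \<psi> n x = \<bar>H x\<bar> * (\<bar>H x\<bar> powr (p - 1) / Wd x powr (p - 1))" using True W by (simp add: \<psi>_def sgn_if powr_divide)
    also have "\<dots> = (\<bar>H x\<bar> * \<bar>H x\<bar> powr (p - 1)) * inverse (Wd x powr (p - 1))" by (simp add: divide_inverse)
    also have "\<bar>H x\<bar> * \<bar>H x\<bar> powr (p - 1) = \<bar>H x\<bar> powr p" by (simp add: powr_mult_base)
    also have "inverse (Wd x powr (p - 1)) = Wd x powr (1 - p)" by (simp flip: powr_minus)
    finally show ?thesis using True by (simp add: k_def mult.commute)
  qed (use p1 in \<open>auto simp: \<psi>_def k_def\<close>)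
  have k2: "Wd x * \<bar>\<psi> n x\<bar> powr q = k n x" for n x
  proof (cases "R n x \<and> H x \<noteq> 0")
    case True
    then have W: "0 < Wd x" using pos by blast
    have "\<bar>\<psi> n x\<bar> powr q = ((\<bar>H x\<bar> / Wd x) powr (p - 1)) powr q" using True by (simp add: \<psi>_def abs_mult abs_sgn_eq)
    also have "\<dots> = \<bar>H x\<bar> powr p / Wd x powr p" using W by (simp add: powr_powr pq'(1) powr_divide)
    finally have "Wd x * \<bar>\<psi> n x\<bar> powr q = Wd x powr 1 * \<bar>H x\<bar> powr p / Wd x powr p" using W by simp
    also have "\<dots> = Wd x powr 1 / Wd x powr p * \<bar>H x\<bar> powr p" by simp
    also have "Wd x powr 1 / Wd x powr p = Wd x powr (1 - p)" by (rule powr_diff[symmetric])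
    finally show ?thesis using True by (simp add: k_def)
  qed (use p1 q1 in \<open>auto simp: \<psi>_def k_def\<close>)
  have k0: "0 \<le> k n x" for n x by (simp add: k_def)
  have \<psi>b: "\<bar>\<psi> n x\<bar> \<le> real n powr (p - 1)" for n x
  proof (cases "R n x")
    case True
    have "(\<bar>H x\<bar> / Wd x) powr (p - 1) \<le> real n powr (p - 1)" using quot[OF True] p1 Wd_nonneg by (intro powr_mono2) auto
    then show ?thesis using True by (auto simp: \<psi>_def abs_mult abs_sgn_eq)
  qed (simp add: \<psi>_def)
  have Lk: "L1loc (k n)" for n
  proof (rule L1loc_dom[OF L1loc_cmult[OF Wd_L1, of "(real n powr (p - 1)) powr q"] km], intro exI[of _ 1] ballI)
    fix t
    have "\<bar>\<psi> n t\<bar> powr q \<le> (real n powr (p - 1)) powr q" using \<psi>b q1 by (intro powr_mono2) auto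
    then have "Wd t * \<bar>\<psi> n t\<bar> powr q \<le> Wd t * (real n powr (p - 1)) powr q" by (rule mult_left_mono[OF _ Wd_nonneg])
    then show "\<bar>k n t\<bar> \<le> 1 * \<bar>(real n powr (p - 1)) powr q * Wd t\<bar>" unfolding k2 using k0 Wd_nonneg by (simp add: abs_mult mult.commute)
  qed
  have l: "0 < l0 / 2" using l0 by simp
  show "k n \<in> borel_measurable (lebesgue_on {0<..})" for n by (rule km)
  show "nnI {0<..} (k n) \<le> ennreal ((32 * J) powr p)" for n
  proof -
    define I where "I = integral {l0 / 2..\<beta>} (k n)"
    have I0: "0 \<le> I" unfolding I_def by (intro Henstock_Kurzweil_Integration.integral_nonneg L1loc_integrable[OF Lk l] k0)
    have z: "H x = 0" if "x \<notin> {l0 / 2..\<beta>}" for x using H_zero[of x] that l0 by auto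
    have kI: "nnI {0<..} (k n) = ennreal I" unfolding I_def
      by (rule nnI_supp[OF Lk k0 l]) (use z p1 in \<open>auto simp: k_def\<close>)
    have "\<bar>I\<bar> \<le> 32 * J * I powr (1 / q)"
      using H_pairing_bounded[OF \<psi>m \<psi>b, of n] H_zero unfolding k1 k2 I_def by (simp add: \<psi>_def)
    then have "I \<le> (32 * J) powr p" using self_bound[OF p1 pq I0, of "32 * J"] J0 by simp
    then show ?thesis unfolding kI by (rule ennreal_leI)
  qed
  fix x :: real
  show "(\<lambda>n. k n x) \<longlonglongrightarrow> Wd x powr (1 - p) * \<bar>H x\<bar> powr p"
  \<comment> \<open>Where \<open>Wd\<close> vanishes the limit is zero as well, since
    \<open>0 powr (1 - p) = 0\<close>.\<close>
  proof (cases "Wd x = 0")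
    case True
    then have "k n x = 0" for n by (simp add: k_def)
    then show ?thesis using True by simp
  next
    case False
    then have W: "0 < Wd x" using Wd_nonneg[of x] by simp
    obtain m where m: "\<bar>H x\<bar> / Wd x \<le> real m" using real_arch_simple by blast
    have "R n x" if "m \<le> n" for n
    proof -
      have "\<bar>H x\<bar> \<le> real m * Wd x" using m W by (simp add: divide_le_eq)
      also have "\<dots> \<le> real n * Wd x" using that W by (intro mult_right_mono) auto
      finally show ?thesis by (simp add: R_def)
    qed
    then have "\<forall>\<^sub>F n in sequentially. k n x = Wd x powr (1 - p) * \<bar>H x\<bar> powr p" by (auto simp: eventually_sequentially k_def intro!: exI[of _ m])
    then show ?thesis by (rule tendsto_eventually)
  qed
qed

lemma Wd_powr: "0 < x \<Longrightarrow> Wd x powr (1 - p) = w x powr (1 - p) * V x powr (- p)"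
proof -
  assume "0 < x"
  have "(V x powr q) powr (1 - p) = V x powr (- p)"
  proof -
    have "q * (1 - p) = - p" using pq'(1) by (simp add: algebra_simps)
    then show ?thesis by (simp add: powr_powr)
  qed
  then show ?thesis by (simp add: Wd_def powr_mult)
qed

text \<open>Collects 32 from \<open>H_bound\<close> and 8 from \<open>weighted_bound\<close>. The
  outer power of two comes from splitting \<open>\<bar>h\<bar> powr p\<close> into two terms, the
  inner one from the bound \<open>2 * w\<close> for the density of \<open>V\<close>.\<close>

definition K1 :: real where "K1 = 2 powr p * (32 powr p + 2 powr p * 8 powr p)"

text \<open>The quotient rule for \<open>Ft / V\<close>. The derivative of \<open>1 / V\<close>
  contributes at most \<open>2 * w * \<bar>f / V\<bar>\<close>, because
  \<open>\<bar>w - \<rho>\<bar> \<le> w\<close>. Both parts of \<open>h\<close> are thus controlled,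
  and \<open>v0_total\<close> supplies the remaining part of the Sobolev norm.\<close>

lemma representation:
  obtains ft h where "prim ft h" "\<And>x. w x = 0 \<Longrightarrow> h x = 0" "\<And>x. 0 < x \<Longrightarrow> x \<notin> {l0<..<\<beta>} \<Longrightarrow> ft x = 0"
    "AE x in lebesgue. 0 < x \<longrightarrow> f x = ft x"
    "nnI {0<..} (\<lambda>x. w x powr (1 - p) * \<bar>h x\<bar> powr p) \<le> ennreal (K1 * J powr p)"
    "nnI {0<..} (\<lambda>x. v0 x powr p * \<bar>ft x\<bar> powr p) \<le> ennreal (2 * 4 powr p * (8 powr p + K1) * J powr p)"
proof -
  have "prim (\<lambda>x. 1 / V x) (\<lambda>x. - 1 / (V x)\<^sup>2 * (2 * (w x - \<rho> x)))"
  proof (rule prim_chain[OF V_prim, where S = "{0<..}"])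
    show "((\<lambda>z. 1 / z) has_real_derivative - 1 / z\<^sup>2) (at z within {0<..})" if "z \<in> {0<..}" for z :: real
      using that by (auto intro!: derivative_eq_intros simp: power2_eq_square)
    show "continuous_on {0<..} (\<lambda>z::real. - 1 / z\<^sup>2)" by (intro continuous_intros) auto
  qed (use V_pos in \<open>auto simp: convex_real_interval\<close>)
  from prim_mult[OF H_prim this] have P: "prim (\<lambda>x. Ft x * (1 / V x)) (\<lambda>x. H x * (1 / V x) + Ft x * (- 1 / (V x)\<^sup>2 * (2 * (w x - \<rho> x))))" .
  define ft where "ft x = Ft x * (1 / V x)" for x
  obtain h where h: "prim ft h" "\<And>x. w x = 0 \<Longrightarrow> h x = 0"
    "AE x in lebesgue. 0 < x \<longrightarrow> h x = H x * (1 / V x) + Ft x * (- 1 / (V x)\<^sup>2 * (2 * (w x - \<rho> x)))"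
    using good_density[OF P] unfolding ft_def[abs_def] by blast
  have sz: "ft x = 0" if x: "0 < x" "x \<notin> {l0<..<\<beta>}" for x
  proof -
    have "x < \<alpha> \<or> \<beta> \<le> x" using x l0 by auto
    then show ?thesis using Ft_zero[OF x(1)] by (simp add: ft_def)
  qed
  have ae: "AE x in lebesgue. 0 < x \<longrightarrow> f x = ft x" using Ft_AE
  proof eventually_elim
    case (elim x)
    then show ?case using V_pos[of x] by (auto simp: ft_def)
  qed
  let ?g = "\<lambda>x. w x powr (1 - p) * \<bar>h x\<bar> powr p" and ?k1 = "\<lambda>x. Wd x powr (1 - p) * \<bar>H x\<bar> powr p" and ?k2 = "\<lambda>x. w x * \<bar>f x / V x\<bar> powr p"
  have bound: "AE x in lebesgue. x \<in> {0<..} \<longrightarrow> ?g x \<le> 2 powr p * (?k1 x + 2 powr p * ?k2 x)"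
    using ae h(3)
  proof eventually_elim
    case (elim x)
    show ?case
    proof
      assume "x \<in> {0<..}"
      then have x: "0 < x" by simp
      note V = V_pos[OF x]
      define z where "z = f x / V x"
      define y where "y = w x - \<rho> x"
      have "f x = Ft x / V x" using elim x by (simp add: ft_def)
      then have hx: "h x = H x / V x - 2 * y * z" using elim x by (simp add: z_def y_def power2_eq_square)
      have "\<bar>2 * y * z\<bar> = 2 * (\<bar>y\<bar> * \<bar>z\<bar>)" by (simp add: abs_mult)
      also have "\<dots> \<le> 2 * (w x * \<bar>z\<bar>)"
        using rho_bounds[of x] by (intro mult_left_mono mult_right_mono) (auto simp: y_def)
      finally have "\<bar>h x\<bar> \<le> \<bar>H x / V x\<bar> + 2 * w x * \<bar>z\<bar>" unfolding hx by linarith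
      then have "\<bar>h x\<bar> \<le> \<bar>H x\<bar> / V x + 2 * w x * \<bar>f x / V x\<bar>" unfolding z_def using V by simp
      then have "\<bar>h x\<bar> powr p \<le> (\<bar>H x\<bar> / V x + 2 * w x * \<bar>f x / V x\<bar>) powr p" using p1 by (intro powr_mono2) auto
      also have "\<dots> \<le> 2 powr p * ((\<bar>H x\<bar> / V x) powr p + (2 * w x * \<bar>f x / V x\<bar>) powr p)"
        by (rule powr_add_le) (use V w_nonneg p1 in auto)
      finally have "?g x \<le> w x powr (1 - p) * (2 powr p * ((\<bar>H x\<bar> / V x) powr p + (2 * w x * \<bar>f x / V x\<bar>) powr p))"
        by (rule mult_left_mono) simp
      also have "\<dots> = 2 powr p * (w x powr (1 - p) * (\<bar>H x\<bar> / V x) powr p + 2 powr p * ((w x powr (1 - p) * w x powr p) * \<bar>f x / V x\<bar> powr p))"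
      proof -
        have e: "(2 * w x * \<bar>f x / V x\<bar>) powr p = 2 powr p * (w x powr p * \<bar>f x / V x\<bar> powr p)" by (simp only: powr_mult mult.assoc)
        show ?thesis unfolding e by (simp only: distrib_left ac_simps)
      qed
      also have "w x powr (1 - p) * (\<bar>H x\<bar> / V x) powr p = ?k1 x"
        using V by (simp add: Wd_powr[OF x] powr_divide powr_minus_divide)
      also have "w x powr (1 - p) * w x powr p = w x" using w_nonneg[of x] by (simp flip: powr_add)
      finally show "?g x \<le> 2 powr p * (?k1 x + 2 powr p * ?k2 x)" .
    qed
  qed
  have m: "?k1 \<in> borel_measurable (lebesgue_on {0<..})" "?k2 \<in> borel_measurable (lebesgue_on {0<..})" "?g \<in> borel_measurable (lebesgue_on {0<..})"
    using f_meas L1loc_measurable[OF prim_L1[OF H_prim]] L1loc_measurable[OF Wd_L1] L1loc_measurable[OF prim_L1[OF h(1)]] by measurable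
  have "nnI {0<..} ?g \<le> nnI {0<..} (\<lambda>x. 2 powr p * (?k1 x + 2 powr p * ?k2 x))" by (rule nnI_mono_AE[OF bound])
  also have "\<dots> = ennreal (2 powr p) * (nnI {0<..} ?k1 + ennreal (2 powr p) * nnI {0<..} ?k2)"
  proof -
    have m2: "(\<lambda>x. 2 powr p * ?k2 x) \<in> borel_measurable (lebesgue_on {0<..})" using m(2) by measurable
    have m3: "(\<lambda>x. ?k1 x + 2 powr p * ?k2 x) \<in> borel_measurable (lebesgue_on {0<..})" using m(1) m2 by (rule borel_measurable_add)
    have "nnI {0<..} (\<lambda>x. ?k1 x + 2 powr p * ?k2 x) = nnI {0<..} ?k1 + nnI {0<..} (\<lambda>x. 2 powr p * ?k2 x)"
      by (rule nnI_add[OF m(1) m2]) (simp_all add: w_nonneg)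
    moreover have "nnI {0<..} (\<lambda>x. 2 powr p * ?k2 x) = ennreal (2 powr p) * nnI {0<..} ?k2" by (rule nnI_cmult[OF m(2)]) simp_all
    moreover have "nnI {0<..} (\<lambda>x. 2 powr p * (?k1 x + 2 powr p * ?k2 x)) = ennreal (2 powr p) * nnI {0<..} (\<lambda>x. ?k1 x + 2 powr p * ?k2 x)"
      by (rule nnI_cmult[OF m3]) simp_all
    ultimately show ?thesis by simp
  qed
  also have "\<dots> \<le> ennreal (2 powr p) * (ennreal ((32 * J) powr p) + ennreal (2 powr p) * ennreal ((8 * J) powr p))"
    by (intro mult_left_mono add_mono H_bound weighted_bound) auto
  also have "\<dots> = ennreal (K1 * J powr p)"
  proof -
    have "ennreal X * (ennreal Y + ennreal X * ennreal Z) = ennreal (X * (Y + X * Z))" if "0 \<le> X" "0 \<le> Y" "0 \<le> Z" for X Y Z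
      using that by (simp add: ennreal_mult)
    moreover have "2 powr p * ((32 * J) powr p + 2 powr p * (8 * J) powr p) = K1 * J powr p"
      unfolding K1_def powr_mult by (simp only: distrib_left distrib_right ac_simps)
    ultimately show ?thesis by simp
  qed
  finally have D: "nnI {0<..} ?g \<le> ennreal (K1 * J powr p)" .
  have K1: "0 \<le> K1 * J powr p" by (simp add: K1_def)
  have LD: "L1loc ?g" by (rule L1loc_nnI[OF m(3) _ le_less_trans[OF D]]) auto
  have "nnI {0<..} (\<lambda>x. w x * \<bar>ft x / V x\<bar> powr p) = nnI {0<..} ?k2"
    by (rule nnI_AE_cong) (use ae in eventually_elim, simp)
  then have Hb: "nnI {0<..} (\<lambda>x. w x * \<bar>ft x / V x\<bar> powr p) \<le> ennreal ((8 * J) powr p)" using weighted_bound by simp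
  have "nnI {0<..} (\<lambda>x. v0 x powr p * \<bar>ft x\<bar> powr p) \<le> ennreal (2 * 4 powr p * ((8 * J) powr p + K1 * J powr p))"
    using v0_total[OF h(1,2) LD l0(1,3) sz, of "(8 * J) powr p" "K1 * J powr p"] Hb D K1 unfolding Gdens_def[abs_def] Hdens_def[abs_def] Vdens_def[abs_def] by simp
  also have "2 * 4 powr p * ((8 * J) powr p + K1 * J powr p) = 2 * 4 powr p * (8 powr p + K1) * J powr p"
    using J0 by (simp add: powr_mult algebra_simps)
  finally show ?thesis using that[OF h(1,2) sz ae D] by simp
qed

end

section \<open>The associate spaces\<close>

lemma LINT_AE_cong:
  fixes k k' :: "real \<Rightarrow> real"
  assumes "k \<in> borel_measurable (lebesgue_on {0<..})" "k' \<in> borel_measurable (lebesgue_on {0<..})"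
    and e: "AE x in lebesgue. 0 < x \<longrightarrow> k x = k' x"
  shows "(LINT x:{0<..}|lebesgue. k x) = (LINT x:{0<..}|lebesgue. k' x)"
  unfolding set_lebesgue_integral_def
proof (rule integral_cong_AE)
  show "(\<lambda>x. indicat_real {0<..} x *\<^sub>R k x) \<in> borel_measurable lebesgue" "(\<lambda>x. indicat_real {0<..} x *\<^sub>R k' x) \<in> borel_measurable lebesgue"
    using pos_indicator_measurable assms(1,2) by simp_all
  show "AE x in lebesgue. indicat_real {0<..} x *\<^sub>R k x = indicat_real {0<..} x *\<^sub>R k' x"
    using e by eventually_elim (auto simp: indicator_def)
qed

lemma Jfun_AE_cong:
  assumes X: "\<And>g. g \<in> X \<Longrightarrow> g \<in> borel_measurable (lebesgue_on {0<..})"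
    and f: "f \<in> borel_measurable (lebesgue_on {0<..})" "f' \<in> borel_measurable (lebesgue_on {0<..})"
    and e: "AE x in lebesgue. 0 < x \<longrightarrow> f x = f' x"
  shows "Jfun X N f = Jfun X N f'"
  unfolding Jfun_def
proof (rule SUP_cong[OF refl])
  fix g assume "g \<in> {f \<in> X. N f \<noteq> 0}"
  then have g: "g \<in> borel_measurable (lebesgue_on {0<..})" using X by simp
  have "(LINT x:{0<..}|lebesgue. g x * f x) = (LINT x:{0<..}|lebesgue. g x * f' x)"
    by (rule LINT_AE_cong) (use g f in measurable, use e in eventually_elim, simp)
  then show "ennreal (\<bar>LINT x:{0<..}|lebesgue. g x * f x\<bar> / N g) = ennreal (\<bar>LINT x:{0<..}|lebesgue. g x * f' x\<bar> / N g)" by simp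
qed

text \<open>The set of positive points where the functions differ is open and null, hence
  empty.\<close>

lemma continuous_AE_eq:
  fixes f g :: "real \<Rightarrow> real"
  assumes "continuous_on {0<..} f" "continuous_on {0<..} g" "AE x in lebesgue. 0 < x \<longrightarrow> f x = g x" "0 < x"
  shows "f x = g x"
proof -
  define S where "S = {0<..} \<inter> (\<lambda>x. f x - g x) -` (- {0})"
  have o: "open S" unfolding S_def
    by (rule continuous_open_preimage) (use assms(1,2) in \<open>auto intro!: continuous_intros\<close>)
  obtain N where N: "{x \<in> space lebesgue. \<not> (0 < x \<longrightarrow> f x = g x)} \<subseteq> N" "emeasure lebesgue N = 0" "N \<in> sets lebesgue"
    using assms(3) by (rule AE_E)
  have "negligible N" unfolding negligible_iff_null_sets using N by (intro null_setsI)
  moreover have "S \<subseteq> N" using N(1) by (auto simp: S_def)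
  ultimately have "negligible S" by (rule negligible_subset)
  then have "S = {}" using open_not_negligible[OF o] by blast
  then show ?thesis using assms(4) by (auto simp: S_def)
qed

text \<open>Enlarging the support slightly makes \<open>f\<close> vanish at \<open>\<alpha>\<close>
  and \<open>\<beta>\<close> themselves, as integration by parts requires.\<close>

lemma cpt_supp_iff:
  "cpt_supp f \<longleftrightarrow> (\<exists>\<alpha> \<beta>. 0 < \<alpha> \<and> \<alpha> < \<beta> \<and> (\<forall>x. 0 < x \<longrightarrow> x \<notin> {\<alpha><..<\<beta>} \<longrightarrow> f x = 0))" (is "_ \<longleftrightarrow> ?R")
proof
  let ?K = "closure {x. 0 < x \<and> f x \<noteq> 0}"
  assume c: "cpt_supp f"
  show ?R
  proof (cases "?K = {}")
    case True
    then have "{x. 0 < x \<and> f x \<noteq> 0} = {}" by simp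
    then show ?thesis by (intro exI[of _ 1] exI[of _ 2]) auto
  next
    case False
    have K: "compact ?K" "?K \<subseteq> {0<..}" using c by (auto simp: cpt_supp_def)
    obtain l where l: "l \<in> ?K" "\<And>y. y \<in> ?K \<Longrightarrow> l \<le> y" using compact_attains_inf[OF K(1) False] by blast
    obtain r where r: "r \<in> ?K" "\<And>y. y \<in> ?K \<Longrightarrow> y \<le> r" using compact_attains_sup[OF K(1) False] by blast
    have l0: "0 < l" "l \<le> r" using l K(2) r by auto
    have "f x = 0" if x: "0 < x" "x \<notin> {l / 2<..<r + 1}" for x
    proof (rule ccontr)
      assume "f x \<noteq> 0"
      then have "x \<in> ?K" using x closure_subset[of "{x. 0 < x \<and> f x \<noteq> 0}"] by blast
      then show False using l(2)[of x] r(2)[of x] x l0 by auto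
    qed
    then show ?thesis using l0 by (intro exI[of _ "l / 2"] exI[of _ "r + 1"]) auto
  qed
next
  assume ?R
  then obtain \<alpha> \<beta> where ab: "0 < \<alpha>" "\<alpha> < \<beta>" "\<And>x. 0 < x \<Longrightarrow> x \<notin> {\<alpha><..<\<beta>} \<Longrightarrow> f x = 0" by blast
  have "{x. 0 < x \<and> f x \<noteq> 0} \<subseteq> {\<alpha>..\<beta>}" using ab(3) by force
  then have K: "closure {x. 0 < x \<and> f x \<noteq> 0} \<subseteq> {\<alpha>..\<beta>}" by (rule closure_minimal) simp
  then have "compact (closure {x. 0 < x \<and> f x \<noteq> 0})"
    unfolding compact_eq_bounded_closed using bounded_subset[OF bounded_closed_interval K] by simp
  moreover have "{\<alpha>..\<beta>} \<subseteq> {0<..}" using ab(1) by auto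
  ultimately show "cpt_supp f" unfolding cpt_supp_def using K by blast
qed

context oscillation
begin

abbreviation S :: "(real \<Rightarrow> real) set" where "S \<equiv> W00 p v0 v1"
abbreviation NS :: "(real \<Rightarrow> real) \<Rightarrow> real" where "NS \<equiv> sob_norm p v0 v1"
abbreviation W :: "(real \<Rightarrow> real) set" where "W \<equiv> Wset p v1 a b"
abbreviation NW :: "(real \<Rightarrow> real) \<Rightarrow> real" where "NW \<equiv> Wnorm p v1 a b"

lemma NS_nonneg: "0 \<le> NS f" by (simp add: sob_norm_def Lp_norm_def)

lemma Lp_pow_density:
  assumes f: "prim f h" "\<And>x. w x = 0 \<Longrightarrow> h x = 0"
  shows "Lp_pow p (\<lambda>x. v1 x * Dw f x) = nnI {0<..} (Gdens h)" "Lp_pow p (\<lambda>x. v0 x * f x) = nnI {0<..} (Vdens f)"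
proof -
  have "Lp_pow p (\<lambda>x. v1 x * Dw f x) = nnI {0<..} (\<lambda>x. \<bar>v1 x * h x\<bar> powr p)"
    unfolding Lp_pow_def by (rule nnI_AE_cong) (use Dw_AE_eq[OF f(1)] in eventually_elim, simp)
  also have "\<dots> = nnI {0<..} (Gdens h)" unfolding Gdens_def[abs_def] by (rule nnI_v1_pos) (rule f(2))
  finally show "Lp_pow p (\<lambda>x. v1 x * Dw f x) = nnI {0<..} (Gdens h)" .
  show "Lp_pow p (\<lambda>x. v0 x * f x) = nnI {0<..} (Vdens f)"
    unfolding Lp_pow_def Vdens_def[abs_def] by (rule nnI_cong) (use v0_nonneg in \<open>simp add: abs_mult powr_mult\<close>)
qed

lemma NS_density:
  assumes f: "prim f h" "\<And>x. w x = 0 \<Longrightarrow> h x = 0"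
  shows "NS f = enn2real (nnI {0<..} (Vdens f)) powr (1 / p) + enn2real (nnI {0<..} (Gdens h)) powr (1 / p)"
  using Lp_pow_density[OF f(1)] f(2) by (simp add: sob_norm_def Lp_norm_def)

lemma W00_I:
  assumes f: "prim f h" "\<And>x. w x = 0 \<Longrightarrow> h x = 0" and ab: "0 < \<alpha>" "\<alpha> < \<beta>"
    and supp: "\<And>x. 0 < x \<Longrightarrow> x \<notin> {\<alpha><..<\<beta>} \<Longrightarrow> f x = 0"
    and fin: "nnI {0<..} (Gdens h) < \<infinity>" "nnI {0<..} (Vdens f) < \<infinity>"
  shows "f \<in> S"
proof -
  have "\<forall>\<^sub>F x in at_right 0. f x = 0" unfolding eventually_at_right_field using supp ab by (intro exI[of _ \<alpha>]) auto
  then have "(f \<longlongrightarrow> 0) (at_right 0)" by (rule tendsto_eventually)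
  moreover have "cpt_supp f" unfolding cpt_supp_iff using ab supp by blast
  moreover have "\<exists>g. weak_deriv f g" by (rule exI[of _ h], rule prim_weak_deriv[OF f(1)])
  ultimately show ?thesis unfolding W00_def using prim_loc_abs_cont[OF f(1)] fin Lp_pow_density[OF f] by simp
qed

lemma W00_prim: assumes "f \<in> S" shows "\<exists>h. prim f h \<and> (\<forall>x. w x = 0 \<longrightarrow> h x = 0)"
proof -
  obtain h0 where h0: "prim f h0" using loc_abs_cont_prim assms unfolding W00_def by blast
  obtain h where "prim f h" "\<And>x. w x = 0 \<Longrightarrow> h x = 0" using good_density[OF h0] by blast
  then show ?thesis by (intro exI[of _ h]) simp
qed

lemma W00_D:
  assumes f: "f \<in> S"
  obtains h \<alpha> \<beta> D T where "prim f h" "\<And>x. w x = 0 \<Longrightarrow> h x = 0" "0 < \<alpha>" "\<alpha> < \<beta>"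
    "\<And>x. 0 < x \<Longrightarrow> x \<notin> {\<alpha><..<\<beta>} \<Longrightarrow> f x = 0" "nnI {0<..} (Gdens h) = ennreal D" "0 \<le> D"
    "nnI {0<..} (Vdens f) = ennreal T" "0 \<le> T" "NS f = T powr (1 / p) + D powr (1 / p)" "L1loc (Gdens h)"
proof -
  obtain h where h: "prim f h" "\<And>x. w x = 0 \<Longrightarrow> h x = 0" using W00_prim[OF f] by blast
  obtain \<alpha> \<beta> where ab: "0 < \<alpha>" "\<alpha> < \<beta>" "\<And>x. 0 < x \<Longrightarrow> x \<notin> {\<alpha><..<\<beta>} \<Longrightarrow> f x = 0"
    using f unfolding W00_def cpt_supp_iff by blast
  have fin: "nnI {0<..} (Gdens h) < \<infinity>" "nnI {0<..} (Vdens f) < \<infinity>"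
    using f Lp_pow_density[OF h] unfolding W00_def by simp_all
  then obtain D T where DT: "nnI {0<..} (Gdens h) = ennreal D" "0 \<le> D" "nnI {0<..} (Vdens f) = ennreal T" "0 \<le> T"
    by (cases "nnI {0<..} (Gdens h)"; cases "nnI {0<..} (Vdens f)") auto
  have n: "NS f = T powr (1 / p) + D powr (1 / p)" using NS_density[OF h] DT by simp
  have m: "Gdens h \<in> borel_measurable (lebesgue_on {0<..})"
    unfolding Gdens_def[abs_def] using L1loc_measurable[OF prim_L1[OF h(1)]] by measurable
  have L: "L1loc (Gdens h)" by (rule L1loc_nnI[OF m _ fin(1)]) (simp add: Gdens_def)
  show ?thesis by (rule that[OF h ab DT n L])
qed

text \<open>The leading 2 is that of the duality pairing. The power \<open>1 / p\<close> is applied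
  to the Hardy constant, and the 2 next to it comes from splitting
  \<open>(T + D) powr (1 / p)\<close>.\<close>

definition C1 :: real where "C1 = 2 * (1 + (2 * (K0 * (2 powr (p + 2) + 1))) powr (1 / p))"

lemma C1_pos: "0 < C1" unfolding C1_def by (intro mult_pos_pos add_pos_nonneg) auto

lemma S_meas: "f \<in> S \<Longrightarrow> f \<in> borel_measurable (lebesgue_on {0<..})"
  using W00_prim[of f] by (auto intro: cont_meas prim_continuous)

lemma W_meas: "g \<in> W \<Longrightarrow> g \<in> borel_measurable (lebesgue_on {0<..})" by (rule L1loc_measurable[OF Wnorm_D(1)])

lemma pairing_finite:
  assumes f: "f \<in> S" and g: "L1loc g" shows "nnI {0<..} (\<lambda>x. \<bar>f x * g x\<bar>) < \<infinity>"
proof -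
  obtain h where h: "prim f h" using W00_prim[OF f] by blast
  obtain \<alpha> \<beta> where ab: "0 < \<alpha>" "\<alpha> < \<beta>" "\<And>x. 0 < x \<Longrightarrow> x \<notin> {\<alpha><..<\<beta>} \<Longrightarrow> f x = 0"
    using f unfolding W00_def cpt_supp_iff by blast
  show ?thesis
    by (subst nnI_supp[OF L1loc_abs[OF L1loc_cont_mult[OF prim_continuous[OF h] g]] _ ab(1), where r = \<beta>]) (use ab in auto)
qed

lemma pairing_bound:
  assumes f: "f \<in> S" and g: "g \<in> W"
  shows "\<bar>LINT x:{0<..}|lebesgue. g x * f x\<bar> \<le> C1 * NS f * NW g"
proof -
  from f obtain h \<alpha> \<beta> D T where h: "prim f h" "\<And>x. w x = 0 \<Longrightarrow> h x = 0" "0 < \<alpha>" "\<alpha> < \<beta>"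
    "\<And>x. 0 < x \<Longrightarrow> x \<notin> {\<alpha><..<\<beta>} \<Longrightarrow> f x = 0" and DT: "nnI {0<..} (Gdens h) = ennreal D" "0 \<le> D"
    "nnI {0<..} (Vdens f) = ennreal T" "0 \<le> T" "NS f = T powr (1 / p) + D powr (1 / p)" and L: "L1loc (Gdens h)"
    by (rule W00_D) blast
  let ?K = "K0 * (2 powr (p + 2) + 1)"
  have K: "0 \<le> ?K" using K0_pos by simp
  have H: "nnI {0<..} (Hdens f) \<le> ennreal (?K * (T + D))"
    by (rule hardy_total[OF h(1,2) L[unfolded Gdens_def[abs_def]] h(3,4)]) (use h(5) DT in auto)
  have H0: "0 \<le> ?K * (T + D)" using K DT by simp
  have "(?K * (T + D)) powr (1 / p) = ?K powr (1 / p) * (T + D) powr (1 / p)" by (rule powr_mult)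
  also have "\<dots> \<le> ?K powr (1 / p) * (2 powr (1 / p) * NS f)"
    unfolding DT(5) using DT p1 by (intro mult_left_mono powr_add_le) auto
  also have "\<dots> = (2 * ?K) powr (1 / p) * NS f" by (simp add: powr_mult)
  finally have "(?K * (T + D)) powr (1 / p) \<le> (2 * ?K) powr (1 / p) * NS f" .
  moreover have "D powr (1 / p) \<le> NS f" using DT(5) by simp
  ultimately have e: "D powr (1 / p) + (?K * (T + D)) powr (1 / p) \<le> NS f + (2 * ?K) powr (1 / p) * NS f" by linarith
  have "\<bar>LINT x:{0<..}|lebesgue. g x * f x\<bar> \<le> 2 * (D powr (1 / p) + (?K * (T + D)) powr (1 / p)) * NW g"
    by (rule duality_W[OF h(1,2) g h(3,4,5) _ DT(2) _ H0]) (use DT(1) H in \<open>auto simp: Gdens_def[abs_def] Hdens_def[abs_def]\<close>)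
  also have "\<dots> \<le> 2 * (NS f + (2 * ?K) powr (1 / p) * NS f) * NW g" using e Wnorm_nonneg by (intro mult_right_mono) auto
  also have "\<dots> = C1 * NS f * NW g" by (simp add: C1_def algebra_simps)
  finally show ?thesis .
qed

text \<open>Zero energy makes \<open>f\<close> constant up to the right end of its support, where it
  is zero.\<close>

lemma NS_zero:
  assumes f: "f \<in> S" and 0: "NS f = 0" shows "AE x in lebesgue. 0 < x \<longrightarrow> f x = 0"
proof -
  from f obtain h \<alpha> \<beta> D T where h: "prim f h" "\<And>x. w x = 0 \<Longrightarrow> h x = 0" "0 < \<alpha>" "\<alpha> < \<beta>"
    "\<And>x. 0 < x \<Longrightarrow> x \<notin> {\<alpha><..<\<beta>} \<Longrightarrow> f x = 0" and DT: "nnI {0<..} (Gdens h) = ennreal D" "0 \<le> D"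
    "nnI {0<..} (Vdens f) = ennreal T" "0 \<le> T" "NS f = T powr (1 / p) + D powr (1 / p)" and L: "L1loc (Gdens h)"
    by (rule W00_D) blast
  have "D powr (1 / p) \<le> 0" using 0 DT(5) by (simp add: add_nonneg_eq_0_iff)
  then have D0: "D = 0" by simp
  have "f x = 0" if x: "0 < x" for x
  proof (cases "x < \<beta>")
    case True
    have "integral {x..\<beta>} (Gdens h) \<le> 0" 
      by (rule integral_le_nnI[OF h(1,2) L[unfolded Gdens_def[abs_def]] L]) (use DT D0 x in \<open>auto simp: Gdens_def\<close>)
    moreover have "\<bar>f \<beta> - f x\<bar> powr p \<le> (Om \<beta> - Om x) powr (p - 1) * integral {x..\<beta>} (Gdens h)"
      by (rule increment_bound[OF h(1,2) L[unfolded Gdens_def[abs_def]] x]) (use True in auto)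
    moreover have "(Om \<beta> - Om x) powr (p - 1) * integral {x..\<beta>} (Gdens h) \<le> (Om \<beta> - Om x) powr (p - 1) * 0"
      using calculation by (intro mult_left_mono) auto
    ultimately have "\<bar>f \<beta> - f x\<bar> powr p \<le> 0" by linarith
    then have "f x = f \<beta>" by simp
    then show ?thesis using h(5)[of \<beta>] h(3,4) by simp
  next
    case False then show ?thesis using h(5)[OF x] by simp
  qed
  then show ?thesis by simp
qed

text \<open>Local integrability of \<open>v0 powr p\<close> and \<open>v1 powr p\<close> makes both
  parts of the norm finite. Hence there are enough Sobolev functions to separate locally integrable
  functions.\<close>

lemma test_fun_in_S:
  assumes "test_fun \<phi>" shows "\<phi> \<in> S"
proof -
  note t = test_fun_facts[OF assms]
  obtain \<alpha> \<beta> where ab: "0 < \<alpha>" "\<alpha> < \<beta>" "\<And>s. s \<notin> {\<alpha><..<\<beta>} \<Longrightarrow> \<phi> s = 0 \<and> deriv \<phi> s = 0" using t(3) by blast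
  obtain h where h: "prim \<phi> h" "\<And>x. w x = 0 \<Longrightarrow> h x = 0" "AE x in lebesgue. 0 < x \<longrightarrow> h x = deriv \<phi> x"
    using good_density[OF t(1)] by blast
  have fin: "nnI {0<..} (\<lambda>x. v x powr p * \<bar>k x\<bar> powr p) < \<infinity>"
    if c: "continuous_on {0<..} k" and k: "\<And>x. x \<notin> {\<alpha><..<\<beta>} \<Longrightarrow> k x = 0" and v: "L1loc (\<lambda>x. v x powr p)" for k v
  proof -
    have "continuous_on {0<..} (\<lambda>x. \<bar>k x\<bar> powr p)" using c p1 by (intro continuous_on_powr' continuous_intros) auto
    from L1loc_cont_mult[OF this v] have "L1loc (\<lambda>x. v x powr p * \<bar>k x\<bar> powr p)" by (simp add: mult.commute)
    then show ?thesis by (subst nnI_supp[where l = \<alpha> and r = \<beta>]) (use ab(1) k p1 in auto)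
  qed
  have "AE x in lebesgue. x \<in> {0<..} \<longrightarrow> Gdens h x = v1 x powr p * \<bar>deriv \<phi> x\<bar> powr p"
    using h(3) v1_w_AE by eventually_elim (auto simp: Gdens_def)
  from nnI_AE_cong[OF this] have "nnI {0<..} (Gdens h) < \<infinity>" using fin[OF t(2) _ v1p_L1] ab(3) by simp
  moreover have "nnI {0<..} (Vdens \<phi>) < \<infinity>" unfolding Vdens_def[abs_def]
    using fin[OF prim_continuous[OF t(1)] _ v0p_L1] ab(3) by simp
  ultimately show ?thesis using W00_I[OF h(1,2) ab(1,2)] ab(3) by blast
qed

lemma S_orthogonal:
  assumes "L1loc g" "\<And>\<phi>. \<phi> \<in> S \<Longrightarrow> (LINT x:{0<..}|lebesgue. g x * \<phi> x) = 0"
  shows "AE x in lebesgue. 0 < x \<longrightarrow> g x = 0"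
  by (rule bump_orthogonal_AE_zero[OF assms(1)]) (rule assms(2)[OF test_fun_in_S[OF bump_test_fun]])

text \<open>If the norm vanishes, the pairing bound makes \<open>g\<close> orthogonal to all Sobolev
  functions, in particular to all bumps. Definiteness matters because \<open>Jfun\<close> disregards
  elements of norm zero.\<close>

lemma Wnorm_zero: "g \<in> W \<Longrightarrow> NW g = 0 \<Longrightarrow> AE x in lebesgue. 0 < x \<longrightarrow> g x = 0"
  by (rule S_orthogonal[OF Wnorm_D(1)]) (use pairing_bound[of _ g] in auto)

lemma S_in_assoc:
  assumes f: "f \<in> S" shows "f \<in> Dset W" "Jfun W NW f \<le> ennreal (C1 * NS f)"
proof -
  show "f \<in> Dset W" unfolding Dset_def
    using S_meas[OF f] pairing_finite[OF f Wnorm_D(1)] by (simp add: mult.commute)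
  show "Jfun W NW f \<le> ennreal (C1 * NS f)" by (rule Jfun_le[OF pairing_bound[OF f] Wnorm_nonneg])
qed

text \<open>The \<open>p\<close>-th roots of the two bounds in \<open>representation\<close>, for
  the \<open>v0\<close> part and for the derivative; \<open>K1\<close> leaves its locale as a
  function of \<open>p\<close> alone.\<close>

definition C2 :: real where "C2 = (2 * 4 powr p * (8 powr p + dual_element.K1 p)) powr (1 / p) + dual_element.K1 p powr (1 / p)"

lemma C2_nonneg: "0 \<le> C2" by (simp add: C2_def)

lemma assoc_in_S:
  assumes f: "f \<in> Dset W" and J: "Jfun W NW f < \<infinity>"
  obtains ft where "ft \<in> S" "AE x in lebesgue. 0 < x \<longrightarrow> f x = ft x" "NS ft \<le> C2 * enn2real (Jfun W NW f)"
proof -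
  let ?J = "enn2real (Jfun W NW f)"
  obtain \<alpha> \<beta> where ab: "0 < \<alpha>" "\<alpha> < \<beta>" "AE x in lebesgue. 0 < x \<longrightarrow> x \<notin> {\<alpha><..<\<beta>} \<longrightarrow> f x = 0"
    using dual_compact_support[OF f] by blast
  \<comment> \<open>\<open>f\<close> vanishes outside the interval only almost everywhere. Its
    modification does so everywhere, as the locale demands, and pairs in the same way.\<close>
  define f' where "f' x = (if x \<in> {\<alpha><..<\<beta>} then f x else 0)" for x
  have e: "AE x in lebesgue. 0 < x \<longrightarrow> f x = f' x" using ab(3) by eventually_elim (auto simp: f'_def)
  have fm: "f \<in> borel_measurable (lebesgue_on {0<..})" using f by (simp add: Dset_def)
  moreover have "(\<lambda>x::real. x) \<in> borel_measurable (lebesgue_on {0<..})" by (rule cont_meas) (rule continuous_on_id)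
  ultimately have fm': "f' \<in> borel_measurable (lebesgue_on {0<..})" unfolding f'_def[abs_def] by measurable
  interpret dual_element p v0 v1 c a b f' ?J \<alpha> \<beta>
  proof unfold_locales
    have "nnI {0<..} (\<lambda>x. \<bar>g x * f' x\<bar>) < \<infinity>" if g: "g \<in> W" for g
    proof -
      have "nnI {0<..} (\<lambda>x. \<bar>g x * f' x\<bar>) \<le> nnI {0<..} (\<lambda>x. \<bar>g x * f x\<bar>)" by (rule nnI_mono) (simp add: f'_def)
      also have "\<dots> < \<infinity>" using f g by (simp add: Dset_def)
      finally show ?thesis .
    qed
    then show "f' \<in> Dset W" using fm' by (simp add: Dset_def)
    fix g assume g: "g \<in> W"
    have "(LINT x:{0<..}|lebesgue. g x * f' x) = (LINT x:{0<..}|lebesgue. g x * f x)"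
      by (rule LINT_AE_cong) (use W_meas[OF g] fm fm' in measurable, use e in eventually_elim, simp)
    then show "\<bar>LINT x:{0<..}|lebesgue. g x * f' x\<bar> \<le> ?J * NW g"
      using Jfun_pairing[OF J g Wnorm_nonneg Wnorm_zero[OF g]] by simp
  qed (use ab in \<open>auto simp: f'_def\<close>)
  obtain ft h where ft: "prim ft h" "\<And>x. w x = 0 \<Longrightarrow> h x = 0" "\<And>x. 0 < x \<Longrightarrow> x \<notin> {l0<..<\<beta>} \<Longrightarrow> ft x = 0"
    "AE x in lebesgue. 0 < x \<longrightarrow> f' x = ft x"
    "nnI {0<..} (Gdens h) \<le> ennreal (K1 * ?J powr p)"
    "nnI {0<..} (Vdens ft) \<le> ennreal (2 * 4 powr p * (8 powr p + K1) * ?J powr p)"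
    using representation unfolding Gdens_def[abs_def] Vdens_def[abs_def] by blast
  have r: "enn2real X powr (1 / p) \<le> K powr (1 / p) * ?J" if X: "X \<le> ennreal (K * ?J powr p)" and K: "0 \<le> K" for X K
  proof -
    have "enn2real X \<le> enn2real (ennreal (K * ?J powr p))" by (rule enn2real_mono[OF X]) simp
    also have "\<dots> = K * ?J powr p" using K by simp
    finally have "enn2real X powr (1 / p) \<le> (K * ?J powr p) powr (1 / p)" using p1 by (intro powr_mono2) auto
    also have "\<dots> = K powr (1 / p) * ?J" using p1 by (simp add: powr_mult powr_powr)
    finally show ?thesis .
  qed
  have K: "0 \<le> K1" by (simp add: K1_def)
  have "NS ft \<le> (2 * 4 powr p * (8 powr p + K1)) powr (1 / p) * ?J + K1 powr (1 / p) * ?J"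
  proof -
    have "NS ft = enn2real (nnI {0<..} (Vdens ft)) powr (1 / p) + enn2real (nnI {0<..} (Gdens h)) powr (1 / p)"
      by (rule NS_density[OF ft(1)]) (rule ft(2))
    moreover have "enn2real (nnI {0<..} (Vdens ft)) powr (1 / p) \<le> (2 * 4 powr p * (8 powr p + K1)) powr (1 / p) * ?J" by (rule r[OF ft(6)]) (use K in simp)
    moreover have "enn2real (nnI {0<..} (Gdens h)) powr (1 / p) \<le> K1 powr (1 / p) * ?J" by (rule r[OF ft(5) K])
    ultimately show ?thesis by linarith
  qed
  then have n: "NS ft \<le> C2 * ?J" by (simp add: C2_def algebra_simps)
  have "ft \<in> S"
    by (rule W00_I[OF ft(1,2) l0(1,3) ft(3) le_less_trans[OF ft(5)] le_less_trans[OF ft(6)]]) auto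
  moreover have "AE x in lebesgue. 0 < x \<longrightarrow> f x = ft x" using e ft(4) by eventually_elim auto
  ultimately show ?thesis using n by (rule that)
qed

text \<open>Both functions are continuous, so they agree at every positive point and share a
  density.\<close>

lemma NS_eq:
  assumes f: "f \<in> S" and g: "g \<in> S" and e: "AE x in lebesgue. 0 < x \<longrightarrow> f x = g x"
  shows "NS f = NS g"
proof -
  obtain h where h: "prim f h" "\<And>x. w x = 0 \<Longrightarrow> h x = 0" using W00_prim[OF f] by blast
  obtain k where k: "prim g k" using W00_prim[OF g] by blast
  have eq: "f x = g x" if "0 < x" for x
    by (rule continuous_AE_eq[OF prim_continuous[OF h(1)] prim_continuous[OF k] e that])
  have gh: "prim g h" by (rule prim_cong_on[OF h(1)]) (use eq in auto)
  have "nnI {0<..} (Vdens f) = nnI {0<..} (Vdens g)" by (rule nnI_cong) (simp add: Vdens_def eq)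
  then show ?thesis using NS_density[OF h] NS_density[OF gh h(2)] by simp
qed

text \<open>The construction yields some representative of \<open>f\<close>; by continuity it
  coincides on the half line with the given one, so the norms agree.\<close>

lemma norm_equivalence:
  assumes f: "f \<in> Dset W" and ft: "ft \<in> S" and e: "AE x in lebesgue. 0 < x \<longrightarrow> f x = ft x"
  shows "Jfun W NW f \<le> ennreal (C1 * NS ft)" "NS ft \<le> C2 * enn2real (Jfun W NW f)"
proof -
  have fm: "f \<in> borel_measurable (lebesgue_on {0<..})" using f by (simp add: Dset_def)
  have "Jfun W NW f = Jfun W NW ft" by (rule Jfun_AE_cong[OF W_meas fm S_meas[OF ft] e])
  then show J: "Jfun W NW f \<le> ennreal (C1 * NS ft)" using S_in_assoc(2)[OF ft] by simp
  then have "Jfun W NW f < \<infinity>" by (rule le_less_trans) simp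
  from assoc_in_S[OF f this] obtain f1 where f1: "f1 \<in> S" "AE x in lebesgue. 0 < x \<longrightarrow> f x = f1 x" "NS f1 \<le> C2 * enn2real (Jfun W NW f)" .
  have "NS f1 = NS ft" by (rule NS_eq[OF f1(1) ft]) (use f1(2) e in eventually_elim, simp)
  then show "NS ft \<le> C2 * enn2real (Jfun W NW f)" using f1(3) by simp
qed

section \<open>The second associate space\<close>

abbreviation B1 :: "(real \<Rightarrow> real) set" where "B1 \<equiv> weak_assoc S NS"
abbreviation NB1 :: "(real \<Rightarrow> real) \<Rightarrow> real" where "NB1 \<equiv> assoc_norm S NS"

lemma B1_meas: "g \<in> B1 \<Longrightarrow> g \<in> borel_measurable (lebesgue_on {0<..})" by (simp add: weak_assoc_def Dset_def)

lemma B1_pairing: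
  assumes g: "g \<in> B1" and f: "f \<in> S" shows "\<bar>LINT x:{0<..}|lebesgue. g x * f x\<bar> \<le> NS f * NB1 g"
  using Jfun_pairing[where X = S and N = NS and f = g and g = f, OF _ f NS_nonneg NS_zero[OF f]] g by (simp add: weak_assoc_def assoc_norm_def mult.commute)

text \<open>The pairing bound read in its other variable, together with the fact that Sobolev
  functions separate locally integrable functions.\<close>

lemma W_in_B1:
  assumes g: "g \<in> W" shows "g \<in> B1" "NB1 g \<le> C1 * NW g" "NB1 g = 0 \<Longrightarrow> AE x in lebesgue. 0 < x \<longrightarrow> g x = 0"
proof -
  have "g \<in> Dset S" unfolding Dset_def using W_meas[OF g] pairing_finite[OF _ Wnorm_D(1)[OF g]] by simp
  moreover have J: "Jfun S NS g \<le> ennreal (C1 * NW g)"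
    by (rule Jfun_le) (use pairing_bound[OF _ g] NS_nonneg in \<open>auto simp: ac_simps\<close>)
  then have "Jfun S NS g < \<infinity>" by (rule le_less_trans) simp
  ultimately show B: "g \<in> B1" by (simp add: weak_assoc_def)
  show "NB1 g \<le> C1 * NW g" using enn2real_mono[OF J] C1_pos Wnorm_nonneg[of g] by (simp add: assoc_norm_def)
  show "AE x in lebesgue. 0 < x \<longrightarrow> g x = 0" if "NB1 g = 0"
    by (rule S_orthogonal[OF Wnorm_D(1)[OF g]]) (use B1_pairing[OF B] that in simp)
qed

lemma second_assoc_upper:
  assumes f: "f \<in> S" shows "f \<in> Dset B1" "Jfun B1 NB1 f \<le> ennreal (NS f)"
proof -
  have "nnI {0<..} (\<lambda>x. \<bar>g x * f x\<bar>) < \<infinity>" if "g \<in> B1" for g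
    using that f unfolding weak_assoc_def Dset_def by (auto simp: mult.commute)
  then show "f \<in> Dset B1" using S_meas[OF f] by (simp add: Dset_def)
  show "Jfun B1 NB1 f \<le> ennreal (NS f)" by (rule Jfun_le[OF B1_pairing[OF _ f]]) (simp_all add: assoc_norm_def)
qed

text \<open>No description of \<open>B1\<close> is involved: it contains \<open>W\<close> with
  control of the norm, so a bounded functional on \<open>B1\<close> restricts to one on
  \<open>W\<close>, and the characterization for \<open>W\<close> takes over.\<close>

lemma second_assoc_lower:
  assumes f: "f \<in> weak_assoc B1 NB1"
  shows "f \<in> Dset W" "Jfun W NW f \<le> ennreal (C1 * assoc_norm B1 NB1 f)"
proof -
  have fD: "f \<in> Dset B1" and J: "Jfun B1 NB1 f < \<infinity>" using f by (simp_all add: weak_assoc_def)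
  show "f \<in> Dset W" using fD W_in_B1(1) by (auto simp: Dset_def)
  show "Jfun W NW f \<le> ennreal (C1 * assoc_norm B1 NB1 f)"
  proof (rule Jfun_le[OF _ Wnorm_nonneg])
    fix g assume g: "g \<in> W"
    have "\<bar>LINT x:{0<..}|lebesgue. g x * f x\<bar> \<le> assoc_norm B1 NB1 f * NB1 g"
      unfolding assoc_norm_def[of B1] by (rule Jfun_pairing[OF J W_in_B1(1)[OF g] _ W_in_B1(3)[OF g]]) (simp_all add: assoc_norm_def)
    also have "\<dots> \<le> assoc_norm B1 NB1 f * (C1 * NW g)" by (rule mult_left_mono[OF W_in_B1(2)[OF g]]) (simp add: assoc_norm_def)
    finally show "\<bar>LINT x:{0<..}|lebesgue. g x * f x\<bar> \<le> C1 * assoc_norm B1 NB1 f * NW g" by (simp add: ac_simps)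
  qed
qed

end

theorem theorem3p4:
  fixes p :: real
  assumes "1 < p"
  shows "\<exists>C>0. \<forall>v0 v1 c a b. standing p v0 v1 c a b \<longrightarrow>
    (let W = Wset p v1 a b; NW = Wnorm p v1 a b;
         S = W00 p v0 v1; NS = sob_norm p v0 v1;
         A1 = weak_assoc W NW; NA1 = assoc_norm W NW;
         B1 = weak_assoc S NS; NB1 = assoc_norm S NS;
         A2 = weak_assoc B1 NB1; NA2 = assoc_norm B1 NB1
     in
     (\<forall>f\<in>Dset W.
        (Jfun W NW f < \<infinity> \<longleftrightarrow> (\<exists>ft\<in>S. AE x in lebesgue_on {0<..}. f x = ft x)) \<and>
        (\<forall>ft\<in>S. (AE x in lebesgue_on {0<..}. f x = ft x) \<longrightarrow>
           NS ft \<le> C * enn2real (Jfun W NW f) \<and> enn2real (Jfun W NW f) \<le> C * NS ft)) \<and>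
     (\<forall>f\<in>S. f \<in> A1 \<and> NS f \<le> C * NA1 f \<and> NA1 f \<le> C * NS f) \<and>
     (\<forall>g\<in>A1. \<exists>f\<in>S. (AE x in lebesgue_on {0<..}. g x = f x) \<and>
        NS f \<le> C * NA1 g \<and> NA1 g \<le> C * NS f) \<and>
     (\<forall>f\<in>S. f \<in> A2 \<and> NS f \<le> C * NA2 f \<and> NA2 f \<le> C * NS f) \<and>
     (\<forall>g\<in>A2. \<exists>f\<in>S. (AE x in lebesgue_on {0<..}. g x = f x) \<and>
        NS f \<le> C * NA2 g \<and> NA2 g \<le> C * NS f))"
proof -
  \<comment> \<open>\<open>C1\<close> and \<open>C2\<close> are declared inside a locale but depend
    on \<open>p\<close> alone, so one constant can be fixed before the weights are given. It
    dominates both of them, their product and 1.\<close>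
  define C where "C = (1 + \<bar>oscillation.C1 p\<bar>) * (1 + \<bar>oscillation.C2 p\<bar>)"
  have C0: "0 < C" unfolding C_def by (intro mult_pos_pos) auto
  show ?thesis
  proof (intro exI[of _ C] conjI C0 allI impI)
    fix v0 v1 :: "real \<Rightarrow> real" and c :: real and a b :: "real \<Rightarrow> real"
    assume "standing p v0 v1 c a b"
    then interpret oscillation p v0 v1 c a b using assms by unfold_locales
    have C: "C1 \<le> C" "C2 \<le> C" "C2 * C1 \<le> C" "1 \<le> C"
      using C1_pos C2_nonneg by (simp_all add: C_def algebra_simps)
    have up: "C' * x \<le> C * x" if "C' \<le> C" "0 \<le> x" for C' x using that by (rule mult_right_mono)
    have ae: "(AE x in lebesgue_on {0<..}. f x = g x) \<longleftrightarrow> (AE x in lebesgue. 0 < x \<longrightarrow> f x = g x)" for f g :: "real \<Rightarrow> real"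
      by (simp add: AE_restrict_space_iff)
    have J: "Jfun W NW f < \<infinity>" "NS ft \<le> C * enn2real (Jfun W NW f)" "enn2real (Jfun W NW f) \<le> C * NS ft"
      if f: "f \<in> Dset W" and ft: "ft \<in> S" and e: "AE x in lebesgue. 0 < x \<longrightarrow> f x = ft x" for f ft
    proof -
      note n = norm_equivalence[OF f ft e]
      show "Jfun W NW f < \<infinity>" by (rule le_less_trans[OF n(1)]) simp
      show "NS ft \<le> C * enn2real (Jfun W NW f)" using n(2) up[OF C(2), of "enn2real (Jfun W NW f)"] by simp
      have "enn2real (Jfun W NW f) \<le> C1 * NS ft" using enn2real_mono[OF n(1)] C1_pos NS_nonneg[of ft] by simp
      then show "enn2real (Jfun W NW f) \<le> C * NS ft" using up[OF C(1) NS_nonneg[of ft]] by simp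
    qed
    have J2: "enn2real (Jfun B1 NB1 f) \<le> C * NS f" if f: "f \<in> S" for f
    proof -
      have "enn2real (Jfun B1 NB1 f) \<le> NS f" using enn2real_mono[OF second_assoc_upper(2)[OF f]] NS_nonneg[of f] by simp
      then show ?thesis using up[OF C(4) NS_nonneg[of f]] by simp
    qed
    \<comment> \<open>The second associate norm is compared with the Sobolev norm through the
      functional on \<open>W\<close>, which is why \<open>C2 * C1\<close> has to lie below
      \<open>C\<close>.\<close>
    have lower: "NS f \<le> C * assoc_norm B1 NB1 g"
      if g: "g \<in> weak_assoc B1 NB1" and n: "NS f \<le> C2 * enn2real (Jfun W NW g)" for f g
    proof -
      have a0: "0 \<le> assoc_norm B1 NB1 g" by (simp add: assoc_norm_def)
      have "enn2real (Jfun W NW g) \<le> C1 * assoc_norm B1 NB1 g"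
        using enn2real_mono[OF second_assoc_lower(2)[OF g]] C1_pos a0 by simp
      then have "C2 * enn2real (Jfun W NW g) \<le> C2 * C1 * assoc_norm B1 NB1 g"
        unfolding mult.assoc by (rule mult_left_mono) (rule C2_nonneg)
      then show ?thesis using n up[OF C(3) a0] by linarith
    qed
    have 1: "(Jfun W NW f < \<infinity> \<longleftrightarrow> (\<exists>ft\<in>S. AE x in lebesgue_on {0<..}. f x = ft x)) \<and>
        (\<forall>ft\<in>S. (AE x in lebesgue_on {0<..}. f x = ft x) \<longrightarrow>
           NS ft \<le> C * enn2real (Jfun W NW f) \<and> enn2real (Jfun W NW f) \<le> C * NS ft)" if f: "f \<in> Dset W" for f
      unfolding ae
    proof (intro conjI iffI ballI impI)
      assume "Jfun W NW f < \<infinity>"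
      from assoc_in_S[OF f this] obtain ft where ft: "ft \<in> S" "AE x in lebesgue. 0 < x \<longrightarrow> f x = ft x" by blast
      show "\<exists>ft\<in>S. AE x in lebesgue. 0 < x \<longrightarrow> f x = ft x" using ft by (intro bexI[of _ ft]) simp_all
    next
      assume "\<exists>ft\<in>S. AE x in lebesgue. 0 < x \<longrightarrow> f x = ft x"
      then show "Jfun W NW f < \<infinity>" using J(1)[OF f] by blast
    qed (rule J(2,3)[OF f], assumption+)+
    have 2: "f \<in> weak_assoc W NW \<and> NS f \<le> C * assoc_norm W NW f \<and> assoc_norm W NW f \<le> C * NS f" if f: "f \<in> S" for f
      using J[OF S_in_assoc(1)[OF f] f] S_in_assoc(1)[OF f] by (simp add: weak_assoc_def assoc_norm_def)
    have 3: "\<exists>f\<in>S. (AE x in lebesgue_on {0<..}. g x = f x) \<and> NS f \<le> C * assoc_norm W NW g \<and> assoc_norm W NW g \<le> C * NS f"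
      if g: "g \<in> weak_assoc W NW" for g
    proof -
      have g': "g \<in> Dset W" "Jfun W NW g < \<infinity>" using g by (simp_all add: weak_assoc_def)
      from assoc_in_S[OF g'] obtain f where f: "f \<in> S" "AE x in lebesgue. 0 < x \<longrightarrow> g x = f x" by blast
      show ?thesis unfolding ae assoc_norm_def using J(2,3)[OF g'(1) f] f by (intro bexI[of _ f]) simp_all
    qed
    have 4: "f \<in> weak_assoc B1 NB1 \<and> NS f \<le> C * assoc_norm B1 NB1 f \<and> assoc_norm B1 NB1 f \<le> C * NS f" if f: "f \<in> S" for f
    proof -
      have "Jfun B1 NB1 f < \<infinity>" by (rule le_less_trans[OF second_assoc_upper(2)[OF f]]) simp
      then have B: "f \<in> weak_assoc B1 NB1" using second_assoc_upper(1)[OF f] by (simp add: weak_assoc_def)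
      have "NS f \<le> C2 * enn2real (Jfun W NW f)" by (rule norm_equivalence(2)[OF S_in_assoc(1)[OF f] f]) simp
      from lower[OF B this] J2[OF f] B show ?thesis by (simp add: assoc_norm_def[of B1])
    qed
    have 5: "\<exists>f\<in>S. (AE x in lebesgue_on {0<..}. g x = f x) \<and> NS f \<le> C * assoc_norm B1 NB1 g \<and> assoc_norm B1 NB1 g \<le> C * NS f"
      if g: "g \<in> weak_assoc B1 NB1" for g
    proof -
      have "Jfun W NW g < \<infinity>" by (rule le_less_trans[OF second_assoc_lower(2)[OF g]]) simp
      from assoc_in_S[OF second_assoc_lower(1)[OF g] this] obtain f where
        f: "f \<in> S" "AE x in lebesgue. 0 < x \<longrightarrow> g x = f x" "NS f \<le> C2 * enn2real (Jfun W NW g)" .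
      have "Jfun B1 NB1 g = Jfun B1 NB1 f"
        by (rule Jfun_AE_cong[OF B1_meas _ S_meas[OF f(1)] f(2)]) (use g in \<open>auto simp: weak_assoc_def Dset_def\<close>)
      then have "assoc_norm B1 NB1 g \<le> C * NS f" using J2[OF f(1)] by (simp add: assoc_norm_def[of B1])
      then show ?thesis unfolding ae using f lower[OF g f(3)] by (intro bexI[of _ f]) simp_all
    qed
    show "let W = Wset p v1 a b; NW = Wnorm p v1 a b;
         S = W00 p v0 v1; NS = sob_norm p v0 v1;
         A1 = weak_assoc W NW; NA1 = assoc_norm W NW;
         B1 = weak_assoc S NS; NB1 = assoc_norm S NS;
         A2 = weak_assoc B1 NB1; NA2 = assoc_norm B1 NB1
     in
     (\<forall>f\<in>Dset W.
        (Jfun W NW f < \<infinity> \<longleftrightarrow> (\<exists>ft\<in>S. AE x in lebesgue_on {0<..}. f x = ft x)) \<and>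
        (\<forall>ft\<in>S. (AE x in lebesgue_on {0<..}. f x = ft x) \<longrightarrow>
           NS ft \<le> C * enn2real (Jfun W NW f) \<and> enn2real (Jfun W NW f) \<le> C * NS ft)) \<and>
     (\<forall>f\<in>S. f \<in> A1 \<and> NS f \<le> C * NA1 f \<and> NA1 f \<le> C * NS f) \<and>
     (\<forall>g\<in>A1. \<exists>f\<in>S. (AE x in lebesgue_on {0<..}. g x = f x) \<and>
        NS f \<le> C * NA1 g \<and> NA1 g \<le> C * NS f) \<and>
     (\<forall>f\<in>S. f \<in> A2 \<and> NS f \<le> C * NA2 f \<and> NA2 f \<le> C * NS f) \<and>
     (\<forall>g\<in>A2. \<exists>f\<in>S. (AE x in lebesgue_on {0<..}. g x = f x) \<and>
        NS f \<le> C * NA2 g \<and> NA2 g \<le> C * NS f)"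
      unfolding Let_def by (rule conjI[OF ballI conjI[OF ballI conjI[OF ballI conjI[OF ballI ballI]]]]) (erule 1 2 3 4 5)+
  qed
qed

end
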